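(* Let $f:\mathbb{R}^n\to\mathbb{R}$ be a $C^l$ definable function with $l\geqslant 2$, having no critical points, and let $c$ be a value such that the set of generalised critical values $K(f)$ of $f$ is contained in $\{c\}$ (so $c$ is a regular value). Assume that $f$ satisfies condition SISI at $c$. If the total absolute curvature function $t\mapsto |K|(t)$ is continuous at $c$, then $f$ is trivialised over a neighbourhood of $c$ by means of the flow of a $C^{l-1}$ definable vector field. In particular $c\notin B(f)$.
   Context: Fix an o-minimal structure expanding the ordered field of real numbers. A subset of $\mathbb{R}^p$ is definable if it belongs to the structure; a subset of real projective space $\mathbb{P}^p_{\mathbb{R}}$ is definable if its trace in each affine chart is definable; a map $g:X\to\mathbb{R}^q$, $X\subset\mathbb{R}^p\subset\mathbb{P}^p_{\mathbb{R}}$, is definable if the intersection of the closure of its graph in $\mathbb{P}^p_{\mathbb{R}}\times\mathbb{R}^q$ with $\mathbb{P}^p_{\mathbb{R}}\times B$ is definable for every ball $B\subset\mathbb{R}^q$. For a regular value $t$ let $F_t=f^{-1}(t)$, $\nu_t=\nabla f/|\nabla f|$ restricted to $F_t$ (the Gauss map), $k_t(x)=\det(d_x\nu_t)$ the Gaussian curvature, and $|K|(t)=\int_{F_t}|k_t(x)|\,dv_{n-1}(x)$, where $dv_{n-1}$ is $(n-1)$-dimensional Hausdorff measure; this is the total absolute curvature function, defined on the set of regular values. $K_0(f)=f(\mathrm{crit}(f))$; a value $c$ is an asymptotic critical value ($c\in K_\infty(f)$) if there is a sequence $x$ with $|x|\to+\infty$, $f(x)\to c$ and $|x|\cdot|\nabla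 f(x)|\to 0$; $K(f)=K_0(f)\cup K_\infty(f)$. $B(f)$ (bifurcation values) is the smallest subset of $\mathbb{R}$ such that each $c\notin B(f)$ has an open neighbourhood $D$ over which $f$ is a $C^{l-1}$ trivial fibration ($f^{-1}(D)$ is $C^{l-1}$-diffeomorphic to $D\times f^{-1}(c)$ compatibly with $f$). Identify the hyperplane at infinity $\mathbb{H}^\infty=\mathbb{P}^n_{\mathbb{R}}\setminus\mathbb{R}^n$ with the space $G(1,n)$ of line directions of $\mathbb{R}^n$, and let $G(n-1,n)$ be the Grassmannian of hyperplane directions. For a line direction $\lambda$ and value $c$, let $\Omega_{\lambda,c}\subset G(n-1,n)$ be the set of all limits $\lim T_{x_k}(f^{-1}(f(x_k)))$ along sequences $x_k$ of non-critical points with $|x_k|\to\infty$, $\mathbb{R}x_k\to\lambda$ in $G(1,n)$ and $f(x_k)\to c$; let $X_c^\infty$ be the set of $\lambda$ with $\Omega_{\lambda,c}\neq\emptyset$. Condition SISI at $c$: there is a finite set $\Lambda_c\subset G(1,n)$ such that for every $\lambda\in X_c^\infty\setminus\Lambda_c$ and every $h\in\Omega_{\lambda,c}$, the line $\lambda$ is contained in $h$. *)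

theory Defs
  imports "HOL-Analysis.Analysis"
begin

text \<open>Subsets of R^p are represented as sets of real lists of length p;
  S p is the family of definable subsets of R^p.\<close>

definition o_minimal :: "(nat \<Rightarrow> real list set set) \<Rightarrow> bool" where
  "o_minimal S \<longleftrightarrow>
     (\<forall>p. \<forall>A\<in>S p. A \<subseteq> {xs. length xs = p}) \<and>
     (\<forall>p. {xs. length xs = p} \<in> S p) \<and>
     (\<forall>p. \<forall>A\<in>S p. \<forall>B\<in>S p. A \<union> B \<in> S p) \<and>
     (\<forall>p. \<forall>A\<in>S p. {xs. length xs = p} - A \<in> S p) \<and>
     (\<forall>p. \<forall>A\<in>S p. {xs @ [t] |xs t. xs \<in> A} \<in> S (Suc p)) \<and>
     (\<forall>p. \<forall>A\<in>S p. {t # xs |t xs. xs \<in> A} \<in> S (Suc p)) \<and>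
     (\<forall>p i j. i < p \<and> j < p \<longrightarrow> {xs. length xs = p \<and> xs ! i = xs ! j} \<in> S p) \<and>
     (\<forall>p. \<forall>A\<in>S (Suc p). butlast ` A \<in> S p) \<and>
     (\<forall>a::real. {[a]} \<in> S 1) \<and>
     {[x, y] |x y. x < y} \<in> S 2 \<and>
     {[x, y, z] |x y z. z = x + y} \<in> S 3 \<and>
     {[x, y, z] |x y z. z = x * y} \<in> S 3 \<and>
     (\<forall>A\<in>S 1. \<exists>P I. finite P \<and> finite I \<and> (\<forall>(a, b)\<in>I. a < b) \<and>
        A = {[x] |x. x \<in> P \<or> (\<exists>(a, b)\<in>I. a < ereal x \<and> ereal x < b)})"

text \<open>R^p is embedded in P^p via x \<mapsto> [1:x]; the affine chart i (i = 0..p) is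
  {z_i \<noteq> 0}, with coordinates y \<mapsto> [y_0 : ... : 1 (position i) : ... : y_(p-1)].\<close>

definition chart_ins :: "nat \<Rightarrow> real list \<Rightarrow> real list" where
  "chart_ins i y = take i y @ [1] @ drop i y"

definition lconv :: "(nat \<Rightarrow> real list) \<Rightarrow> real list \<Rightarrow> bool" where
  "lconv u v \<longleftrightarrow> (\<forall>k. length (u k) = length v) \<and>
     (\<forall>i<length v. (\<lambda>k. u k ! i) \<longlonglongrightarrow> v ! i)"

text \<open>Trace, in chart i (times R^q), of the closure in P^p x R^q of the graph of g:
  a point ([chart_ins i y], w) lies in the closure iff some sequence of graph points
  ([1:x_k], g x_k) converges to it, i.e. suitable homogeneous representatives converge.\<close>

definition graph_closure_chart ::
  "nat \<Rightarrow> real list set \<Rightarrow> (real list \<Rightarrow> real list) \<Rightarrow> real list \<Rightarrow> real list \<Rightarrow> bool" where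
  "graph_closure_chart i X g y w \<longleftrightarrow>
     (\<exists>s x. (\<forall>k. x k \<in> X \<and> s k \<noteq> 0) \<and>
        lconv (\<lambda>k. map (\<lambda>z. s k * z) (1 # x k)) (chart_ins i y) \<and>
        lconv (\<lambda>k. g (x k)) w)"

definition definable_map ::
  "(nat \<Rightarrow> real list set set) \<Rightarrow> nat \<Rightarrow> nat \<Rightarrow> real list set \<Rightarrow> (real list \<Rightarrow> real list) \<Rightarrow> bool" where
  "definable_map S p q X g \<longleftrightarrow>
     (\<forall>a r i. length a = q \<and> r > 0 \<and> i \<le> p \<longrightarrow>
        {y @ w |y w. length y = p \<and> length w = q \<and> (\<Sum>j<q. (w ! j - a ! j)^2) < r^2 \<and>
            graph_closure_chart i X g y w} \<in> S (p + q))"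

definition enum_idx :: "nat \<Rightarrow> 'n::finite" where
  "enum_idx = (SOME e. bij_betw e {..<CARD('n)} (UNIV :: 'n set))"

definition vec_to_list :: "real^'n::finite \<Rightarrow> real list" where
  "vec_to_list x = map (\<lambda>i. x $ enum_idx i) [0..<CARD('n)]"

definition list_to_vec :: "real list \<Rightarrow> real^'n::finite" where
  "list_to_vec xs = (\<chi> j. xs ! (inv_into {..<CARD('n)} enum_idx j))"

definition definable_fun :: "(nat \<Rightarrow> real list set set) \<Rightarrow> (real^'n::finite \<Rightarrow> real) \<Rightarrow> bool" where
  "definable_fun S f \<longleftrightarrow>
     definable_map S CARD('n) 1 {xs. length xs = CARD('n)} (\<lambda>xs. [f (list_to_vec xs)])"

definition definable_vfield ::
  "(nat \<Rightarrow> real list set set) \<Rightarrow> (real^'n::finite) set \<Rightarrow> (real^'n \<Rightarrow> real^'n) \<Rightarrow> bool" where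
  "definable_vfield S U w \<longleftrightarrow>
     definable_map S CARD('n) CARD('n) (vec_to_list ` U) (\<lambda>xs. vec_to_list (w (list_to_vec xs)))"

fun Ck_on :: "nat \<Rightarrow> 'a::euclidean_space set \<Rightarrow> ('a \<Rightarrow> 'b::real_normed_vector) \<Rightarrow> bool" where
  "Ck_on 0 U g = continuous_on U g"
| "Ck_on (Suc k) U g =
     ((\<forall>x\<in>U. g differentiable (at x)) \<and>
      (\<forall>v\<in>Basis. Ck_on k U (\<lambda>x. frechet_derivative g (at x) v)))"

definition grad :: "('a::euclidean_space \<Rightarrow> real) \<Rightarrow> 'a \<Rightarrow> 'a" where
  "grad f x = (\<Sum>b\<in>Basis. frechet_derivative f (at x) b *\<^sub>R b)"

definition K0 :: "(real^'n::finite \<Rightarrow> real) \<Rightarrow> real set" where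
  "K0 f = f ` {x. grad f x = 0}"

definition Kinf :: "(real^'n::finite \<Rightarrow> real) \<Rightarrow> real set" where
  "Kinf f = {c. \<exists>x::nat \<Rightarrow> real^'n.
      filterlim (\<lambda>k. norm (x k)) at_top sequentially \<and>
      (\<lambda>k. f (x k)) \<longlonglongrightarrow> c \<and>
      (\<lambda>k. norm (x k) * norm (grad f (x k))) \<longlonglongrightarrow> 0}"

definition Kgen :: "(real^'n::finite \<Rightarrow> real) \<Rightarrow> real set" where
  "Kgen f = K0 f \<union> Kinf f"

text \<open>f is a C^k trivial fibration over D: there is a C^k diffeomorphism
  h : f^-1(D) \<rightarrow> D x f^-1(c) with fst \<circ> h = f (the inverse being C^k means it extends to a
  C^k map on an open neighbourhood of the submanifold D x f^-1(c)).\<close>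

definition trivialising_diffeo ::
  "nat \<Rightarrow> (real^'n::finite \<Rightarrow> real) \<Rightarrow> real set \<Rightarrow> real \<Rightarrow> (real^'n \<Rightarrow> real \<times> (real^'n)) \<Rightarrow> bool" where
  "trivialising_diffeo k f D c h \<longleftrightarrow>
     bij_betw h (f -` D) (D \<times> f -` {c}) \<and>
     (\<forall>x\<in>f -` D. fst (h x) = f x) \<and>
     Ck_on k (f -` D) h \<and>
     (\<exists>U G. open U \<and> D \<times> f -` {c} \<subseteq> U \<and> Ck_on k U (G :: real \<times> (real^'n) \<Rightarrow> real^'n) \<and>
        (\<forall>p\<in>D \<times> f -` {c}. G p \<in> f -` D \<and> h (G p) = p))"

definition trivial_fibration_over :: "nat \<Rightarrow> (real^'n::finite \<Rightarrow> real) \<Rightarrow> real set \<Rightarrow> real \<Rightarrow> bool" where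
  "trivial_fibration_over k f D c \<longleftrightarrow> (\<exists>h. trivialising_diffeo k f D c h)"

definition bifurcation_values :: "nat \<Rightarrow> (real^'n::finite \<Rightarrow> real) \<Rightarrow> real set" where
  "bifurcation_values l f =
     {c. \<not> (\<exists>D. open D \<and> c \<in> D \<and> trivial_fibration_over (l - 1) f D c)}"

definition Grass :: "nat \<Rightarrow> (real^'n::finite) set set" where
  "Grass d = {V. subspace V \<and> dim V = d}"

text \<open>Topology of the Grassmannian: convergence of the orthogonal projections.\<close>

definition subspace_conv :: "(nat \<Rightarrow> (real^'n::finite) set) \<Rightarrow> (real^'n) set \<Rightarrow> bool" where
  "subspace_conv V h \<longleftrightarrow> (\<forall>v. (\<lambda>k. closest_point (V k) v) \<longlonglongrightarrow> closest_point h v)"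

definition tangent_level :: "(real^'n::finite \<Rightarrow> real) \<Rightarrow> real^'n \<Rightarrow> (real^'n) set" where
  "tangent_level f x = {v. grad f x \<bullet> v = 0}"

definition Omega :: "(real^'n::finite \<Rightarrow> real) \<Rightarrow> (real^'n) set \<Rightarrow> real \<Rightarrow> (real^'n) set set" where
  "Omega f lam c = {h \<in> Grass (CARD('n) - 1). \<exists>x::nat \<Rightarrow> real^'n.
      (\<forall>k. x k \<noteq> 0 \<and> grad f (x k) \<noteq> 0) \<and>
      filterlim (\<lambda>k. norm (x k)) at_top sequentially \<and>
      subspace_conv (\<lambda>k. span {x k}) lam \<and>
      (\<lambda>k. f (x k)) \<longlonglongrightarrow> c \<and>
      subspace_conv (\<lambda>k. tangent_level f (x k)) h}"

definition Xinf :: "(real^'n::finite \<Rightarrow> real) \<Rightarrow> real \<Rightarrow> (real^'n) set set" where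
  "Xinf f c = {lam \<in> Grass 1. Omega f lam c \<noteq> {}}"

definition SISI :: "(real^'n::finite \<Rightarrow> real) \<Rightarrow> real \<Rightarrow> bool" where
  "SISI f c \<longleftrightarrow> (\<exists>\<Lambda>. finite \<Lambda> \<and> \<Lambda> \<subseteq> Grass 1 \<and>
      (\<forall>lam \<in> Xinf f c - \<Lambda>. \<forall>h \<in> Omega f lam c. lam \<subseteq> h))"

definition hausdorff_outer :: "nat \<Rightarrow> 'a::euclidean_space set \<Rightarrow> ennreal" where
  "hausdorff_outer m A =
     (SUP \<delta>\<in>{0<..}. INF C\<in>{C :: nat \<Rightarrow> 'a set. A \<subseteq> (\<Union>i. C i) \<and>
            (\<forall>i. bounded (C i) \<and> diameter (C i) \<le> \<delta>)}.
        (\<Sum>i. if C i = {} then 0 else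
           ennreal (pi powr (real m / 2) / Gamma (real m / 2 + 1) * (diameter (C i) / 2) ^ m)))"

definition hausdorff_measure :: "nat \<Rightarrow> 'a::euclidean_space measure" where
  "hausdorff_measure m = measure_of UNIV (sets borel) (hausdorff_outer m)"

definition gauss_map :: "(real^'n::finite \<Rightarrow> real) \<Rightarrow> real^'n \<Rightarrow> real^'n" where
  "gauss_map f x = grad f x /\<^sub>R norm (grad f x)"

text \<open>k_t(x) = det(d_x \<nu>_t), where d_x \<nu>_t is the endomorphism of T_x F_t = \<nu>(x)^\<bottom>
  given by the derivative of \<nu>; its determinant is computed as the determinant of the
  endomorphism of R^n acting as d_x\<nu>_t on \<nu>(x)^\<bottom> and as the identity on R \<nu>(x).\<close>

definition gauss_curv :: "(real^'n::finite \<Rightarrow> real) \<Rightarrow> real^'n \<Rightarrow> real" where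
  "gauss_curv f x =
     (let \<nu> = gauss_map f x; D = frechet_derivative (gauss_map f) (at x) in
      det (matrix (\<lambda>v. D (v - (v \<bullet> \<nu>) *\<^sub>R \<nu>) + (v \<bullet> \<nu>) *\<^sub>R \<nu>)))"

definition total_abs_curv :: "(real^'n::finite \<Rightarrow> real) \<Rightarrow> real \<Rightarrow> ennreal" where
  "total_abs_curv f t =
     (\<integral>\<^sup>+ x. indicator (f -` {t}) x * ennreal \<bar>gauss_curv f x\<bar>
        \<partial>(hausdorff_measure (CARD('n) - 1)))"

end

theory Submission
 imports Defs
begin

text \<open>
 The area formula writes the total absolute curvature of a level as the integral over the sphere of the number of
 nondegenerate points with a given normal. If every hyperplane transverse to a line \<open>%\<close> were a limit of tangent
 hyperplanes along \<open>%\<close> at \<open>c\<close>, then by o-minimality an open set of normals would be attained, on one side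
 of \<open>c\<close>, at points escaping to infinity, whereas nondegenerate points at level \<open>c\<close> persist; by Fatou's lemma this
 contradicts continuity of the curvature at \<open>c\<close>, which is finite by uniform finiteness. So for each of the finitely
 many exceptional lines some transverse hyperplane is omitted, and a positive homogeneous polynomial \<open>q\<close> can be
 chosen whose level hypersurfaces have these hyperplanes as tangents along the exceptional lines. By the condition
 on the other lines the levels of \<open>f\<close> and \<open>q\<close> are uniformly transverse near infinity, so \<open>f\<close> lifts
 \<open>\<partial>\<^sub>t\<close> to a definable field along which \<open>q\<close> changes at bounded speed, and its flow is complete over a
 neighbourhood of \<open>c\<close>.
\<close>

subsection \<open>Calculus of \<open>C\<^sup>k\<close> maps\<close>

text \<open>At a line obeying the condition, every limit tangent hyperplane contains the line, so by
  Euler's identity it differs from the tangent hyperplane of any positive homogeneous function; the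
  squared norm would do there. Along an exceptional line the levels of \<open>f\<close> may become
  tangent to large spheres, which dictates the choice of \<open>q\<close>: its gradient on that line
  has to be normal to a hyperplane that is not a limit, and the curvature serves to find one. A
  hyperplane determines its normal up to sign, so points with normal u and with normal -u are
  counted together. Escaping points enter the count only if they are nondegenerate; a Sard argument
  for the Gauss map secures this for almost all normals along a sequence of levels. Definability of
  \<open>f\<close> is available over bounded intervals of values, so all definable objects are built
  from truncations of \<open>f\<close> and its gradient near c. Instead of cell decomposition, the
  geometry of definable sets rests on finiteness on lines and Baire category.\<close>

lemma Ck_on_subset: "Ck_on k U g ==> V \<subseteq> U ==> Ck_on k V g"
 by (induction k arbitrary: g) (auto intro: continuous_on_subset)

lemma Ck_on_cong:
 assumes "open U" "!!x. x \<in> U ==> g x = h x"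
 shows "Ck_on k U g \<longleftrightarrow> Ck_on k U h"
 using assms(2)
proof (induction k arbitrary: g h)
 case 0 thus ?case by (simp cong: continuous_on_cong_simp)
next
 case (Suc k)
 have d: "g differentiable (at x) \<longleftrightarrow> h differentiable (at x)" if "x \<in> U" for x
  using has_derivative_transform_within_open[OF _ assms(1) that, of g _ UNIV h]
   has_derivative_transform_within_open[OF _ assms(1) that, of h _ UNIV g] Suc.prems
  unfolding differentiable_def by auto
 have "frechet_derivative g (at x) = frechet_derivative h (at x)"
  if "x \<in> U" "g differentiable (at x)" for x
  using frechet_derivative_transform_within_open[OF that(2) assms(1) that(1)] Suc.prems by metis
 hence "Ck_on k U (%x. frechet_derivative g (at x) v) \<longleftrightarrow>
   Ck_on k U (%x. frechet_derivative h (at x) v)"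
  if "\<forall>x\<in>U. g differentiable (at x)" for v
  using Suc.IH[of "%x. frechet_derivative g (at x) v" "%x. frechet_derivative h (at x) v"] that
  by metis
 with d show ?case by auto
qed

text \<open>The definition of \<open>Ck_on\<close> fixes \<open>frechet_derivative\<close>; on an
  open set an explicit derivative agrees with it, so by \<open>Ck_on_cong\<close> the recursion can
  be continued with the formula. Most closure properties that follow are inductions on the order
  through this rule.\<close>

lemma Ck_on_SucI:
 assumes "open U" and "!!x. x \<in> U ==> (g has_derivative g' x) (at x)"
  and "!!v. v \<in> Basis ==> Ck_on k U (%x. g' x v)"
 shows "Ck_on (Suc k) U g"
proof -
 have "Ck_on k U (%x. frechet_derivative g (at x) v)" if "v \<in> Basis" for v
  using assms(3)[OF that] Ck_on_cong[OF assms(1), of "%x. g' x v" "%x. frechet_derivative g (at x) v" k]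
   frechet_derivative_at[OF assms(2)] by metis
 thus ?thesis
  using assms(2) by (auto simp: differentiable_def)
qed

lemma Ck_on_SucD: "Ck_on (Suc k) U g ==> Ck_on k U g"
proof (induction k arbitrary: g)
 case 0
 thus ?case
  by (auto intro!: continuous_at_imp_continuous_on differentiable_imp_continuous_within)
next
 case (Suc k) thus ?case by auto
qed

lemma Ck_on_mono: "Ck_on k U g ==> j <= k ==> Ck_on j U g"
 by (induction k) (auto simp: le_Suc_eq simp del: Ck_on.simps(2) dest: Ck_on_SucD)

lemma Ck_on_continuous: "Ck_on k U g ==> continuous_on U g"
 using Ck_on_mono[of k U g 0] by simp

lemma Ck_on_has_derivative:
 "Ck_on (Suc k) U g ==> x \<in> U ==> (g has_derivative frechet_derivative g (at x)) (at x)"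
 by (simp add: frechet_derivative_works)

lemma Ck_on_const: "open U ==> Ck_on k U (%x. a)"
 by (induction k arbitrary: a) auto

lemma Ck_on_linear_compose:
 assumes "bounded_linear L" "open U"
 shows "Ck_on k U g ==> Ck_on k U (%x. L (g x))"
proof (induction k arbitrary: g)
 case 0 thus ?case by (simp add: bounded_linear.continuous_on[OF assms(1)])
next
 case (Suc k)
 show ?case
  by (rule Ck_on_SucI[OF assms(2) bounded_linear.has_derivative[OF assms(1) Ck_on_has_derivative[OF Suc.prems]]])
   (use Suc in auto)
qed

lemma Ck_on_ident: "open U ==> Ck_on k U (%x. x)"
 by (cases k) (auto intro!: Ck_on_const)

lemma Ck_on_add:
 assumes "open U"
 shows "Ck_on k U g ==> Ck_on k U h ==> Ck_on k U (%x. g x + h x)"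
proof (induction k arbitrary: g h)
 case 0 thus ?case by (auto intro: continuous_intros)
next
 case (Suc k)
 show ?case
  by (rule Ck_on_SucI[OF assms has_derivative_add[OF Ck_on_has_derivative[OF Suc.prems(1)]
   Ck_on_has_derivative[OF Suc.prems(2)]]]) (use Suc in auto)
qed

lemma Ck_on_sum:
 assumes "open U" shows "(!!i. i \<in> I ==> Ck_on k U (g i)) ==> Ck_on k U (%x. \<Sum>i\<in>I. g i x)"
 by (induction I rule: infinite_finite_induct) (auto intro!: Ck_on_const Ck_on_add assms)

lemma Ck_on_uminus: "open U ==> Ck_on k U g ==> Ck_on k U (%x. - g x)"
 by (rule Ck_on_linear_compose[OF bounded_linear_minus[OF bounded_linear_ident]])

lemma Ck_on_diff:
 assumes "open U" "Ck_on k U g" "Ck_on k U h" shows "Ck_on k U (%x. g x - h x)"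
 using Ck_on_add[OF assms(1,2) Ck_on_uminus[OF assms(1,3)]] by simp

lemma (in bounded_bilinear) Ck_on:
 fixes g :: "'d::euclidean_space => 'a" and h :: "'d => 'b"
 assumes "open U"
 shows "Ck_on k U g ==> Ck_on k U h ==> Ck_on k U (%x. g x ** h x)"
proof (induction k arbitrary: g h)
 case 0 thus ?case by (auto intro: continuous_on)
next
 case (Suc k)
 have "Ck_on k U g" "Ck_on k U h" using Suc.prems Ck_on_SucD by blast+
 thus ?case
  by (intro Ck_on_SucI[OF assms FDERIV[OF Ck_on_has_derivative[OF Suc.prems(1)]
   Ck_on_has_derivative[OF Suc.prems(2)]]])
   (use Suc.prems in \<open>auto intro!: Ck_on_add[OF assms] Suc.IH\<close>)
qed

lemmas Ck_on_scaleR = bounded_bilinear.Ck_on[OF bounded_bilinear_scaleR]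
lemmas Ck_on_inner = bounded_bilinear.Ck_on[OF bounded_bilinear_inner]
lemmas Ck_on_mult = bounded_bilinear.Ck_on[OF bounded_bilinear_mult]

lemma Ck_on_power:
 fixes g :: "'a::euclidean_space => real"
 shows "open U ==> Ck_on k U g ==> Ck_on k U (%x. g x ^ m)"
 by (induction m) (auto intro!: Ck_on_const Ck_on_mult)

lemma Ck_on_Pair:
 assumes "open U" "Ck_on k U g" "Ck_on k U h" shows "Ck_on k U (%x. (g x, h x))"
proof -
 have "bounded_linear (%x::'b. (x, 0::'c))" "bounded_linear (%x::'c. (0::'b, x))"
  by (auto intro: bounded_linear_Pair bounded_linear_ident bounded_linear_zero)
 from Ck_on_add[OF assms(1) Ck_on_linear_compose[OF this(1) assms(1,2)]
   Ck_on_linear_compose[OF this(2) assms(1,3)]]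
 show ?thesis by simp
qed

lemma Ck_on_fst: "open U ==> Ck_on k U (%x. fst x)"
 by (rule Ck_on_linear_compose[OF bounded_linear_fst _ Ck_on_ident])

lemma Ck_on_snd: "open U ==> Ck_on k U (%x. snd x)"
 by (rule Ck_on_linear_compose[OF bounded_linear_snd _ Ck_on_ident])

lemma linear_eq_sum_Basis:
 assumes "linear L" shows "L (x::'a::euclidean_space) = (\<Sum>b\<in>Basis. (x \<bullet> b) *\<^sub>R L b)"
 by (subst (1) euclidean_representation[symmetric])
  (simp only: linear_sum[OF assms] linear_cmul[OF assms])

text \<open>By the chain rule the derivative is a sum over the basis of components of the derivative
  of \<open>h\<close> times partial derivatives of \<open>g\<close> composed with \<open>h\<close>.
  The induction therefore varies \<open>g\<close> and keeps \<open>h\<close>, used with one order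
  less.\<close>

lemma Ck_on_compose:
 fixes g :: "'b::euclidean_space => 'c::real_normed_vector" and h :: "'a::euclidean_space => 'b"
 assumes "open U" "open V" "!!x. x \<in> U ==> h x \<in> V"
 shows "Ck_on k V g ==> Ck_on k U h ==> Ck_on k U (%x. g (h x))"
proof (induction k arbitrary: g)
 case 0
 hence "continuous_on U h" "continuous_on V g" by auto
 thus ?case using assms(3) by (auto intro: continuous_on_compose2)
next
 case (Suc k)
 have hk: "Ck_on k U h" using Suc.prems Ck_on_SucD by blast
 define G where "G y = frechet_derivative g (at y)" for y
 define H where "H x = frechet_derivative h (at x)" for x
 have d: "((%x. g (h x)) has_derivative (%v. \<Sum>b\<in>Basis. (H x v \<bullet> b) *\<^sub>R G (h x) b)) (at x)"
  if x: "x \<in> U" for x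
 proof -
  have 1: "(h has_derivative H x) (at x)" "(g has_derivative G (h x)) (at (h x))"
   using Ck_on_has_derivative[OF Suc.prems(2) x] Ck_on_has_derivative[OF Suc.prems(1) assms(3)[OF x]]
   by (simp_all add: H_def G_def)
  have lin: "linear (G (h x))" using 1(2) has_derivative_linear by blast
  have "G (h x) (H x v) = (\<Sum>b\<in>Basis. (H x v \<bullet> b) *\<^sub>R G (h x) b)" for v
   by (rule linear_eq_sum_Basis[OF lin])
  thus ?thesis
   using diff_chain_at[OF 1] by (simp add: o_def)
 qed
 show ?case
 proof (rule Ck_on_SucI[OF assms(1) d])
  fix v :: 'a assume v: "v \<in> Basis"
  show "Ck_on k U (%x. \<Sum>b\<in>Basis. (H x v \<bullet> b) *\<^sub>R G (h x) b)"
  proof (intro Ck_on_sum Ck_on_scaleR Ck_on_inner Ck_on_const assms(1))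
   show "Ck_on k U (%x. H x v)" using Suc.prems(2) v by (simp add: H_def)
   fix b :: 'b assume "b \<in> Basis"
   hence "Ck_on k V (%y. G y b)" using Suc.prems(1) by (simp add: G_def)
   from Suc.IH[OF this hk] show "Ck_on k U (%x. G (h x) b)" .
  qed
 qed
qed

lemma Ck_on_inverse_real: "Ck_on k (- {0::real}) inverse"
proof (induction k)
 case 0 thus ?case by (auto intro!: continuous_intros)
next
 case (Suc k)
 show ?case
  by (rule Ck_on_SucI[where g' = "%x v. - (inverse x * v * inverse x)"])
   (auto intro!: derivative_eq_intros Ck_on_uminus Ck_on_mult Suc)
qed

lemma Ck_on_inverse:
 fixes g :: "'a::euclidean_space => real"
 assumes "open U" "Ck_on k U g" "!!x. x \<in> U ==> g x ~= 0"
 shows "Ck_on k U (%x. inverse (g x))"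
 by (rule Ck_on_compose[OF assms(1) _ _ Ck_on_inverse_real assms(2)]) (use assms(3) in auto)

lemma Ck_on_divide:
 fixes g :: "'a::euclidean_space => real"
 assumes "open U" "Ck_on k U g" "Ck_on k U h" "!!x. x \<in> U ==> h x ~= 0"
 shows "Ck_on k U (%x. g x / h x)"
 unfolding divide_inverse by (intro Ck_on_mult Ck_on_inverse assms)

text \<open>Derivatives in \<open>Ck_on\<close> are taken with respect to the whole space, so the
  notion is local even if \<open>U\<close> is not open. It serves to glue the flows of truncated
  fields.\<close>

lemma Ck_on_locally:
 assumes "!!x. x \<in> U ==> \<exists>V. open V \<and> x \<in> V \<and> Ck_on k V g"
 shows "Ck_on k U g"
 using assms
proof (induction k arbitrary: g)
 case 0
 show ?case
  unfolding Ck_on.simps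
 proof (rule continuous_at_imp_continuous_on, rule ballI)
  fix x assume "x \<in> U"
  then obtain V where "open V" "x \<in> V" "continuous_on V g" using 0 by auto
  thus "isCont g x" by (simp add: continuous_on_eq_continuous_at)
 qed
next
 case (Suc k)
 have "Ck_on k U (%x. frechet_derivative g (at x) v)" if "v \<in> Basis" for v
  using Suc.prems that by (intro Suc.IH) fastforce
 thus ?case using Suc.prems by fastforce
qed

subsection \<open>Ordinary differential equations\<close>

lemma gronwall_forward:
 fixes z :: "real => 'a::real_inner"
 assumes "0 <= T" and d: "!!s. s \<in> {0..T} ==> (z has_vector_derivative z' s) (at s)"
  and b: "!!s. s \<in> {0..T} ==> norm (z' s) <= L * norm (z s) + \<beta>" and "0 <= L" "0 <= \<beta>"
 shows "(norm (z T))\<^sup>2 + \<beta>\<^sup>2 <= ((norm (z 0))\<^sup>2 + \<beta>\<^sup>2) * exp ((2 * L + 1) * T)"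
proof -
 define M where "M = 2 * L + 1"
 \<comment> \<open>By Cauchy-Schwarz and 2ab <= a^2 + b^2, the derivative of |z|^2 + \<beta>^2 is at
   most \<open>M\<close> times this quantity, so its weighted version decreases. Squares keep it
   differentiable where \<open>z\<close> vanishes.\<close>
 define g where "g s = exp (- M * s) * (z s \<bullet> z s + \<beta>\<^sup>2)" for s
 have "g 0 \<ge> g T"
 proof (rule DERIV_nonpos_imp_nonincreasing[OF assms(1)])
  fix s assume "0 <= s" "s <= T"
  hence s: "s \<in> {0..T}" by simp
  define D where "D = exp (- M * s) * (2 * (z s \<bullet> z' s)) - M * exp (- M * s) * (z s \<bullet> z s + \<beta>\<^sup>2)"
  have zd: "(z has_derivative (%h. h *\<^sub>R z' s)) (at s)"
   using d[OF s] by (simp add: has_vector_derivative_def)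
  have "((%s. z s \<bullet> z s) has_derivative (%h. 2 * (z s \<bullet> z' s) * h)) (at s)"
   by (rule has_derivative_eq_rhs[OF has_derivative_inner[OF zd zd]])
    (auto simp: inner_commute algebra_simps)
  hence "((%s. z s \<bullet> z s) has_real_derivative 2 * (z s \<bullet> z' s)) (at s)"
   by (simp add: has_field_derivative_def)
  hence "(g has_real_derivative D) (at s)"
   unfolding g_def[abs_def] D_def by (auto intro!: derivative_eq_intros simp: algebra_simps)
  moreover have "D <= 0"
  proof -
   have "2 * (z s \<bullet> z' s) <= 2 * (norm (z s) * norm (z' s))"
    using norm_cauchy_schwarz by (auto simp: norm_cauchy_schwarz)
   also have "... <= 2 * (norm (z s) * (L * norm (z s) + \<beta>))"
    by (intro mult_left_mono b s) auto
   also have "... = 2 * L * (norm (z s))\<^sup>2 + 2 * norm (z s) * \<beta>"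
    by (simp add: algebra_simps power2_eq_square)
   also have "... <= 2 * L * (norm (z s))\<^sup>2 + ((norm (z s))\<^sup>2 + \<beta>\<^sup>2)"
    using sum_squares_bound[of "norm (z s)" \<beta>] by simp
   also have "... <= M * ((norm (z s))\<^sup>2 + \<beta>\<^sup>2)"
    using assms(4) by (simp add: M_def algebra_simps)
   finally have "2 * (z s \<bullet> z' s) <= M * (z s \<bullet> z s + \<beta>\<^sup>2)" by (simp add: power2_norm_eq_inner)
   hence "exp (- M * s) * (2 * (z s \<bullet> z' s) - M * (z s \<bullet> z s + \<beta>\<^sup>2)) <= 0"
    by (intro mult_nonneg_nonpos) auto
   thus ?thesis by (simp add: D_def algebra_simps)
  qed
  ultimately show "\<exists>y. (g has_real_derivative y) (at s) \<and> y <= 0" by blast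
 qed
 hence "exp (M * T) * g T <= exp (M * T) * g 0" by simp
 hence "(norm (z T))\<^sup>2 + \<beta>\<^sup>2 <= exp (M * T) * ((norm (z 0))\<^sup>2 + \<beta>\<^sup>2)"
  by (simp add: g_def power2_norm_eq_inner mult.assoc[symmetric] exp_add[symmetric])
 thus ?thesis by (simp add: M_def mult.commute)
qed

lemma has_vector_derivative_reflect:
 assumes "(z has_vector_derivative v) (at (- s))"
 shows "((%s. z (- s)) has_vector_derivative - v) (at (s::real))"
 using vector_diff_chain_at[of uminus "-1" s z v] assms
  has_vector_derivative_minus[OF has_vector_derivative_id, of "at s"] by (simp add: o_def)

lemma gronwall:
 fixes z :: "real => 'a::real_inner"
 assumes d: "!!s. s \<in> closed_segment 0 T ==> (z has_vector_derivative z' s) (at s)"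
  and b: "!!s. s \<in> closed_segment 0 T ==> norm (z' s) <= L * norm (z s) + \<beta>" and "0 <= L" "0 <= \<beta>"
 shows "(norm (z T))\<^sup>2 + \<beta>\<^sup>2 <= ((norm (z 0))\<^sup>2 + \<beta>\<^sup>2) * exp ((2 * L + 1) * \<bar>T\<bar>)"
proof (cases "0 <= T")
 case True
 thus ?thesis using gronwall_forward[of T z z' L \<beta>] assms by (simp add: closed_segment_eq_real_ivl)
next
 case False
 have "((%s. z (- s)) has_vector_derivative - z' (- s)) (at s)" if "s \<in> {0..- T}" for s
  using has_vector_derivative_reflect[OF d[of "- s"]] that False
  by (auto simp: closed_segment_eq_real_ivl)
 thus ?thesis
  using gronwall_forward[of "- T" "%s. z (- s)" "%s. - z' (- s)" L \<beta>] b False assms(3,4)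
  by (simp add: closed_segment_eq_real_ivl)
qed

lemma ode_unique:
 fixes y :: "real => 'a::real_inner"
 assumes "!!s. s \<in> closed_segment 0 T ==> (y has_vector_derivative F s (y s)) (at s)"
  and "!!s. s \<in> closed_segment 0 T ==> (x has_vector_derivative F s (x s)) (at s)"
  and "!!s. s \<in> closed_segment 0 T ==> norm (F s (y s) - F s (x s)) <= L * norm (y s - x s)"
  and "0 <= L" "y 0 = x 0"
 shows "y T = x T"
 using gronwall[of T "%s. y s - x s" "%s. F s (y s) - F s (x s)" L 0] assms
 by (auto intro!: derivative_eq_intros simp: sum_power2_le_zero_iff)

section \<open>Global existence for Lipschitz fields\<close>

lemma exp_growth_bound:
 fixes G :: "real => 'a::real_normed_vector"
 assumes d: "!!s. (G has_vector_derivative G' s) (at s)" and L: "L > 0"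
  and b: "!!s. norm (G' s) <= K * exp (2 * L * \<bar>s\<bar>)"
 shows "norm (G s - G 0) <= K / (2 * L) * exp (2 * L * \<bar>s\<bar>)"
proof -
 have K: "0 <= K" using order_trans[OF norm_ge_zero b[of 0]] by simp
 have main: "norm (H s - H 0) <= K / (2 * L) * exp (2 * L * s)"
  if "s > 0" and H: "!!s. (H has_vector_derivative H' s) (at s)"
   "!!s. s > 0 ==> norm (H' s) <= K * exp (2 * L * s)" for s and H :: "real => 'a" and H'
 proof -
  have "norm (H s - H 0) <= K / (2 * L) * exp (2 * L * s) - K / (2 * L) * exp (2 * L * 0)"
  proof (rule differentiable_bound_general[OF that(1), where f' = H' and \<phi>' = "%s. K * exp (2 * L * s)"])
   show "continuous_on {0..s} H"
    using H(1) by (auto intro!: continuous_at_imp_continuous_on has_vector_derivative_continuous)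
   show "((%s. K / (2 * L) * exp (2 * L * s)) has_vector_derivative K * exp (2 * L * x)) (at x)" for x
    using \<open>L > 0\<close> by (auto intro!: derivative_eq_intros
     simp: has_real_derivative_iff_has_vector_derivative[symmetric])
  qed (use H L in \<open>auto intro!: continuous_intros\<close>)
  thus ?thesis using K \<open>L > 0\<close> by (smt (verit) divide_nonneg_pos exp_ge_zero mult_nonneg_nonneg)
 qed
 consider "s > 0" | "s = 0" | "s < 0" by linarith
 thus ?thesis
 proof cases
  case 1 thus ?thesis using main[OF 1, of G G'] d b by (metis abs_of_pos)
 next
  case 2 thus ?thesis using K \<open>L > 0\<close> by simp
 next
  case 3
  have "((%s. G (- s)) has_vector_derivative - G' (- s)) (at s)" for s
   by (rule has_vector_derivative_reflect[OF d])
  from main[of "- s" "%s. G (- s)", OF _ this] 3 b show ?thesis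
   by (metis abs_minus_cancel abs_of_pos minus_minus minus_zero neg_0_less_iff_less norm_minus_cancel)
 qed
qed

text \<open>Picard iteration in the space of continuous functions \<open>y\<close> with \<open>exp (-2 L \<bar>s\<bar>) y(s)\<close> bounded, where it
 is a contraction on the whole time line.\<close>

lemma ode_exists_bounded:
 fixes F :: "real => 'a::euclidean_space => 'a"
 assumes cont: "continuous_on UNIV (%p. F (fst p) (snd p))"
  and lip: "!!s x y. norm (F s x - F s y) <= L * norm (x - y)" and L: "L > 0"
  and bd: "!!s. norm (F s 0) <= M"
 shows "\<exists>y. y 0 = x0 \<and> (\<forall>s. (y has_vector_derivative F s (y s)) (at s))"
proof -
 define E :: "real => real" where "E s = exp (2 * L * \<bar>s\<bar>)" for s
 have E1: "E s \<ge> 1" for s using L by (simp add: E_def)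
 have E0: "E s > 0" for s by (simp add: E_def)
 have Ec: "continuous_on UNIV E" unfolding E_def by (intro continuous_intros)
 have M: "0 <= M" using order_trans[OF norm_ge_zero bd] .
 define h where "h g s = F s (E s *\<^sub>R apply_bcontfun g s)" for g :: "real \<Rightarrow>\<^sub>C 'a" and s
 have hc: "continuous_on UNIV (h g)" for g
 proof -
  have "continuous_on UNIV (%s. (s, E s *\<^sub>R apply_bcontfun g s))"
   by (intro continuous_intros Ec) auto
  from continuous_on_compose2[OF cont this] show ?thesis by (simp add: h_def[abs_def])
 qed
 have "\<exists>F. (\<forall>s. (F has_vector_derivative h g s) (at s)) \<and> F 0 = 0" for g
 proof -
  obtain G where "\<forall>s::real. (G has_vector_derivative h g s) (at s)"
   using einterval_antiderivative[of "-\<infinity>" "\<infinity>" "h g"] hc[of g]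
   by (auto simp: continuous_on_eq_continuous_at)
  thus ?thesis by (intro exI[of _ "%s. G s - G 0"]) (auto intro!: derivative_eq_intros)
 qed
 then obtain G where G: "!!g s. (G g has_vector_derivative h g s) (at s)" "!!g. G g 0 = 0" by metis
 have hb: "norm (h g s) <= (M + L * norm g) * E s" for g s
 proof -
  have "norm (h g s) <= norm (F s 0) + norm (h g s - F s 0)" by norm
  also have "... <= M + L * norm (E s *\<^sub>R apply_bcontfun g s - 0)"
   unfolding h_def by (intro add_mono bd lip)
  also have "... <= M * E s + L * (E s * norm g)"
   using mult_left_mono[OF E1[of s] M] L E0[of s] norm_bounded[of g s]
   by (intro add_mono) (auto intro!: mult_left_mono)
  finally show ?thesis by (simp add: algebra_simps)
 qed
 have Gb: "norm (G g s) <= (M + L * norm g) / (2 * L) * E s" for g s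
  using exp_growth_bound[OF G(1) L, of g "M + L * norm g" s] hb[of g] G(2)[of g] by (simp add: E_def)
 \<comment> \<open>Integrating the weight contributes 1 / (2 L), which turns the Lipschitz constant
   \<open>L\<close> into the contraction factor 1/2; this is why the weight has the exponent 2
   L.\<close>
 have Gd: "norm (G g s - G g' s) <= (1/2) * dist g g' * E s" for g g' s
 proof -
  have "norm (h g s - h g' s) <= L * dist g g' * exp (2 * L * \<bar>s\<bar>)" for s
  proof -
   have "norm (h g s - h g' s) <= L * norm (E s *\<^sub>R apply_bcontfun g s - E s *\<^sub>R apply_bcontfun g' s)"
    unfolding h_def by (rule lip)
   also have "... = L * (E s * dist (apply_bcontfun g s) (apply_bcontfun g' s))"
    using E0[of s] by (simp add: dist_norm scaleR_diff_right[symmetric])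
   also have "... <= L * (E s * dist g g')"
    using L E0[of s] dist_bounded[of g s g'] by (intro mult_left_mono) auto
   finally show ?thesis by (simp add: E_def algebra_simps)
  qed
  from exp_growth_bound[OF has_vector_derivative_diff[OF G(1) G(1)] L this, of s] G(2) L
  show ?thesis by (simp add: E_def)
 qed
 \<comment> \<open>Picard's operator conjugated by the weight: \<open>G g\<close> is the
   antiderivative of the field along the unweighted curve, and a fixed point gives the solution
   \<open>x0 + G g\<close>.\<close>
 define \<Phi> where "\<Phi> g = Bcontfun (%s. (1 / E s) *\<^sub>R (x0 + G g s))" for g
 have app: "apply_bcontfun (\<Phi> g) s = (1 / E s) *\<^sub>R (x0 + G g s)" for g s
 proof -
  have "continuous_on UNIV (%s. (1 / E s) *\<^sub>R (x0 + G g s))"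
   using G(1) E0 by (intro continuous_intros Ec)
    (auto simp: less_le intro!: continuous_at_imp_continuous_on has_vector_derivative_continuous)
  moreover have "norm ((1 / E s) *\<^sub>R (x0 + G g s)) <= norm x0 + (M + L * norm g) / (2 * L)" for s
  proof -
   have "norm (x0 + G g s) <= norm x0 * E s + (M + L * norm g) / (2 * L) * E s"
    using norm_triangle_ineq[of x0 "G g s"] Gb[of g s] mult_left_mono[OF E1[of s] norm_ge_zero[of x0]]
    by simp
   hence "norm (x0 + G g s) / E s <= norm x0 + (M + L * norm g) / (2 * L)"
    using E0[of s] by (simp only: pos_divide_le_eq distrib_right)
   thus ?thesis using E0[of s] by simp
  qed
  ultimately show ?thesis
   unfolding \<Phi>_def by (subst Bcontfun_inverse) (blast intro: bcontfun_normI, rule refl)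
 qed
 have "\<exists>!g. \<Phi> g = g"
 proof (rule banach_fix_type[of "1/2"])
  show "\<forall>g g'. dist (\<Phi> g) (\<Phi> g') <= 1 / 2 * dist g g'"
  proof (intro allI dist_bound)
   fix g g' s
   have "apply_bcontfun (\<Phi> g) s - apply_bcontfun (\<Phi> g') s = (1 / E s) *\<^sub>R (G g s - G g' s)"
    by (simp add: app scaleR_diff_right[symmetric])
   hence "dist (apply_bcontfun (\<Phi> g) s) (apply_bcontfun (\<Phi> g') s) = norm (G g s - G g' s) / E s"
    using E0[of s] by (simp add: dist_norm)
   also have "... <= 1/2 * dist g g'"
    using Gd[of g s g'] E0[of s] by (simp add: field_simps)
   finally show "dist (apply_bcontfun (\<Phi> g) s) (apply_bcontfun (\<Phi> g') s) <= 1/2 * dist g g'" .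
  qed
 qed auto
 then obtain g where g: "\<Phi> g = g" by blast
 define y where "y s = x0 + G g s" for s
 have "E s *\<^sub>R apply_bcontfun g s = y s" for s
  using app[of g s] E0[of s] by (simp add: g y_def)
 hence "(y has_vector_derivative F s (y s)) (at s)" for s
  using G(1)[of g s] unfolding y_def[abs_def] h_def by (auto intro!: derivative_eq_intros)
 thus ?thesis using G(2) by (intro exI[of _ y]) (auto simp: y_def)
qed

text \<open>The field at the origin may be unbounded in time, so time is clamped to [-T, T], where
  it is bounded by compactness. Solutions for different \<open>T\<close> agree on common times by
  uniqueness, and the value at time \<open>s\<close> is taken from the clamp
  \<open>\<bar>s\<bar> + 1\<close>.\<close>

lemma ode_exists:
 fixes F :: "real => 'a::euclidean_space => 'a"
 assumes cont: "continuous_on UNIV (%p. F (fst p) (snd p))"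
  and lip: "!!s x y. norm (F s x - F s y) <= L * norm (x - y)" and L: "L > 0"
 shows "\<exists>y. y 0 = x0 \<and> (\<forall>s. (y has_vector_derivative F s (y s)) (at s))"
proof -
 define c where "c T s = max (- T) (min T s)" for T s :: real
 have "\<exists>y. y 0 = x0 \<and> (\<forall>s. (y has_vector_derivative F (c T s) (y s)) (at s))" for T
 proof -
  have cc: "continuous_on UNIV (%p::real \<times> 'a. (c T (fst p), snd p))"
   unfolding c_def by (intro continuous_intros)
  have "continuous_on {-\<bar>T\<bar>..\<bar>T\<bar>} (%s. F s 0)"
   using continuous_on_compose2[OF cont continuous_on_Pair[OF continuous_on_id continuous_on_const]] by simp
  hence "bounded ((%s. F s 0) ` {-\<bar>T\<bar>..\<bar>T\<bar>})"
   by (intro compact_imp_bounded compact_continuous_image) auto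
  then obtain M where M: "!!s. s \<in> {-\<bar>T\<bar>..\<bar>T\<bar>} ==> norm (F s 0) <= M"
   unfolding bounded_iff by (metis imageI)
  have "c T s \<in> {-\<bar>T\<bar>..\<bar>T\<bar>}" for s by (auto simp: c_def)
  with M have "norm (F (c T s) 0) <= M" for s by blast
  from ode_exists_bounded[of "%s. F (c T s)" L M x0, OF _ lip L this] continuous_on_compose2[OF cont cc]
  show ?thesis by simp
 qed
 then obtain y where y: "!!T. y T 0 = x0"
  "!!T s. (y T has_vector_derivative F (c T s) (y T s)) (at s)" by metis
 have same: "y T s = y T' s" if "\<bar>s\<bar> < T" "\<bar>s\<bar> < T'" for T T' s
 proof (rule ode_unique[where F = F and L = L])
  fix r assume "r \<in> closed_segment 0 s"
  hence "c T r = r" "c T' r = r" using that by (auto simp: closed_segment_eq_real_ivl c_def split: if_splits)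
  thus "(y T has_vector_derivative F r (y T r)) (at r)" "(y T' has_vector_derivative F r (y T' r)) (at r)"
   using y(2)[of T r] y(2)[of T' r] by auto
 qed (use lip L y(1) in auto)
 define Y where "Y s = y (\<bar>s\<bar> + 1) s" for s
 have "(Y has_vector_derivative F s (Y s)) (at s)" for s
 proof (rule has_vector_derivative_transform_within_open[of "y (\<bar>s\<bar> + 1)" _ s "{-(\<bar>s\<bar> + 1)<..<\<bar>s\<bar> + 1}"])
  show "(y (\<bar>s\<bar> + 1) has_vector_derivative F s (Y s)) (at s)"
   using y(2)[of "\<bar>s\<bar> + 1" s] by (simp add: Y_def c_def min_def max_def split: if_splits)
  show "y (\<bar>s\<bar> + 1) r = Y r" if "r \<in> {-(\<bar>s\<bar> + 1)<..<\<bar>s\<bar> + 1}" for r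
   unfolding Y_def using that by (intro same) auto
 qed auto
 thus ?thesis using y(1) by (intro exI[of _ Y]) (auto simp: Y_def)
qed

section \<open>Dependence on parameters and smoothness of flows\<close>

lemma continuous_uniform_compact:
 fixes h :: "'s::euclidean_space \<times> 'p::euclidean_space => 'a::metric_space"
 assumes "continuous_on UNIV h" "compact K" "e > 0"
 shows "\<exists>d>0. \<forall>p. dist p p0 < d --> (\<forall>s\<in>K. dist (h (s, p)) (h (s, p0)) < e)"
proof -
 have "uniformly_continuous_on (K \<times> cball p0 1) h"
  using assms by (intro compact_uniformly_continuous compact_Times)
   (auto intro: continuous_on_subset)
 then obtain d where d: "d > 0" "!!x y. x \<in> K \<times> cball p0 1 ==> y \<in> K \<times> cball p0 1 ==> dist y x < d ==> dist (h y) (h x) < e"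
  using assms(3) unfolding uniformly_continuous_on_def by metis
 show ?thesis
  using d(1) by (intro exI[of _ "min d 1"]) (auto intro!: d(2) simp: dist_Pair_Pair dist_commute)
qed

text \<open>Two solutions are compared by Gronwall's inequality. The defect is the change of the
  field along the fixed reference solution when the parameter moves, which is small uniformly on a
  compact time interval. The map \<open>J\<close> allows both for constant initial values and for
  the parameter itself as initial value.\<close>

lemma ode_continuous_param:
 fixes G :: "real \<times> 'p::euclidean_space \<times> 'a::euclidean_space => 'a"
 assumes cont: "continuous_on UNIV G"
  and lip: "!!s p x y. norm (G (s, p, x) - G (s, p, y)) <= L * norm (x - y)" and L: "L \<ge> 0"
  and y: "!!s p. ((%s. y (s, p)) has_vector_derivative G (s, p, y (s, p))) (at s)"
  and J: "bounded_linear J" "!!p q. y (0, q) - y (0, p) = J (q - p)"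
 shows "continuous_on UNIV y"
proof -
 have "isCont y (s0, p0)" for s0 p0
 proof -
  define T where "T = \<bar>s0\<bar> + 1"
  define C where "C = exp ((2 * L + 1) * T)"
  have C: "C > 0" by (simp add: C_def)
  have yc: "continuous_on UNIV (%s. y (s, p0))"
   using y by (auto intro!: continuous_at_imp_continuous_on has_vector_derivative_continuous)
  show ?thesis
   unfolding continuous_at_eps_delta
  proof (intro allI impI)
   fix e :: real assume e: "e > 0"
   \<comment> \<open>Initial error and defect are both kept below \<open>e1\<close>, so the Gronwall
     bound becomes 2 e1^2 C = (e/2)^2.\<close>
   define e1 where "e1 = sqrt ((e/2)\<^sup>2 / (2 * C))"
   have e1: "e1 > 0" "2 * e1\<^sup>2 * C = (e/2)\<^sup>2" using e C by (auto simp: e1_def)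
   have "continuous_on UNIV (%z. G (fst z, snd z, y (fst z, p0)))"
    by (rule continuous_on_compose2[OF cont])
     (auto intro!: continuous_intros continuous_on_compose2[OF yc])
   from continuous_uniform_compact[OF this, of "{-T..T}" e1 p0] e1
   obtain d1 where d1: "d1 > 0" "!!p s. dist p p0 < d1 ==> s \<in> {-T..T} ==>
     norm (G (s, p, y (s, p0)) - G (s, p0, y (s, p0))) < e1" by (auto simp: dist_norm)
   obtain K where K: "K > 0" "!!v. norm (J v) <= norm v * K" using bounded_linear.pos_bounded[OF J(1)] by blast
   from yc have "isCont (%s. y (s, p0)) s0" by (simp add: continuous_on_eq_continuous_at)
   then obtain d2 where d2: "d2 > 0" "!!s. \<bar>s - s0\<bar> < d2 ==> dist (y (s, p0)) (y (s0, p0)) < e/2"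
    unfolding continuous_at_eps_delta using e by (metis dist_real_def half_gt_zero)
   define d where "d = min (min d1 (e1 / K)) (min d2 1)"
   have dpos: "d > 0" using d1 d2 e1 K by (simp add: d_def)
   have "dist (y q) (y (s0, p0)) < e" if q: "dist q (s0, p0) < d" for q
   proof -
    obtain s p where sp: "q = (s, p)" by (cases q)
    have s: "\<bar>s - s0\<bar> < d" and p: "dist p p0 < d"
     using q dist_fst_le[of q "(s0,p0)"] dist_snd_le[of q "(s0,p0)"] by (auto simp: sp dist_real_def)
    have sT: "\<bar>s\<bar> <= T" using s by (auto simp: d_def T_def)
    let ?z = "%r. y (r, p) - y (r, p0)"
    have "(norm (?z s))\<^sup>2 + e1\<^sup>2 <= ((norm (?z 0))\<^sup>2 + e1\<^sup>2) * exp ((2 * L + 1) * \<bar>s\<bar>)"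
    proof (rule gronwall[where z' = "%r. G (r, p, y (r, p)) - G (r, p0, y (r, p0))"])
     fix r assume r: "r \<in> closed_segment 0 s"
     hence rT: "r \<in> {-T..T}" using sT by (auto simp: closed_segment_eq_real_ivl split: if_splits)
     show "(?z has_vector_derivative G (r, p, y (r, p)) - G (r, p0, y (r, p0))) (at r)"
      by (intro has_vector_derivative_diff y)
     have "dist p p0 < d1" using p by (simp add: d_def)
     from d1(2)[OF this rT] lip[of r p "y (r, p)" "y (r, p0)"]
      norm_triangle_ineq[of "G (r, p, y (r, p)) - G (r, p, y (r, p0))" "G (r, p, y (r, p0)) - G (r, p0, y (r, p0))"]
     show "norm (G (r, p, y (r, p)) - G (r, p0, y (r, p0))) <= L * norm (?z r) + e1"
      by simp
    qed (use L e1 in auto)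
    also have "... <= (e1\<^sup>2 + e1\<^sup>2) * C"
    proof (intro mult_mono add_mono power_mono)
     have "norm (?z 0) <= norm (p - p0) * K" using J(2) K(2) by simp
     also have "... <= e1" using p K(1) by (simp add: d_def dist_norm field_simps)
     finally show "norm (?z 0) <= e1" .
     show "exp ((2 * L + 1) * \<bar>s\<bar>) <= C" using sT L by (auto simp: C_def intro!: mult_left_mono)
    qed (use e1(1) in auto)
    finally have "(norm (?z s))\<^sup>2 + e1\<^sup>2 <= (e/2)\<^sup>2" using e1(2) by (simp add: algebra_simps)
    moreover have "e1\<^sup>2 > 0" using e1(1) by simp
    ultimately have "(norm (?z s))\<^sup>2 < (e/2)\<^sup>2" by linarith
    hence "norm (?z s) < e/2" by (rule power_less_imp_less_base) (use e in auto)
    moreover have "dist (y (s, p0)) (y (s0, p0)) < e/2" using s by (intro d2) (simp add: d_def)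
    ultimately show ?thesis unfolding sp using dist_triangle[of "y (s,p)" "y (s0,p0)" "y (s,p0)"]
     by (simp add: dist_norm)
   qed
   thus "\<exists>d>0. \<forall>q. dist q (s0, p0) < d --> dist (y q) (y (s0, p0)) < e" using dpos by blast
  qed
 qed
 thus ?thesis by (auto intro!: continuous_at_imp_continuous_on)
qed

text \<open>This is strict differentiability, uniform over \<open>K\<close>: both endpoints may
  vary, as needed to compare two points of a level near a third. The mean value inequality reduces
  it to continuity of the derivative on basis vectors, each allowed the share \<open>e1\<close> of
  \<open>e\<close>.\<close>

lemma C1_uniform_differentiability:
 fixes G :: "'a::euclidean_space => 'b::euclidean_space"
 assumes d: "!!z. (G has_derivative G' z) (at z)"
  and c: "!!v. v \<in> Basis ==> continuous_on UNIV (%z. G' z v)"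
  and "compact K" "e > 0"
 shows "\<exists>\<delta>>0. \<forall>z\<in>K. \<forall>z1 z2. dist z1 z < \<delta> --> dist z2 z < \<delta> -->
  norm (G z2 - G z1 - G' z (z2 - z1)) <= e * norm (z2 - z1)"
proof -
 define e1 where "e1 = e / DIM('a)"
 have e1: "e1 > 0" using assms(4) by (simp add: e1_def)
 have "\<exists>\<delta>>0. \<forall>h. dist h 0 < \<delta> --> (\<forall>z\<in>K. dist (G' (z + h) v) (G' (z + 0) v) < e1)" if "v \<in> Basis" for v
 proof -
  have "continuous_on UNIV (%z::'a \<times> 'a. G' (fst z + snd z) v)"
   by (rule continuous_on_compose2[OF c[OF that]]) (auto intro!: continuous_intros)
  from continuous_uniform_compact[OF this assms(3) e1, of 0] show ?thesis by simp
 qed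
 then obtain \<delta> where \<delta>: "!!v. v \<in> Basis ==> \<delta> v > 0"
  "!!v h z. v \<in> Basis ==> norm h < \<delta> v ==> z \<in> K ==> dist (G' (z + h) v) (G' z v) < e1"
  by (simp add: dist_norm) metis
 define D where "D = Min (\<delta> ` Basis)"
 have D: "D > 0" "!!v. v \<in> Basis ==> D <= \<delta> v" using \<delta>(1) by (auto simp: D_def)
 have "norm (G z2 - G z1 - G' z (z2 - z1)) <= e * norm (z2 - z1)"
  if z: "z \<in> K" "dist z1 z < D" "dist z2 z < D" for z z1 z2
 proof -
  have "norm (G z2 - G z1 - G' z (z2 - z1)) <= norm (z2 - z1) * e"
  proof (rule differentiable_bound_linearization[of z1 z2 "ball z D" G G' z e])
   fix t :: real assume t: "t \<in> {0..1}"
   have "(1 - t) *\<^sub>R z1 + t *\<^sub>R z2 \<in> ball z D"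
    using t z(2,3) by (intro convexD[OF convex_ball]) (auto simp: dist_commute)
   thus "z1 + t *\<^sub>R (z2 - z1) \<in> ball z D" by (simp add: algebra_simps)
  next
   fix x assume "x \<in> ball z D"
   thus "(G has_derivative G' x) (at x within ball z D)"
    using d has_derivative_at_withinI by blast
   have lin: "linear (G' x)" "linear (G' z)" using d has_derivative_linear by blast+
   have xd: "norm (x - z) < \<delta> v" if "v \<in> Basis" for v
    using \<open>x \<in> ball z D\<close> D(2)[OF that] by (simp add: dist_norm norm_minus_commute)
   have "norm ((G' x - G' z) u) <= e * norm u" for u
   proof -
    have "(G' x - G' z) u = (\<Sum>b\<in>Basis. (u \<bullet> b) *\<^sub>R (G' x b - G' z b))"
     using linear_eq_sum_Basis[OF lin(1), of u] linear_eq_sum_Basis[OF lin(2), of u]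
     by (simp add: sum_subtractf scaleR_diff_right)
    also have "norm ... <= (\<Sum>b\<in>(Basis::'a set). norm u * e1)"
    proof (rule sum_norm_le)
     fix b :: 'a assume b: "b \<in> Basis"
     have "norm (G' x b - G' z b) <= e1"
      using \<delta>(2)[OF b xd[OF b] z(1)] by (simp add: dist_norm)
     thus "norm ((u \<bullet> b) *\<^sub>R (G' x b - G' z b)) <= norm u * e1"
      using Basis_le_norm[OF b, of u] by (auto intro!: mult_mono)
    qed
    also have "... = e * norm u" by (simp add: e1_def)
    finally show ?thesis .
   qed
   thus "onorm (G' x - G' z) <= e" by (intro onorm_le)
  qed (use D in auto)
  thus ?thesis by (simp add: mult.commute)
 qed
 thus ?thesis using D(1) by blast
qed

lemma C1_lipschitz_on_compact:
 fixes G :: "'a::euclidean_space => 'b::euclidean_space"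
 assumes d: "!!z. (G has_derivative G' z) (at z)"
  and c: "!!v. v \<in> Basis ==> continuous_on UNIV (%z. G' z v)" and "compact K"
 shows "\<exists>M>0. \<exists>\<delta>>0. \<forall>z\<in>K. \<forall>z'. dist z' z < \<delta> --> norm (G z' - G z) <= M * norm (z' - z)"
proof -
 obtain \<delta> where \<delta>: "\<delta> > 0" "!!z z1 z2. z \<in> K ==> dist z1 z < \<delta> ==> dist z2 z < \<delta> ==>
  norm (G z2 - G z1 - G' z (z2 - z1)) <= 1 * norm (z2 - z1)"
  using C1_uniform_differentiability[OF d c assms(3), of 1] by auto
 have "bounded ((%z. G' z v) ` K)" if "v \<in> Basis" for v
  using c[OF that] assms(3)
  by (intro compact_imp_bounded compact_continuous_image) (auto intro: continuous_on_subset)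
 then obtain B where B: "!!v z. v \<in> Basis ==> z \<in> K ==> norm (G' z v) <= B v"
  unfolding bounded_iff by (metis imageI)
 define M where "M = 1 + (\<Sum>v\<in>Basis. \<bar>B v\<bar>)"
 have "norm (G z' - G z) <= M * norm (z' - z)" if z: "z \<in> K" "dist z' z < \<delta>" for z z'
 proof -
  have lin: "linear (G' z)" using d has_derivative_linear by blast
  have "norm (G' z (z' - z)) <= (\<Sum>b\<in>Basis. norm (z' - z) * \<bar>B b\<bar>)"
   unfolding linear_eq_sum_Basis[OF lin, of "z' - z"]
  proof (rule sum_norm_le)
   fix b :: 'a assume b: "b \<in> Basis"
   thus "norm (((z' - z) \<bullet> b) *\<^sub>R G' z b) <= norm (z' - z) * \<bar>B b\<bar>"
    using Basis_le_norm[OF b, of "z' - z"] B[OF b z(1)] by (auto intro!: mult_mono)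
  qed
  moreover have "norm (G z' - G z - G' z (z' - z)) <= norm (z' - z)"
   using \<delta>(2)[OF z(1) _ z(2), of z] \<delta>(1) by simp
  moreover have "norm (G z' - G z) <= norm (G' z (z' - z)) + norm (G z' - G z - G' z (z' - z))"
   by (rule norm_triangle_sub)
  ultimately have "norm (G z' - G z) <= norm (z' - z) * (\<Sum>b\<in>Basis. \<bar>B b\<bar>) + norm (z' - z)"
   unfolding sum_distrib_left[symmetric] by linarith
  thus ?thesis
   by (simp only: M_def distrib_right mult_1_left) (simp add: mult.commute)
 qed
 moreover have "M > 0" unfolding M_def by (simp add: add_pos_nonneg sum_nonneg)
 ultimately show ?thesis using \<delta>(1) by blast
qed

text \<open>Here \<open>Y s p v\<close> solves the equation of first variation.\<close>

lemma ode_differentiable_param: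
 fixes G :: "real \<times> 'p::euclidean_space \<times> 'a::euclidean_space => 'a"
 assumes d: "!!z. (G has_derivative G' z) (at z)"
  and c: "!!v. v \<in> Basis ==> continuous_on UNIV (%z. G' z v)"
  and lip: "!!s p x y. norm (G (s, p, x) - G (s, p, y)) <= L * norm (x - y)"
  and lip': "!!s p x u. norm (G' (s, p, x) (0, 0, u)) <= L * norm u" and L: "L \<ge> 0"
  and y: "!!s p. ((%s. y (s, p)) has_vector_derivative G (s, p, y (s, p))) (at s)"
  and J: "linear J" "!!v. norm (J v) <= norm v" "!!p q. y (0, q) - y (0, p) = J (q - p)"
  and Y: "!!s p v. ((%s. Y s p v) has_vector_derivative G' (s, p, y (s, p)) (0, v, Y s p v)) (at s)"
   "!!p v. Y 0 p v = J v"
 shows "(y has_derivative (%(\<sigma>, v). \<sigma> *\<^sub>R G (s, p, y (s, p)) + Y s p v)) (at (s, p))"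
proof -
 have Gc: "continuous_on UNIV G"
  using d by (auto intro!: continuous_at_imp_continuous_on has_derivative_continuous)
 have yc: "continuous_on UNIV y"
  by (rule ode_continuous_param[OF Gc lip L y linear_conv_bounded_linear[THEN iffD1, OF J(1)] J(3)])
 have lin: "linear (G' z)" for z using d has_derivative_linear by blast
 have split: "G' z (0, v, u) = G' z (0, v, 0) + G' z (0, 0, u)" for z v u
  using linear_add[OF lin, of z "(0, v, 0)" "(0, 0, u)"] by simp
 have Yadd: "Y s p (v + v') = Y s p v + Y s p v'" for s p v v'
 proof (rule ode_unique[where F = "%s x. G' (s, p, y (s, p)) (0, v + v', x)" and L = L])
  fix r
  have "G' (r, p, y (r, p)) (0, v + v', Y r p v + Y r p v') =
   G' (r, p, y (r, p)) (0, v, Y r p v) + G' (r, p, y (r, p)) (0, v', Y r p v')"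
   using linear_add[OF lin, of "(r, p, y (r, p))" "(0, v, Y r p v)" "(0, v', Y r p v')"] by simp
  thus "((%s. Y s p v + Y s p v') has_vector_derivative
    G' (r, p, y (r, p)) (0, v + v', Y r p v + Y r p v')) (at r)"
   using has_vector_derivative_add[OF Y(1)[of p v r] Y(1)[of p v' r]] by simp
  show "norm (G' (r, p, y (r, p)) (0, v + v', Y r p (v + v')) -
    G' (r, p, y (r, p)) (0, v + v', Y r p v + Y r p v')) <= L * norm (Y r p (v + v') - (Y r p v + Y r p v'))"
   using lip'[of r p "y (r, p)" "Y r p (v + v') - (Y r p v + Y r p v')"]
    linear_diff[OF lin, of "(r, p, y (r, p))" "(0, v + v', Y r p (v + v'))" "(0, v + v', Y r p v + Y r p v')"]
   by simp
 qed (use Y L J(1) in \<open>auto simp: linear_add\<close>)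
 have Yscale: "Y s p (a *\<^sub>R v) = a *\<^sub>R Y s p v" for s p v a
 proof (rule ode_unique[where F = "%s x. G' (s, p, y (s, p)) (0, a *\<^sub>R v, x)" and L = L])
  fix r
  have "G' (r, p, y (r, p)) (0, a *\<^sub>R v, a *\<^sub>R Y r p v) = a *\<^sub>R G' (r, p, y (r, p)) (0, v, Y r p v)"
   using linear_cmul[OF lin, of "(r, p, y (r, p))" a "(0, v, Y r p v)"] by simp
  thus "((%s. a *\<^sub>R Y s p v) has_vector_derivative
    G' (r, p, y (r, p)) (0, a *\<^sub>R v, a *\<^sub>R Y r p v)) (at r)"
   using bounded_linear.has_vector_derivative[OF bounded_linear_scaleR_right[of a] Y(1)[of p v r]] by simp
  show "norm (G' (r, p, y (r, p)) (0, a *\<^sub>R v, Y r p (a *\<^sub>R v)) -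
    G' (r, p, y (r, p)) (0, a *\<^sub>R v, a *\<^sub>R Y r p v)) <= L * norm (Y r p (a *\<^sub>R v) - a *\<^sub>R Y r p v)"
   using lip'[of r p "y (r, p)" "Y r p (a *\<^sub>R v) - a *\<^sub>R Y r p v"]
    linear_diff[OF lin, of "(r, p, y (r, p))" "(0, a *\<^sub>R v, Y r p (a *\<^sub>R v))" "(0, a *\<^sub>R v, a *\<^sub>R Y r p v)"]
   by simp
 qed (use Y L J(1) in \<open>auto simp: linear_cmul\<close>)
 have "linear (Y s p)" for s p by (rule linearI[OF Yadd Yscale])
 hence Ylin: "bounded_linear (Y s p)" for s p by (simp add: linear_conv_bounded_linear)
 have Yder: "((%q. y (s, q)) has_derivative Y s p) (at p)" for s p
  unfolding has_derivative_at_alt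
 proof (intro conjI allI impI Ylin)
  fix e :: real assume e: "e > 0"
  define T where "T = \<bar>s\<bar>"
  define C where "C = exp ((2 * L + 1) * T)"
  have C: "C \<ge> 1" using L by (simp add: C_def T_def)
  define K where "K = (%r. (r, p, y (r, p))) ` {-T..T}"
  have "continuous_on UNIV (%r. (r, p, y (r, p)))"
   by (intro continuous_intros continuous_on_compose2[OF yc]) auto
  hence K: "compact K" unfolding K_def
   by (intro compact_continuous_image) (auto intro: continuous_on_subset)
  obtain M \<delta>1 where M: "M > 0" "\<delta>1 > 0" "!!z z'. z \<in> K ==> dist z' z < \<delta>1 ==> norm (G z' - G z) <= M * norm (z' - z)"
   using C1_lipschitz_on_compact[OF d c K] by blast
  define B where "B = sqrt ((1 + M\<^sup>2) * C)"
  have B: "B > 0" "B\<^sup>2 = (1 + M\<^sup>2) * C" using C M(1) by (auto simp: B_def add_pos_pos)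
  \<comment> \<open>\<open>1 + B\<close> bounds the displacement of the graph point per unit of
    \<open>q - p\<close>, and \<open>sqrt C\<close> is the loss in the Gronwall estimate.\<close>
  define e1 where "e1 = e / ((1 + B) * sqrt C)"
  have e1: "e1 > 0" using e B C by (simp add: e1_def)
  obtain \<delta>2 where \<delta>2: "\<delta>2 > 0" "!!z z1 z2. z \<in> K ==> dist z1 z < \<delta>2 ==> dist z2 z < \<delta>2 ==>
    norm (G z2 - G z1 - G' z (z2 - z1)) <= e1 * norm (z2 - z1)"
   using C1_uniform_differentiability[OF d c K e1] by blast
  define \<delta> where "\<delta> = min \<delta>1 (\<delta>2 / (1 + B))"
  have \<delta>: "\<delta> > 0" using M \<delta>2 B by (simp add: \<delta>_def)
  have "norm (y (s, q) - y (s, p) - Y s p (q - p)) <= e * norm (q - p)" if q: "norm (q - p) < \<delta>" for q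
  proof -
   have rK: "(r, p, y (r, p)) \<in> K" if "\<bar>r\<bar> <= T" for r using that by (auto simp: K_def abs_le_iff intro!: image_eqI[of _ _ r])
   have sub: "\<bar>t\<bar> <= T" if "t \<in> closed_segment 0 r" "\<bar>r\<bar> <= T" for r t
    using that by (auto simp: closed_segment_eq_real_ivl split: if_splits)
   have expC: "exp ((2 * L + 1) * \<bar>r\<bar>) <= C" if "\<bar>r\<bar> <= T" for r
    using that L by (auto simp: C_def intro!: mult_left_mono)
   have dB: "norm (y (r, q) - y (r, p)) <= B * norm (q - p)" if r: "\<bar>r\<bar> <= T" for r
   proof -
    let ?z = "%r. y (r, q) - y (r, p)"
    have "(norm (?z r))\<^sup>2 + (M * norm (q - p))\<^sup>2 \<le>
     ((norm (?z 0))\<^sup>2 + (M * norm (q - p))\<^sup>2) * exp ((2 * L + 1) * \<bar>r\<bar>)"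
    proof (rule gronwall[where z' = "%r. G (r, q, y (r, q)) - G (r, p, y (r, p))"])
     fix t assume t: "t \<in> closed_segment 0 r"
     show "(?z has_vector_derivative G (t, q, y (t, q)) - G (t, p, y (t, p))) (at t)"
      by (intro has_vector_derivative_diff y)
     have "norm (G (t, q, y (t, p)) - G (t, p, y (t, p))) <= M * norm ((t, q, y (t, p)) - (t, p, y (t, p)))"
      using q by (intro M(3) rK sub[OF t r]) (simp add: dist_Pair_Pair dist_norm \<delta>_def)
     thus "norm (G (t, q, y (t, q)) - G (t, p, y (t, p))) <= L * norm (?z t) + M * norm (q - p)"
      using lip[of t q "y (t, q)" "y (t, p)"]
       norm_triangle_ineq[of "G (t, q, y (t, q)) - G (t, q, y (t, p))" "G (t, q, y (t, p)) - G (t, p, y (t, p))"]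
      by (simp add: norm_Pair)
    qed (use L M in auto)
    also have "... <= ((norm (q - p))\<^sup>2 + (M * norm (q - p))\<^sup>2) * C"
     using J(2,3) expC[OF r] M(1) by (intro mult_mono add_mono power_mono) auto
    also have "... = (B * norm (q - p))\<^sup>2" by (simp add: power_mult_distrib B(2) algebra_simps)
    finally have "(norm (?z r))\<^sup>2 <= (B * norm (q - p))\<^sup>2"
     using zero_le_power2[of "M * norm (q - p)"] by linarith
    thus ?thesis by (rule power2_le_imp_le) (use B in auto)
   qed
   \<comment> \<open>The remainder vanishes at time 0 because initial values are affine in the
     parameter, so Gronwall's inequality bounds it by the linearisation error \<open>\<beta>\<close>
     alone.\<close>
   let ?z = "%r. y (r, q) - y (r, p) - Y r p (q - p)"
   define \<beta> where "\<beta> = e1 * ((1 + B) * norm (q - p))"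
   have b0: "\<beta> \<ge> 0" using e1 B by (simp add: \<beta>_def)
   have "(norm (?z s))\<^sup>2 + \<beta>\<^sup>2 <= ((norm (?z 0))\<^sup>2 + \<beta>\<^sup>2) * exp ((2 * L + 1) * \<bar>s\<bar>)"
   proof (rule gronwall[where z' = "%r. G (r, q, y (r, q)) - G (r, p, y (r, p)) -
     G' (r, p, y (r, p)) (0, q - p, Y r p (q - p))"])
    fix t assume "t \<in> closed_segment 0 s"
    hence t: "\<bar>t\<bar> <= T" using sub[of t s] by (simp add: T_def)
    show "(?z has_vector_derivative G (t, q, y (t, q)) - G (t, p, y (t, p)) -
     G' (t, p, y (t, p)) (0, q - p, Y t p (q - p))) (at t)"
     by (intro has_vector_derivative_diff y Y(1))
    let ?a = "(t, p, y (t, p))" and ?b = "(t, q, y (t, q))"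
    have n: "norm (?b - ?a) <= (1 + B) * norm (q - p)"
     using dB[OF t] norm_triangle_ineq[of "(0::real, q - p, 0::'a)" "(0, 0, y (t, q) - y (t, p))"]
     by (simp add: norm_Pair algebra_simps)
    also have "... < (1 + B) * (\<delta>2 / (1 + B))"
     using q B by (intro mult_strict_left_mono) (auto simp: \<delta>_def)
    also have "... = \<delta>2" using B by simp
    finally have "dist ?b ?a < \<delta>2" by (simp add: dist_norm)
    hence "norm (G ?b - G ?a - G' ?a (?b - ?a)) <= e1 * norm (?b - ?a)"
     using \<delta>2(1) by (intro \<delta>2(2) rK t) auto
    also have "... <= \<beta>" using n e1 unfolding \<beta>_def by (intro mult_left_mono) auto
    finally have 1: "norm (G ?b - G ?a - G' ?a (?b - ?a)) <= \<beta>" .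
    have "G' ?a (?b - ?a) - G' ?a (0, q - p, Y t p (q - p)) = G' ?a (0, 0, ?z t)"
     by (subst linear_diff[OF lin, symmetric]) simp
    hence "G ?b - G ?a - G' ?a (0, q - p, Y t p (q - p)) =
     (G ?b - G ?a - G' ?a (?b - ?a)) + G' ?a (0, 0, ?z t)" by (simp add: algebra_simps)
    also have "norm ... <= \<beta> + L * norm (?z t)"
     using 1 lip'[of t p "y (t, p)" "?z t"] norm_triangle_mono by blast
    finally show "norm (G ?b - G ?a - G' ?a (0, q - p, Y t p (q - p))) <= L * norm (?z t) + \<beta>"
     by (simp only: add.commute)
   qed (use L b0 in auto)
   also have "... <= (0 + \<beta>\<^sup>2) * C"
    using expC[of s] J(3)[of q p] Y(2)[of p "q - p"] by (intro mult_mono) (auto simp: T_def)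
   also have "... = (\<beta> * sqrt C)\<^sup>2" using C by (simp add: power_mult_distrib)
   finally have "(norm (?z s))\<^sup>2 <= (\<beta> * sqrt C)\<^sup>2" using zero_le_power2[of \<beta>] by linarith
   hence "norm (?z s) <= \<beta> * sqrt C" by (rule power2_le_imp_le) (use b0 C in auto)
   also have "... = e * norm (q - p)" using B C by (simp add: \<beta>_def e1_def)
   finally show ?thesis .
  qed
  thus "\<exists>d>0. \<forall>q. norm (q - p) < d --> norm (y (s, q) - y (s, p) - Y s p (q - p)) <= e * norm (q - p)"
   using \<delta> by blast
 qed
 \<comment> \<open>Joint differentiability: the derivative in the parameter is known at the point,
   and the time derivative is jointly continuous.\<close>
 have "((%(q, r). y (r, q)) has_derivative
   (%(v, \<sigma>). Y s p v + blinfun_apply (blinfun_scaleR_left (G (s, p, y (s, p)))) \<sigma>)) (at (p, s) within UNIV \<times> UNIV)"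
 proof (rule has_derivative_partialsI[where fy = "%q r. blinfun_scaleR_left (G (r, q, y (r, q)))"])
  show "((%x. y (s, x)) has_derivative Y s p) (at p)" by (rule Yder)
  show "((%r. y (r, q)) has_derivative blinfun_apply (blinfun_scaleR_left (G (r, q, y (r, q))))) (at r)" for q r
   using y[of q r] by (simp add: has_vector_derivative_def blinfun_scaleR_left.rep_eq)
  have "continuous_on UNIV (%z. G (snd z, fst z, y (snd z, fst z)))"
   by (intro continuous_on_compose2[OF Gc] continuous_intros continuous_on_compose2[OF yc]) auto
  hence "continuous_on UNIV (%z. blinfun_scaleR_left (G (snd z, fst z, y (snd z, fst z))))"
   by (intro bounded_linear.continuous_on[OF bounded_linear_blinfun_scaleR_left])
  thus "continuous (at (p, s) within UNIV \<times> UNIV) (%(q, r). blinfun_scaleR_left (G (r, q, y (r, q))))"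
   by (simp add: continuous_on_eq_continuous_at case_prod_unfold)
 qed auto
 hence 1: "((%(q, r). y (r, q)) has_derivative
   (%(v, \<sigma>). Y s p v + \<sigma> *\<^sub>R G (s, p, y (s, p)))) (at (p, s))"
  by (simp add: blinfun_scaleR_left.rep_eq)
 have 2: "((%z::real \<times> 'p. (snd z, fst z)) has_derivative (%z. (snd z, fst z))) (at (s, p))"
  by (auto intro!: derivative_eq_intros)
 from diff_chain_at[OF 2, of "%(q, r). y (r, q)" "%(v, \<sigma>). Y s p v + \<sigma> *\<^sub>R G (s, p, y (s, p))"] 1
 show ?thesis by (simp add: o_def case_prod_unfold add.commute)
qed

text \<open>The derivative in a parameter direction \<open>v\<close> satisfies a linear equation
  with the same \<open>A\<close>, the new inhomogeneity \<open>bv v\<close> and initial value 0.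
  That inhomogeneity contains \<open>\<xi>\<close>, known to have order \<open>j\<close> by a first
  use of the induction hypothesis; a second use gives order \<open>j\<close> for the derivative.
  Hence \<open>b\<close>, \<open>\<xi>\<close> and \<open>ini\<close> vary in the induction while
  \<open>A\<close> stays.\<close>

lemma linear_ode_Ck:
 fixes A :: "real \<times> 'p::euclidean_space => 'a::euclidean_space => 'a"
 assumes "!!z. linear (A z)" "!!z u. norm (A z u) <= L * norm u" "L > 0"
  and "!!u. Ck_on j UNIV (%z. A z u)" "Ck_on j UNIV b"
  and "!!s p. ((%s. \<xi> (s, p)) has_vector_derivative A (s, p) (\<xi> (s, p)) + b (s, p)) (at s)"
  and "!!p. \<xi> (0, p) = ini"
 shows "Ck_on j UNIV \<xi>"
 using assms(4-)
proof (induction j arbitrary: b \<xi> ini)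
 case (0 b \<xi> ini)
 define G where "G = (%z. (\<Sum>i\<in>Basis. (snd (snd z) \<bullet> i) *\<^sub>R A (fst z, fst (snd z)) i) + b (fst z, fst (snd z)))"
 have G: "G (s, p, x) = A (s, p) x + b (s, p)" for s p x
  unfolding G_def using linear_eq_sum_Basis[OF assms(1), of "(s, p)" x] by simp
 have cA: "continuous_on UNIV (%z. A z u)" and cb: "continuous_on UNIV b" for u using 0 by auto
 have cP: "continuous_on UNIV (%z::real \<times> 'p \<times> 'a. (fst z, fst (snd z)))"
  by (intro continuous_intros)
 have "continuous_on UNIV G"
  unfolding G_def
  by (intro continuous_on_add continuous_on_sum continuous_on_scaleR continuous_on_inner continuous_on_const
   continuous_on_snd continuous_on_id continuous_on_compose2[OF cA cP] continuous_on_compose2[OF cb cP] subset_UNIV)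
 hence "continuous_on UNIV \<xi>"
 proof (rule ode_continuous_param[where L = L and J = "%_. 0"])
  show "norm (G (s, p, x) - G (s, p, y)) <= L * norm (x - y)" for s p x y
   using assms(2)[of "(s, p)" "x - y"] linear_diff[OF assms(1), of "(s, p)" x y] by (simp add: G)
 qed (use 0 assms(3) in \<open>auto simp: G\<close>)
 thus ?case by simp
next
 case (Suc j b \<xi> ini)
 define G where "G = (%z. (\<Sum>i\<in>Basis. (snd (snd z) \<bullet> i) *\<^sub>R A (fst z, fst (snd z)) i) + b (fst z, fst (snd z)))"
 have G: "G (s, p, x) = A (s, p) x + b (s, p)" for s p x
  unfolding G_def using linear_eq_sum_Basis[OF assms(1), of "(s, p)" x] by simp
 have P: "Ck_on (Suc j) UNIV (%z::real \<times> 'p \<times> 'a. (fst z, fst (snd z)))"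
  "Ck_on (Suc j) UNIV (%z::real \<times> 'p \<times> 'a. snd (snd z))"
  by (auto intro!: Ck_on_Pair Ck_on_linear_compose[OF bounded_linear_fst] Ck_on_snd Ck_on_fst
   Ck_on_linear_compose[OF bounded_linear_snd] simp del: Ck_on.simps)
 have GC: "Ck_on (Suc j) UNIV G"
  unfolding G_def
  by (intro Ck_on_add Ck_on_sum Ck_on_scaleR Ck_on_inner Ck_on_const P open_UNIV
   Ck_on_compose[OF open_UNIV open_UNIV UNIV_I Suc.prems(1) P(1)]
   Ck_on_compose[OF open_UNIV open_UNIV UNIV_I Suc.prems(2) P(1)])
 define G' where "G' z = frechet_derivative G (at z)" for z
 have Gd: "(G has_derivative G' z) (at z)" for z
  using Ck_on_has_derivative[OF GC UNIV_I] by (simp add: G'_def)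
 have lin: "linear (G' z)" for z using Gd has_derivative_linear by blast
 have G'C: "Ck_on j UNIV (%z. G' z v)" if "v \<in> Basis" for v using GC that by (simp add: G'_def)
 have G'A: "G' (s, p, x) (0, 0, u) = A (s, p) u" for s p x u
 proof -
  have "((%x. (s, p, x)) has_derivative (%u. (0, 0, u))) (at x)"
   by (auto intro!: derivative_eq_intros)
  from diff_chain_at[OF this Gd]
  have 1: "((%x. A (s, p) x + b (s, p)) has_derivative (%u. G' (s, p, x) (0, 0, u))) (at x)"
   by (simp add: o_def G)
  have "((%x. A (s, p) x + b (s, p)) has_derivative A (s, p)) (at x)"
   using has_derivative_add[OF linear_imp_has_derivative[OF assms(1)] has_derivative_const] by simp
  from has_derivative_unique[OF 1 this] show ?thesis by metis
 qed
 have Aj: "Ck_on j UNIV (%z. A z u)" and bj: "Ck_on j UNIV b" for u using Suc.prems(1)[of u] Suc.prems(2) Ck_on_SucD by blast+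
 have \<xi>j: "Ck_on j UNIV \<xi>" by (rule Suc.IH[OF Aj bj Suc.prems(3,4)])
 have graph: "Ck_on j UNIV (%z. (fst z, snd z, \<xi> z))"
  by (intro Ck_on_Pair Ck_on_fst Ck_on_snd \<xi>j open_UNIV)
 have comb: "Ck_on j UNIV (%z. A z (\<xi> z))"
 proof -
  have "Ck_on j UNIV (%z. \<Sum>i\<in>Basis. (\<xi> z \<bullet> i) *\<^sub>R A z i)"
   by (intro Ck_on_sum Ck_on_scaleR Ck_on_inner Ck_on_const \<xi>j Aj open_UNIV)
  moreover have "(%z. A z (\<xi> z)) = (%z. \<Sum>i\<in>Basis. (\<xi> z \<bullet> i) *\<^sub>R A z i)"
   using linear_eq_sum_Basis[OF assms(1)] by blast
  ultimately show ?thesis by simp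
 qed
 define bv where "bv v z = G' (fst z, snd z, \<xi> z) (0, v, 0)" for v z
 have bvC: "Ck_on j UNIV (bv v)" for v
 proof -
  have "bv v z = (\<Sum>i\<in>Basis. ((0, v, 0) \<bullet> i) *\<^sub>R G' (fst z, snd z, \<xi> z) i)" for z
   unfolding bv_def by (rule linear_eq_sum_Basis[OF lin])
  hence "bv v = (%z. \<Sum>i\<in>Basis. ((0, v, 0) \<bullet> i) *\<^sub>R G' (fst z, snd z, \<xi> z) i)" by blast
  thus ?thesis
   by (simp only:) (intro Ck_on_sum Ck_on_scaleR Ck_on_const open_UNIV
    Ck_on_compose[OF open_UNIV open_UNIV UNIV_I G'C graph])
 qed
 have "\<exists>Y. Y 0 = 0 \<and> (\<forall>s. (Y has_vector_derivative A (s, p) (Y s) + bv v (s, p)) (at s))" for p v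
 proof (rule ode_exists[where F = "%s x. A (s, p) x + bv v (s, p)" and L = L])
  have "continuous_on UNIV (%z. \<Sum>i\<in>Basis. (snd z \<bullet> i) *\<^sub>R A (fst z, p) i)"
   by (intro continuous_intros continuous_on_compose2[OF Ck_on_continuous[OF Aj], of _ "%z. (fst z, p)"]) auto
  moreover have "continuous_on UNIV (%z::real \<times> 'a. bv v (fst z, p))"
   by (intro continuous_on_compose2[OF Ck_on_continuous[OF bvC]] continuous_intros) auto
  moreover have "(%z. A (fst z, p) (snd z)) = (%z. \<Sum>i\<in>Basis. (snd z \<bullet> i) *\<^sub>R A (fst z, p) i)"
   using linear_eq_sum_Basis[OF assms(1)] by blast
  ultimately have "continuous_on UNIV (%z. A (fst z, p) (snd z))" "continuous_on UNIV (%z::real \<times> 'a. bv v (fst z, p))"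
   by (simp_all only:)
  thus "continuous_on UNIV (%z. A (fst z, p) (snd z) + bv v (fst z, p))"
   by (rule continuous_on_add)
  show "norm (A (s, p) x + bv v (s, p) - (A (s, p) y + bv v (s, p))) <= L * norm (x - y)" for s x y
   using assms(2)[of "(s, p)" "x - y"] linear_diff[OF assms(1), of "(s, p)" x y] by simp
 qed (rule assms(3))
 then obtain Y where Y: "!!p v. Y p v 0 = 0"
  "!!p v s. (Y p v has_vector_derivative A (s, p) (Y p v s) + bv v (s, p)) (at s)" by metis
 have YC: "Ck_on j UNIV (%z. Y (snd z) v (fst z))" for v
  by (rule Suc.IH[OF Aj bvC[of v]]) (use Y in auto)
 have "(\<xi> has_derivative (%(\<sigma>, v). \<sigma> *\<^sub>R G (s, p, \<xi> (s, p)) + Y p v s)) (at (s, p))" for s p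
 proof (rule ode_differentiable_param[where G = G and G' = G' and L = L and J = "%_. 0", OF Gd])
  show "continuous_on UNIV (%z. G' z v)" if "v \<in> Basis" for v using Ck_on_continuous[OF G'C[OF that]] .
  show "norm (G (s, p, x) - G (s, p, y)) <= L * norm (x - y)" for s p x y
   using assms(2)[of "(s, p)" "x - y"] linear_diff[OF assms(1), of "(s, p)" x y] by (simp add: G)
  show "norm (G' (s, p, x) (0, 0, u)) <= L * norm u" for s p x u using assms(2) by (simp add: G'A)
  show "((%s. Y p v s) has_vector_derivative G' (s, p, \<xi> (s, p)) (0, v, Y p v s)) (at s)" for s p v
   using Y(2)[of p v s] linear_add[OF lin, of "(s, p, \<xi> (s, p))" "(0, v, 0)" "(0, 0, Y p v s)"]
   by (simp add: G'A bv_def add.commute)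
 qed (use Suc.prems(3,4) assms(3) Y in \<open>auto simp: G bounded_linear.linear[OF bounded_linear_zero]\<close>)
 hence D: "(\<xi> has_derivative (%h. fst h *\<^sub>R (A z (\<xi> z) + b z) + Y (snd z) (snd h) (fst z))) (at z)" for z
  by (cases z) (simp add: G case_prod_unfold)
 have Y0: "Y p 0 s = 0" for p s
  using linear_0[OF has_derivative_linear[OF D[of "(s, p)"]]] by simp
 show ?case
 proof (rule Ck_on_SucI[OF open_UNIV D])
  fix h :: "real \<times> 'p" assume "h \<in> Basis"
  then consider "h = (1, 0)" | v where "h = (0, v)" by (auto simp: Basis_prod_def)
  thus "Ck_on j UNIV (%z. fst h *\<^sub>R (A z (\<xi> z) + b z) + Y (snd z) (snd h) (fst z))"
  proof cases
   case 1 thus ?thesis using Ck_on_add[OF open_UNIV comb bj] by (simp add: Y0)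
  next
   case 2 thus ?thesis using YC by simp
  qed
 qed
qed

text \<open>A bootstrap: if \<open>\<phi>\<close> has order \<open>j\<close>, then so has the
  coefficient of the first variation equation, the derivative of \<open>w\<close> along
  \<open>\<phi>\<close>, and \<open>linear_ode_Ck\<close> raises the order of \<open>\<phi>\<close>
  by one, until the order of \<open>w\<close> is reached. The global Lipschitz bound makes all
  solutions exist for all times.\<close>

theorem flow_Ck:
 fixes w :: "'a::euclidean_space => 'a"
 assumes w: "Ck_on (Suc k) UNIV w" and lip: "!!x y. norm (w x - w y) <= L * norm (x - y)" and L: "L > 0"
 shows "\<exists>\<phi>. Ck_on (Suc k) UNIV \<phi> \<and> (\<forall>x. \<phi> (0, x) = x) \<and>
  (\<forall>s x. ((%s. \<phi> (s, x)) has_vector_derivative w (\<phi> (s, x))) (at s))"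
proof -
 define W where "W x = frechet_derivative w (at x)" for x
 have Wd: "(w has_derivative W x) (at x)" for x
  using Ck_on_has_derivative[OF w UNIV_I] by (simp add: W_def)
 have Wlin: "linear (W x)" for x using Wd has_derivative_linear by blast
 have WC: "Ck_on k UNIV (%x. W x u)" for u
 proof -
  have "(%x. W x u) = (%x. \<Sum>i\<in>Basis. (u \<bullet> i) *\<^sub>R W x i)"
   using linear_eq_sum_Basis[OF Wlin] by blast
  thus ?thesis
   using w by (simp only:) (intro Ck_on_sum Ck_on_scaleR Ck_on_const open_UNIV, simp add: W_def)
 qed
 have Wb: "norm (W x u) <= L * norm u" for x u
 proof -
  have "norm (W x u) <= L * norm u + e * norm u" if e: "e > 0" for e
  proof -
   from e Wd[of x] obtain d where d: "d > 0"
    "!!y. norm (y - x) < d ==> norm (w y - w x - W x (y - x)) <= e * norm (y - x)"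
    unfolding has_derivative_at_alt by blast
   define h where "h = d / (2 * (norm u + 1))"
   have n1: "norm u + 1 > 0" by (simp add: add_nonneg_pos)
   have h: "h > 0" using d(1) n1 by (simp add: h_def)
   have "h * norm u < h * (2 * (norm u + 1))" using h n1 by (intro mult_strict_left_mono) auto
   also have "... = d" using n1 by (simp add: h_def)
   finally have "norm (w (x + h *\<^sub>R u) - w x - W x (h *\<^sub>R u)) <= e * norm (h *\<^sub>R u)"
    using d(2)[of "x + h *\<^sub>R u"] h by simp
   hence "norm (W x (h *\<^sub>R u)) <= L * norm (h *\<^sub>R u) + e * norm (h *\<^sub>R u)"
    using lip[of "x + h *\<^sub>R u" x] norm_triangle_sub[of "W x (h *\<^sub>R u)" "w (x + h *\<^sub>R u) - w x"]
    by (simp add: norm_minus_commute)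
   hence "h * norm (W x u) <= h * (L * norm u + e * norm u)"
    using h by (simp add: linear_cmul[OF Wlin] algebra_simps)
   thus ?thesis using h by (simp add: mult_le_cancel_left)
  qed
  note * = this
  show ?thesis
  proof (cases "u = 0")
   case True thus ?thesis by (simp add: linear_0[OF Wlin])
  next
   case False
   show ?thesis
   proof (rule field_le_epsilon)
    fix e :: real assume "e > 0"
    thus "norm (W x u) <= L * norm u + e" using *[of "e / norm u"] False by simp
   qed
  qed
 qed
 have "\<exists>y. y 0 = x \<and> (\<forall>s. (y has_vector_derivative w (y s)) (at s))" for x
  using ode_exists[of "%_. w" L x] lip L
   continuous_on_compose2[OF Ck_on_continuous[OF w] continuous_on_snd[OF continuous_on_id]] by auto
 then obtain y where y: "!!x. y x 0 = x" "!!x s. (y x has_vector_derivative w (y x s)) (at s)" by metis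
 define \<phi> where "\<phi> z = y (snd z) (fst z)" for z
 define G where "G = (%z::real \<times> 'a \<times> 'a. w (snd (snd z)))"
 have Gd: "(G has_derivative (%h. W (snd (snd z)) (snd (snd h)))) (at z)" for z
 proof -
  have "((%z::real \<times> 'a \<times> 'a. snd (snd z)) has_derivative (%h. snd (snd h))) (at z)"
   by (auto intro!: derivative_eq_intros)
  from diff_chain_at[OF this Wd] show ?thesis by (simp add: o_def G_def)
 qed
 have Gc: "continuous_on UNIV G"
  using Gd by (auto intro!: continuous_at_imp_continuous_on has_derivative_continuous)
 have Gl: "norm (G (s, p, x) - G (s, p, y)) <= L * norm (x - y)" for s p x y using lip by (simp add: G_def)
 have \<phi>d: "((%s. \<phi> (s, p)) has_vector_derivative G (s, p, \<phi> (s, p))) (at s)" for s p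
  using y(2) by (simp add: \<phi>_def G_def)
 have \<phi>0: "\<phi> (0, q) - \<phi> (0, p) = q - p" for p q by (simp add: \<phi>_def y(1))
 have "Ck_on j UNIV \<phi>" if "j <= Suc k" for j
  using that
 proof (induction j)
  case 0
  have "continuous_on UNIV \<phi>"
   by (rule ode_continuous_param[OF Gc Gl _ \<phi>d bounded_linear_ident \<phi>0]) (use L in auto)
  thus ?case by simp
 next
  case (Suc j)
  hence \<phi>j: "Ck_on j UNIV \<phi>" by simp
  have AC: "Ck_on j UNIV (%z. W (\<phi> z) u)" for u
   using Suc.prems by (intro Ck_on_compose[OF open_UNIV open_UNIV UNIV_I Ck_on_mono[OF WC] \<phi>j]) auto
  have cA: "continuous_on UNIV (%z. W (\<phi> z) u)" for u using Ck_on_continuous[OF AC] .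
  have "\<exists>Y. Y 0 = v \<and> (\<forall>s. (Y has_vector_derivative W (\<phi> (s, p)) (Y s)) (at s))" for p v
  proof (rule ode_exists[where F = "%s. W (\<phi> (s, p))" and L = L])
   have "continuous_on UNIV (%z. \<Sum>i\<in>Basis. (snd z \<bullet> i) *\<^sub>R W (\<phi> (fst z, p)) i)"
    by (intro continuous_intros continuous_on_compose2[OF cA, of _ "%z. (fst z, p)"]) auto
   thus "continuous_on UNIV (%z. W (\<phi> (fst z, p)) (snd z))"
    by (subst linear_eq_sum_Basis[OF Wlin])
   show "norm (W (\<phi> (s, p)) x - W (\<phi> (s, p)) y) <= L * norm (x - y)" for s x y
    using Wb[of "\<phi> (s, p)" "x - y"] linear_diff[OF Wlin] by metis
  qed (rule L)
  hence "\<forall>p v. \<exists>Y. Y 0 = v \<and> (\<forall>s. (Y has_vector_derivative W (\<phi> (s, p)) (Y s)) (at s))" by blast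
  then obtain Y where Y: "!!p v. Y p v 0 = v"
   "!!p v s. (Y p v has_vector_derivative W (\<phi> (s, p)) (Y p v s)) (at s)"
   unfolding choice_iff by blast
  have YC: "Ck_on j UNIV (%z. Y (snd z) v (fst z))" for v
   by (rule linear_ode_Ck[where A = "%z. W (\<phi> z)" and b = "%_. 0" and ini = v, OF Wlin Wb L AC])
    (use Y in \<open>auto intro: Ck_on_const\<close>)
  have "(\<phi> has_derivative (%(\<sigma>, v). \<sigma> *\<^sub>R G (s, p, \<phi> (s, p)) + Y p v s)) (at (s, p))" for s p
  proof (rule ode_differentiable_param[where G = G and L = L and J = "%v. v", OF Gd])
   show "continuous_on UNIV (%z::real \<times> 'a \<times> 'a. W (snd (snd z)) (snd (snd v)))" for v :: "real \<times> 'a \<times> 'a"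
    by (intro continuous_on_compose2[OF Ck_on_continuous[OF WC]] continuous_intros) auto
  qed (use Gl \<phi>d \<phi>0 Y Wb L in \<open>auto simp: linear_id[unfolded id_def]\<close>)
  hence D: "(\<phi> has_derivative (%h. fst h *\<^sub>R w (\<phi> z) + Y (snd z) (snd h) (fst z))) (at z)" for z
   by (cases z) (simp add: G_def case_prod_unfold)
  have Y0: "Y p 0 s = 0" for p s
   using linear_0[OF has_derivative_linear[OF D[of "(s, p)"]]] by simp
  have w\<phi>: "Ck_on j UNIV (%z. w (\<phi> z))"
   using Suc.prems by (intro Ck_on_compose[OF open_UNIV open_UNIV UNIV_I Ck_on_mono[OF w] \<phi>j]) auto
  show ?case
  proof (rule Ck_on_SucI[OF open_UNIV D])
   fix h :: "real \<times> 'a" assume "h \<in> Basis"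
   then consider "h = (1, 0)" | v where "h = (0, v)" by (auto simp: Basis_prod_def)
   thus "Ck_on j UNIV (%z. fst h *\<^sub>R w (\<phi> z) + Y (snd z) (snd h) (fst z))"
   proof cases
    case 1 thus ?thesis using w\<phi> by (simp add: Y0)
   next
    case 2 thus ?thesis using YC by simp
   qed
  qed
 qed
 thus ?thesis using y by (intro exI[of _ \<phi>]) (auto simp: \<phi>_def simp del: Ck_on.simps)
qed

subsection \<open>Definable sets and maps\<close>

locale ominimal =
 fixes S :: "nat => real list set set"
 assumes o_minimal: "o_minimal S"
begin

lemma S_length: "A \<in> S p ==> xs \<in> A ==> length xs = p"
 and S_UNIV: "{xs. length xs = p} \<in> S p"
 and S_Un: "A \<in> S p ==> B \<in> S p ==> A \<union> B \<in> S p"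
 and S_compl: "A \<in> S p ==> {xs. length xs = p} - A \<in> S p"
 and S_snoc: "A \<in> S p ==> {xs @ [t] |xs t. xs \<in> A} \<in> S (Suc p)"
 and S_Cons: "A \<in> S p ==> {t # xs |t xs. xs \<in> A} \<in> S (Suc p)"
 and S_diag: "i < p ==> j < p ==> {xs. length xs = p \<and> xs ! i = xs ! j} \<in> S p"
 and S_butlast: "A \<in> S (Suc p) ==> butlast ` A \<in> S p"
 and S_point: "{[a]} \<in> S 1"
 and S_less: "{[x, y] |x y. x < y} \<in> S 2"
 and S_add: "{[x, y, z] |x y z. z = x + y} \<in> S 3"
 and S_mult: "{[x, y, z] |x y z. z = x * y} \<in> S 3"
 and S_line: "A \<in> S 1 ==> \<exists>P I. finite P \<and> finite I \<and> (\<forall>(a, b)\<in>I. a < b) \<and>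
    A = {[x] |x. x \<in> P \<or> (\<exists>(a, b)\<in>I. a < ereal x \<and> ereal x < b)}"
proof -
 note c0 = o_minimal[unfolded o_minimal_def, THEN conjunct1] and r0 = o_minimal[unfolded o_minimal_def, THEN conjunct2]
 note c1 = r0[THEN conjunct1] and r1 = r0[THEN conjunct2]
 note c2 = r1[THEN conjunct1] and r2 = r1[THEN conjunct2]
 note c3 = r2[THEN conjunct1] and r3 = r2[THEN conjunct2]
 note c4 = r3[THEN conjunct1] and r4 = r3[THEN conjunct2]
 note c5 = r4[THEN conjunct1] and r5 = r4[THEN conjunct2]
 note c6 = r5[THEN conjunct1] and r6 = r5[THEN conjunct2]
 note c7 = r6[THEN conjunct1] and r7 = r6[THEN conjunct2]
 note c8 = r7[THEN conjunct1] and r8 = r7[THEN conjunct2]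
 note c9 = r8[THEN conjunct1] and r9 = r8[THEN conjunct2]
 note c10 = r9[THEN conjunct1] and r10 = r9[THEN conjunct2]
 note c11 = r10[THEN conjunct1] and r11 = r10[THEN conjunct2]
 show "length xs = p" if "A \<in> S p" "xs \<in> A" using c0 that by blast
 show "{xs. length xs = p} \<in> S p" using c1 by blast
 show "A \<union> B \<in> S p" if "A \<in> S p" "B \<in> S p" using c2 that by blast
 show "{xs. length xs = p} - A \<in> S p" if "A \<in> S p" using c3 that by blast
 show "{xs @ [t] |xs t. xs \<in> A} \<in> S (Suc p)" if "A \<in> S p" using c4 that by blast
 show "{t # xs |t xs. xs \<in> A} \<in> S (Suc p)" if "A \<in> S p" using c5 that by blast
 show "{xs. length xs = p \<and> xs ! i = xs ! j} \<in> S p" if "i < p" "j < p" using c6 that by blast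
 show "butlast ` A \<in> S p" if "A \<in> S (Suc p)" using c7 that by blast
 show "{[a]} \<in> S 1" using c8 by blast
 show "{[x, y] |x y. x < y} \<in> S 2" by (rule c9)
 show "{[x, y, z] |x y z. z = x + y} \<in> S 3" by (rule c10)
 show "{[x, y, z] |x y z. z = x * y} \<in> S 3" by (rule c11)
 show "\<exists>P I. finite P \<and> finite I \<and> (\<forall>(a, b)\<in>I. a < b) \<and>
    A = {[x] |x. x \<in> P \<or> (\<exists>(a, b)\<in>I. a < ereal x \<and> ereal x < b)}" if "A \<in> S 1"
  using r11 that by (rule bspec)
qed

lemma S_Int:
 assumes "A \<in> S p" "B \<in> S p" shows "A \<inter> B \<in> S p"
proof -
 have "A \<inter> B = {xs. length xs = p} - (({xs. length xs = p} - A) \<union> ({xs. length xs = p} - B))"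
  using S_length assms by blast
 thus ?thesis using assms by (simp only:) (intro S_compl S_Un)
qed

lemma S_INT: "finite I ==> (!!i. i \<in> I ==> A i \<in> S p) ==> {xs. length xs = p \<and> (\<forall>i\<in>I. xs \<in> A i)} \<in> S p"
proof (induction I rule: finite_induct)
 case (insert i I)
 have "{xs. length xs = p \<and> (\<forall>j\<in>insert i I. xs \<in> A j)} = A i \<inter> {xs. length xs = p \<and> (\<forall>j\<in>I. xs \<in> A j)}"
  using S_length[OF insert.prems, of i] by auto
 thus ?case using insert by (simp only:) (intro S_Int, auto)
qed (simp add: S_UNIV)

lemma S_prepend: "A \<in> S q ==> {ys @ xs |ys xs. length ys = p \<and> xs \<in> A} \<in> S (p + q)"
proof (induction p)
 case (Suc p)
 have "{ys @ xs |ys xs. length ys = Suc p \<and> xs \<in> A} =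
   {t # xs |t xs. xs \<in> {ys @ xs |ys xs. length ys = p \<and> xs \<in> A}}"
  (is "?L = ?R")
 proof (intro set_eqI iffI)
  fix zs assume "zs \<in> ?L"
  then obtain ys xs where "zs = ys @ xs" "length ys = Suc p" "xs \<in> A" by blast
  thus "zs \<in> ?R" by (cases ys) auto
 next
  fix zs assume "zs \<in> ?R"
  then obtain t ys xs where "zs = (t # ys) @ xs" "length (t # ys) = Suc p" "xs \<in> A" by auto
  thus "zs \<in> ?L" by blast
 qed
 thus ?case using S_Cons[OF Suc.IH[OF Suc.prems]] by simp
qed simp

lemma S_take: "A \<in> S (p + q) ==> take p ` A \<in> S p"
proof (induction q arbitrary: A)
 case 0
 hence "take p ` A = A" using S_length[OF 0] by force
 thus ?case using 0 by simp
next
 case (Suc q)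
 hence "take p ` butlast ` A \<in> S p" using S_butlast by simp
 moreover have "take p ` butlast ` A = take p ` A"
  unfolding image_image using S_length[OF Suc.prems]
  by (intro image_cong) (auto simp: butlast_conv_take)
 ultimately show ?case by simp
qed

text \<open>Form the product with \<open>A\<close>, impose the equalities between coordinates by
  diagonals, and project the copy of \<open>A\<close> away. Permuting, repeating and omitting
  variables are all covered.\<close>

lemma S_reindex:
 assumes A: "A \<in> S q" and "length is = q" "!!i. i \<in> set is ==> i < p"
 shows "{xs. length xs = p \<and> map (nth xs) is \<in> A} \<in> S p"
proof -
 define B where "B = {ys @ xs |ys xs. length ys = p \<and> xs \<in> A}"
 define D where "D = {zs::real list. length zs = p + q \<and> (\<forall>j\<in>{..<q}. zs \<in> {zs. length zs = p + q \<and> zs ! (is ! j) = zs ! (p + j)})}"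
 have "B \<inter> D \<in> S (p + q)"
  unfolding B_def D_def
 proof (intro S_Int S_prepend A S_INT S_diag)
  fix j assume "j \<in> {..<q}"
  hence "is ! j < p" using assms by simp
  thus "is ! j < p + q" by simp
 qed auto
 moreover have "take p ` (B \<inter> D) = {xs. length xs = p \<and> map (nth xs) is \<in> A}"
 proof (intro set_eqI iffI)
  fix xs assume "xs \<in> take p ` (B \<inter> D)"
  then obtain zs where zs: "xs = take p zs" "zs \<in> B" "zs \<in> D" by blast
  from zs(2) obtain us ys where us: "zs = us @ ys" "length us = p" "ys \<in> A" unfolding B_def by blast
  have x: "xs = us" using zs(1) us by simp
  have "map (nth xs) is = ys"
  proof (rule nth_equalityI)
   show "length (map (nth xs) is) = length ys" using S_length[OF A us(3)] assms(2) by simp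
   fix j assume "j < length (map (nth xs) is)"
   hence j: "j < q" using assms(2) by simp
   have ij: "is ! j < p" using assms j by simp
   have "zs ! (is ! j) = zs ! (p + j)" using zs(3) j by (simp add: D_def)
   thus "map (nth xs) is ! j = ys ! j" using ij j assms(2) us(2) by (simp add: x us(1) nth_append)
  qed
  thus "xs \<in> {xs. length xs = p \<and> map (nth xs) is \<in> A}" using us x by simp
 next
  fix xs assume x: "xs \<in> {xs. length xs = p \<and> map (nth xs) is \<in> A}"
  let ?z = "xs @ map (nth xs) is"
  have "is ! j < p" if "j < q" for j using assms that by simp
  hence "?z \<in> D" using x assms(2) by (auto simp: nth_append D_def)
  moreover have "?z \<in> B" using x unfolding B_def by blast
  moreover have "xs = take p ?z" using x by simp
  ultimately show "xs \<in> take p ` (B \<inter> D)" by blast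
 qed
 ultimately show ?thesis using S_take by metis
qed

end

section \<open>Definable predicates and functions on euclidean spaces\<close>

definition basis_list :: "'a::euclidean_space list => bool" where
 "basis_list bs \<longleftrightarrow> distinct bs \<and> set bs = Basis"

definition coords :: "'a::euclidean_space list => 'a => real list" where
 "coords bs x = map (%b. x \<bullet> b) bs"

lemma length_coords [simp]: "length (coords bs x) = length bs"
 by (simp add: coords_def)

lemma basis_list_exists: "\<exists>bs :: 'a::euclidean_space list. basis_list bs"
 unfolding basis_list_def using finite_distinct_list[OF finite_Basis] by blast

lemma coords_inj: "basis_list bs ==> coords bs x = coords bs y \<longleftrightarrow> x = y"
 unfolding coords_def basis_list_def by (auto intro: euclidean_eqI)

lemma coords_surj:
 fixes bs :: "'a::euclidean_space list"
 assumes bs: "basis_list bs" and "length xs = length bs" shows "\<exists>x. coords bs x = xs"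
proof -
 define x where "x = (\<Sum>i<length bs. (xs ! i) *\<^sub>R bs ! i)"
 have "x \<bullet> bs ! j = xs ! j" if j: "j < length bs" for j
 proof -
  have "bs ! i \<bullet> bs ! j = (if i = j then 1 else 0)" if "i < length bs" for i
   using bs that j unfolding basis_list_def
   by (metis inner_Basis nth_eq_iff_index_eq nth_mem)
  hence "x \<bullet> bs ! j = (\<Sum>i<length bs. xs ! i * (if i = j then 1 else 0))"
   unfolding x_def inner_sum_left by (intro sum.cong) auto
  thus ?thesis using j by (simp add: sum.delta' mult_delta_right)
 qed
 thus ?thesis using assms(2) by (intro exI[of _ x]) (auto simp: coords_def intro!: nth_equalityI)
qed

lemma basis_list_prod:
 assumes "basis_list as" "basis_list bs"
 shows "basis_list (map (%a. (a, 0)) as @ map (%b. (0, b)) bs)"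
 using assms unfolding basis_list_def
 by (auto simp: Basis_prod_def distinct_map inj_on_def)

lemma coords_prod:
 "coords (map (%a. (a, 0)) as @ map (%b. (0, b)) bs) (x, y) = coords as x @ coords bs y"
 by (simp add: coords_def o_def)

context ominimal
begin

text \<open>Predicates on euclidean types, products included, replace sets of lists, so that
  definability can be read off the syntax of a formula. The order of the basis is immaterial by
  \<open>dpred_iff\<close>.\<close>

definition dpred :: "('a::euclidean_space => bool) => bool" where
 "dpred P \<longleftrightarrow> (\<exists>bs. basis_list bs \<and> coords bs ` Collect P \<in> S (length bs))"

text \<open>Substituting such a map into a formula is a renaming of variables, which is what
  \<open>S_reindex\<close> provides.\<close>

definition coordmap :: "('a::euclidean_space => 'b::euclidean_space) => bool" where
 "coordmap \<pi> \<longleftrightarrow> (\<forall>b\<in>Basis. \<exists>a\<in>Basis. \<forall>x. \<pi> x \<bullet> b = x \<bullet> a)"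

lemma coordmap_reindex:
 fixes \<pi> :: "'a::euclidean_space => 'b::euclidean_space"
 assumes "coordmap \<pi>" "basis_list bs" "basis_list as" "coords bs ` Collect P \<in> S (length bs)"
 shows "coords as ` {x. P (\<pi> x)} \<in> S (length as)"
proof -
 have "\<exists>i<length as. \<forall>x. \<pi> x \<bullet> b = x \<bullet> as ! i" if "b \<in> Basis" for b
  using assms(1,3) that unfolding coordmap_def basis_list_def by (metis in_set_conv_nth)
 then obtain ix where ix: "!!b. b \<in> Basis ==> ix b < length as"
  "!!b x. b \<in> Basis ==> \<pi> x \<bullet> b = x \<bullet> as ! ix b" by metis
 have B: "set bs = Basis" using assms(2) by (simp add: basis_list_def)
 have key: "map (nth (coords as x)) (map ix bs) = coords bs (\<pi> x)" for x
  using ix B by (simp add: coords_def)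
 have "coords as ` {x. P (\<pi> x)} =
   {xs. length xs = length as \<and> map (nth xs) (map ix bs) \<in> coords bs ` Collect P}" (is "?L = ?R")
 proof (intro set_eqI iffI)
  fix xs assume "xs \<in> ?L" thus "xs \<in> ?R" using key by auto
 next
  fix xs assume xs: "xs \<in> ?R"
  then obtain x where x: "coords as x = xs" using coords_surj[OF assms(3)] by auto
  with xs key[of x] have "coords bs (\<pi> x) \<in> coords bs ` Collect P" by simp
  hence "P (\<pi> x)" using coords_inj[OF assms(2)] by auto
  with x show "xs \<in> ?L" by auto
 qed
 moreover have "?R \<in> S (length as)"
  using ix(1) B by (intro S_reindex[OF assms(4)]) auto
 ultimately show ?thesis by simp
qed

lemma dpred_iff: "basis_list bs ==> dpred P \<longleftrightarrow> coords bs ` Collect P \<in> S (length bs)"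
 unfolding dpred_def using coordmap_reindex[of "%x. x" _ bs P] by (auto simp: coordmap_def)

lemma dpred_coordmap: "coordmap \<pi> ==> dpred P ==> dpred (%x. P (\<pi> x))"
 using coordmap_reindex basis_list_exists unfolding dpred_def by metis

lemma coordmap_ident: "coordmap (%x. x)"
 by (auto simp: coordmap_def)

lemma coordmap_fst:
 fixes \<pi> :: "'a::euclidean_space => 'b::euclidean_space \<times> 'c::euclidean_space"
 assumes c: "coordmap \<pi>" shows "coordmap (%x. fst (\<pi> x))"
 unfolding coordmap_def
proof
 fix b :: 'b assume "b \<in> Basis"
 hence "(b, 0::'c) \<in> Basis" by (simp add: Basis_prod_def)
 with c obtain a where "a \<in> Basis" "\<forall>x. \<pi> x \<bullet> (b, 0) = x \<bullet> a" unfolding coordmap_def by meson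
 thus "\<exists>a\<in>Basis. \<forall>x. fst (\<pi> x) \<bullet> b = x \<bullet> a"
  by (intro bexI[of _ a]) (auto simp: inner_prod_def)
qed

lemma coordmap_snd:
 fixes \<pi> :: "'a::euclidean_space => 'b::euclidean_space \<times> 'c::euclidean_space"
 assumes c: "coordmap \<pi>" shows "coordmap (%x. snd (\<pi> x))"
 unfolding coordmap_def
proof
 fix b :: 'c assume "b \<in> Basis"
 hence "(0::'b, b) \<in> Basis" by (simp add: Basis_prod_def)
 with c obtain a where "a \<in> Basis" "\<forall>x. \<pi> x \<bullet> (0, b) = x \<bullet> a" unfolding coordmap_def by meson
 thus "\<exists>a\<in>Basis. \<forall>x. snd (\<pi> x) \<bullet> b = x \<bullet> a"
  by (intro bexI[of _ a]) (auto simp: inner_prod_def)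
qed

lemma coordmap_Pair: "coordmap \<pi>1 ==> coordmap \<pi>2 ==> coordmap (%x. (\<pi>1 x, \<pi>2 x))"
 by (auto simp: coordmap_def Basis_prod_def)

lemma coordmap_inner: "coordmap \<pi> ==> b \<in> Basis ==> coordmap (%x. \<pi> x \<bullet> b)"
 by (auto simp: coordmap_def)

lemma coordmap_compose: "coordmap \<pi>1 ==> coordmap \<pi>2 ==> coordmap (%x. \<pi>1 (\<pi>2 x))"
 unfolding coordmap_def by metis

lemmas coordmap_intros = coordmap_ident coordmap_fst coordmap_snd coordmap_Pair coordmap_inner

lemma dpred_not: "dpred P ==> dpred (%x. \<not> P x)"
proof -
 assume P: "dpred P"
 then obtain bs where bs: "basis_list bs" "coords bs ` Collect P \<in> S (length bs)" unfolding dpred_def by blast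
 have "coords bs ` {x. \<not> P x} = {xs. length xs = length bs} - coords bs ` Collect P"
  using coords_surj[OF bs(1)] coords_inj[OF bs(1)] by fastforce
 thus ?thesis using bs S_compl unfolding dpred_def by metis
qed

lemma dpred_or: "dpred P ==> dpred Q ==> dpred (%x. P x \<or> Q x)"
proof -
 assume P: "dpred P" "dpred Q"
 then obtain bs where bs: "basis_list bs" "coords bs ` Collect P \<in> S (length bs)" unfolding dpred_def by blast
 have "coords bs ` {x. P x \<or> Q x} = coords bs ` Collect P \<union> coords bs ` Collect Q" by auto
 thus ?thesis using bs P(2) S_Un dpred_iff[OF bs(1)] by metis
qed

lemma dpred_and: "dpred P ==> dpred Q ==> dpred (%x. P x \<and> Q x)"
 using dpred_not[OF dpred_or[OF dpred_not dpred_not], of P Q] by simp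

lemma dpred_imp: "dpred P ==> dpred Q ==> dpred (%x. P x --> Q x)"
 unfolding imp_conv_disj by (intro dpred_or dpred_not)

lemma dpred_iff_iff: "dpred P ==> dpred Q ==> dpred (%x. P x \<longleftrightarrow> Q x)"
 unfolding iff_conv_conj_imp by (intro dpred_and dpred_imp)

lemma dpred_True: "dpred (%x. True)"
proof -
 obtain bs :: "'a list" where bs: "basis_list bs" using basis_list_exists by blast
 have "coords bs ` UNIV = {xs. length xs = length bs}" using coords_surj[OF bs] by fastforce
 thus ?thesis using bs S_UNIV dpred_iff[OF bs, of "%x. True"] by simp
qed

lemma dpred_const: "dpred (%x. b)"
 using dpred_True dpred_not[OF dpred_True] by (cases b) auto

lemma dpred_ball: "finite I ==> (!!i. i \<in> I ==> dpred (P i)) ==> dpred (%x. \<forall>i\<in>I. P i x)"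
 by (induction I rule: finite_induct) (auto intro: dpred_True dpred_and)

lemma dpred_ex:
 fixes P :: "'a::euclidean_space => 'b::euclidean_space => bool"
 assumes "dpred (%z. P (fst z) (snd z))"
 shows "dpred (%x. \<exists>y. P x y)"
proof -
 obtain as :: "'a list" and bs :: "'b list" where as: "basis_list as" and bs: "basis_list bs"
  using basis_list_exists by metis
 let ?cs = "map (%a. (a, 0 :: 'b)) as @ map (%b. (0, b)) bs"
 have "coords ?cs ` {z. P (fst z) (snd z)} \<in> S (length as + length bs)"
  using assms dpred_iff[OF basis_list_prod[OF as bs]] by simp
 hence "take (length as) ` coords ?cs ` {z. P (fst z) (snd z)} \<in> S (length as)" by (rule S_take)
 moreover have "take (length as) ` coords ?cs ` {z. P (fst z) (snd z)} = coords as ` {x. \<exists>y. P x y}"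
 proof -
  have *: "take (length as) (coords ?cs z) = coords as (fst z)" for z
   using coords_prod[of as bs "fst z" "snd z"] by simp
  show ?thesis unfolding image_image * by (auto simp: image_iff) (metis fst_conv snd_conv)
 qed
 ultimately show ?thesis using dpred_iff[OF as] by simp
qed

lemma dpred_all: "dpred (%z. P (fst z) (snd z)) ==> dpred (%x. \<forall>y. P x y)"
 using dpred_not[OF dpred_ex[OF dpred_not], of P] by simp

lemma dpred_coord_eq:
 fixes a b :: "'a::euclidean_space"
 assumes "a \<in> Basis" "b \<in> Basis" shows "dpred (%x. x \<bullet> a = x \<bullet> b)"
proof -
 obtain bs :: "'a list" where bs: "basis_list bs" using basis_list_exists by blast
 then obtain i j where ij: "i < length bs" "j < length bs" "bs ! i = a" "bs ! j = b"
  using assms unfolding basis_list_def by (metis in_set_conv_nth)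
 have c: "coords bs x ! i = x \<bullet> a" "coords bs x ! j = x \<bullet> b" for x using ij by (auto simp: coords_def)
 have "coords bs ` {x. x \<bullet> a = x \<bullet> b} = {xs. length xs = length bs \<and> xs ! i = xs ! j}"
 proof (intro set_eqI iffI)
  fix xs :: "real list" assume "xs \<in> {xs. length xs = length bs \<and> xs ! i = xs ! j}"
  with coords_surj[OF bs, of xs] obtain x where "coords bs x = xs" "xs ! i = xs ! j" by blast
  with c[of x] show "xs \<in> coords bs ` {x. x \<bullet> a = x \<bullet> b}" by auto
 qed (auto simp: c)
 thus ?thesis using dpred_iff[OF bs] S_diag[OF ij(1,2)] by simp
qed

definition dfn :: "('a::euclidean_space => 'b::euclidean_space) => bool" where
 "dfn g \<longleftrightarrow> dpred (%z. snd z = g (fst z))"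

lemma dpred_eq_coordmap:
 fixes \<pi>1 :: "'a::euclidean_space => 'b::euclidean_space"
 assumes "coordmap \<pi>1" "coordmap \<pi>2" shows "dpred (%x. \<pi>1 x = \<pi>2 x)"
proof -
 have "dpred (%x. \<pi>1 x \<bullet> b = \<pi>2 x \<bullet> b)" if b: "b \<in> Basis" for b
 proof -
  obtain a where "a \<in> Basis" "!!x. \<pi>1 x \<bullet> b = x \<bullet> a"
   using assms(1) b unfolding coordmap_def by meson
  moreover obtain a' where "a' \<in> Basis" "!!x. \<pi>2 x \<bullet> b = x \<bullet> a'"
   using assms(2) b unfolding coordmap_def by meson
  ultimately show ?thesis using dpred_coord_eq by simp
 qed
 hence "dpred (%x. \<forall>b\<in>Basis. \<pi>1 x \<bullet> b = \<pi>2 x \<bullet> b)" by (intro dpred_ball finite_Basis)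
 thus ?thesis by (simp add: euclidean_eq_iff[symmetric])
qed

lemma dfn_coordmap: "coordmap \<pi> ==> dfn \<pi>"
 unfolding dfn_def
 by (rule dpred_eq_coordmap[OF coordmap_snd[OF coordmap_ident] coordmap_compose[OF _ coordmap_fst[OF coordmap_ident]]])

lemma dfnI:
 fixes g :: "'a::euclidean_space => 'b::euclidean_space"
 shows "dpred (%z. snd z = g (fst z)) ==> dfn g"
 by (simp add: dfn_def)

lemma dpred_compose:
 assumes "dpred P" "dfn g" shows "dpred (%x. P (g x))"
proof -
 have "dpred (%x. \<exists>y. y = g x \<and> P y)"
  by (intro dpred_ex dpred_and dpred_coordmap[OF _ assms(1), of snd])
   (use assms(2) in \<open>auto simp: dfn_def intro: coordmap_intros\<close>)
 thus ?thesis by simp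
qed

lemma dfn_compose:
 assumes "dfn h" "dfn g" shows "dfn (%x. h (g x))"
proof (rule dfnI)
 have "dpred (%z. \<exists>y. y = g (fst z) \<and> snd z = h y)"
 proof (intro dpred_ex dpred_and)
  show "dpred (%z. snd z = g (fst (fst z)))"
   using dpred_coordmap[of "%z. (fst (fst z), snd z)", OF _ assms(2)[unfolded dfn_def]]
   by (simp add: coordmap_fst coordmap_snd coordmap_ident coordmap_Pair)
  show "dpred (%z. snd (fst z) = h (snd z))"
   using dpred_coordmap[of "%z. (snd z, snd (fst z))", OF _ assms(1)[unfolded dfn_def]]
   by (simp add: coordmap_fst coordmap_snd coordmap_ident coordmap_Pair)
 qed
 thus "dpred (%z. snd z = h (g (fst z)))" by simp
qed

lemma dfn_Pair:
 assumes "dfn g" "dfn h" shows "dfn (%x. (g x, h x))"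
proof (rule dfnI)
 have 1: "dpred (%z. fst (snd z) = g (fst z))"
  using dpred_coordmap[of "%z. (fst z, fst (snd z))", OF _ assms(1)[unfolded dfn_def]]
  by (simp add: coordmap_fst coordmap_snd coordmap_ident coordmap_Pair)
 have 2: "dpred (%z. snd (snd z) = h (fst z))"
  using dpred_coordmap[of "%z. (fst z, snd (snd z))", OF _ assms(2)[unfolded dfn_def]]
  by (simp add: coordmap_fst coordmap_snd coordmap_ident coordmap_Pair)
 show "dpred (%z. snd z = (g (fst z), h (fst z)))"
  using dpred_and[OF 1 2] by (simp add: prod_eq_iff)
qed

lemmas dfn_ident = dfn_coordmap[OF coordmap_ident]
lemmas dfn_fst = dfn_compose[OF dfn_coordmap[OF coordmap_fst[OF coordmap_ident]]]
lemmas dfn_snd = dfn_compose[OF dfn_coordmap[OF coordmap_snd[OF coordmap_ident]]]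

lemma dfn_inner_Basis: "dfn g ==> b \<in> Basis ==> dfn (%x. g x \<bullet> b)"
 by (rule dfn_compose[of "%y. y \<bullet> b"]) (auto intro!: dfn_coordmap coordmap_inner coordmap_ident)

lemma dpred_eq: "dfn g ==> dfn h ==> dpred (%x. g x = h x)"
 using dpred_compose[OF dpred_eq_coordmap[OF coordmap_fst[OF coordmap_ident] coordmap_snd[OF coordmap_ident]] dfn_Pair, of g h]
 by simp

lemma basis_list_real: "basis_list [1::real]"
 by (simp add: basis_list_def)

lemma coords_real: "coords [1] x = [x]"
 by (simp add: coords_def)

lemma dpred_real_eq: "dpred (%x::real. x = a)"
 using dpred_iff[OF basis_list_real, of "%x. x = a"] S_point[of a] by (simp add: coords_real)

lemma dfn_vecI:
 assumes "!!b. b \<in> Basis ==> dfn (%x. g x \<bullet> b)" shows "dfn g"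
proof (rule dfnI)
 have "dpred (%z. snd z \<bullet> b = g (fst z) \<bullet> b)" if "b \<in> Basis" for b
  by (intro dpred_eq dfn_compose[OF assms] dfn_inner_Basis dfn_snd dfn_fst dfn_ident that)
 hence "dpred (%z. \<forall>b\<in>Basis. snd z \<bullet> b = g (fst z) \<bullet> b)" by (intro dpred_ball finite_Basis)
 thus "dpred (%z. snd z = g (fst z))"
  by (simp add: euclidean_eq_iff[symmetric])
qed

lemma dfn_const: "dfn (%x. a)"
proof (rule dfn_vecI, rule dfnI)
 fix b :: 'b
 show "dpred (%z. snd z = a \<bullet> b)"
  by (rule dpred_compose[OF dpred_real_eq dfn_snd[OF dfn_ident]])
qed

lemma basis_list_real2: "basis_list [(1::real, 0::real), (0, 1)]"
 using basis_list_prod[OF basis_list_real basis_list_real] by simp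

lemma dpred_real2: "{[x, y] |x y. P x y} \<in> S 2 ==> dpred (%z. P (fst z) (snd z))"
proof -
 assume a: "{[x, y] |x y. P x y} \<in> S 2"
 have "coords [(1::real, 0::real), (0, 1)] ` {z. P (fst z) (snd z)} = {[x, y] |x y. P x y}"
 proof -
  have c: "coords [(1::real, 0::real), (0, 1)] z = [fst z, snd z]" for z by (cases z) (simp add: coords_def)
  show ?thesis
   by (auto simp: c) (metis (mono_tags, lifting) c fst_conv image_iff mem_Collect_eq snd_conv)
 qed
 thus ?thesis using dpred_iff[OF basis_list_real2] a by (simp add: numeral_2_eq_2)
qed

lemma dpred_real3: "{[x, y, z] |x y z. P x y z} \<in> S 3 ==> dpred (%w. P (fst (fst w)) (snd (fst w)) (snd w))"
proof -
 assume a: "{[x, y, z] |x y z. P x y z} \<in> S 3"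
 have b: "basis_list [((1::real, 0::real), 0::real), ((0, 1), 0), ((0, 0), 1)]"
  using basis_list_prod[OF basis_list_real2 basis_list_real] by (simp add: zero_prod_def)
 have "coords [((1::real, 0::real), 0::real), ((0, 1), 0), ((0, 0), 1)] `
   {w. P (fst (fst w)) (snd (fst w)) (snd w)} = {[x, y, z] |x y z. P x y z}"
 proof -
  have c: "coords [((1::real, 0::real), 0::real), ((0, 1), 0), ((0, 0), 1)] w = [fst (fst w), snd (fst w), snd w]" for w
   by (cases w) (auto simp: coords_def inner_prod_def)
  show ?thesis
   by (auto simp: c) (metis (mono_tags, lifting) c fst_conv image_iff mem_Collect_eq snd_conv)
 qed
 thus ?thesis using dpred_iff[OF b] a by (simp add: numeral_3_eq_3)
qed

lemma dpred_less: "dfn g ==> dfn h ==> dpred (%x. g x < (h x :: real))"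
 using dpred_compose[OF dpred_real2[OF S_less] dfn_Pair, of g h] by simp

lemma dpred_le: "dfn g ==> dfn h ==> dpred (%x. g x <= (h x :: real))"
 using dpred_not[OF dpred_less, of h g] by (simp add: not_less)

lemma dfn_add_real: "dfn g ==> dfn h ==> dfn (%x. g x + (h x :: real))"
 using dfn_compose[OF dfnI dfn_Pair, of "%z. fst z + snd z" g h] dpred_real3[OF S_add] by simp

lemma dfn_mult: "dfn g ==> dfn h ==> dfn (%x. g x * (h x :: real))"
 using dfn_compose[OF dfnI dfn_Pair, of "%z. fst z * snd z" g h] dpred_real3[OF S_mult] by simp

lemma dfn_minus_real: "dfn g ==> dfn h ==> dfn (%x. g x - (h x :: real))"
 using dfn_add_real[OF _ dfn_mult[OF dfn_const[of "-1"]], of g h] by simp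

lemma dfn_add: "dfn g ==> dfn h ==> dfn (%x. g x + h x)"
 by (rule dfn_vecI) (simp add: inner_add_left dfn_add_real dfn_inner_Basis)

lemma dfn_minus: "dfn g ==> dfn h ==> dfn (%x. g x - h x)"
 by (rule dfn_vecI) (simp add: inner_diff_left dfn_minus_real dfn_inner_Basis)

lemma dfn_uminus: "dfn g ==> dfn (%x. - g x)"
 using dfn_minus[OF dfn_const[of 0], of g] by simp

lemma dfn_scaleR: "dfn g ==> dfn h ==> dfn (%x. g x *\<^sub>R h x)"
 by (rule dfn_vecI) (simp add: dfn_mult dfn_inner_Basis)

lemma dfn_sum: "(!!i. i \<in> I ==> dfn (g i)) ==> dfn (%x. \<Sum>i\<in>I. g i x)"
 by (induction I rule: infinite_finite_induct) (auto intro: dfn_const dfn_add)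

lemma dfn_power: "dfn g ==> dfn (%x. (g x :: real) ^ k)"
 by (induction k) (auto intro: dfn_const dfn_mult)

lemma dfn_inner: "dfn g ==> dfn h ==> dfn (%x. g x \<bullet> h x)"
 by (subst euclidean_inner) (intro dfn_sum dfn_mult dfn_inner_Basis)

lemma dfn_inverse: "dfn g ==> dfn (%x. inverse (g x :: real))"
proof (rule dfn_compose[of inverse], rule dfnI)
 \<comment> \<open>\<open>inverse 0\<close> is 0 by convention, hence the first disjunct.\<close>
 have "dpred (%z::real \<times> real. (fst z = 0 \<and> snd z = 0) \<or> fst z * snd z = 1)"
  by (intro dpred_or dpred_and dpred_eq dfn_mult dfn_fst dfn_snd dfn_ident dfn_const)
 moreover have "(%z::real \<times> real. (fst z = 0 \<and> snd z = 0) \<or> fst z * snd z = 1) = (%z. snd z = inverse (fst z))"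
 proof
  fix z :: "real \<times> real"
  show "((fst z = 0 \<and> snd z = 0) \<or> fst z * snd z = 1) = (snd z = inverse (fst z))"
   by (cases "fst z = 0") (auto intro: inverse_unique[symmetric])
 qed
 ultimately show "dpred (%z::real \<times> real. snd z = inverse (fst z))" by simp
qed

lemma dfn_divide: "dfn g ==> dfn h ==> dfn (%x. g x / (h x :: real))"
 unfolding divide_inverse by (intro dfn_mult dfn_inverse)

lemma dfn_norm: "dfn g ==> dfn (%x. norm (g x :: 'a::euclidean_space))"
proof (rule dfn_compose[of norm], rule dfnI)
 have "dpred (%z::'a \<times> real. 0 <= snd z \<and> snd z ^ 2 = fst z \<bullet> fst z)"
  by (intro dpred_and dpred_eq dpred_le dfn_power dfn_inner dfn_fst dfn_snd dfn_ident dfn_const)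
 moreover have "(%z::'a \<times> real. 0 <= snd z \<and> snd z ^ 2 = fst z \<bullet> fst z) = (%z. snd z = norm (fst z))"
  by (auto simp: fun_eq_iff power2_norm_eq_inner[symmetric])
 ultimately show "dpred (%z::'a \<times> real. snd z = norm (fst z))" by simp
qed

lemma dfn_abs: "dfn g ==> dfn (%x. \<bar>g x :: real\<bar>)"
 using dfn_norm[of g] by simp

lemmas dintros = dpred_ex dpred_all dpred_and dpred_or dpred_imp dpred_iff_iff dpred_not
 dpred_eq dpred_less dpred_le dfn_Pair dfn_fst dfn_snd dfn_add dfn_minus dfn_uminus dfn_mult dfn_divide
 dfn_scaleR dfn_power dfn_norm dfn_abs dfn_inner dfn_ident dfn_const

subsection \<open>Definable subsets of the line\<close>

text \<open>The axiom on subsets of the line enters the later arguments through these two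
  consequences. The frontier of a finite union lies in the union of the frontiers, and a set made of
  points alone is finite.\<close>

lemma dpred_real_cases:
 assumes "dpred (P :: real => bool)"
 shows "finite (frontier {x. P x})"
  and "infinite {x. P x} ==> \<exists>a b. a < b \<and> {a<..<b} \<subseteq> {x. P x}"
proof -
 have "coords [1] ` Collect P \<in> S 1" using assms dpred_iff[OF basis_list_real] by simp
 from S_line[OF this] obtain Q I where QI: "finite Q" "finite I" "\<forall>(a, b)\<in>I. a < b"
  "coords [1] ` Collect P = {[x] |x. x \<in> Q \<or> (\<exists>(a, b)\<in>I. a < ereal x \<and> ereal x < b)}"
  by (elim exE conjE)
 have P: "P x \<longleftrightarrow> x \<in> Q \<or> (\<exists>(a, b)\<in>I. a < ereal x \<and> ereal x < b)" for x
 proof -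
  have "P x \<longleftrightarrow> [x] \<in> coords [1] ` Collect P" by (auto simp: coords_real)
  thus ?thesis unfolding QI(4) by auto
 qed
 define U where "U = (\<Union>(a, b)\<in>I. {x. a < ereal x \<and> ereal x < b})"
 have eq: "{x. P x} = Q \<union> U" unfolding P U_def by auto
 have fr: "finite (frontier {x::real. a < ereal x \<and> ereal x < b})" for a b
 proof -
  have "{x::real. a < ereal x \<and> ereal x < b} = einterval a b" by (auto simp: einterval_def)
  moreover have "frontier (einterval a b) \<subseteq> {real_of_ereal a, real_of_ereal b}"
  proof
   fix x assume x: "x \<in> frontier (einterval a b)"
   have "open (einterval a b)" by simp
   hence "x \<notin> einterval a b" using x by (simp add: frontier_def interior_open)
   moreover have "\<not> ereal x < a"
   proof
    assume "ereal x < a"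
    hence "x \<in> {y. ereal y < a}" "{y. ereal y < a} \<inter> einterval a b = {}" "open {y::real. ereal y < a}"
     by (auto simp: einterval_def intro!: open_Collect_less continuous_intros)
    thus False using x by (metis Diff_iff closure_iff_nhds_not_empty frontier_def inf_commute order_refl)
   qed
   moreover have "\<not> b < ereal x"
   proof
    assume "b < ereal x"
    hence "x \<in> {y. b < ereal y}" "{y. b < ereal y} \<inter> einterval a b = {}" "open {y::real. b < ereal y}"
     by (auto simp: einterval_def intro!: open_Collect_less continuous_intros)
    thus False using x by (metis Diff_iff closure_iff_nhds_not_empty frontier_def inf_commute order_refl)
   qed
   ultimately have "a = ereal x \<or> b = ereal x" by (auto simp: einterval_def not_less)
   thus "x \<in> {real_of_ereal a, real_of_ereal b}" by auto
  qed
  ultimately show ?thesis by (metis finite.emptyI finite_insert finite_subset)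
 qed
 have "finite (frontier U)"
 proof -
  have "finite J ==> finite (frontier (\<Union>(a, b)\<in>J. {x::real. a < ereal x \<and> ereal x < b}))" for J
  proof (induction J rule: finite_induct)
   case (insert p J)
   have "finite (frontier {x. fst p < ereal x \<and> ereal x < snd p} \<union>
     frontier (\<Union>(a, b)\<in>J. {x. a < ereal x \<and> ereal x < b}))"
    using insert.IH fr by blast
   hence "finite (frontier ({x. fst p < ereal x \<and> ereal x < snd p} \<union>
     (\<Union>(a, b)\<in>J. {x. a < ereal x \<and> ereal x < b})))"
    by (rule finite_subset[OF frontier_Un_subset])
   thus ?case by (simp add: case_prod_unfold)
  qed simp
  thus ?thesis using QI(2) by (simp add: U_def)
 qed
 moreover have "finite (frontier Q)" using QI(1) by (meson finite_imp_closed frontier_subset_closed finite_subset)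
 ultimately show "finite (frontier {x. P x})"
  unfolding eq using frontier_Un_subset[of Q U] by (meson finite_UnI finite_subset)
 assume "infinite {x. P x}"
 hence "U ~= {}" using QI(1) eq by auto
 then obtain a b where ab: "(a, b) \<in> I" unfolding U_def by auto
 hence "a < b" using QI(3) by auto
 obtain r where r: "a < ereal r" "ereal r < b" using \<open>a < b\<close> ereal_dense2 by blast
 obtain s where s: "ereal r < ereal s" "ereal s < b" using r(2) ereal_dense2 by blast
 have "a < ereal x \<and> ereal x < b" if "x \<in> {r<..<s}" for x
  using that r(1) s(2) by (auto intro: less_trans[of a "ereal r"] less_trans[of _ "ereal s"])
 hence "{r<..<s} \<subseteq> U" unfolding U_def using ab by blast
 thus "\<exists>a b. a < b \<and> {a<..<b} \<subseteq> {x. P x}" using s eq by (intro exI[of _ r] exI[of _ s]) auto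
qed

text \<open>An infinite definable set of reals contains an interval, which is uncountable.
  Countability is what arguments with isolated points or rational endpoints deliver.\<close>

lemma dpred_countable_finite:
 assumes "dpred (P :: real => bool)" "countable {x. P x}" shows "finite {x. P x}"
proof (rule ccontr)
 assume "infinite {x. P x}"
 then obtain a b where "a < b" "{a<..<b} \<subseteq> {x. P x}" using dpred_real_cases(2)[OF assms(1)] by blast
 thus False using assms(2) countable_subset uncountable_open_interval by blast
qed

text \<open>Once \<open>e\<close> keeps the interval off the finite frontier, connectedness leaves
  the two alternatives.\<close>

lemma dpred_right_germ:
 assumes "dpred (P :: real => bool)"
 shows "\<exists>e>0. (\<forall>t. c < t \<and> t < c + e --> P t) \<or> (\<forall>t. c < t \<and> t < c + e --> \<not> P t)"
proof -
 let ?F = "frontier {x. P x} - {c}"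
 have "finite ?F" using dpred_real_cases(1)[OF assms] by simp
 then obtain e where e: "e > 0" "!!x. x \<in> ?F ==> e <= dist c x"
  using finite_set_avoid[of ?F c] by auto
 have "{c<..<c+e} \<inter> frontier {x. P x} = {}" using e by (force simp: dist_real_def)
 hence "{c<..<c+e} \<inter> {x. P x} = {} \<or> {c<..<c+e} - {x. P x} = {}"
  using connected_Int_frontier[of "{c<..<c+e}" "{x. P x}"] connected_Ioo by blast
 thus ?thesis using e(1) by (intro exI[of _ e]) auto
qed

lemma dpred_left_germ:
 assumes "dpred (P :: real => bool)"
 shows "\<exists>e>0. (\<forall>t. c - e < t \<and> t < c --> P t) \<or> (\<forall>t. c - e < t \<and> t < c --> \<not> P t)"
proof -
 have "dpred (%t. P (- t))" by (intro dpred_compose[OF assms] dintros)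
 from dpred_right_germ[OF this, of "- c"] obtain e where e: "e > 0"
  "(\<forall>t. - c < t \<and> t < - c + e --> P (- t)) \<or> (\<forall>t. - c < t \<and> t < - c + e --> \<not> P (- t))" by blast
 have "(\<forall>t. c - e < t \<and> t < c --> P t) \<or> (\<forall>t. c - e < t \<and> t < c --> \<not> P t)"
  using e(2)
 proof (elim disjE)
  assume h: "\<forall>t. - c < t \<and> t < - c + e --> P (- t)"
  have "P t" if "c - e < t" "t < c" for t using h[rule_format, of "- t"] that by simp
  thus ?thesis by blast
 next
  assume h: "\<forall>t. - c < t \<and> t < - c + e --> \<not> P (- t)"
  have "\<not> P t" if "c - e < t" "t < c" for t using h[rule_format, of "- t"] that by simp
  thus ?thesis by blast
 qed
 thus ?thesis using e(1) by blast
qed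

end

subsection \<open>Generic behaviour of definable sets\<close>

lemma baire_open:
 fixes A :: "nat => 'a::euclidean_space set"
 assumes U: "open U" "U ~= {}"
  and nd: "!!k W. open W ==> W ~= {} ==> W \<subseteq> U ==> \<exists>W'. open W' \<and> W' ~= {} \<and> W' \<subseteq> W \<and> W' \<inter> A k = {}"
 shows "\<exists>x\<in>U. \<forall>k. x \<notin> A k"
proof -
 define T where "T k = - closure (A k \<inter> U)" for k
 have "UNIV \<subseteq> closure (\<Inter> (range T))"
 proof (rule Baire)
  fix G assume "G \<in> range T"
  then obtain k where G: "G = T k" by blast
  have "W \<inter> T k ~= {}" if W: "open W" "W ~= {}" for W
  proof (cases "W \<inter> U = {}")
   case True
   hence "W \<inter> closure (A k \<inter> U) = {}" using W(1) open_Int_closure_eq_empty by blast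
   thus ?thesis using W by (auto simp: T_def)
  next
   case False
   then obtain W' where W': "open W'" "W' ~= {}" "W' \<subseteq> W \<inter> U" "W' \<inter> A k = {}"
    using nd[of "W \<inter> U" k] W U by blast
   hence "W' \<inter> closure (A k \<inter> U) = {}" using open_Int_closure_eq_empty by blast
   thus ?thesis using W' by (auto simp: T_def)
  qed
  from this[of "- closure (T k)"] have "closure (T k) = UNIV"
   using closure_subset[of "T k"] by auto
  thus "openin (top_of_set UNIV) G \<and> UNIV \<subseteq> closure G" by (auto simp: G T_def)
 qed auto
 hence "closure (\<Inter> (range T)) = UNIV" by blast
 hence "U \<inter> \<Inter> (range T) ~= {}" using U by (metis Int_UNIV_right open_Int_closure_eq_empty)
 then obtain x where "x \<in> U" "!!k. x \<in> T k" by blast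
 moreover have "A k \<inter> U \<subseteq> closure (A k \<inter> U)" for k by (rule closure_subset)
 ultimately show ?thesis unfolding T_def by blast
qed

text \<open>Moving along one coordinate within the same type lets an induction on dimension be run
  as an induction on the set of coordinates on which a predicate depends.\<close>

definition setc :: "'a::euclidean_space => 'a => real => 'a" where
 "setc b x t = x + (t - x \<bullet> b) *\<^sub>R b"

lemma setc_inner: "b \<in> Basis ==> i \<in> Basis ==> setc b x t \<bullet> i = (if i = b then t else x \<bullet> i)"
 by (auto simp: setc_def inner_add_left inner_Basis)

lemma setc_setc: "b \<in> Basis ==> setc b (setc b x s) t = setc b x t"
 by (auto intro!: euclidean_eqI[where 'a='a] simp: setc_inner)

lemma setc_same: "setc b x (x \<bullet> b) = x"
 by (simp add: setc_def)

lemma setc_add_same: "b \<in> Basis ==> setc b (x + r *\<^sub>R b) t = setc b x t"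
 by (auto intro!: euclidean_eqI[where 'a='a] simp: setc_inner inner_add_left inner_Basis)

lemma setc_add_other: "b \<in> Basis ==> i \<in> Basis ==> i ~= b ==> setc b (x + r *\<^sub>R i) t = setc b x t + r *\<^sub>R i"
 by (auto intro!: euclidean_eqI[where 'a='a] simp: setc_inner inner_add_left inner_Basis)

lemma invariant_all_const:
 fixes P :: "'a::euclidean_space => bool"
 assumes "!!b t x. b \<in> Basis ==> P (x + t *\<^sub>R b) = P x"
 shows "P x = P y"
proof -
 have "P (x + (\<Sum>b\<in>C. ((y - x) \<bullet> b) *\<^sub>R b)) = P x" if "finite C" "C \<subseteq> Basis" for C
  using that
 proof (induction C rule: finite_induct)
  case (insert b C)
  have "x + (\<Sum>i\<in>insert b C. ((y - x) \<bullet> i) *\<^sub>R i) = (x + (\<Sum>i\<in>C. ((y - x) \<bullet> i) *\<^sub>R i)) + ((y - x) \<bullet> b) *\<^sub>R b"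
   using insert by simp
  thus ?case using insert assms[of b] by (simp only: insert_subset)
 qed simp
 from this[of Basis] show ?thesis by (simp add: euclidean_representation)
qed

context ominimal
begin

lemma dfn_setc: "dfn g ==> dfn h ==> dfn (%x. setc b (g x) (h x))"
 unfolding setc_def by (intro dintros)

text \<open>Suppose neither alternative holds on any open part of \<open>U\<close>. For a rational
  interval of the coordinate \<open>b\<close>, the points whose fibre satisfies \<open>P\<close>
  throughout that interval form a definable set depending on \<open>B\<close> only. By induction it
  locally contains or misses an open set, and containing one would make \<open>P\<close> true on an
  open part of \<open>U\<close>; so it is nowhere dense, and likewise for the negation. Baire
  category gives a fibre on which neither \<open>P\<close> nor its negation contains an interval.
  Both are then finite there, which is absurd.\<close>

lemma dense_or_codense_aux:
 fixes P :: "'a::euclidean_space => bool"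
 assumes "finite B" "B \<subseteq> Basis" "dpred P"
  and "!!b t x. b \<in> Basis - B ==> P (x + t *\<^sub>R b) = P x" and "open U" "U ~= {}"
 shows "\<exists>W. open W \<and> W ~= {} \<and> W \<subseteq> U \<and> ((\<forall>x\<in>W. P x) \<or> (\<forall>x\<in>W. \<not> P x))"
 using assms
proof (induction B arbitrary: P U rule: finite_induct)
 case empty
 hence "P x = P y" for x y using invariant_all_const[of P x y] by blast
 thus ?case using empty.prems(4,5) by (intro exI[of _ U]) blast
next
 case (insert b B P U)
 have b: "b \<in> Basis" using insert.prems by blast
 show ?case
 proof (rule ccontr)
  assume "\<not> ?thesis"
  hence no: "!!W. open W ==> W ~= {} ==> W \<subseteq> U ==> (\<exists>x\<in>W. P x) \<and> (\<exists>x\<in>W. \<not> P x)" by blast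
  obtain x0 e where "x0 \<in> U" "e > 0" "ball x0 e \<subseteq> U"
   using insert.prems(4,5) open_contains_ball by blast
  then obtain l h where lh: "x0 \<in> box l h" "box l h \<subseteq> U" using rational_boxes[of e x0] by blast
  define V where "V = {x::'a. \<forall>i\<in>Basis - {b}. l \<bullet> i < x \<bullet> i \<and> x \<bullet> i < h \<bullet> i}"
  have "V = (\<Inter>i\<in>Basis - {b}. {x. l \<bullet> i < x \<bullet> i} \<inter> {x. x \<bullet> i < h \<bullet> i})" by (auto simp: V_def)
  moreover have "open (\<Inter>i\<in>Basis - {b}. {x::'a. l \<bullet> i < x \<bullet> i} \<inter> {x. x \<bullet> i < h \<bullet> i})"
   by (intro open_INT open_Int ballI open_Collect_less continuous_intros) auto
  ultimately have V: "open V" by simp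
  have x0V: "x0 \<in> V" using lh by (auto simp: V_def mem_box)
  have inbox: "y \<in> box l h" if "setc b y s \<in> V" "l \<bullet> b < y \<bullet> b" "y \<bullet> b < h \<bullet> b" for y s
   unfolding mem_box
  proof
   fix i :: 'a assume i: "i \<in> Basis"
   show "l \<bullet> i < y \<bullet> i \<and> y \<bullet> i < h \<bullet> i"
   proof (cases "i = b")
    case False
    hence "l \<bullet> i < setc b y s \<bullet> i \<and> setc b y s \<bullet> i < h \<bullet> i" using that(1) i by (auto simp: V_def)
    thus ?thesis using False i b by (simp add: setc_inner)
   qed (use that in auto)
  qed
  have key: "\<exists>W'. open W' \<and> W' ~= {} \<and> W' \<subseteq> W \<and> (\<forall>x\<in>W'. \<not> (\<forall>t. p < t \<and> t < q --> Q (setc b x t)))"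
   if Q: "Q = P \<or> Q = (%x. \<not> P x)" and W: "open W" "W ~= {}" "W \<subseteq> V"
    and pq: "p < q" "l \<bullet> b <= p" "q <= h \<bullet> b" for Q W p q
  proof -
   define X where "X x = (\<forall>t. p < t \<and> t < q --> Q (setc b x t))" for x
   have dQ: "dpred Q" using Q insert.prems(2) dpred_not by blast
   have iQ: "Q (x + t *\<^sub>R i) = Q x" if "i \<in> Basis - insert b B" for i t x
    using Q insert.prems(3)[OF that] by auto
   have "dpred X" unfolding X_def by (intro dintros dpred_compose[OF dQ] dfn_setc)
   moreover have "X (x + t *\<^sub>R i) = X x" if i: "i \<in> Basis - B" for i t x
   proof (cases "i = b")
    case True thus ?thesis using b by (simp add: X_def setc_add_same)
   next
    case False thus ?thesis using i b iQ by (simp add: X_def setc_add_other)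
   qed
   moreover have "B \<subseteq> Basis" using insert.prems by blast
   ultimately obtain W' where W': "open W'" "W' ~= {}" "W' \<subseteq> W" "(\<forall>x\<in>W'. X x) \<or> (\<forall>x\<in>W'. \<not> X x)"
    using insert.IH[of X W] W by blast
   \<comment> \<open>Otherwise \<open>Q\<close> would hold on \<open>Z\<close>, the open set of
     points whose fibre meets \<open>W'\<close> and whose coordinate along \<open>b\<close> lies
     between \<open>p\<close> and \<open>q\<close>.\<close>
   have "\<not> (\<forall>x\<in>W'. X x)"
   proof
    assume X: "\<forall>x\<in>W'. X x"
    define Z where "Z = {y. p < y \<bullet> b} \<inter> {y. y \<bullet> b < q} \<inter> (\<Union>s. (%y. setc b y s) -` W')"
    have "open ((%y. setc b y s) -` W')" for s
     by (rule open_vimage[OF W'(1)]) (auto simp: setc_def intro!: continuous_intros)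
    hence "open (\<Union>s. (%y. setc b y s) -` W')" by blast
    moreover have "open {y. p < y \<bullet> b}" "open {y. y \<bullet> b < q}"
     by (intro open_Collect_less continuous_intros)+
    ultimately have "open Z" unfolding Z_def by (simp only: open_Int)
    moreover have "Z ~= {}"
    proof -
     obtain x where x: "x \<in> W'" using W' by blast
     have "setc b x ((p+q)/2) \<in> Z"
      unfolding Z_def using pq x b setc_same[of b x]
      by (auto simp: setc_inner setc_setc intro!: exI[of _ "x \<bullet> b"])
     thus ?thesis by blast
    qed
    moreover have "Z \<subseteq> U"
    proof
     fix y assume "y \<in> Z"
     then obtain s where "p < y \<bullet> b" "y \<bullet> b < q" "setc b y s \<in> W'" by (auto simp: Z_def)
     hence "setc b y s \<in> V" "l \<bullet> b < y \<bullet> b" "y \<bullet> b < h \<bullet> b" using W'(3) W(3) pq by auto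
     hence "y \<in> box l h" by (rule inbox)
     thus "y \<in> U" using lh by blast
    qed
    moreover have "Q y" if y: "y \<in> Z" for y
    proof -
     obtain s where s: "p < y \<bullet> b" "y \<bullet> b < q" "setc b y s \<in> W'" using y by (auto simp: Z_def)
     hence "Q (setc b (setc b y s) (y \<bullet> b))" using X by (auto simp: X_def)
     thus ?thesis using b by (simp add: setc_setc setc_same)
    qed
    ultimately show False using no[of Z] Q by blast
   qed
   thus ?thesis using W' unfolding X_def by blast
  qed
  define idx where "idx k = (let (i, p, q) = (from_nat k :: bool \<times> rat \<times> rat) in (i, real_of_rat p, real_of_rat q))" for k
  define A where "A k = (case idx k of (i, p, q) =>
   {x. p < q \<and> l \<bullet> b <= p \<and> q <= h \<bullet> b \<and> (\<forall>t. p < t \<and> t < q --> (i = P (setc b x t)))})" for k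
  have "\<exists>x\<in>V. \<forall>k. x \<notin> A k"
  proof (rule baire_open[OF V])
   show "V ~= {}" using x0V by blast
   fix k and W :: "'a set" assume W: "open W" "W ~= {}" "W \<subseteq> V"
   obtain i p q where ipq: "idx k = (i, p, q)" by (cases "idx k") auto
   show "\<exists>W'. open W' \<and> W' ~= {} \<and> W' \<subseteq> W \<and> W' \<inter> A k = {}"
   proof (cases "p < q \<and> l \<bullet> b <= p \<and> q <= h \<bullet> b")
    case True
    define Q where "Q = (%y. i = P y)"
    have "Q = P \<or> Q = (%x. \<not> P x)" by (cases i) (auto simp: Q_def)
    with key[of Q W p q] W True obtain W' where W': "open W'" "W' ~= {}" "W' \<subseteq> W"
     "\<forall>x\<in>W'. \<not> (\<forall>t. p < t \<and> t < q --> Q (setc b x t))" by metis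
    have Ak: "\<forall>t. p < t \<and> t < q --> Q (setc b x t)" if "x \<in> A k" for x
     using that unfolding A_def ipq prod.case Q_def by simp
    have "W' \<inter> A k = {}"
    proof (rule equals0I)
     fix x assume "x \<in> W' \<inter> A k"
     thus False using W'(4) Ak[of x] by (meson IntD1 IntD2)
    qed
    thus ?thesis using W'(1-3) by (intro exI[of _ W'] conjI)
   next
    case False
    hence "A k = {}" by (auto simp: A_def ipq)
    thus ?thesis using W by blast
   qed
  qed
  then obtain x where x: "x \<in> V" "!!k. x \<notin> A k" by blast
  have fin: "finite {t. l \<bullet> b < t \<and> t < h \<bullet> b \<and> (i = P (setc b x t))}" for i
  proof (rule ccontr)
   assume inf: "infinite {t. l \<bullet> b < t \<and> t < h \<bullet> b \<and> (i = P (setc b x t))}"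
   have "dpred (%t. l \<bullet> b < t \<and> t < h \<bullet> b \<and> (i = P (setc b x t)))"
    by (intro dintros dpred_const dpred_compose[OF insert.prems(2)] dfn_setc)
   from dpred_real_cases(2)[OF this inf] obtain u v where uv: "u < v"
    "{u<..<v} \<subseteq> {t. l \<bullet> b < t \<and> t < h \<bullet> b \<and> (i = P (setc b x t))}" by blast
   obtain p where p: "u < real_of_rat p" "real_of_rat p < v" using of_rat_dense[OF uv(1)] by blast
   obtain q where q: "real_of_rat p < real_of_rat q" "real_of_rat q < v" using of_rat_dense[OF p(2)] by blast
   have "real_of_rat p \<in> {u<..<v}" "real_of_rat q \<in> {u<..<v}" using p q by auto
   hence "l \<bullet> b <= real_of_rat p" "real_of_rat q <= h \<bullet> b" using uv(2) by fastforce+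
   moreover have "i = P (setc b x t)" if "real_of_rat p < t" "t < real_of_rat q" for t
   proof -
    have "t \<in> {u<..<v}" using that p q by auto
    thus ?thesis using uv(2) by blast
   qed
   moreover have "idx (to_nat (i, p, q)) = (i, real_of_rat p, real_of_rat q)" by (simp add: idx_def)
   ultimately have "x \<in> A (to_nat (i, p, q))" using q(1) by (auto simp: A_def)
   thus False using x(2) by blast
  qed
  have "{l \<bullet> b<..<h \<bullet> b} \<subseteq> {t. l \<bullet> b < t \<and> t < h \<bullet> b \<and> (True = P (setc b x t))} \<union>
   {t. l \<bullet> b < t \<and> t < h \<bullet> b \<and> (False = P (setc b x t))}" by auto
  hence "finite {l \<bullet> b<..<h \<bullet> b}" using fin[of True] fin[of False] by (meson finite_UnI finite_subset)
  moreover have "l \<bullet> b < h \<bullet> b" using lh(1) b by (force simp: mem_box)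
  ultimately show False using infinite_Ioo by blast
 qed
qed

theorem dense_or_codense:
 fixes P :: "'a::euclidean_space => bool"
 assumes "dpred P" "open U" "U ~= {}"
 obtains W where "open W" "W ~= {}" "W \<subseteq> U" "(\<forall>x\<in>W. P x) \<or> (\<forall>x\<in>W. \<not> P x)"
 using dense_or_codense_aux[OF finite_Basis order_refl assms(1) _ assms(2,3)] by auto

text \<open>By \<open>dense_or_codense\<close> a definable set without interior is nowhere dense,
  and countably many of those cannot cover an open set.\<close>

lemma dpred_cover_interior:
 fixes P :: "nat => 'a::euclidean_space => bool"
 assumes "!!k. dpred (P k)" "open U" "U ~= {}" "!!x. x \<in> U ==> \<exists>k. P k x"
 obtains k W where "open W" "W ~= {}" "W \<subseteq> U" "\<forall>x\<in>W. P k x"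
proof -
 have "\<exists>k W. open W \<and> W ~= {} \<and> W \<subseteq> U \<and> (\<forall>x\<in>W. P k x)"
 proof (rule ccontr)
  assume no: "\<not> ?thesis"
  have "\<exists>x\<in>U. \<forall>k. x \<notin> {x. P k x}"
  proof (rule baire_open[OF assms(2,3)])
   fix k and W :: "'a set" assume W: "open W" "W ~= {}" "W \<subseteq> U"
   obtain W' where "open W'" "W' ~= {}" "W' \<subseteq> W" "(\<forall>x\<in>W'. P k x) \<or> (\<forall>x\<in>W'. \<not> P k x)"
    using dense_or_codense[OF assms(1) W(1,2)] by metis
   moreover have "\<not> (\<forall>x\<in>W'. P k x)" if "open W'" "W' ~= {}" "W' \<subseteq> W" for W' using no that W(3) by blast
   ultimately show "\<exists>W'. open W' \<and> W' ~= {} \<and> W' \<subseteq> W \<and> W' \<inter> {x. P k x} = {}" by blast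
  qed
  thus False using assms(4) by blast
 qed
 thus ?thesis using that by blast
qed

subsection \<open>Uniform finiteness\<close>

text \<open>Near a good parameter the solutions move without splitting, merging or escaping: old and
  new ones correspond to each other within distance \<open>d\<close>, and the old ones are more than
  \<open>2 * d\<close> apart. Being a first-order formula, the notion stays definable when
  \<open>C\<close> depends on further parameters.\<close>

definition good :: "(real => real => bool) => real => bool" where
 "good C s \<longleftrightarrow> (\<exists>d e. 0 < d \<and> 0 < e \<and> (\<forall>r. \<bar>r - s\<bar> < e -->
   (\<forall>y. C s y --> (\<exists>y'. C r y' \<and> \<bar>y' - y\<bar> < d)) \<and>
   (\<forall>y y' y''. C s y \<and> C r y' \<and> \<bar>y' - y\<bar> < d \<and> C r y'' \<and> \<bar>y'' - y\<bar> < d --> y' = y'') \<and>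
   (\<forall>y'. C r y' --> (\<exists>y. C s y \<and> \<bar>y' - y\<bar> < d)) \<and>
   (\<forall>y z. C s y \<and> C s z \<and> y ~= z --> 2 * d < \<bar>y - z\<bar>)))"

lemma good_card:
 assumes "good C s"
 shows "\<exists>e>0. \<forall>r. \<bar>r - s\<bar> < e --> card {y. C r y} = card {y. C s y}"
proof -
 obtain d e where de: "0 < d" "0 < e" and g: "!!r. \<bar>r - s\<bar> < e ==>
   (\<forall>y. C s y --> (\<exists>y'. C r y' \<and> \<bar>y' - y\<bar> < d)) \<and>
   (\<forall>y y' y''. C s y \<and> C r y' \<and> \<bar>y' - y\<bar> < d \<and> C r y'' \<and> \<bar>y'' - y\<bar> < d --> y' = y'') \<and>
   (\<forall>y'. C r y' --> (\<exists>y. C s y \<and> \<bar>y' - y\<bar> < d)) \<and>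
   (\<forall>y z. C s y \<and> C s z \<and> y ~= z --> 2 * d < \<bar>y - z\<bar>)"
  using assms unfolding good_def by blast
 have "card {y. C r y} = card {y. C s y}" if r: "\<bar>r - s\<bar> < e" for r
 proof -
  from g[OF r] obtain h where h: "!!y. C s y ==> C r (h y) \<and> \<bar>h y - y\<bar> < d" by metis
  have "bij_betw h {y. C s y} {y. C r y}"
   unfolding bij_betw_def
  proof
   show "inj_on h {y. C s y}"
   proof (rule inj_onI)
    fix y z assume yz: "y \<in> {y. C s y}" "z \<in> {y. C s y}" "h y = h z"
    hence "\<bar>y - z\<bar> < 2 * d" using h[of y] h[of z] by auto
    thus "y = z" using g[OF r] yz by force
   qed
   show "h ` {y. C s y} = {y. C r y}"
   proof
    show "{y. C r y} \<subseteq> h ` {y. C s y}"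
    proof
     fix y' assume y': "y' \<in> {y. C r y}"
     then obtain y where y: "C s y" "\<bar>y' - y\<bar> < d" using g[OF r] by blast
     hence "h y = y'" using g[OF r] h[OF y(1)] y' by blast
     thus "y' \<in> h ` {y. C s y}" using y by blast
    qed
   qed (use h in auto)
  qed
  thus ?thesis by (metis bij_betw_same_card)
 qed
 thus ?thesis using de by blast
qed

text \<open>Having exactly one solution in a rational interval, having none in it, and having all
  solutions below a rational bound are definable conditions on the parameter, so each changes at
  finitely many places. Away from these countably many places, finitely many such conditions valid
  at \<open>s\<close> persist nearby and pin down all solutions.\<close>

lemma good_cocountable:
 assumes C: "dpred (%z. C (fst z) (snd z))" and fin: "!!s. finite {y. C s y}"
 shows "countable {s. \<not> good C s}"
proof -
 define E where "E p q s \<longleftrightarrow> (\<exists>y. p < y \<and> y < q \<and> C s y) \<and>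
  (\<forall>y y'. p < y \<and> y < q \<and> C s y \<and> p < y' \<and> y' < q \<and> C s y' --> y = y')" for p q s
 define Z where "Z p q s \<longleftrightarrow> (\<forall>y. p < y \<and> y < q --> \<not> C s y)" for p q s
 define Bd where "Bd m s \<longleftrightarrow> (\<forall>y. C s y --> \<bar>y\<bar> < m)" for m s
 have C': "dfn g ==> dfn h ==> dpred (%x. C (g x) (h x))" for g h :: "'z::euclidean_space => real"
  using dpred_compose[OF C dfn_Pair, of g h] by simp
 have d: "dpred (E p q)" "dpred (Z p q)" "dpred (Bd m)" for p q m
  unfolding E_def Z_def Bd_def by (intro dintros C')+
 define N where "N = (\<Union>p::rat. \<Union>q::rat. frontier {s. E (of_rat p) (of_rat q) s} \<union>
   frontier {s. Z (of_rat p) (of_rat q) s} \<union> frontier {s. Bd (of_rat p) s})"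
 have "countable N" unfolding N_def
  using dpred_real_cases(1)[OF d(1)] dpred_real_cases(1)[OF d(2)] dpred_real_cases(1)[OF d(3)]
  by (intro countable_UN countable_Un countableI_type) (auto intro: countable_finite)
 moreover have "good C s" if s: "s \<notin> N" for s
 proof -
  have nbhd: "eventually Q (nhds s)" if "Q s" "s \<notin> frontier {s. Q s}" for Q
  proof -
   have "s \<in> closure {s. Q s}" using that(1) closure_subset by fastforce
   hence "s \<in> interior {s. Q s}" using that by (simp add: frontier_def)
   hence "eventually (%x. x \<in> interior {s. Q s}) (nhds s)" by (intro eventually_nhds_in_open) auto
   thus ?thesis by eventually_elim (use interior_subset in blast)
  qed
  have evE: "eventually (E (of_rat p) (of_rat q)) (nhds s)" if "E (of_rat p) (of_rat q) s" for p q
   using that s by (intro nbhd) (auto simp: N_def)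
  have evZ: "eventually (Z (of_rat p) (of_rat q)) (nhds s)" if "Z (of_rat p) (of_rat q) s" for p q
   using that s by (intro nbhd) (auto simp: N_def)
  have evO: "eventually (Bd (of_rat p)) (nhds s)" if "Bd (of_rat p) s" for p
   using that s by (intro nbhd) (auto simp: N_def)
  define Y where "Y = {y. C s y}"
  have Y: "finite Y" using fin by (simp add: Y_def)
  obtain d where d: "d > 0" "!!y z. y \<in> Y ==> z \<in> Y ==> y ~= z ==> 2 * d < \<bar>y - z\<bar>"
  proof -
   have "\<exists>e>0. \<forall>z\<in>Y. z ~= y --> e <= dist y z" for y using finite_set_avoid[OF Y, of y] by metis
   then obtain e where e: "!!y. e y > 0" "!!y z. z \<in> Y ==> z ~= y ==> e y <= dist y z" by metis
   define m where "m = Min (insert 1 (e ` Y))"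
   have m: "m > 0" "!!y. y \<in> Y ==> m <= e y" using Y e(1) by (auto simp: m_def)
   have "2 * (m / 3) < \<bar>y - z\<bar>" if "y \<in> Y" "z \<in> Y" "y ~= z" for y z
    using e(2)[of z y] m(2)[of y] m(1) that by (auto simp: dist_real_def)
   thus ?thesis using that[of "m/3"] m(1) by auto
  qed
  have "\<exists>p. y - d < real_of_rat p \<and> real_of_rat p < y" "\<exists>q. y < real_of_rat q \<and> real_of_rat q < y + d" for y
   using of_rat_dense[of "y - d" y] of_rat_dense[of y "y + d"] d(1) by auto
  then obtain p q where p: "!!y. y - d < real_of_rat (p y)" "!!y. real_of_rat (p y) < y"
   and q: "!!y. y < real_of_rat (q y)" "!!y. real_of_rat (q y) < y + d" by metis
  have Es: "E (of_rat (p y)) (of_rat (q y)) s" if y: "y \<in> Y" for y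
  proof -
   have "z = y" if "C s z" "real_of_rat (p y) < z" "z < real_of_rat (q y)" for z
   proof (rule ccontr)
    assume "z ~= y"
    hence "2 * d < \<bar>z - y\<bar>" using that y by (intro d(2)) (auto simp: Y_def)
    moreover have "y - d < z" "z < y + d" using p(1)[of y] q(2)[of y] that by linarith+
    ultimately show False using d(1) by linarith
   qed
   thus ?thesis unfolding E_def using p(2)[of y] q(1)[of y] y by (auto simp: Y_def)
  qed
  obtain M :: rat where M: "!!y. y \<in> Y ==> \<bar>y\<bar> < of_rat M"
  proof -
   obtain M0 where M0: "\<forall>y\<in>Y. norm y <= M0" using finite_imp_bounded[OF Y] bounded_iff by metis
   obtain M where "M0 < real_of_rat M" using of_rat_dense[of M0 "M0 + 1"] by auto
   thus ?thesis using that[of M] M0 by force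
  qed
  \<comment> \<open>What the isolating intervals leave of the bounded range. It contains no solution
    at \<open>s\<close>, so finitely many solution-free rational intervals cover it.\<close>
  define K where "K = {- real_of_rat M..real_of_rat M} - (\<Union>y\<in>Y. {real_of_rat (p y)<..<real_of_rat (q y)})"
  have K: "compact K" unfolding K_def by (intro compact_diff open_UN ballI) auto
  have "\<exists>a b. real_of_rat a < z \<and> z < real_of_rat b \<and> Z (of_rat a) (of_rat b) s" if z: "z \<in> K" for z
  proof -
   have "z \<notin> Y" using z p(2) q(1) by (auto simp: K_def)
   obtain e where e: "e > 0" "!!y. y \<in> Y ==> e <= dist z y"
    using finite_set_avoid[OF Y, of z] \<open>z \<notin> Y\<close> by metis
   obtain a where a: "z - e < real_of_rat a" "real_of_rat a < z" using of_rat_dense[of "z - e" z] e(1) by auto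
   obtain b where b: "z < real_of_rat b" "real_of_rat b < z + e" using of_rat_dense[of z "z + e"] e(1) by auto
   have "Z (of_rat a) (of_rat b) s" unfolding Z_def
   proof (intro allI impI notI)
    fix y assume y: "real_of_rat a < y \<and> y < real_of_rat b" "C s y"
    hence "e <= dist z y" by (intro e(2)) (simp add: Y_def)
    thus False using y a b unfolding dist_real_def by linarith
   qed
   thus ?thesis using a b by blast
  qed
  then obtain a b where ab: "!!z. z \<in> K ==> real_of_rat (a z) < z" "!!z. z \<in> K ==> z < real_of_rat (b z)"
   "!!z. z \<in> K ==> Z (of_rat (a z)) (of_rat (b z)) s" by metis
  obtain D where D: "D \<subseteq> K" "finite D" "K \<subseteq> (\<Union>z\<in>D. {real_of_rat (a z)<..<real_of_rat (b z)})"
  proof (rule compactE_image[OF K, of K "%z. {real_of_rat (a z)<..<real_of_rat (b z)}"])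
   show "K \<subseteq> (\<Union>z\<in>K. {real_of_rat (a z)<..<real_of_rat (b z)})" using ab by fastforce
  qed auto
  have "eventually (%r. (\<forall>y\<in>Y. E (of_rat (p y)) (of_rat (q y)) r) \<and> (\<forall>z\<in>D. Z (of_rat (a z)) (of_rat (b z)) r) \<and> Bd (of_rat M) r) (nhds s)"
  proof (intro eventually_conj eventually_ball_finite ballI)
   show "eventually (Bd (of_rat M)) (nhds s)" using M by (intro evO) (auto simp: Bd_def Y_def)
  qed (use Y D Es ab evE evZ in auto)
  then obtain e where e: "e > 0" "!!r. dist r s < e ==> (\<forall>y\<in>Y. E (of_rat (p y)) (of_rat (q y)) r) \<and>
    (\<forall>z\<in>D. Z (of_rat (a z)) (of_rat (b z)) r) \<and> Bd (of_rat M) r"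
   unfolding eventually_nhds_metric by blast
  show ?thesis unfolding good_def
  proof (rule exI[of _ d], rule exI[of _ e], intro conjI allI impI)
   fix r assume "\<bar>r - s\<bar> < e"
   hence r: "!!y. y \<in> Y ==> E (of_rat (p y)) (of_rat (q y)) r" "!!z. z \<in> D ==> Z (of_rat (a z)) (of_rat (b z)) r" "Bd (of_rat M) r"
    using e(2)[of r] by (auto simp: dist_real_def)
   have loc: "\<exists>y\<in>Y. real_of_rat (p y) < y' \<and> y' < real_of_rat (q y)" if y': "C r y'" for y'
   proof (rule ccontr)
    assume "\<not> ?thesis"
    moreover have "\<bar>y'\<bar> < real_of_rat M" using r(3) y' by (simp add: Bd_def)
    ultimately have "y' \<in> K" by (auto simp: K_def)
    then obtain z where "z \<in> D" "real_of_rat (a z) < y'" "y' < real_of_rat (b z)" using D(3) by auto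
    thus False using r(2)[of z] y' by (simp add: Z_def)
   qed
   show "\<exists>y'. C r y' \<and> \<bar>y' - y\<bar> < d" if "C s y" for y
   proof -
    from r(1)[of y] that obtain y' where "real_of_rat (p y) < y'" "y' < real_of_rat (q y)" "C r y'"
     by (auto simp: E_def Y_def)
    thus ?thesis using p(1)[of y] q(2)[of y] by (intro exI[of _ y']) auto
   qed
   show "\<exists>y. C s y \<and> \<bar>y' - y\<bar> < d" if "C r y'" for y'
   proof -
    from loc[OF that] obtain y where "y \<in> Y" "real_of_rat (p y) < y'" "y' < real_of_rat (q y)" by blast
    thus ?thesis using p(1)[of y] q(2)[of y] by (intro exI[of _ y]) (auto simp: Y_def)
   qed
   show "2 * d < \<bar>y - z\<bar>" if "C s y \<and> C s z \<and> y ~= z" for y z using that d(2) by (simp add: Y_def)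
   show "y' = y''" if h: "C s y \<and> C r y' \<and> \<bar>y' - y\<bar> < d \<and> C r y'' \<and> \<bar>y'' - y\<bar> < d" for y y' y''
   proof -
    have in_y: "real_of_rat (p y) < v \<and> v < real_of_rat (q y)" if v: "C r v" "\<bar>v - y\<bar> < d" for v
    proof -
     obtain z where z: "z \<in> Y" "real_of_rat (p z) < v" "v < real_of_rat (q z)" using loc[OF v(1)] by blast
     have "z = y"
     proof (rule ccontr)
      assume "z ~= y"
      hence "2 * d < \<bar>z - y\<bar>" using z h by (intro d(2)) (auto simp: Y_def)
      thus False using v(2) z p(1)[of z] q(2)[of z] by linarith
     qed
     thus ?thesis using z by simp
    qed
    have "E (of_rat (p y)) (of_rat (q y)) r" using r(1)[of y] h by (simp add: Y_def)
    thus ?thesis using in_y[of y'] in_y[of y''] h unfolding E_def by blast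
   qed
  qed (use d e in auto)
 qed
 ultimately show ?thesis using countable_subset[of "{s. \<not> good C s}" N] by blast
qed

text \<open>On each interval between consecutive bad points the number of solutions is constant, so it is attained on the
 finite set of bad points, midpoints, and one point beyond each end.\<close>

definition probe :: "(real => real => bool) => real => bool" where
 "probe C s \<longleftrightarrow> s = 0 \<or> \<not> good C s \<or> (\<exists>a. \<not> good C a \<and> (s = a + 1 \<or> s = a - 1)) \<or>
   (\<exists>a. \<not> good C a \<and> (\<exists>b. \<not> good C b \<and> s = (a + b) / 2))"

lemma finite_probe:
 assumes "finite {s. \<not> good C s}" shows "finite {s. probe C s}"
proof -
 let ?B = "{s. \<not> good C s}"
 have "{s. probe C s} \<subseteq> {0} \<union> ?B \<union> (%a. a + 1) ` ?B \<union> (%a. a - 1) ` ?B \<union> (%(a, b). (a + b) / 2) ` (?B \<times> ?B)"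
 proof
  fix s assume "s \<in> {s. probe C s}"
  then consider "s = 0" | "s \<in> ?B" | a where "a \<in> ?B" "s = a + 1" | a where "a \<in> ?B" "s = a - 1"
   | a b where "(a, b) \<in> ?B \<times> ?B" "s = (%(a, b). (a + b) / 2) (a, b)" unfolding probe_def by auto
  thus "s \<in> {0} \<union> ?B \<union> (%a. a + 1) ` ?B \<union> (%a. a - 1) ` ?B \<union> (%(a, b). (a + b) / 2) ` (?B \<times> ?B)"
   by cases blast+
 qed
 thus ?thesis using assms by (elim finite_subset) (intro finite_UnI finite_imageI finite_cartesian_product, auto)
qed

lemma probe_card:
 assumes fin: "finite {s. \<not> good C s}"
 shows "\<exists>r. probe C r \<and> card {y. C s y} = card {y. C r y}"
proof (cases "good C s")
 case False thus ?thesis by (auto simp: probe_def)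
next
 case True
 have const: "card {y. C s y} = card {y. C r y}" if "connected I" "s \<in> I" "r \<in> I" "!!x. x \<in> I ==> good C x" for I r
 proof -
  have "(%x. card {y. C x y}) constant_on I"
  proof (rule locally_constant_imp_constant[OF that(1)])
   fix x assume x: "x \<in> I"
   have "good C x" using that(4) x by blast
   then obtain e where e: "e > 0" "\<forall>r. \<bar>r - x\<bar> < e --> card {y. C r y} = card {y. C x y}"
    using good_card by blast
   show "\<exists>T. openin (top_of_set I) T \<and> x \<in> T \<and> (\<forall>r\<in>T. card {y. C r y} = card {y. C x y})"
   proof (intro exI[of _ "I \<inter> ball x e"] conjI ballI)
    fix r assume "r \<in> I \<inter> ball x e"
    hence "\<bar>r - x\<bar> < e" by (simp add: dist_real_def abs_minus_commute[of x])
    thus "card {y. C r y} = card {y. C x y}" using e(2) by blast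
   qed (use e x in \<open>auto intro: openin_open_Int\<close>)
  qed
  thus ?thesis using that(2,3) unfolding constant_on_def by auto
 qed
 define L where "L = {a. \<not> good C a \<and> a < s}"
 define R where "R = {a. \<not> good C a \<and> s < a}"
 have fLR: "finite L" "finite R" using fin by (auto simp: L_def R_def intro: finite_subset)
 have other: "\<not> good C x ==> x \<in> L \<or> x \<in> R" for x using True by (cases x s rule: linorder_cases) (auto simp: L_def R_def)
 consider "L = {}" "R = {}" | "L ~= {}" "R = {}" | "L = {}" "R ~= {}" | "L ~= {}" "R ~= {}" by blast
 thus ?thesis
 proof cases
  case 1
  hence "card {y. C s y} = card {y. C 0 y}" using other by (intro const[of UNIV]) auto
  thus ?thesis by (auto simp: probe_def)
 next
  case 2
  have m: "Max L \<in> L" using 2 fLR by simp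
  have "card {y. C s y} = card {y. C (Max L + 1) y}"
  proof (rule const[of "{Max L<..}"])
   fix x assume "x \<in> {Max L<..}"
   thus "good C x" using other[of x] 2 Max_ge[OF fLR(1), of x] by fastforce
  qed (use m in \<open>auto simp: L_def\<close>)
  thus ?thesis using m by (auto simp: probe_def L_def)
 next
  case 3
  have m: "Min R \<in> R" using 3 fLR by simp
  have "card {y. C s y} = card {y. C (Min R - 1) y}"
  proof (rule const[of "{..<Min R}"])
   fix x assume "x \<in> {..<Min R}"
   thus "good C x" using other[of x] 3 Min_le[OF fLR(2), of x] by fastforce
  qed (use m in \<open>auto simp: R_def\<close>)
  thus ?thesis using m by (auto simp: probe_def R_def)
 next
  case 4
  have m: "Max L \<in> L" "Min R \<in> R" using 4 fLR by auto
  hence lt: "Max L < s" "s < Min R" by (auto simp: L_def R_def)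
  have "card {y. C s y} = card {y. C ((Max L + Min R) / 2) y}"
  proof (rule const[of "{Max L<..<Min R}"])
   fix x assume "x \<in> {Max L<..<Min R}"
   thus "good C x" using other[of x] Max_ge[OF fLR(1), of x] Min_le[OF fLR(2), of x] by fastforce
  qed (use lt in auto)
  moreover have "probe C ((Max L + Min R) / 2)" unfolding probe_def using m by (auto simp: L_def R_def)
  ultimately show ?thesis by blast
 qed
qed

text \<open>The solutions at the finitely many probes along \<open>b\<close> are collected in
  \<open>A1\<close>, which no longer depends on \<open>b\<close>. By \<open>probe_card\<close> every
  fibre has as many solutions as some fibre at a probe, hence at most as many as \<open>A1\<close>,
  which is bounded by induction.\<close>

lemma uniform_finiteness_aux:
 fixes A :: "'a::euclidean_space => real => bool"
 assumes "finite B" "B \<subseteq> Basis" "dpred (%z. A (fst z) (snd z))"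
  and "!!b t u. b \<in> Basis - B ==> A (u + t *\<^sub>R b) = A u" and "!!u. finite {y. A u y}"
 shows "\<exists>N. \<forall>u. card {y. A u y} <= N"
 using assms
proof (induction B arbitrary: A rule: finite_induct)
 case (empty A)
 have "A u = A v" for u v
 proof
  fix y show "A u y = A v y" using invariant_all_const[of "%u. A u y" u v] empty.prems(3) by simp
 qed
 hence "card {y. A u y} <= card {y. A 0 y}" for u by (metis order_refl)
 thus ?case by blast
next
 case (insert b B A)
 have b: "b \<in> Basis" using insert.prems by blast
 define C where "C u s y = A (setc b u s) y" for u s y
 have A': "dfn g ==> dfn h ==> dpred (%x. A (g x) (h x))" for g :: "'z::euclidean_space => 'a" and h
  using dpred_compose[OF insert.prems(2) dfn_Pair, of g h] by simp
 have C': "dfn f ==> dfn g ==> dfn h ==> dpred (%x. C (f x) (g x) (h x))" for f :: "'z::euclidean_space => 'a" and g h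
  unfolding C_def by (intro A' dfn_setc)
 have good': "dfn f ==> dfn g ==> dpred (%x. good (C (f x)) (g x))" for f :: "'z::euclidean_space => 'a" and g
 proof -
  have 1: "dpred (%z. good (C (fst z)) (snd z))"
   unfolding good_def by (intro dintros C')
  show "dfn f ==> dfn g ==> dpred (%x. good (C (f x)) (g x))"
   using dpred_compose[OF 1 dfn_Pair, of f g] by simp
 qed
 have fin: "finite {s. \<not> good (C u) s}" for u
 proof (rule dpred_countable_finite)
  show "dpred (%s. \<not> good (C u) s)" by (intro dpred_not good' dintros)
  show "countable {s. \<not> good (C u) s}"
   by (rule good_cocountable) (intro C' dintros, simp add: C_def insert.prems)
 qed
 define A1 where "A1 u y \<longleftrightarrow> (\<exists>s. probe (C u) s \<and> C u s y)" for u y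
 have "\<exists>N. \<forall>u. card {y. A1 u y} <= N"
 proof (rule insert.IH)
  show "B \<subseteq> Basis" using insert.prems by blast
  show "dpred (%z. A1 (fst z) (snd z))"
   unfolding A1_def probe_def by (intro dintros C' good')
  fix i t and u :: 'a assume i: "i \<in> Basis - B"
  have "C (u + t *\<^sub>R i) = C u"
  proof (cases "i = b")
   case True thus ?thesis using b by (simp add: C_def fun_eq_iff setc_add_same)
  next
   case False thus ?thesis using b i insert.prems(3) by (simp add: C_def fun_eq_iff setc_add_other)
  qed
  thus "A1 (u + t *\<^sub>R i) = A1 u" unfolding A1_def by simp
 next
  fix u
  have "{y. A1 u y} = (\<Union>s\<in>{s. probe (C u) s}. {y. C u s y})" by (auto simp: A1_def)
  thus "finite {y. A1 u y}" using finite_probe[OF fin] insert.prems(4) by (simp add: C_def)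
 qed
 then obtain N where N: "!!u. card {y. A1 u y} <= N" by blast
 have "card {y. A u y} <= N" for u
 proof -
  obtain r where r: "probe (C u) r" "card {y. C u (u \<bullet> b) y} = card {y. C u r y}" using probe_card[OF fin] by blast
  have "{y. A1 u y} = (\<Union>s\<in>{s. probe (C u) s}. {y. C u s y})" by (auto simp: A1_def)
  hence f: "finite {y. A1 u y}" using finite_probe[OF fin] insert.prems(4) by (simp add: C_def)
  have "card {y. A u y} = card {y. C u r y}" using r(2) by (simp add: C_def setc_same)
  also have "... <= card {y. A1 u y}" using r(1) by (intro card_mono f) (auto simp: A1_def)
  finally show ?thesis using N[of u] by linarith
 qed
 thus ?case by blast
qed

text \<open>A finite set of points embeds into the product of its coordinate projections, and each
  of these is bounded by the case of real solutions.\<close>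

theorem uniform_finiteness:
 fixes A :: "'a::euclidean_space => 'b::euclidean_space => bool"
 assumes "dpred (%z. A (fst z) (snd z))" and fin: "!!u. finite {y. A u y}"
 shows "\<exists>N. \<forall>u. card {y. A u y} <= N"
proof -
 have A': "dfn g ==> dfn h ==> dpred (%x. A (g x) (h x))" for g :: "'z::euclidean_space => 'a" and h
  using dpred_compose[OF assms(1) dfn_Pair, of g h] by simp
 have "\<exists>N. \<forall>u. card {t. \<exists>y. A u y \<and> t = y \<bullet> i} <= N" for i
 proof (rule uniform_finiteness_aux[OF finite_Basis order_refl])
  show "dpred (%z. \<exists>y. A (fst z) y \<and> snd z = y \<bullet> i)" by (intro dintros A')
  have "{t. \<exists>y. A u y \<and> t = y \<bullet> i} = (%y. y \<bullet> i) ` {y. A u y}" for u by auto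
  thus "finite {t. \<exists>y. A u y \<and> t = y \<bullet> i}" for u using fin by simp
 qed auto
 then obtain N where N: "!!i u. card {t. \<exists>y. A u y \<and> t = y \<bullet> i} <= N i" by metis
 have "card {y. A u y} <= (\<Prod>i\<in>Basis. N i)" for u
 proof -
  let ?F = "%i. {t. \<exists>y. A u y \<and> t = y \<bullet> i}"
  have F: "finite (?F i)" for i
  proof -
   have "?F i = (%y. y \<bullet> i) ` {y. A u y}" by auto
   thus ?thesis using fin by simp
  qed
  have "card {y. A u y} <= card (PiE Basis ?F)"
  proof (rule card_inj_on_le[where f = "%y. restrict (%i. y \<bullet> i) Basis"])
   show "inj_on (%y. restrict (%i. y \<bullet> i) Basis) {y. A u y}"
   proof (rule inj_onI, rule euclidean_eqI)
    fix x y i :: 'b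
    assume "restrict (%i. x \<bullet> i) Basis = restrict (%i. y \<bullet> i) Basis" "i \<in> Basis"
    thus "x \<bullet> i = y \<bullet> i" by (metis (no_types, lifting) restrict_apply')
   qed
   show "finite (PiE Basis ?F)" by (intro finite_PiE F finite_Basis)
  qed auto
  also have "... = (\<Prod>i\<in>Basis. card (?F i))" by (rule card_PiE[OF finite_Basis])
  also have "... <= (\<Prod>i\<in>Basis. N i)" by (intro prod_mono) (use N in auto)
  finally show ?thesis .
 qed
 thus ?thesis by blast
qed

end

subsection \<open>Hausdorff measure\<close>

notation hausdorff_outer ("\<H>")

definition haus_gauge :: "nat => 'a::euclidean_space set => ennreal" where
 "haus_gauge m C = (if C = {} then 0 else
   ennreal (pi powr (real m / 2) / Gamma (real m / 2 + 1) * (diameter C / 2) ^ m))"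

definition haus_cover :: "real => 'a::euclidean_space set => (nat => 'a set) => bool" where
 "haus_cover \<delta> A C \<longleftrightarrow> A \<subseteq> (\<Union>i. C i) \<and> (\<forall>i. bounded (C i) \<and> diameter (C i) <= \<delta>)"

definition haus_pre :: "nat => real => 'a::euclidean_space set => ennreal" where
 "haus_pre m \<delta> A = (INF C\<in>{C. haus_cover \<delta> A C}. \<Sum>i. haus_gauge m (C i))"

lemma hausdorff_outer_eq: "\<H> m A = (SUP \<delta>\<in>{0<..}. haus_pre m \<delta> A)"
 unfolding hausdorff_outer_def haus_pre_def haus_gauge_def haus_cover_def by simp

lemma haus_const_pos: "pi powr (real m / 2) / Gamma (real m / 2 + 1) > 0"
 by (intro divide_pos_pos Gamma_real_pos) (auto simp: add_nonneg_pos)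

lemma haus_gauge_empty [simp]: "haus_gauge m {} = 0"
 by (simp add: haus_gauge_def)

lemma haus_pre_le: "haus_cover \<delta> A C ==> haus_pre m \<delta> A <= (\<Sum>i. haus_gauge m (C i))"
 unfolding haus_pre_def by (rule INF_lower) simp

lemma haus_preI: "(!!C. haus_cover \<delta> A C ==> z <= (\<Sum>i. haus_gauge m (C i))) ==> z <= haus_pre m \<delta> A"
 unfolding haus_pre_def by (rule INF_greatest) simp

lemma haus_pre_antimono: "\<delta> <= \<delta>' ==> haus_pre m \<delta>' A <= haus_pre m \<delta> A"
 by (rule haus_preI, rule haus_pre_le) (auto simp: haus_cover_def intro: order_trans)

lemma haus_pre_mono: "A \<subseteq> B ==> haus_pre m \<delta> A <= haus_pre m \<delta> B"
 by (rule haus_preI, rule haus_pre_le) (auto simp: haus_cover_def)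

lemma haus_pre_le_outer: "\<delta> > 0 ==> haus_pre m \<delta> A <= \<H> m A"
 unfolding hausdorff_outer_eq by (rule SUP_upper) simp

lemma hausdorff_outer_leI: "(!!\<delta>. \<delta> > 0 ==> haus_pre m \<delta> A <= z) ==> \<H> m A <= z"
 unfolding hausdorff_outer_eq by (rule SUP_least) simp

lemma hausdorff_outer_mono: "A \<subseteq> B ==> \<H> m A <= \<H> m B"
 by (meson haus_pre_le_outer haus_pre_mono hausdorff_outer_leI order_trans)

lemma hausdorff_outer_empty [simp]: "\<H> m ({} :: 'a::euclidean_space set) = 0"
proof -
 have "\<H> m ({} :: 'a set) <= 0"
 proof (rule hausdorff_outer_leI)
  fix \<delta> :: real assume "\<delta> > 0"
  hence "haus_cover \<delta> ({} :: 'a set) (%_. {})" by (simp add: haus_cover_def)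
  from haus_pre_le[OF this, of m] show "haus_pre m \<delta> ({} :: 'a set) <= 0" by simp
 qed
 thus ?thesis by simp
qed

lemma hausdorff_outer_subadditive:
 fixes A :: "nat => 'a::euclidean_space set"
 shows "\<H> m (\<Union>i. A i) <= (\<Sum>i. \<H> m (A i))"
proof (rule hausdorff_outer_leI)
 fix \<delta> :: real assume \<delta>: "\<delta> > 0"
 show "haus_pre m \<delta> (\<Union>i. A i) <= (\<Sum>i. \<H> m (A i))"
 proof (cases "\<exists>i. \<H> m (A i) = \<infinity>")
  case True
  then obtain i where "\<H> m (A i) = \<infinity>" by blast
  hence "(\<Sum>i. \<H> m (A i)) = \<infinity>"
   using sum_le_suminf[of "%i. \<H> m (A i)" "{i}"] by (simp add: top_unique)
  thus ?thesis by simp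
 next
  case False
  show ?thesis
  proof (rule ennreal_le_epsilon)
   fix e :: real assume e: "e > 0"
   have "\<exists>C. haus_cover \<delta> (A i) C \<and> (\<Sum>j. haus_gauge m (C j)) <= \<H> m (A i) + ennreal (e * (1/2) ^ Suc i)" for i
   proof (rule ccontr)
    assume no: "\<not> ?thesis"
    hence "\<H> m (A i) + ennreal (e * (1/2) ^ Suc i) <= haus_pre m \<delta> (A i)"
     by (intro haus_preI) (meson less_imp_le not_le)
    also have "... <= \<H> m (A i)" by (rule haus_pre_le_outer[OF \<delta>])
    finally have "\<H> m (A i) + ennreal (e * (1/2) ^ Suc i) <= \<H> m (A i) + 0" by simp
    hence "ennreal (e * (1/2) ^ Suc i) <= 0" using False by (simp only: ennreal_add_left_cancel_le) simp
    thus False using e by simp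
   qed
   then obtain C where C: "!!i. haus_cover \<delta> (A i) (C i)"
    "!!i. (\<Sum>j. haus_gauge m (C i j)) <= \<H> m (A i) + ennreal (e * (1/2) ^ Suc i)" by metis
   define C' where "C' k = (case prod_decode k of (i, j) => C i j)" for k
   have "haus_cover \<delta> (\<Union>i. A i) C'"
    unfolding haus_cover_def
   proof (intro conjI allI subsetI)
    fix x assume "x \<in> (\<Union>i. A i)"
    then obtain i j where "x \<in> C i j" using C(1) unfolding haus_cover_def by blast
    hence "x \<in> C' (prod_encode (i, j))" by (simp add: C'_def)
    thus "x \<in> (\<Union>i. C' i)" by blast
   qed (use C(1) in \<open>auto simp: C'_def haus_cover_def split: prod.split\<close>)
   hence "haus_pre m \<delta> (\<Union>i. A i) <= (\<Sum>k. haus_gauge m (C' k))" by (rule haus_pre_le)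
   also have "... = (\<Sum>i. \<Sum>j. haus_gauge m (C i j))"
    using suminf_ennreal_2dimen[of "%i. \<Sum>j. haus_gauge m (C i j)" "%(i, j). haus_gauge m (C i j)"]
    by (simp add: C'_def o_def case_prod_unfold)
   also have "... <= (\<Sum>i. \<H> m (A i) + ennreal (e * (1/2) ^ Suc i))"
    by (intro suminf_le C(2)) auto
   also have "... = (\<Sum>i. \<H> m (A i)) + (\<Sum>i. ennreal (e * (1/2) ^ Suc i))"
    by (rule suminf_add[symmetric]) auto
   also have "(\<Sum>i. ennreal (e * (1/2) ^ Suc i)) = ennreal e"
    using e sums_mult[OF power_half_series, of e] by (intro suminf_ennreal_eq) auto
   finally show "haus_pre m \<delta> (\<Union>i. A i) <= (\<Sum>i. \<H> m (A i)) + ennreal e" .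
  qed
 qed
qed

lemma hausdorff_outer_Un_le:
 fixes A B :: "'a::euclidean_space set"
 shows "\<H> m (A \<union> B) <= \<H> m A + \<H> m B"
proof -
 have "\<H> m (\<Union>i::nat. if i = 0 then A else if i = 1 then B else {})
   <= (\<Sum>i. \<H> m (if i = 0 then A else if i = 1 then B else {}))"
  by (rule hausdorff_outer_subadditive)
 also have "(\<Union>i::nat. if i = 0 then A else if i = 1 then B else {}) = A \<union> B" by (auto split: if_splits)
 also have "(\<Sum>i. \<H> m (if i = 0 then A else if i = 1 then B else {})) =
   (\<Sum>i\<in>{0, 1::nat}. \<H> m (if i = 0 then A else if i = 1 then B else {}))"
  by (rule suminf_finite) auto
 finally show ?thesis by simp
qed

text \<open>A cover of mesh below \<open>e\<close> has no member meeting both sets, so it splits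
  into a cover of each.\<close>

lemma hausdorff_outer_separated:
 fixes A B :: "'a::euclidean_space set"
 assumes e: "e > 0" "!!x y. x \<in> A ==> y \<in> B ==> e <= dist x y"
 shows "\<H> m A + \<H> m B <= \<H> m (A \<union> B)"
proof -
 have pre: "haus_pre m \<delta> A + haus_pre m \<delta> B <= haus_pre m \<delta> (A \<union> B)" if "\<delta> < e" for \<delta>
 proof (rule haus_preI)
  fix C assume C: "haus_cover \<delta> (A \<union> B) C"
  let ?CA = "%i. if C i \<inter> A = {} then {} else C i" and ?CB = "%i. if C i \<inter> B = {} then {} else C i"
  have d0: "\<delta> \<ge> 0" using C diameter_ge_0 unfolding haus_cover_def by (meson order_trans)
  have "haus_cover \<delta> A ?CA" "haus_cover \<delta> B ?CB" using C d0 unfolding haus_cover_def by (fastforce split: if_splits)+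
  hence "haus_pre m \<delta> A + haus_pre m \<delta> B <= (\<Sum>i. haus_gauge m (?CA i)) + (\<Sum>i. haus_gauge m (?CB i))"
   by (intro add_mono haus_pre_le)
  also have "... = (\<Sum>i. haus_gauge m (?CA i) + haus_gauge m (?CB i))" by (rule suminf_add) auto
  also have "... <= (\<Sum>i. haus_gauge m (C i))"
  proof (intro suminf_le)
   fix i
   have "C i \<inter> A = {} \<or> C i \<inter> B = {}"
   proof (rule ccontr)
    assume "\<not> ?thesis"
    then obtain x y where xy: "x \<in> C i" "x \<in> A" "y \<in> C i" "y \<in> B" by blast
    hence "dist x y <= diameter (C i)" using C by (intro diameter_bounded_bound) (auto simp: haus_cover_def)
    also have "... <= \<delta>" using C by (auto simp: haus_cover_def)
    finally show False using e(2)[of x y] xy that by linarith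
   qed
   thus "haus_gauge m (?CA i) + haus_gauge m (?CB i) <= haus_gauge m (C i)" by auto
  qed auto
  finally show "haus_pre m \<delta> A + haus_pre m \<delta> B <= (\<Sum>i. haus_gauge m (C i))" .
 qed
 have le: "haus_pre m \<delta>1 A + haus_pre m \<delta>2 B <= \<H> m (A \<union> B)" if "\<delta>1 > 0" "\<delta>2 > 0" for \<delta>1 \<delta>2
 proof -
  let ?\<delta> = "min (min \<delta>1 \<delta>2) (e / 2)"
  have "haus_pre m \<delta>1 A + haus_pre m \<delta>2 B <= haus_pre m ?\<delta> A + haus_pre m ?\<delta> B"
   by (intro add_mono haus_pre_antimono) auto
  also have "... <= haus_pre m ?\<delta> (A \<union> B)" using e by (intro pre) auto
  also have "... <= \<H> m (A \<union> B)" using e that by (intro haus_pre_le_outer) auto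
  finally show ?thesis .
 qed
 have "\<H> m A + \<H> m B = (SUP \<delta>1\<in>{0<..}. haus_pre m \<delta>1 A + \<H> m B)"
  unfolding hausdorff_outer_eq[of m A] by (rule ennreal_SUP_add_left[symmetric]) auto
 also have "... <= \<H> m (A \<union> B)"
 proof (rule SUP_least)
  fix \<delta>1 :: real assume "\<delta>1 \<in> {0<..}"
  have "haus_pre m \<delta>1 A + \<H> m B = (SUP \<delta>2\<in>{0<..}. haus_pre m \<delta>1 A + haus_pre m \<delta>2 B)"
   unfolding hausdorff_outer_eq[of m B] by (simp add: add.commute[of "haus_pre m \<delta>1 A"] ennreal_SUP_add_left)
  also have "... <= \<H> m (A \<union> B)" by (rule SUP_least) (use \<open>\<delta>1 \<in> {0<..}\<close> le in auto)
  finally show "haus_pre m \<delta>1 A + \<H> m B <= \<H> m (A \<union> B)" .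
 qed
 finally show ?thesis .
qed

text \<open>Caratheodory's criterion for metric outer measures. \<open>A k\<close> keeps distance
  \<open>r k\<close> from \<open>F\<close>, so the measures of \<open>X \<inter> F\<close> and
  \<open>A k\<close> add up. What is missing from \<open>X - F\<close> lies in the shells
  \<open>D j\<close> with \<open>j \<ge> k\<close>; shells of equal parity are separated, so the sum
  over all shells is at most twice the measure of \<open>X\<close> and its tails vanish.\<close>

lemma hausdorff_outer_closed_split:
 fixes F X :: "'a::euclidean_space set"
 assumes F: "closed F"
 shows "\<H> m (X \<inter> F) + \<H> m (X - F) <= \<H> m X"
proof (cases "F = {} \<or> \<H> m X = \<infinity>")
 case True thus ?thesis by auto
next
 case False
 hence Fne: "F ~= {}" and fin: "\<H> m X ~= \<infinity>" by auto
 let ?H = "\<H> m"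
 define r where "r j = 1 / real (Suc j)" for j
 have r: "r j > 0" "i < j ==> r j < r i" "i <= j ==> r j <= r i" for i j
  by (auto simp: r_def field_simps)
 define A where "A k = {x\<in>X. r k <= infdist x F}" for k
 define D where "D j = {x\<in>X. r (Suc j) <= infdist x F \<and> infdist x F < r j}" for j
 have infdist_dist: "infdist x F <= infdist y F + dist x y" for x y by (rule infdist_triangle)
 \<comment> \<open>\<open>p\<close> is later 0 or 1 and selects the shells of one parity; the shell
   in between separates two of them.\<close>
 have part: "(\<Sum>i<n. ?H (D (2 * i + p))) <= ?H (\<Union>i<n. D (2 * i + p))" for n p
 proof (induction n)
  case (Suc n)
  have "(\<Sum>i<Suc n. ?H (D (2 * i + p))) <= ?H (\<Union>i<n. D (2 * i + p)) + ?H (D (2 * n + p))"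
   using Suc by (simp add: add_right_mono)
  also have "... <= ?H ((\<Union>i<n. D (2 * i + p)) \<union> D (2 * n + p))"
  proof (cases n)
   case 0 thus ?thesis by simp
  next
   case (Suc n')
   show ?thesis
   proof (rule hausdorff_outer_separated)
    show "0 < r (Suc (2 * n' + p)) - r (2 * n + p)" using r(2)[of "Suc (2 * n' + p)" "2 * n + p"] Suc by simp
    fix x y assume "x \<in> (\<Union>i<n. D (2 * i + p))" "y \<in> D (2 * n + p)"
    then obtain i where i: "i < n" "r (Suc (2 * i + p)) <= infdist x F" "infdist y F < r (2 * n + p)" by (auto simp: D_def)
    moreover have "r (Suc (2 * n' + p)) <= r (Suc (2 * i + p))" using i Suc by (intro r(3)) auto
    ultimately show "r (Suc (2 * n' + p)) - r (2 * n + p) <= dist x y" using infdist_dist[of x y] by linarith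
   qed
  qed
  also have "(\<Union>i<n. D (2 * i + p)) \<union> D (2 * n + p) = (\<Union>i<Suc n. D (2 * i + p))" by (auto simp: less_Suc_eq)
  finally show ?case .
 qed simp
 have par: "(\<Sum>i. ?H (D (2 * i + p))) <= ?H X" for p
 proof (rule suminf_le_const)
  fix n show "(\<Sum>i<n. ?H (D (2 * i + p))) <= ?H X"
   by (rule order_trans[OF part]) (rule hausdorff_outer_mono, auto simp: D_def)
 qed auto
 have tot: "(\<Sum>j. ?H (D j)) ~= \<infinity>"
 proof -
  have "(\<Sum>j<n. ?H (D j)) <= ?H X + ?H X" for n
  proof -
   have "(\<Sum>j<n. ?H (D j)) <= (\<Sum>j<2*n. ?H (D j))" by (rule sum_mono2) auto
   also have "... = (\<Sum>i<n. ?H (D (2 * i + 0))) + (\<Sum>i<n. ?H (D (2 * i + 1)))"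
    by (induction n) (auto simp: algebra_simps)
   also have "... <= ?H X + ?H X"
    by (intro add_mono order_trans[OF sum_le_suminf par]) auto
   finally show ?thesis .
  qed
  hence "(\<Sum>j. ?H (D j)) <= ?H X + ?H X" by (intro suminf_le_const) auto
  thus ?thesis using fin by (auto simp: top_unique)
 qed
 have main: "?H (X \<inter> F) + ?H (X - F) <= ?H X + (\<Sum>j. ?H (D (j + k)))" for k
 proof -
  have sub: "X - F \<subseteq> A k \<union> (\<Union>j. D (j + k))"
  proof
   fix x assume x: "x \<in> X - F"
   have "infdist x F > 0" using x F Fne by (simp add: infdist_pos_not_in_closed)
   then obtain n where n: "r n < infdist x F" using nat_approx_posE[of "infdist x F"] by (auto simp: r_def)
   define N where "N = (LEAST n. r n <= infdist x F)"
   have N: "r N <= infdist x F" unfolding N_def by (rule LeastI[of _ n]) (use n in auto)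
   show "x \<in> A k \<union> (\<Union>j. D (j + k))"
   proof (cases "N <= k")
    case True thus ?thesis using N r(3)[OF True] x by (auto simp: A_def)
   next
    case False
    then obtain j where j: "N = Suc (j + k)" by (metis add.commute less_imp_Suc_add not_le)
    have "\<not> r (j + k) <= infdist x F" using not_less_Least[of "j + k" "%n. r n <= infdist x F"] j N_def by auto
    hence "x \<in> D (j + k)" using N x j by (auto simp: D_def)
    thus ?thesis by blast
   qed
  qed
  have "?H (X - F) <= ?H (A k) + (\<Sum>j. ?H (D (j + k)))"
   by (rule order_trans[OF hausdorff_outer_mono[OF sub]], rule order_trans[OF hausdorff_outer_Un_le],
     rule add_left_mono, rule hausdorff_outer_subadditive)
  hence "?H (X \<inter> F) + ?H (X - F) <= ?H (X \<inter> F) + ?H (A k) + (\<Sum>j. ?H (D (j + k)))"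
   by (simp add: add.assoc add_left_mono)
  also have "?H (X \<inter> F) + ?H (A k) <= ?H ((X \<inter> F) \<union> A k)"
  proof (rule hausdorff_outer_separated[OF r(1)[of k]])
   fix x y assume "x \<in> X \<inter> F" "y \<in> A k"
   thus "r k <= dist x y" using infdist_dist[of y x] by (auto simp: A_def dist_commute)
  qed
  also have "... <= ?H X" by (rule hausdorff_outer_mono) (auto simp: A_def)
  finally show ?thesis by (simp add: add_right_mono)
 qed
 show ?thesis
 proof (rule ennreal_le_epsilon)
  fix e :: real assume e: "e > 0"
  have "\<exists>k. (\<Sum>j. ?H (D (j + k))) <= ennreal e"
  proof (rule ccontr)
   assume "\<not> ?thesis"
   hence big: "ennreal e <= (\<Sum>j. ?H (D (j + k)))" for k by (meson less_imp_le not_le)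
   have split: "(\<Sum>j. ?H (D j)) = (\<Sum>j. ?H (D (j + k))) + (\<Sum>j<k. ?H (D j))" for k
    by (rule suminf_offset) auto
   have "(\<Sum>j<k. ?H (D j)) + ennreal e <= (\<Sum>j. ?H (D j))" for k
    using big[of k] unfolding split[of k] by (simp add: add.commute add_left_mono)
   hence "(SUP k. (\<Sum>j<k. ?H (D j)) + ennreal e) <= (\<Sum>j. ?H (D j))" by (intro SUP_least)
   hence "(\<Sum>j. ?H (D j)) + ennreal e <= (\<Sum>j. ?H (D j)) + 0"
    by (simp add: ennreal_SUP_add_left suminf_eq_SUP)
   hence "ennreal e <= 0" using tot by (simp only: ennreal_add_left_cancel_le) simp
   thus False using e by simp
  qed
  then obtain k where "(\<Sum>j. ?H (D (j + k))) <= ennreal e" by blast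
  thus "?H (X \<inter> F) + ?H (X - F) <= ?H X + ennreal e"
   using main[of k] add_left_mono order_trans by blast
 qed
qed

lemma sets_hausdorff_measure [simp, measurable_cong]: "sets (hausdorff_measure m) = sets borel"
 and space_hausdorff_measure [simp]: "space (hausdorff_measure m) = UNIV"
 unfolding hausdorff_measure_def using sets.space_closed[of borel] sets.sigma_sets_eq[of borel]
 by (auto simp: sets_measure_of space_measure_of)

text \<open>A measure built by \<open>measure_of\<close> has the intended values once these are
  known to be countably additive. Closed sets satisfy Caratheodory's condition by the preceding
  split, hence so do all Borel sets.\<close>

lemma emeasure_hausdorff_measure:
 fixes A :: "'a::euclidean_space set"
 assumes "A \<in> sets borel"
 shows "emeasure (hausdorff_measure m) A = \<H> m A"
proof -
 let ?H = "\<H> m :: 'a set => ennreal"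
 let ?L = "lambda_system UNIV (Pow UNIV) ?H"
 interpret P: sigma_algebra UNIV "Pow (UNIV :: 'a set)" by (rule sigma_algebra_Pow)
 have oms: "outer_measure_space (Pow UNIV) ?H"
  unfolding outer_measure_space_def positive_def increasing_def countably_subadditive_def
  using hausdorff_outer_mono hausdorff_outer_subadditive by auto
 hence L: "measure_space UNIV ?L ?H" by (rule P.caratheodory_lemma)
 hence sL: "sigma_algebra UNIV ?L" by (simp add: measure_space_def)
 have "F \<in> ?L" if "closed F" for F
  unfolding lambda_system_def
 proof (safe; simp)
  fix X
  have "?H X <= ?H (F \<inter> X) + ?H ((UNIV - F) \<inter> X)"
   by (rule order_trans[OF _ hausdorff_outer_Un_le]) (rule hausdorff_outer_mono, auto)
  moreover have "?H (F \<inter> X) + ?H ((UNIV - F) \<inter> X) <= ?H X"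
   using hausdorff_outer_closed_split[OF that, of m X] by (simp add: Int_commute Diff_eq)
  ultimately show "?H (F \<inter> X) + ?H ((UNIV - F) \<inter> X) = ?H X" by (rule antisym[rotated])
 qed
 hence "sigma_sets UNIV (Collect closed) \<subseteq> ?L"
  by (intro sigma_algebra.sigma_sets_subset[OF sL]) auto
 hence sub: "sets borel \<subseteq> ?L" by (simp add: borel_eq_closed sets_measure_of)
 have "measure_space UNIV (sets borel) ?H"
  using measure_down[OF L _ sub] sets.sigma_algebra_axioms[of borel] by simp
 hence "positive (sets borel) ?H" "countably_additive (sets borel) ?H" by (auto simp: measure_space_def)
 thus ?thesis
  unfolding hausdorff_measure_def
  by (intro emeasure_measure_of_sigma) (use assms sets.sigma_algebra_axioms[of borel] in auto)
qed

section \<open>Lipschitz images and finiteness on hyperplanes\<close>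

lemma ennreal_pos_divide_le_iff:
 assumes "c > 0" shows "a / ennreal c <= b \<longleftrightarrow> a <= ennreal c * b"
proof -
 have "a = (a / ennreal c) * ennreal c"
  using assms by (simp add: ennreal_divide_times ennreal_divide_self)
 moreover have "ennreal c * b / ennreal c = b"
  using assms by (subst mult.commute) (rule ennreal_mult_divide_eq, auto)
 ultimately show ?thesis
  by (metis divide_right_mono_ennreal mult.commute mult_right_mono zero_le)
qed

text \<open>A cover of mesh \<open>\<delta> / K\<close> is pushed forward to one of mesh
  \<open>\<delta>\<close>, each gauge growing by at most \<open>K ^ m\<close>. The members are cut
  with \<open>A\<close> first, since \<open>g\<close> is controlled only there.\<close>

lemma hausdorff_outer_lipschitz:
 fixes g :: "'a::euclidean_space => 'b::euclidean_space"
 assumes K: "K > 0" and lip: "!!x y. x \<in> A ==> y \<in> A ==> dist (g x) (g y) <= K * dist x y"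
 shows "\<H> m (g ` A) <= ennreal (K ^ m) * \<H> m A"
proof (rule hausdorff_outer_leI)
 fix \<delta> :: real assume \<delta>: "\<delta> > 0"
 have "haus_pre m \<delta> (g ` A) <= ennreal (K ^ m) * haus_pre m (\<delta> / K) A"
 proof -
  have "haus_pre m \<delta> (g ` A) <= ennreal (K ^ m) * (\<Sum>i. haus_gauge m (C i))" if C: "haus_cover (\<delta> / K) A C" for C
  proof -
   let ?C = "%i. g ` (C i \<inter> A)"
   have b: "bounded (C i)" "diameter (C i) <= \<delta> / K" for i using C by (auto simp: haus_cover_def)
   have gd: "dist (g x) (g y) <= K * diameter (C i)" if "x \<in> C i \<inter> A" "y \<in> C i \<inter> A" for x y i
    using lip[of x y] diameter_bounded_bound[OF b(1), of x i y] that K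
    by (auto intro: order_trans mult_left_mono)
   have bd: "bounded (?C i)" for i
   proof (cases "C i \<inter> A = {}")
    case False
    then obtain x where "x \<in> C i \<inter> A" by blast
    thus ?thesis unfolding bounded_def using gd by (intro exI[of _ "g x"] exI[of _ "K * diameter (C i)"]) auto
   qed simp
   have dm: "diameter (?C i) <= K * diameter (C i)" if "C i \<inter> A ~= {}" for i
    using that gd by (intro diameter_le) (auto simp: dist_norm)
   have "haus_cover \<delta> (g ` A) ?C"
    unfolding haus_cover_def
   proof (intro conjI allI bd)
    show "g ` A \<subseteq> (\<Union>i. ?C i)" using C unfolding haus_cover_def by blast
    fix i show "diameter (?C i) <= \<delta>"
    proof (cases "C i \<inter> A = {}")
     case True thus ?thesis using \<delta> by simp
    next
     case False
     have "K * diameter (C i) <= K * (\<delta> / K)" using b(2) K by (intro mult_left_mono) auto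
     thus ?thesis using dm[OF False] K by simp
    qed
   qed
   hence "haus_pre m \<delta> (g ` A) <= (\<Sum>i. haus_gauge m (?C i))" by (rule haus_pre_le)
   also have "... <= (\<Sum>i. ennreal (K ^ m) * haus_gauge m (C i))"
   proof (intro suminf_le)
    fix i show "haus_gauge m (?C i) <= ennreal (K ^ m) * haus_gauge m (C i)"
    proof (cases "C i \<inter> A = {}")
     case False
     let ?k = "pi powr (real m / 2) / Gamma (real m / 2 + 1)"
     have "?k * (diameter (?C i) / 2) ^ m <= ?k * ((K * diameter (C i)) / 2) ^ m"
      using dm[OF False] diameter_ge_0[OF bd[of i]] haus_const_pos[of m]
      by (intro mult_left_mono power_mono divide_right_mono) auto
     also have "... = K ^ m * (?k * (diameter (C i) / 2) ^ m)"
      by (simp add: power_mult_distrib power_divide)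
     finally have "ennreal (?k * (diameter (?C i) / 2) ^ m) <= ennreal (K ^ m * (?k * (diameter (C i) / 2) ^ m))"
      by (rule ennreal_leI)
     moreover have "C i ~= {}" using False by blast
     ultimately show ?thesis
      using False K haus_const_pos[of m] diameter_ge_0[OF b(1)[of i]]
      by (simp add: haus_gauge_def ennreal_mult del: times_divide_eq_left)
    qed simp
   qed auto
   also have "... = ennreal (K ^ m) * (\<Sum>i. haus_gauge m (C i))" by simp
   finally show ?thesis .
  qed
  note * = this
  have Km: "K ^ m > 0" using K by simp
  have "haus_pre m \<delta> (g ` A) / ennreal (K ^ m) <= haus_pre m (\<delta> / K) A"
   by (rule haus_preI) (use * ennreal_pos_divide_le_iff[OF Km] in blast)
  thus ?thesis using ennreal_pos_divide_le_iff[OF Km] by blast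
 qed
 also have "... <= ennreal (K ^ m) * \<H> m A"
  using \<delta> K by (intro mult_left_mono haus_pre_le_outer) auto
 finally show "haus_pre m \<delta> (g ` A) <= ennreal (K ^ m) * \<H> m A" .
qed

lemma hausdorff_outer_isometry:
 fixes g :: "'a::euclidean_space => 'b::euclidean_space"
 assumes "!!x y. x \<in> A ==> y \<in> A ==> dist (g x) (g y) = dist x y"
 shows "\<H> m (g ` A) = \<H> m A"
proof (rule antisym)
 show "\<H> m (g ` A) <= \<H> m A"
  using hausdorff_outer_lipschitz[of 1 A g m] assms by simp
 have inj: "inj_on g A" using assms by (metis dist_eq_0_iff inj_onI)
 have "\<H> m (inv_into A g ` g ` A) <= ennreal (1 ^ m) * \<H> m (g ` A)"
  by (rule hausdorff_outer_lipschitz) (use assms inj in auto)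
 thus "\<H> m A <= \<H> m (g ` A)" using inj by simp
qed

lemma haus_pre_finite_cover:
 fixes C :: "'i => 'a::euclidean_space set"
 assumes I: "finite I" and "A \<subseteq> (\<Union>i\<in>I. C i)" "!!i. i \<in> I ==> bounded (C i)" "!!i. i \<in> I ==> diameter (C i) <= \<delta>"
  and "!!i. i \<in> I ==> haus_gauge m (C i) <= z" "\<delta> \<ge> 0"
 shows "haus_pre m \<delta> A <= of_nat (card I) * z"
proof -
 obtain h where h: "bij_betw h {0..<card I} I" using ex_bij_betw_nat_finite[OF I] by blast
 define C' where "C' k = (if k < card I then C (h k) else {})" for k
 have hI: "h k \<in> I" if "k < card I" for k using bij_betwE[OF h] that by simp
 have "haus_cover \<delta> A C'"
  unfolding haus_cover_def
 proof (intro conjI allI subsetI)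
  fix x assume "x \<in> A"
  then obtain i where i: "i \<in> I" "x \<in> C i" using assms(2) by blast
  then obtain k where "k < card I" "h k = i" using h unfolding bij_betw_def by (metis atLeastLessThan_iff imageE)
  hence "x \<in> C' k" using i by (simp add: C'_def)
  thus "x \<in> (\<Union>k. C' k)" by blast
 qed (use assms hI in \<open>auto simp: C'_def\<close>)
 hence "haus_pre m \<delta> A <= (\<Sum>k. haus_gauge m (C' k))" by (rule haus_pre_le)
 also have "... = (\<Sum>k<card I. haus_gauge m (C' k))" by (rule suminf_finite) (auto simp: C'_def)
 also have "... <= of_nat (card {..<card I}) * z"
  by (rule sum_bounded_above) (use assms hI in \<open>auto simp: C'_def\<close>)
 finally show ?thesis by simp
qed

text \<open>A grid with cells of side 2 r / N has at most (N + 1)^(n-1) cells in the hyperplane,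
  while their gauges are bounded by a multiple of N^-(n-1); the product stays bounded as N grows.
  The index N itself occurs, on the far faces, hence N + 1.\<close>

lemma hausdorff_outer_hyperplane_finite:
 fixes i0 :: "'n::finite" and r :: real
 assumes r: "r > 0"
 shows "\<H> (CARD('n) - 1) {x :: real^'n. x $ i0 = 0 \<and> (\<forall>i. \<bar>x $ i\<bar> <= r)} < \<infinity>"
proof -
 let ?A = "{x :: real^'n. x $ i0 = 0 \<and> (\<forall>i. \<bar>x $ i\<bar> <= r)}" and ?m = "CARD('n) - 1" and ?n = "real CARD('n)"
 define kk where "kk = pi powr (real ?m / 2) / Gamma (real ?m / 2 + 1)"
 have kp: "kk > 0" unfolding kk_def by (rule haus_const_pos)
 have "\<H> ?m ?A <= ennreal (kk * (2 * ?n * r) ^ ?m)"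
 proof (rule hausdorff_outer_leI)
  fix \<delta> :: real assume \<delta>: "\<delta> > 0"
  obtain N :: nat where N: "N > 2 * ?n * r / \<delta>" using reals_Archimedean2 by blast
  have N0: "N > 0" using N \<delta> r by (smt (verit) divide_nonneg_pos mult_nonneg_nonneg of_nat_0_le_iff of_nat_0_less_iff)
  define I where "I = PiE (UNIV - {i0}) (%_. {..N})"
  define C where "C k = {x\<in>?A. \<forall>i. i ~= i0 --> real (k i) <= (x $ i + r) * N / (2 * r) \<and> (x $ i + r) * N / (2 * r) <= real (k i) + 1}" for k
  have diam: "dist x y <= 2 * (?n * r / N)" if "x \<in> C k" "y \<in> C k" for x y k
  proof -
   have "\<bar>(x - y) $ i\<bar> <= 2 * r / N" for i
   proof (cases "i = i0")
    case True thus ?thesis using that r by (simp add: C_def)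
   next
    case False
    hence "real (k i) <= (x $ i + r) * N / (2 * r)" "(x $ i + r) * N / (2 * r) <= real (k i) + 1"
     "real (k i) <= (y $ i + r) * N / (2 * r)" "(y $ i + r) * N / (2 * r) <= real (k i) + 1"
     using that by (auto simp: C_def)
    hence "\<bar>(x $ i + r) * N / (2 * r) - (y $ i + r) * N / (2 * r)\<bar> <= 1" by linarith
    moreover have "(x $ i + r) * N / (2 * r) - (y $ i + r) * N / (2 * r) = ((x - y) $ i) * (N / (2 * r))"
     by (simp add: diff_divide_distrib[symmetric] algebra_simps)
    ultimately have "\<bar>(x - y) $ i\<bar> * (N / (2 * r)) <= 1" using r by (simp add: abs_mult)
    thus ?thesis using r N0 by (simp add: field_simps)
   qed
   hence "(\<Sum>i\<in>UNIV. \<bar>(x - y) $ i\<bar>) <= (\<Sum>i\<in>(UNIV::'n set). 2 * r / N)" by (intro sum_mono)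
   also have "... = 2 * (?n * r / N)" by simp
   finally show ?thesis using norm_le_l1_cart[of "x - y"] unfolding dist_norm by linarith
  qed
  have bd: "bounded (C k)" for k
  proof (rule bounded_subset)
   show "C k \<subseteq> cbox (\<chi> i. - r) (\<chi> i. r)" by (auto simp: C_def mem_box_cart abs_le_iff minus_le_iff)
  qed simp
  have dC: "diameter (C k) <= 2 * (?n * r / N)" for k
   using diam r by (intro diameter_le) (auto simp: dist_norm)
  have "haus_pre ?m \<delta> ?A <= of_nat (card I) * ennreal (kk * (?n * r / N) ^ ?m)"
  proof (rule haus_pre_finite_cover)
   show "finite I" unfolding I_def by (intro finite_PiE) auto
   show "?A \<subseteq> (\<Union>k\<in>I. C k)"
   proof
    fix x assume x: "x \<in> ?A"
    define k where "k = restrict (%i. nat \<lfloor>(x $ i + r) * N / (2 * r)\<rfloor>) (UNIV - {i0})"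
    have pos: "0 <= (x $ i + r) * N / (2 * r)" for i
    proof -
     have "\<bar>x $ i\<bar> <= r" using x by simp
     hence "0 <= x $ i + r" by linarith
     thus ?thesis using r by simp
    qed
    have le: "(x $ i + r) * N / (2 * r) <= N" for i
    proof -
     have "\<bar>x $ i\<bar> <= r" using x by simp
     hence "x $ i + r <= 2 * r" by linarith
     hence "(x $ i + r) * N <= 2 * r * N" by (intro mult_right_mono) auto
     thus ?thesis using r by (simp add: field_simps)
    qed
    have "k \<in> I" unfolding I_def k_def
    proof (rule restrict_PiE_iff[THEN iffD2], rule ballI)
     fix i
     have "\<lfloor>(x $ i + r) * N / (2 * r)\<rfloor> <= int N" using le[of i] by linarith
     thus "nat \<lfloor>(x $ i + r) * N / (2 * r)\<rfloor> \<in> {..N}" by simp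
    qed
    moreover have "x \<in> C k" unfolding C_def
    proof (intro CollectI conjI allI impI)
     fix i assume i: "i ~= i0"
     hence "real (k i) = of_int \<lfloor>(x $ i + r) * N / (2 * r)\<rfloor>" using pos[of i] by (simp add: k_def)
     thus "real (k i) <= (x $ i + r) * N / (2 * r)" "(x $ i + r) * N / (2 * r) <= real (k i) + 1" by linarith+
    qed (use x in auto)
    ultimately show "x \<in> (\<Union>k\<in>I. C k)" by blast
   qed
   show "diameter (C k) <= \<delta>" for k
   proof -
    have "2 * (?n * r / N) <= \<delta>" using N \<delta> N0 by (simp add: field_simps)
    thus ?thesis using dC[of k] by linarith
   qed
   show "haus_gauge ?m (C k) <= ennreal (kk * (?n * r / N) ^ ?m)" for k
   proof (cases "C k = {}")
    case False
    have "diameter (C k) / 2 <= ?n * r / N" using dC[of k] by linarith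
    hence "kk * (diameter (C k) / 2) ^ ?m <= kk * (?n * r / N) ^ ?m"
     using diameter_ge_0[OF bd[of k]] less_imp_le[OF kp]
     by (intro mult_left_mono power_mono) (simp_all only: divide_nonneg_pos zero_less_numeral)
    thus ?thesis using False unfolding haus_gauge_def kk_def[symmetric] by (simp add: ennreal_leI)
   qed simp
  qed (use bd \<delta> in auto)
  also have "card I = Suc N ^ ?m" unfolding I_def by (simp add: card_PiE)
  also have "of_nat (Suc N ^ ?m) * ennreal (kk * (?n * r / N) ^ ?m) = ennreal (real (Suc N ^ ?m) * (kk * (?n * r / N) ^ ?m))"
   using kp r by (subst ennreal_mult) (auto simp: ennreal_of_nat_eq_real_of_nat simp del: of_nat_power)
  also have "... <= ennreal (kk * (2 * ?n * r) ^ ?m)"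
  proof (rule ennreal_leI)
   have "real (Suc N ^ ?m) * (?n * r / N) ^ ?m = (real (Suc N) * (?n * r / N)) ^ ?m" by (simp only: power_mult_distrib of_nat_power)
   also have "... <= (2 * ?n * r) ^ ?m"
   proof (rule power_mono)
    have "real (Suc N) <= 2 * N" using N0 by simp
    hence "real (Suc N) * (?n * r / N) <= (2 * N) * (?n * r / N)" using r by (intro mult_right_mono) auto
    thus "real (Suc N) * (?n * r / N) <= 2 * ?n * r" using N0 by simp
   qed (use r in auto)
   finally show "real (Suc N ^ ?m) * (kk * (?n * r / N) ^ ?m) <= kk * (2 * ?n * r) ^ ?m"
    using kp by (metis less_imp_le mult.left_commute mult_left_mono)
  qed
  finally show "haus_pre ?m \<delta> ?A <= ennreal (kk * (2 * ?n * r) ^ ?m)" .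
 qed
 also have "... < \<infinity>" by simp
 finally show ?thesis .
qed

section \<open>Hausdorff measure on a hyperplane as a multiple of Lebesgue measure\<close>

definition thicken :: "'n::finite => (real^'n) set => (real^'n) set" where
 "thicken i0 A = {y. y - (y $ i0) *\<^sub>R axis i0 1 \<in> A \<and> 0 <= y $ i0 \<and> y $ i0 <= 1}"

lemma thicken_borel:
 assumes "A \<in> sets borel" shows "thicken i0 A \<in> sets borel"
proof -
 have "(%y::real^'a. y - (y $ i0) *\<^sub>R axis i0 1) \<in> borel_measurable borel"
  by (intro borel_measurable_continuous_onI continuous_intros)
 from measurable_sets[OF this assms]
 have "(%y::real^'a. y - (y $ i0) *\<^sub>R axis i0 1) -` A \<in> sets borel" by simp
 moreover have "closed {y::real^'a. 0 <= y $ i0}" "closed {y::real^'a. y $ i0 <= 1}"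
  by (intro closed_Collect_le continuous_intros)+
 moreover have "thicken i0 A = (%y::real^'a. y - (y $ i0) *\<^sub>R axis i0 1) -` A \<inter> {y. 0 <= y $ i0} \<inter> {y. y $ i0 <= 1}"
  by (auto simp: thicken_def)
 ultimately show ?thesis by auto
qed

text \<open>A covering piece of diameter d is enclosed in a box of width 2 d and height 1, whose
  volume (2 d)^(n-1) is the gauge times 4^(n-1) / \<open>kk\<close>. The estimate shows that solid
  pieces of a hyperplane have positive Hausdorff measure.\<close>

lemma thicken_le_hausdorff:
 fixes i0 :: "'n::finite"
 assumes A: "A \<subseteq> {x. x $ i0 = 0}" "A \<in> sets borel"
 shows "\<exists>k>0. emeasure lborel (thicken i0 A) <= ennreal k * \<H> (CARD('n) - 1) A"
proof -
 let ?m = "CARD('n) - 1"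
 define kk where "kk = pi powr (real ?m / 2) / Gamma (real ?m / 2 + 1)"
 have kp: "kk > 0" unfolding kk_def by (rule haus_const_pos)
 have "emeasure lborel (thicken i0 A) <= ennreal (4 ^ ?m / kk) * haus_pre ?m 1 A"
 proof -
  have main: "emeasure lborel (thicken i0 A) <= ennreal (4 ^ ?m / kk) * (\<Sum>i. haus_gauge ?m (C i))"
   if C: "haus_cover 1 A C" for C
  proof -
   define a where "a i = (SOME x. x \<in> C i \<inter> A)" for i
   define B where "B i = (if C i \<inter> A = {} then {} else
    cbox (\<chi> j. if j = i0 then 0 else a i $ j - diameter (C i)) (\<chi> j. if j = i0 then 1 else a i $ j + diameter (C i)))" for i
   have ai: "a i \<in> C i \<inter> A" if "C i \<inter> A ~= {}" for i using that unfolding a_def by (metis all_not_in_conv someI_ex)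
   have bC: "bounded (C i)" for i using C by (simp add: haus_cover_def)
   have sub: "thicken i0 A \<subseteq> (\<Union>i. B i)"
   proof
    fix y assume y: "y \<in> thicken i0 A"
    define x where "x = y - (y $ i0) *\<^sub>R axis i0 1"
    have x: "x \<in> A" "0 <= y $ i0" "y $ i0 <= 1" using y by (auto simp: thicken_def x_def)
    then obtain i where i: "x \<in> C i" using C unfolding haus_cover_def by blast
    hence ne: "C i \<inter> A ~= {}" using x by blast
    have "dist (a i) x <= diameter (C i)" using ai[OF ne] i by (intro diameter_bounded_bound bC) auto
    hence "\<bar>(x - a i) $ j\<bar> <= diameter (C i)" for j
     using component_le_norm_cart[of "x - a i" j] by (simp add: dist_norm norm_minus_commute)
    hence "\<bar>y $ j - a i $ j\<bar> <= diameter (C i)" if "j ~= i0" for j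
    proof -
     have "x $ j = y $ j" using that by (simp add: x_def axis_def)
     thus ?thesis using \<open>!!j. \<bar>(x - a i) $ j\<bar> <= diameter (C i)\<close>[of j] by simp
    qed
    hence "y \<in> B i" using ne x by (auto simp: B_def mem_box_cart abs_le_iff algebra_simps)
    thus "y \<in> (\<Union>i. B i)" by blast
   qed
   have Bm: "B i \<in> sets lborel" for i by (simp add: B_def)
   have eB: "emeasure lborel (B i) <= ennreal (4 ^ ?m / kk) * haus_gauge ?m (C i)" for i
   proof (cases "C i \<inter> A = {}")
    case True thus ?thesis by (simp add: B_def)
   next
    case False
    let ?d = "diameter (C i)"
    let ?l = "\<chi> j. if j = i0 then 0 else a i $ j - ?d" and ?u = "\<chi> j. if j = i0 then 1 else a i $ j + ?d"
    have d0: "?d \<ge> 0" by (rule diameter_ge_0[OF bC])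
    have ne: "cbox ?l ?u ~= {}" using d0 by (auto simp: interval_ne_empty_cart)
    have "measure lborel (cbox ?l ?u) = (\<Prod>j\<in>UNIV. ?u $ j - ?l $ j)" using content_cbox_cart[OF ne] .
    also have "... = (\<Prod>j\<in>UNIV. if j = i0 then 1 else 2 * ?d)" by (intro prod.cong) auto
    also have "... = (\<Prod>j\<in>UNIV - {i0}. 2 * ?d)"
     by (subst prod.remove[of _ i0]) (auto intro!: prod.cong)
    also have "... = (2 * ?d) ^ ?m" by simp
    also have "... = 4 ^ ?m / kk * (kk * (?d / 2) ^ ?m)"
    proof -
     have "2 * ?d = 4 * (?d / 2)" by simp
     hence "(2 * ?d) ^ ?m = 4 ^ ?m * (?d / 2) ^ ?m" by (simp only: power_mult_distrib)
     moreover have "!!k a z::real. k > 0 ==> a / k * (k * z) = a * z" by simp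
     ultimately show ?thesis using kp by presburger
    qed
    finally have ms: "measure lborel (cbox ?l ?u) = 4 ^ ?m / kk * (kk * (?d / 2) ^ ?m)" .
    have "emeasure lborel (B i) = ennreal (measure lborel (cbox ?l ?u))"
     using False emeasure_lborel_cbox_finite[of ?l ?u]
     by (simp only: B_def if_False) (simp add: emeasure_eq_ennreal_measure less_top)
    also have "... = ennreal (4 ^ ?m / kk * (kk * (?d / 2) ^ ?m))" by (simp only: ms)
    also have "... = ennreal (4 ^ ?m / kk) * ennreal (kk * (?d / 2) ^ ?m)"
     using kp d0 by (intro ennreal_mult) auto
    also have "ennreal (kk * (?d / 2) ^ ?m) = haus_gauge ?m (C i)" using False by (auto simp: haus_gauge_def kk_def)
    finally show ?thesis by simp
   qed
   have "emeasure lborel (thicken i0 A) <= emeasure lborel (\<Union>i. B i)"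
    using sub Bm by (intro emeasure_mono sets.countable_UN) auto
   also have "... <= (\<Sum>i. emeasure lborel (B i))" using Bm by (intro emeasure_subadditive_countably) auto
   also have "... <= (\<Sum>i. ennreal (4 ^ ?m / kk) * haus_gauge ?m (C i))" using eB by (intro suminf_le) auto
   also have "... = ennreal (4 ^ ?m / kk) * (\<Sum>i. haus_gauge ?m (C i))" by simp
   finally show ?thesis .
  qed
  let ?c = "4 ^ ?m / kk"
  have c0: "?c > 0" using kp by simp
  have "emeasure lborel (thicken i0 A) / ennreal ?c <= haus_pre ?m 1 A"
   by (rule haus_preI) (use main ennreal_pos_divide_le_iff[OF c0] in blast)
  thus ?thesis using ennreal_pos_divide_le_iff[OF c0] by blast
 qed
 also have "... <= ennreal (4 ^ ?m / kk) * \<H> ?m A" by (intro mult_left_mono haus_pre_le_outer) auto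
 finally show ?thesis using kp by (intro exI[of _ "4 ^ ?m / kk"]) auto
qed

text \<open>Uniqueness of invariant measures by Fubini's theorem: integrate the product of the
  indicators of \<open>B\<close> at x and of \<open>Q\<close> at x + y over both variables.
  Integrating in y first gives one side; shifting x by y, with the invariance of
  \<open>\<nu>\<close>, and then integrating in y gives the other.\<close>

lemma translation_invariant_unique:
 fixes \<nu> :: "'a::euclidean_space measure"
 assumes "sigma_finite_measure \<nu>" and s: "sets \<nu> = sets borel"
  and inv: "!!a B. B \<in> sets borel ==> emeasure \<nu> ((%x. a + x) -` B) = emeasure \<nu> B"
  and B: "B \<in> sets borel" and Q: "Q \<in> sets borel"
 shows "emeasure \<nu> B * emeasure lborel Q = emeasure lborel B * emeasure \<nu> Q"
proof -
 interpret \<nu>: sigma_finite_measure \<nu> by fact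
 interpret P: pair_sigma_finite \<nu> "lborel :: 'a measure" by unfold_locales
 note s[measurable_cong] and B[measurable] and Q[measurable]
 have sp: "space \<nu> = UNIV" using sets_eq_imp_space_eq[OF s] by simp
 have dl: "(\<integral>\<^sup>+ y. indicator E (x + y) \<partial>lborel) = emeasure lborel E" if "E \<in> sets borel" for E :: "'a set" and x
 proof -
  have "emeasure lborel E = emeasure (distr lborel borel ((+) x)) E" by (simp add: lborel_distr_plus)
  also have "... = (\<integral>\<^sup>+ y. indicator E y \<partial>distr lborel borel ((+) x))" using that by simp
  also have "... = (\<integral>\<^sup>+ y. indicator E (x + y) \<partial>lborel)" using that by (intro nn_integral_distr) auto
  finally show ?thesis by simp
 qed
 have dr: "(\<integral>\<^sup>+ y. indicator E (x - y) \<partial>lborel) = emeasure lborel E" if E: "E \<in> sets borel" for E :: "'a set" and x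
 proof -
  have "lborel = distr lborel borel (%y::'a. x + (-1) *\<^sub>R y)"
   using lborel_affine[of "-1" x] by (simp add: density_1)
  hence "emeasure lborel E = emeasure (distr lborel borel (%y::'a. x + (-1) *\<^sub>R y)) E" by metis
  also have "... = (\<integral>\<^sup>+ y. indicator E y \<partial>distr lborel borel (%y::'a. x + (-1) *\<^sub>R y))" using E by simp
  also have "... = (\<integral>\<^sup>+ y. indicator E (x + (-1) *\<^sub>R y) \<partial>lborel)" using E by (intro nn_integral_distr) auto
  finally show ?thesis by simp
 qed
 have distr\<nu>: "distr \<nu> borel (%x. a + x) = \<nu>" for a
 proof (rule measure_eqI)
  fix E assume "E \<in> sets (distr \<nu> borel (%x. a + x))"
  hence E: "E \<in> sets borel" by simp
  hence "emeasure (distr \<nu> borel (%x. a + x)) E = emeasure \<nu> ((%x. a + x) -` E)"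
   by (subst emeasure_distr) (auto simp: sp)
  thus "emeasure (distr \<nu> borel (%x. a + x)) E = emeasure \<nu> E" using inv[OF E] by simp
 qed (simp add: s)
 have "emeasure \<nu> B * emeasure lborel Q = (\<integral>\<^sup>+ x. indicator B x * emeasure lborel Q \<partial>\<nu>)"
  using B by (simp add: nn_integral_multc s)
 also have "... = (\<integral>\<^sup>+ x. \<integral>\<^sup>+ y. indicator B x * indicator Q (x + y) \<partial>lborel \<partial>\<nu>)"
  using dl[OF Q] Q by (intro nn_integral_cong) (simp add: nn_integral_cmult)
 also have "... = (\<integral>\<^sup>+ y. \<integral>\<^sup>+ x. indicator B x * indicator Q (x + y) \<partial>\<nu> \<partial>lborel)"
  by (rule P.Fubini'[symmetric]) measurable
 also have "... = (\<integral>\<^sup>+ y. \<integral>\<^sup>+ x. indicator B (x - y) * indicator Q x \<partial>\<nu> \<partial>lborel)"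
 proof (rule nn_integral_cong)
  fix y :: 'a
  have "(\<integral>\<^sup>+ x. indicator B (x - y) * indicator Q x \<partial>\<nu>) =
    (\<integral>\<^sup>+ x. indicator B (x - y) * indicator Q x \<partial>distr \<nu> borel (%x. y + x))" by (simp add: distr\<nu>)
  also have "... = (\<integral>\<^sup>+ x. indicator B (y + x - y) * indicator Q (y + x) \<partial>\<nu>)"
   by (rule nn_integral_distr) measurable
  finally show "(\<integral>\<^sup>+ x. indicator B x * indicator Q (x + y) \<partial>\<nu>) = (\<integral>\<^sup>+ x. indicator B (x - y) * indicator Q x \<partial>\<nu>)"
   by (simp add: add.commute)
 qed
 also have "... = (\<integral>\<^sup>+ x. \<integral>\<^sup>+ y. indicator B (x - y) * indicator Q x \<partial>lborel \<partial>\<nu>)"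
  by (rule P.Fubini') measurable
 also have "... = (\<integral>\<^sup>+ x. emeasure lborel B * indicator Q x \<partial>\<nu>)"
  using dr[OF B] B by (intro nn_integral_cong) (simp add: nn_integral_multc)
 also have "... = emeasure lborel B * emeasure \<nu> Q"
  using Q by (simp add: nn_integral_cmult s)
 finally show ?thesis .
qed

text \<open>Multiplying the Hausdorff measure on the hyperplane by length along the axis gives a
  translation invariant measure \<open>N\<close> on the whole space, a multiple of Lebesgue measure
  by uniqueness. Its value on a thickened set is the Hausdorff measure of the set. The constant is
  the measure of the unit face \<open>Q\<close>, finite by the grid and positive by the box
  estimate.\<close>

lemma hausdorff_hyperplane_lebesgue:
 fixes i0 :: "'n::finite"
 shows "\<exists>c>0. \<forall>A. A \<in> sets borel \<and> A \<subseteq> {x. x $ i0 = 0} -->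
  \<H> (CARD('n) - 1) A = ennreal c * emeasure lborel (thicken i0 A)"
proof -
 let ?m = "CARD('n) - 1" and ?T = "{x::real^'n. x $ i0 = 0}" and ?e = "axis i0 1 :: real^'n"
 let ?H = "\<H> ?m :: (real^'n) set => ennreal"
 define M where "M = density (hausdorff_measure ?m) (indicator ?T :: real^'n => ennreal)"
 have clT: "closed ?T" by (intro closed_Collect_eq continuous_intros)
 hence T[measurable]: "?T \<in> sets borel" by auto
 have sM[measurable_cong]: "sets M = sets borel" by (simp add: M_def)
 have spM: "space M = UNIV" by (simp add: M_def)
 have eM: "emeasure M B = ?H (?T \<inter> B)" if B: "B \<in> sets borel" for B
 proof -
  have "emeasure M B = (\<integral>\<^sup>+ x. indicator ?T x * indicator B x \<partial>hausdorff_measure ?m)"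
   unfolding M_def using B by (intro emeasure_density) auto
  also have "... = (\<integral>\<^sup>+ x. indicator (?T \<inter> B) x \<partial>hausdorff_measure ?m)"
   by (intro nn_integral_cong) (auto simp: indicator_def)
  also have "... = ?H (?T \<inter> B)" using B T by (simp add: emeasure_hausdorff_measure)
  finally show ?thesis .
 qed
 have sfM: "sigma_finite_measure M"
 proof
  show "\<exists>A. countable A \<and> A \<subseteq> sets M \<and> \<Union>A = space M \<and> (\<forall>a\<in>A. emeasure M a ~= \<infinity>)"
  proof (intro exI[of _ "range (%k::nat. cball 0 (real k + 1))"] conjI ballI)
   show "\<Union> (range (%k::nat. cball (0::real^'n) (real k + 1))) = space M"
   proof -
    have "\<exists>k::nat. norm x <= real k + 1" for x :: "real^'n" using real_arch_simple[of "norm x"] by (metis add_increasing2 zero_le_one)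
    thus ?thesis by (auto simp: spM)
   qed
   fix a assume "a \<in> range (%k::nat. cball (0::real^'n) (real k + 1))"
   then obtain k :: nat where a: "a = cball 0 (real k + 1)" by blast
   have "emeasure M a = ?H (?T \<inter> a)" by (rule eM) (simp add: a)
   also have "... <= ?H {x. x $ i0 = 0 \<and> (\<forall>i. \<bar>x $ i\<bar> <= real k + 1)}"
    using component_le_norm_cart order_trans by (intro hausdorff_outer_mono) (auto simp: a, blast)
   also have "... < \<infinity>" by (rule hausdorff_outer_hyperplane_finite) simp
   finally show "emeasure M a ~= \<infinity>" by simp
  qed (auto simp: sM)
 qed
 interpret M: sigma_finite_measure M by (rule sfM)
 interpret P: pair_sigma_finite M "lborel :: real measure" by unfold_locales
 define N where "N = distr (M \<Otimes>\<^sub>M lborel) borel (%(x, s). x + s *\<^sub>R ?e)"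
 have mm[measurable]: "(%(x, s). x + s *\<^sub>R ?e) \<in> measurable (M \<Otimes>\<^sub>M lborel) borel"
  by measurable
 have eN: "emeasure N B = (\<integral>\<^sup>+ s. \<integral>\<^sup>+ x. indicator B (x + s *\<^sub>R ?e) \<partial>M \<partial>lborel)" if B[measurable]: "B \<in> sets borel" for B
 proof -
  have "emeasure N B = (\<integral>\<^sup>+ z. indicator B z \<partial>N)" using B by (simp add: N_def)
  also have "... = (\<integral>\<^sup>+ z. indicator B ((%(x, s). x + s *\<^sub>R ?e) z) \<partial>(M \<Otimes>\<^sub>M lborel))"
   unfolding N_def by (rule nn_integral_distr) (auto simp: B)
  also have "... = (\<integral>\<^sup>+ s. \<integral>\<^sup>+ x. indicator B (x + s *\<^sub>R ?e) \<partial>M \<partial>lborel)"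
   by (subst P.nn_integral_snd[symmetric]) (auto intro!: measurable_compose[OF mm] borel_measurable_indicator)
  finally show ?thesis .
 qed
 have invM: "(\<integral>\<^sup>+ x. indicator B (a + x) \<partial>M) = (\<integral>\<^sup>+ x. indicator B x \<partial>M)" if B: "B \<in> sets borel" and a: "a \<in> ?T" for a B
 proof -
  have pre: "(%x. a + x) -` B \<in> sets borel"
   using measurable_sets[of "%x. a + x" borel borel B] B by simp
  have "(\<integral>\<^sup>+ x. indicator B (a + x) \<partial>M) = (\<integral>\<^sup>+ x. indicator ((%x. a + x) -` B) x \<partial>M)"
   by (intro nn_integral_cong) (auto simp: indicator_def)
  also have "... = ?H (?T \<inter> (%x. a + x) -` B)" using pre by (simp add: sM eM)
  also have "... = ?H ((%x. a + x) ` (?T \<inter> (%x. a + x) -` B))"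
   by (rule hausdorff_outer_isometry[symmetric]) simp
  also have "(%x. a + x) ` (?T \<inter> (%x. a + x) -` B) = ?T \<inter> B"
  proof -
   have "y \<in> (%x. a + x) ` (?T \<inter> (%x. a + x) -` B)" if "y \<in> ?T \<inter> B" for y
    using that a by (intro image_eqI[of _ _ "y - a"]) auto
   thus ?thesis using a by auto
  qed
  also have "?H (?T \<inter> B) = (\<integral>\<^sup>+ x. indicator B x \<partial>M)" using B by (simp add: sM eM)
  finally show ?thesis .
 qed
 have invN: "emeasure N ((%x. a + x) -` B) = emeasure N B" if B[measurable]: "B \<in> sets borel" for a B
 proof -
  define \<alpha> where "\<alpha> = a $ i0"
  define a' where "a' = a - \<alpha> *\<^sub>R ?e"
  have a': "a' \<in> ?T" by (simp add: a'_def \<alpha>_def)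
  have pre: "(%x. a + x) -` B \<in> sets borel"
   using measurable_sets[of "%x. a + x" borel borel B] B by simp
  have "emeasure N ((%x. a + x) -` B) = (\<integral>\<^sup>+ s. \<integral>\<^sup>+ x. indicator ((%x. x + (\<alpha> + s) *\<^sub>R ?e) -` B) (a' + x) \<partial>M \<partial>lborel)"
   unfolding eN[OF pre] by (intro nn_integral_cong) (auto simp: indicator_def a'_def algebra_simps)
  also have "... = (\<integral>\<^sup>+ s. \<integral>\<^sup>+ x. indicator ((%x. x + (\<alpha> + s) *\<^sub>R ?e) -` B) x \<partial>M \<partial>lborel)"
  proof (rule nn_integral_cong, rule invM[OF _ a'])
   fix s
   have "(%x. x + (\<alpha> + s) *\<^sub>R ?e) \<in> borel_measurable borel" by measurable
   from measurable_sets[OF this B] show "(%x. x + (\<alpha> + s) *\<^sub>R ?e) -` B \<in> sets borel" by simp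
  qed
  also have "... = (\<integral>\<^sup>+ s. (%s. \<integral>\<^sup>+ x. indicator B (x + s *\<^sub>R ?e) \<partial>M) (\<alpha> + s) \<partial>lborel)"
   by (intro nn_integral_cong) (auto simp: indicator_def)
  also have "... = (\<integral>\<^sup>+ s. (\<integral>\<^sup>+ x. indicator B (x + s *\<^sub>R ?e) \<partial>M) \<partial>distr lborel borel ((+) \<alpha>))"
   by (rule nn_integral_distr[symmetric]) measurable
  also have "... = emeasure N B" by (simp add: lborel_distr_plus eN[OF B])
  finally show ?thesis .
 qed
 have thN: "emeasure N (thicken i0 A) = ?H A" if A: "A \<in> sets borel" "A \<subseteq> ?T" for A
 proof -
  have "emeasure N (thicken i0 A) = (\<integral>\<^sup>+ s. \<integral>\<^sup>+ x. indicator (thicken i0 A) (x + s *\<^sub>R ?e) \<partial>M \<partial>lborel)"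
   by (rule eN[OF thicken_borel[OF A(1)]])
  also have "... = (\<integral>\<^sup>+ s. indicator {0..1::real} s * ?H A \<partial>lborel)"
  proof (rule nn_integral_cong)
   fix s :: real
   have th: "(%x. indicator (thicken i0 A) (x + s *\<^sub>R ?e) :: ennreal) \<in> borel_measurable (hausdorff_measure ?m)"
    using thicken_borel[OF A(1), of i0] by measurable
   have "(\<integral>\<^sup>+ x. indicator (thicken i0 A) (x + s *\<^sub>R ?e) \<partial>M) =
     (\<integral>\<^sup>+ x. indicator ?T x * indicator (thicken i0 A) (x + s *\<^sub>R ?e) \<partial>hausdorff_measure ?m)"
    unfolding M_def using th by (intro nn_integral_density) auto
   also have "... = (\<integral>\<^sup>+ x. indicator {0..1} s * indicator A x \<partial>hausdorff_measure ?m)"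
   proof (rule nn_integral_cong)
    fix x
    show "indicator ?T x * indicator (thicken i0 A) (x + s *\<^sub>R ?e) = (indicator {0..1} s * indicator A x :: ennreal)"
    proof (cases "x \<in> ?T")
     case True
     hence "x + s *\<^sub>R ?e \<in> thicken i0 A \<longleftrightarrow> x \<in> A \<and> s \<in> {0..1}" by (auto simp: thicken_def)
     thus ?thesis using True by (auto simp: indicator_def)
    next
     case False thus ?thesis using A(2) by (auto simp: indicator_def)
    qed
   qed
   also have "... = indicator {0..1} s * ?H A"
    using A(1) by (subst nn_integral_cmult) (auto simp: emeasure_hausdorff_measure)
   finally show "(\<integral>\<^sup>+ x. indicator (thicken i0 A) (x + s *\<^sub>R ?e) \<partial>M) = indicator {0..1} s * ?H A" .
  qed
  also have "... = ?H A" by (simp add: nn_integral_multc)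
  finally show ?thesis .
 qed
 define Q where "Q = {x::real^'n. x $ i0 = 0 \<and> (\<forall>i. 0 <= x $ i \<and> x $ i <= 1)}"
 have Qcl: "closed Q"
 proof -
  have "Q = ?T \<inter> cbox 0 1" by (auto simp: Q_def mem_box_cart)
  thus ?thesis using closed_Int[OF clT closed_cbox] by simp
 qed
 hence Qb: "Q \<in> sets borel" by auto
 have thQ: "thicken i0 Q = cbox 0 1"
 proof -
  have "y \<in> thicken i0 Q \<longleftrightarrow> y \<in> cbox 0 1" for y
  proof -
   have "(y - (y $ i0) *\<^sub>R ?e) $ i = (if i = i0 then 0 else y $ i)" for i by (auto simp: axis_def)
   note comp = this
   show ?thesis unfolding thicken_def Q_def mem_box_cart mem_Collect_eq comp
    by (smt (verit) zero_index one_index)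
  qed
  thus ?thesis by blast
 qed
 have l1: "emeasure lborel (cbox 0 (1::real^'n)) = 1"
 proof -
  have "measure lborel (cbox 0 (1::real^'n)) = 1" by (subst content_cbox_cart) (auto simp: interval_ne_empty_cart)
  thus ?thesis using emeasure_lborel_cbox_finite[of 0 "1::real^'n"] by (simp add: emeasure_eq_ennreal_measure less_top)
 qed
 have Hfin: "?H Q < \<infinity>"
  by (rule le_less_trans[OF hausdorff_outer_mono hausdorff_outer_hyperplane_finite[of 1 i0]]) (auto simp: Q_def)
 have Hpos: "?H Q > 0"
 proof -
  obtain k where "k > 0" "emeasure lborel (thicken i0 Q) <= ennreal k * ?H Q"
   using thicken_le_hausdorff[of Q i0] Qb by (auto simp: Q_def)
  hence "1 <= ennreal k * ?H Q" by (simp add: thQ l1)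
  thus ?thesis by (metis gr_zeroI mult_zero_right not_one_le_zero)
 qed
 obtain c where c: "c \<ge> 0" "?H Q = ennreal c" using Hfin by (metis ennreal_cases infinity_ennreal_def less_irrefl)
 \<comment> \<open>Integer translates of the unit cube cover the space and have equal finite
   measure, which makes \<open>N\<close> sigma-finite.\<close>
 define F :: "int^'n => (real^'n) set" where "F z = (%x. - (\<chi> i. of_int (z $ i)) + x) -` cbox 0 1" for z
 have "sigma_finite_measure N"
 proof
  show "\<exists>A. countable A \<and> A \<subseteq> sets N \<and> \<Union>A = space N \<and> (\<forall>a\<in>A. emeasure N a ~= \<infinity>)"
  proof (intro exI[of _ "range F"] conjI ballI)
   show "countable (range F)"
   proof (rule countable_image)
    have "countable (UNIV :: ('n => int) set)" by (rule countableI_type)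
    hence "countable (vec_lambda ` (UNIV :: ('n => int) set))" by (rule countable_image)
    moreover have "vec_lambda ` (UNIV :: ('n => int) set) = UNIV" by (metis surj_def vec_lambda_eta)
    ultimately show "countable (UNIV :: (int^'n) set)" by simp
   qed
   show "range F \<subseteq> sets N"
    by (auto simp: N_def F_def intro!: borel_closed closed_vimage continuous_intros)
   show "\<Union> (range F) = space N"
   proof -
    have "x \<in> F (\<chi> i. \<lfloor>x $ i\<rfloor>)" for x
     unfolding F_def by (auto simp: mem_box_cart) linarith
    hence "x \<in> \<Union> (range F)" for x by blast
    thus ?thesis by (auto simp: N_def)
   qed
   fix a assume "a \<in> range F"
   then obtain z where z: "a = F z" by blast
   have "emeasure N a = emeasure N (cbox 0 1)" unfolding z F_def by (rule invN) simp
   also have "... = ?H Q" using thN[OF Qb] thQ by (auto simp: Q_def)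
   finally show "emeasure N a ~= \<infinity>" using Hfin by auto
  qed
 qed
 hence uniq: "emeasure N B * emeasure lborel (cbox 0 (1::real^'n)) = emeasure lborel B * emeasure N (cbox 0 1)"
  if "B \<in> sets borel" for B using that invN
  by (intro translation_invariant_unique) (auto simp: N_def)
 have "?H A = ennreal c * emeasure lborel (thicken i0 A)" if A: "A \<in> sets borel" "A \<subseteq> ?T" for A
 proof -
  have "emeasure N (cbox 0 1) = ennreal c" using thN[OF Qb] thQ c by (auto simp: Q_def)
  thus ?thesis using uniq[OF thicken_borel[OF A(1)], of i0] thN[OF A] by (simp add: l1 mult.commute)
 qed
 moreover have "c > 0" using Hpos c by (simp add: ennreal_less_zero_iff)
 ultimately show ?thesis by blast
qed

section \<open>Volume and determinants\<close>

lemma linear_bij_image_borel: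
 fixes L :: "'a::euclidean_space => 'a"
 assumes "linear L" "inj L" "B \<in> sets borel" shows "L ` B \<in> sets borel"
proof -
 obtain L' where L': "linear L'" "!!x. L' (L x) = x" "!!x. L (L' x) = x"
  using linear_injective_isomorphism[OF assms(1,2)] by auto
 have "L' \<in> borel_measurable borel" using linear_continuous_on_compose L'(1)
  by (intro borel_measurable_continuous_onI linear_continuous_on) (simp add: linear_conv_bounded_linear)
 from measurable_sets[OF this assms(3)] have "L' -` B \<in> sets borel" by simp
 moreover have "L' -` B = L ` B"
 proof -
  have "y = L (L' y)" for y using L'(3) by simp
  thus ?thesis using L'(2) by (auto simp: image_iff)
 qed
 ultimately show ?thesis by simp
qed

text \<open>The volume of the image is a translation invariant measure of the set, so it is fixed by
  its value on the unit cube.\<close>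

lemma emeasure_linear_image_cube:
 fixes L :: "real^'n::finite => real^'n"
 assumes L: "linear L" "inj L" and B: "B \<in> sets borel"
 shows "emeasure lborel (L ` B) = emeasure lborel (L ` cbox 0 1) * emeasure lborel B"
proof -
 obtain L' where L': "linear L'" "!!x. L' (L x) = x" "!!x. L (L' x) = x"
  using linear_injective_isomorphism[OF L] by auto
 have m[measurable]: "L' \<in> borel_measurable borel"
  using L'(1) by (intro borel_measurable_continuous_onI linear_continuous_on) (simp add: linear_conv_bounded_linear)
 define \<nu> where "\<nu> = distr lborel borel L'"
 have pre: "L' -` E = L ` E" for E using L'(2,3) by (auto simp: image_iff) (metis L'(3))
 have e: "emeasure \<nu> E = emeasure lborel (L ` E)" if "E \<in> sets borel" for E
  unfolding \<nu>_def using that by (subst emeasure_distr) (auto simp: pre)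
 have "emeasure \<nu> B * emeasure lborel (cbox 0 (1::real^'n)) = emeasure lborel B * emeasure \<nu> (cbox 0 1)"
 proof (rule translation_invariant_unique)
  show "sigma_finite_measure \<nu>"
  proof
   show "\<exists>A. countable A \<and> A \<subseteq> sets \<nu> \<and> \<Union>A = space \<nu> \<and> (\<forall>a\<in>A. emeasure \<nu> a ~= \<infinity>)"
   proof (intro exI[of _ "range (%k::nat. cball 0 (real k))"] conjI ballI)
    show "\<Union> (range (%k::nat. cball (0::real^'n) (real k))) = space \<nu>"
     using real_arch_simple by (auto simp: \<nu>_def)
    fix a :: "(real^'n) set" assume "a \<in> range (%k::nat. cball 0 (real k))"
    then obtain k :: nat where a: "a = cball 0 (real k)" by blast
    have "bounded (L ` a)" using L(1) by (intro bounded_linear_image) (auto simp: a linear_conv_bounded_linear)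
    thus "emeasure \<nu> a ~= \<infinity>" using emeasure_bounded_finite[of "L ` a"] by (simp add: e a)
   qed (auto simp: \<nu>_def)
  qed
  fix a and E :: "(real^'n) set" assume E: "E \<in> sets borel"
  have "(%x. a + x) -` E \<in> sets borel" using measurable_sets[of "%x. a + x" borel borel E] E by simp
  hence "emeasure \<nu> ((%x. a + x) -` E) = emeasure lborel (L ` ((%x. a + x) -` E))" by (rule e)
  also have "L ` ((%x. a + x) -` E) = (+) (L a) -` (L ` E)"
  proof (intro set_eqI iffI)
   fix y assume "y \<in> L ` ((%x. a + x) -` E)"
   thus "y \<in> (+) (L a) -` (L ` E)" by (auto simp: linear_add[OF L(1), symmetric])
  next
   fix y assume "y \<in> (+) (L a) -` (L ` E)"
   then obtain x where x: "L a + y = L x" "x \<in> E" by auto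
   hence "y = L (x - a)" by (simp add: linear_diff[OF L(1)] algebra_simps)
   thus "y \<in> L ` ((%x. a + x) -` E)" using x by auto
  qed
  also have "emeasure lborel ((+) (L a) -` (L ` E)) = emeasure (distr lborel borel ((+) (L a))) (L ` E)"
   using linear_bij_image_borel[OF L E] by (subst emeasure_distr) auto
  also have "... = emeasure \<nu> E" by (simp add: lborel_distr_plus e[OF E])
  finally show "emeasure \<nu> ((%x. a + x) -` E) = emeasure \<nu> E" .
 qed (use B in \<open>auto simp: \<nu>_def\<close>)
 moreover have "emeasure lborel (cbox 0 (1::real^'n)) = 1"
 proof -
  have "measure lborel (cbox 0 (1::real^'n)) = 1" by (subst content_cbox_cart) (auto simp: interval_ne_empty_cart)
  thus ?thesis using emeasure_lborel_cbox_finite[of 0 "1::real^'n"] by (simp add: emeasure_eq_ennreal_measure less_top)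
 qed
 ultimately show ?thesis using e[OF B] e[of "cbox 0 1"] by (simp add: mult.commute)
qed

lemma abs_eq_1_of_square: "(a::real) * a = 1 ==> \<bar>a\<bar> = 1"
 by (metis abs_mult abs_mult_self_eq abs_one mult_eq_1 abs_ge_zero square_eq_1_iff abs_minus abs_1)

text \<open>Both sides are multiplicative under composition, so elementary maps suffice. The
  determinant condition sits inside the induction as a premise: it passes from a composite to its
  factors and disposes of the singular generators.\<close>

lemma emeasure_linear_cube_det:
 fixes L :: "real^'n::finite => real^'n"
 assumes "linear L" "det (matrix L) ~= 0"
 shows "emeasure lborel (L ` cbox 0 1) = ennreal \<bar>det (matrix L)\<bar>"
proof -
 let ?Q = "cbox 0 1 :: (real^'n) set"
 let ?k = "%L. emeasure lborel (L ` ?Q)"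
 have Q1: "emeasure lborel ?Q = 1"
 proof -
  have "measure lborel ?Q = 1" by (subst content_cbox_cart) (auto simp: interval_ne_empty_cart)
  thus ?thesis using emeasure_lborel_cbox_finite[of 0 "1::real^'n"] by (simp add: emeasure_eq_ennreal_measure less_top)
 qed
 have kcomp: "?k (f \<circ> g) = ?k f * ?k g" if "linear f" "inj f" "linear g" "inj g" for f g :: "real^'n => real^'n"
  using emeasure_linear_image_cube[OF that(1,2) linear_bij_image_borel[OF that(3,4)], of ?Q] by (simp add: image_comp)
 have "det (matrix L) ~= 0 --> ?k L = ennreal \<bar>det (matrix L)\<bar>"
  using assms(1)
 proof (rule induct_linear_elementary)
  fix f g :: "real^'n => real^'n"
  assume f: "linear f" "linear g" "det (matrix f) ~= 0 --> ?k f = ennreal \<bar>det (matrix f)\<bar>"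
   "det (matrix g) ~= 0 --> ?k g = ennreal \<bar>det (matrix g)\<bar>"
  have d: "det (matrix (f \<circ> g)) = det (matrix f) * det (matrix g)" by (simp add: matrix_compose f det_mul)
  show "det (matrix (f \<circ> g)) ~= 0 --> ?k (f \<circ> g) = ennreal \<bar>det (matrix (f \<circ> g))\<bar>"
  proof
   assume "det (matrix (f \<circ> g)) ~= 0"
   hence nz: "det (matrix f) ~= 0" "det (matrix g) ~= 0" using d by auto
   hence "inj f" "inj g" using det_nz_iff_inj f by auto
   hence "?k (f \<circ> g) = ?k f * ?k g" using f by (intro kcomp)
   thus "?k (f \<circ> g) = ennreal \<bar>det (matrix (f \<circ> g))\<bar>" using nz f d by (simp add: abs_mult ennreal_mult)
  qed
 next
  fix f :: "real^'n => real^'n" and i assume f: "linear f" "!!x. f x $ i = 0"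
  have "axis i 1 \<notin> range f" using f(2) by (metis axis_nth rangeE zero_neq_one)
  hence "\<not> surj f" by blast
  hence "det (matrix f) = 0" using det_nz_iff_inj[OF f(1)] linear_inj_imp_surj[OF f(1)] by blast
  thus "det (matrix f) ~= 0 --> ?k f = ennreal \<bar>det (matrix f)\<bar>" by simp
 next
  fix c :: "'n => real"
  have ms: "measure lebesgue ((%x. \<chi> i. c i * x $ i) ` ?Q) = \<bar>prod c UNIV\<bar> * measure lebesgue ?Q"
   by (intro measure_stretch lmeasurable_cbox)
  have Q1m: "measure lebesgue ?Q = 1"
   by (subst measure_completion) (auto simp: content_cbox_cart interval_ne_empty_cart)
  have "compact ((%x. \<chi> i. c i * x $ i) ` ?Q)"
   by (intro compact_continuous_image continuous_intros compact_cbox)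
  hence "(%x. \<chi> i. c i * x $ i) ` ?Q \<in> sets borel" by (intro borel_closed compact_imp_closed)
  moreover have "emeasure lborel ((%x. \<chi> i. c i * x $ i) ` ?Q) < \<infinity>"
   by (intro emeasure_bounded_finite compact_imp_bounded) fact
  ultimately have "?k (%x. \<chi> i. c i * x $ i) = ennreal (measure lebesgue ((%x. \<chi> i. c i * x $ i) ` ?Q))"
   by (simp add: emeasure_eq_ennreal_measure less_top)
  hence "?k (%x. \<chi> i. c i * x $ i) = ennreal \<bar>prod c UNIV\<bar>" by (simp only: ms Q1m mult_1_right)
  moreover have "det (matrix (%x::real^'n. \<chi> i. c i * x $ i)) = prod c UNIV"
   by (subst det_diagonal) (auto simp: matrix_def axis_def)
  ultimately show "det (matrix (%x::real^'n. \<chi> i. c i * x $ i)) ~= 0 -->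
   ?k (%x. \<chi> i. c i * x $ i) = ennreal \<bar>det (matrix (%x::real^'n. \<chi> i. c i * x $ i))\<bar>" by simp
 next
  fix m n :: 'n assume "m ~= n"
  define f where "f = (%x::real^'n. \<chi> i. x $ Transposition.transpose m n i)"
  have lin: "linear f" by (intro linearI) (auto simp: f_def vec_eq_iff)
  have ff: "f (f x) = x" for x by (simp add: f_def vec_eq_iff)
  have "matrix f ** matrix f = mat 1"
   using matrix_compose[OF lin lin] ff by (simp add: o_def matrix_id_mat_1[symmetric] id_def)
  hence "det (matrix f) * det (matrix f) = 1" by (metis det_I det_mul)
  hence "\<bar>det (matrix f)\<bar> = 1" by (rule abs_eq_1_of_square)
  moreover have "f ` ?Q = ?Q"
  proof -
   have "f x \<in> ?Q" if "x \<in> ?Q" for x using that by (auto simp: f_def mem_box_cart)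
   thus ?thesis using ff by (metis (no_types, lifting) image_eqI image_subsetI subsetI subset_antisym)
  qed
  ultimately show "det (matrix (%x::real^'n. \<chi> i. x $ Transposition.transpose m n i)) ~= 0 -->
   ?k (%x. \<chi> i. x $ Transposition.transpose m n i) =
   ennreal \<bar>det (matrix (%x::real^'n. \<chi> i. x $ Transposition.transpose m n i))\<bar>"
   using Q1 unfolding f_def by simp
 next
  fix m n :: 'n assume mn: "m ~= n"
  define f where "f = (%x::real^'n. \<chi> i. if i = m then x $ m + x $ n else x $ i)"
  define D where "D = (%x::real^'n. \<chi> i. if i = m then - x $ i else x $ i)"
  have lin: "linear f" "linear D" by (intro linearI; auto simp: f_def D_def vec_eq_iff algebra_simps)+
  \<comment> \<open>The shear is conjugate to its own inverse, so it has volume factor 1.\<close>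
  have id: "D (f (D (f x))) = x" for x using mn by (auto simp: f_def D_def vec_eq_iff)
  have DD: "D (D x) = x" for x by (auto simp: D_def vec_eq_iff)
  have inj: "inj f" "inj D" using id DD by (metis injI)+
  have id1: "(D \<circ> f) \<circ> (D \<circ> f) = id" using id by (auto simp: o_def)
  have lDf: "linear (D \<circ> f)" "inj (D \<circ> f)" using lin inj by (auto intro: linear_compose inj_compose)
  have DQ: "?k D * ?k D = 1" using kcomp[OF lin(2) inj(2) lin(2) inj(2)] DD Q1 by (simp add: image_comp o_def)
  have "?k (D \<circ> f) * ?k (D \<circ> f) = 1" using kcomp[OF lDf lDf] id1 Q1 by simp
  moreover have "?k (D \<circ> f) = ?k D * ?k f" by (rule kcomp[OF lin(2) inj(2) lin(1) inj(1)])
  ultimately have "(?k D * ?k f) * (?k D * ?k f) = 1" by simp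
  moreover have "(?k D * ?k f) * (?k D * ?k f) = (?k D * ?k D) * (?k f * ?k f)" by (simp only: ac_simps)
  ultimately have kf: "?k f * ?k f = 1" by (simp only: DQ mult_1_left)
  have "emeasure lborel (f ` ?Q) < \<infinity>"
   using lin by (intro emeasure_bounded_finite bounded_linear_image) (auto simp: linear_conv_bounded_linear)
  then obtain r where r: "r \<ge> 0" "?k f = ennreal r" by (metis ennreal_cases infinity_ennreal_def less_irrefl)
  hence "r * r = 1" using kf by (simp add: ennreal_mult[symmetric])
  hence kf1: "?k f = 1" using abs_eq_1_of_square[of r] r by simp
  have "D \<circ> D = id" using DD by auto
  hence "matrix (D \<circ> f) ** matrix (D \<circ> f) = mat 1" "matrix D ** matrix D = mat 1"
   using matrix_compose[OF lDf(1) lDf(1)] id1 matrix_compose[OF lin(2) lin(2)] by (simp_all add: matrix_id_mat_1)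
  hence "det (matrix (D \<circ> f)) * det (matrix (D \<circ> f)) = 1" "det (matrix D) * det (matrix D) = 1"
   by (metis det_I det_mul)+
  moreover have "det (matrix (D \<circ> f)) = det (matrix D) * det (matrix f)"
   using matrix_compose[OF lin] by (simp add: det_mul)
  ultimately have "\<bar>det (matrix D) * det (matrix f)\<bar> = 1" "\<bar>det (matrix D)\<bar> = 1"
   using abs_eq_1_of_square by metis+
  hence "\<bar>det (matrix f)\<bar> = 1" by (simp add: abs_mult)
  thus "det (matrix (%x::real^'n. \<chi> i. if i = m then x $ m + x $ n else x $ i)) ~= 0 -->
   ?k (%x. \<chi> i. if i = m then x $ m + x $ n else x $ i) =
   ennreal \<bar>det (matrix (%x::real^'n. \<chi> i. if i = m then x $ m + x $ n else x $ i))\<bar>"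
   using kf1 unfolding f_def by simp
 qed
 thus ?thesis using assms by blast
qed

lemma emeasure_lborel_linear_image:
 fixes L :: "real^'n::finite => real^'n"
 assumes L: "linear L" "det (matrix L) ~= 0" and B: "B \<in> sets borel"
 shows "emeasure lborel (L ` B) = ennreal \<bar>det (matrix L)\<bar> * emeasure lborel B"
 using emeasure_linear_image_cube[OF L(1) _ B] emeasure_linear_cube_det[OF L] L det_nz_iff_inj[OF L(1)] by simp

text \<open>Fixing the axis vector and preserving the hyperplane, \<open>L\<close> commutes with
  thickening, so the volume formula descends to the hyperplane.\<close>

lemma hausdorff_linear_image_axis:
 fixes L :: "real^'n::finite => real^'n"
 assumes L: "linear L" "det (matrix L) ~= 0" "!!x. x $ i0 = 0 ==> L x $ i0 = 0" "L (axis i0 1) = axis i0 1"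
  and A: "A \<in> sets borel" "A \<subseteq> {x. x $ i0 = 0}"
 shows "\<H> (CARD('n) - 1) (L ` A) = ennreal \<bar>det (matrix L)\<bar> * \<H> (CARD('n) - 1) A"
proof -
 let ?e = "axis i0 1 :: real^'n"
 have inj: "inj L" using L det_nz_iff_inj[OF L(1)] by simp
 obtain c where c: "c > 0" "!!A. A \<in> sets borel ==> A \<subseteq> {x. x $ i0 = 0} ==>
  \<H> (CARD('n) - 1) A = ennreal c * emeasure lborel (thicken i0 A)"
  using hausdorff_hyperplane_lebesgue[of i0] by blast
 have LA: "L ` A \<in> sets borel" "L ` A \<subseteq> {x. x $ i0 = 0}"
  using linear_bij_image_borel[OF L(1) inj A(1)] L(3) A(2) by auto
 have comp: "L y $ i0 = y $ i0" "L (y - (y $ i0) *\<^sub>R ?e) = L y - (L y $ i0) *\<^sub>R ?e" for y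
 proof -
  have 1: "L (y - (y $ i0) *\<^sub>R ?e) = L y - (y $ i0) *\<^sub>R ?e"
   by (simp add: linear_diff[OF L(1)] linear_cmul[OF L(1)] L(4))
  have "L (y - (y $ i0) *\<^sub>R ?e) $ i0 = 0" by (rule L(3)) simp
  thus "L y $ i0 = y $ i0" using 1 by simp
  thus "L (y - (y $ i0) *\<^sub>R ?e) = L y - (L y $ i0) *\<^sub>R ?e" using 1 by simp
 qed
 have th: "thicken i0 (L ` A) = L ` thicken i0 A"
 proof
  show "L ` thicken i0 A \<subseteq> thicken i0 (L ` A)" using comp by (auto simp: thicken_def) (metis imageI)
  show "thicken i0 (L ` A) \<subseteq> L ` thicken i0 A"
  proof
   fix y assume y: "y \<in> thicken i0 (L ` A)"
   obtain x where x: "y = L x" using linear_inj_imp_surj[OF L(1) inj] by (metis surj_def)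
   hence "L (x - (x $ i0) *\<^sub>R ?e) \<in> L ` A" "0 <= x $ i0" "x $ i0 <= 1"
    using y comp[of x] by (auto simp: thicken_def)
   hence "x \<in> thicken i0 A" using inj by (auto simp: thicken_def inj_image_mem_iff)
   thus "y \<in> L ` thicken i0 A" using x by blast
  qed
 qed
 have "emeasure lborel (L ` thicken i0 A) = ennreal \<bar>det (matrix L)\<bar> * emeasure lborel (thicken i0 A)"
  by (intro emeasure_lborel_linear_image L(1,2) thicken_borel A(1))
 thus ?thesis using c(2)[OF LA] c(2)[OF A] by (simp add: th mult.left_commute)
qed

lemma orth_exists:
 fixes a b :: "real^'n::finite"
 assumes "norm a = norm b" shows "\<exists>R. orthogonal_transformation R \<and> R a = b"
 by (rule orthogonal_transformation_exists[OF assms]) (intro exI conjI)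

lemma orth_isometry: "orthogonal_transformation R ==> dist (R x) (R y) = dist x y"
 by (metis dist_norm linear_diff orthogonal_transformation_linear orthogonal_transformation_norm)

text \<open>A rotation takes \<open>v\<close> to an axis vector; it preserves Hausdorff measure, and
  conjugating by it preserves the determinant.\<close>

theorem hausdorff_linear_image:
 fixes L :: "real^'n::finite => real^'n" and v :: "real^'n"
 assumes L: "linear L" "det (matrix L) ~= 0" "!!x. x \<bullet> v = 0 ==> L x \<bullet> v = 0" "L v = v" and v: "norm v = 1"
  and A: "A \<in> sets borel" "!!x. x \<in> A ==> x \<bullet> v = 0"
 shows "\<H> (CARD('n) - 1) (L ` A) = ennreal \<bar>det (matrix L)\<bar> * \<H> (CARD('n) - 1) A"
proof -
 let ?H = "\<H> (CARD('n) - 1) :: (real^'n) set => ennreal"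
 obtain i0 :: 'n where True by blast
 have "norm (axis i0 1 :: real^'n) = norm v" using v by simp
 from orth_exists[OF this] obtain R :: "real^'n => real^'n" where R: "orthogonal_transformation R" "R (axis i0 1) = v" by blast
 define R' where "R' = inv R"
 have RR: "R (R' x) = x" "R' (R x) = x" for x
  using orthogonal_transformation_bij[OF R(1)] unfolding R'_def by (simp_all add: bij_is_surj surj_f_inv_f bij_is_inj)
 have linR: "linear R" "linear R'" and R'o: "orthogonal_transformation R'"
  using R(1) orthogonal_transformation_inv[OF R(1)] by (auto simp: R'_def orthogonal_transformation_linear)
 define L0 where "L0 = (%x. R' (L (R x)))"
 have coord: "R' x $ i0 = x \<bullet> v" for x
 proof -
  have "R' x \<bullet> axis i0 1 = R (R' x) \<bullet> R (axis i0 1)" using R(1) by (simp add: orthogonal_transformation_def)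
  thus ?thesis by (simp add: RR R(2) inner_axis)
 qed
 have linL0: "linear L0" unfolding L0_def
  using linear_compose[OF linear_compose[OF linR(1) L(1)] linR(2)] by (simp add: o_def)
 have "matrix L0 = matrix R' ** matrix L ** matrix R"
  unfolding L0_def using matrix_compose[OF linear_compose[OF linR(1) L(1)] linR(2)] matrix_compose[OF linR(1) L(1)]
  by (simp add: o_def matrix_mul_assoc)
 moreover have "matrix R' ** matrix R = mat 1"
  using matrix_compose[OF linR] RR(2) by (simp add: o_def matrix_id_mat_1[symmetric] id_def)
 ultimately have det: "det (matrix L0) = det (matrix L)"
  by (metis (no_types, lifting) det_I det_mul mult.commute mult.left_commute mult_1)
 have R'A: "R' ` A \<in> sets borel" "R' ` A \<subseteq> {x. x $ i0 = 0}"
 proof -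
  show "R' ` A \<in> sets borel" using linear_bij_image_borel[OF linR(2) _ A(1)] RR(1) by (metis injI)
 qed (use A(2) coord in auto)
 have "L ` A = R ` L0 ` R' ` A" by (simp add: L0_def image_image RR)
 hence "?H (L ` A) = ?H (L0 ` R' ` A)"
  using hausdorff_outer_isometry[of "L0 ` R' ` A" R "CARD('n) - 1"] orth_isometry[OF R(1)] by simp
 also have "... = ennreal \<bar>det (matrix L0)\<bar> * ?H (R' ` A)"
 proof (rule hausdorff_linear_image_axis[OF linL0 _ _ _ R'A])
  show "det (matrix L0) ~= 0" using L(2) det by simp
  fix x :: "real^'n" assume "x $ i0 = 0"
  hence "R x \<bullet> v = 0" using coord[of "R x"] by (simp add: RR)
  thus "L0 x $ i0 = 0" using L(3) coord by (simp add: L0_def)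
 next
  show "L0 (axis i0 1) = axis i0 1" using RR(2)[of "axis i0 1"] by (simp add: L0_def R(2) L(4))
 qed
 also have "?H (R' ` A) = ?H A"
  using R'o by (intro hausdorff_outer_isometry) (simp add: orth_isometry)
 finally show ?thesis by (simp add: det)
qed

lemma hausdorff_hyperplane_ball_pos:
 fixes v :: "real^'n::finite"
 assumes v: "norm v = 1" and r: "r > 0"
 shows "\<H> (CARD('n) - 1) {x. x \<bullet> v = 0 \<and> norm x < r} > 0"
proof -
 obtain i0 :: 'n where True by blast
 have "norm (axis i0 1 :: real^'n) = norm v" using v by simp
 from orth_exists[OF this] obtain R :: "real^'n => real^'n" where R: "orthogonal_transformation R" "R (axis i0 1) = v" by blast
 let ?A = "{x::real^'n. x $ i0 = 0 \<and> norm x < r}"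
 have "R ` ?A \<subseteq> {x. x \<bullet> v = 0 \<and> norm x < r}"
 proof
  fix y assume "y \<in> R ` ?A"
  then obtain x where x: "y = R x" "x $ i0 = 0" "norm x < r" by blast
  have "R x \<bullet> R (axis i0 1) = x \<bullet> axis i0 1" using R(1) by (simp add: orthogonal_transformation_def)
  thus "y \<in> {x. x \<bullet> v = 0 \<and> norm x < r}"
   using x R by (simp add: inner_axis orthogonal_transformation_norm)
 qed
 hence "\<H> (CARD('n) - 1) (R ` ?A) <= \<H> (CARD('n) - 1) {x. x \<bullet> v = 0 \<and> norm x < r}"
  by (rule hausdorff_outer_mono)
 moreover have "\<H> (CARD('n) - 1) (R ` ?A) = \<H> (CARD('n) - 1) ?A"
  using R(1) by (intro hausdorff_outer_isometry) (simp add: orth_isometry)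
 moreover have "\<H> (CARD('n) - 1) ?A > 0"
 proof -
  have op: "open {x::real^'n. norm x < r}" by (intro open_Collect_less continuous_intros)
  have cl: "closed {x::real^'n. x $ i0 = 0}" by (intro closed_Collect_eq continuous_intros)
  have "?A = {x. x $ i0 = 0} \<inter> {x. norm x < r}" by auto
  hence A: "?A \<in> sets borel" using op cl by auto
  obtain k where k: "k > 0" "emeasure lborel (thicken i0 ?A) <= ennreal k * \<H> (CARD('n) - 1) ?A"
   using thicken_le_hausdorff[of ?A i0] A by auto
  define U where "U = {y::real^'n. norm (y - (y $ i0) *\<^sub>R axis i0 1) < r} \<inter> {y. 0 < y $ i0} \<inter> {y. y $ i0 < 1}"
  have "open U" unfolding U_def by (intro open_Int open_Collect_less continuous_intros)
  moreover have "axis i0 (1/2) \<in> U"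
  proof -
   have "axis i0 (1/2) - (1/2) *\<^sub>R axis i0 1 = (0::real^'n)" by (simp add: vec_eq_iff axis_def)
   thus ?thesis using r by (simp add: U_def)
  qed
  ultimately have "emeasure lborel U ~= 0" using open_not_negligible[of U] by (auto simp: negligible_iff_emeasure0)
  moreover have "U \<subseteq> thicken i0 ?A" by (auto simp: U_def thicken_def)
  ultimately have "emeasure lborel (thicken i0 ?A) ~= 0"
   using emeasure_mono[of U "thicken i0 ?A" lborel] thicken_borel[OF A] by auto
  hence "\<H> (CARD('n) - 1) ?A ~= 0" using k(2) by auto
  thus ?thesis by (simp add: zero_less_iff_neq_zero)
 qed
 ultimately show ?thesis by simp
qed

lemma hausdorff_hyperplane_ball_finite:
 fixes v :: "real^'n::finite"
 assumes v: "norm v = 1"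
 shows "\<H> (CARD('n) - 1) {x. x \<bullet> v = 0 \<and> norm x <= r} < \<infinity>"
proof -
 obtain i0 :: 'n where True by blast
 have "norm v = norm (axis i0 1 :: real^'n)" using v by simp
 from orth_exists[OF this] obtain R :: "real^'n => real^'n" where R: "orthogonal_transformation R" "R v = axis i0 1" by blast
 let ?A = "{x. x \<bullet> v = 0 \<and> norm x <= r}"
 have "R ` ?A \<subseteq> {x. x $ i0 = 0 \<and> (\<forall>i. \<bar>x $ i\<bar> <= \<bar>r\<bar> + 1)}"
 proof
  fix y assume "y \<in> R ` ?A"
  then obtain x where x: "y = R x" "x \<bullet> v = 0" "norm x <= r" by blast
  have "R x \<bullet> R v = x \<bullet> v" using R(1) by (simp add: orthogonal_transformation_def)
  hence "y $ i0 = 0" using x by (simp add: R(2) inner_axis)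
  moreover have "norm y <= r" using x R(1) by (simp add: orthogonal_transformation_norm)
  hence "\<bar>y $ i\<bar> <= \<bar>r\<bar> + 1" for i using component_le_norm_cart[of y i] by linarith
  ultimately show "y \<in> {x. x $ i0 = 0 \<and> (\<forall>i. \<bar>x $ i\<bar> <= \<bar>r\<bar> + 1)}" by simp
 qed
 hence "\<H> (CARD('n) - 1) (R ` ?A) < \<infinity>"
  by (rule le_less_trans[OF hausdorff_outer_mono hausdorff_outer_hyperplane_finite]) simp
 moreover have "\<H> (CARD('n) - 1) (R ` ?A) = \<H> (CARD('n) - 1) ?A"
  using R(1) by (intro hausdorff_outer_isometry) (simp add: orth_isometry)
 ultimately show ?thesis by simp
qed

subsection \<open>Hausdorff measure of linear images of arbitrary sets\<close>

lemma diameter_closure_le: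
 fixes C :: "'a::euclidean_space set"
 assumes "bounded C" shows "diameter (closure C) <= diameter C"
 using assms by (simp add: diameter_closure)

lemma haus_gauge_closure: "bounded C ==> haus_gauge m (closure C) = haus_gauge m C"
 by (simp add: haus_gauge_def diameter_closure)

text \<open>Take covers of mesh 1 / (k + 1) that are optimal up to 1 / (k + 1), close their members,
  which leaves the diameters unchanged, and intersect the unions over all k.\<close>

lemma hausdorff_borel_hull:
 fixes A :: "'a::euclidean_space set"
 shows "\<exists>G\<in>sets borel. A \<subseteq> G \<and> \<H> m G = \<H> m A"
proof (cases "\<H> m A = \<infinity>")
 case True
 hence "\<H> m (UNIV :: 'a set) = \<infinity>" using hausdorff_outer_mono[of A UNIV m] by (simp add: top_unique)
 thus ?thesis using True by (intro bexI[of _ UNIV]) auto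
next
 case False
 define r where "r k = 1 / real (Suc k)" for k
 have r: "r k > 0" for k by (simp add: r_def)
 have "\<exists>C. haus_cover (r k) A C \<and> (\<Sum>j. haus_gauge m (C j)) <= \<H> m A + ennreal (r k)" for k
 proof (rule ccontr)
  assume "\<not> ?thesis"
  hence "\<H> m A + ennreal (r k) <= haus_pre m (r k) A"
   by (intro haus_preI) (meson less_imp_le not_le)
  also have "... <= \<H> m A" by (rule haus_pre_le_outer[OF r])
  finally have "\<H> m A + ennreal (r k) <= \<H> m A + 0" by simp
  hence "ennreal (r k) <= 0" using False by (simp only: ennreal_add_left_cancel_le) simp
  thus False using r[of k] by simp
 qed
 then obtain C where C: "!!k. haus_cover (r k) A (C k)"
  "!!k. (\<Sum>j. haus_gauge m (C k j)) <= \<H> m A + ennreal (r k)" by metis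
 define G where "G = (\<Inter>k. \<Union>j. closure (C k j))"
 have bd: "bounded (C k j)" "diameter (C k j) <= r k" for k j using C(1)[of k] by (auto simp: haus_cover_def)
 have "G \<in> sets borel" unfolding G_def by (intro sets.countable_INT' sets.countable_UN') auto
 moreover have AG: "A \<subseteq> G"
 proof
  fix x assume x: "x \<in> A"
  have "x \<in> (\<Union>j. closure (C k j))" for k
  proof -
   obtain j where "x \<in> C k j" using C(1)[of k] x unfolding haus_cover_def by blast
   thus ?thesis using closure_subset[of "C k j"] by blast
  qed
  thus "x \<in> G" by (simp add: G_def)
 qed
 moreover have "\<H> m G <= \<H> m A"
 proof (rule hausdorff_outer_leI)
  fix \<delta> :: real assume \<delta>: "\<delta> > 0"
  show "haus_pre m \<delta> G <= \<H> m A"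
  proof (rule ennreal_le_epsilon)
   fix e :: real assume e: "e > 0"
   obtain k where k: "r k < min \<delta> e" using nat_approx_posE[of "min \<delta> e"] \<delta> e by (auto simp: r_def)
   have "haus_cover \<delta> G (%j. closure (C k j))"
    unfolding haus_cover_def
   proof (intro conjI allI)
    show "G \<subseteq> (\<Union>j. closure (C k j))" by (auto simp: G_def)
    fix j show "bounded (closure (C k j))" by (intro bounded_closure bd)
    show "diameter (closure (C k j)) <= \<delta>" using bd[where k=k and j=j] diameter_closure_le[of "C k j"] k by linarith
   qed
   hence "haus_pre m \<delta> G <= (\<Sum>j. haus_gauge m (closure (C k j)))" by (rule haus_pre_le)
   also have "... <= \<H> m A + ennreal (r k)" using C(2)[of k] bd by (simp add: haus_gauge_closure)
   also have "... <= \<H> m A + ennreal e" using k by (intro add_left_mono ennreal_leI) auto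
   finally show "haus_pre m \<delta> G <= \<H> m A + ennreal e" .
  qed
 qed
 ultimately show ?thesis using hausdorff_outer_mono[OF AG, of m] by (intro bexI[of _ G]) (auto intro: antisym)
qed

lemma hausdorff_linear_image_le:
 fixes L :: "real^'n::finite => real^'n" and v :: "real^'n"
 assumes L: "linear L" "det (matrix L) ~= 0" "!!x. x \<bullet> v = 0 ==> L x \<bullet> v = 0" "L v = v" and v: "norm v = 1"
  and A: "!!x. x \<in> A ==> x \<bullet> v = 0"
 shows "\<H> (CARD('n) - 1) (L ` A) <= ennreal \<bar>det (matrix L)\<bar> * \<H> (CARD('n) - 1) A"
proof -
 let ?H = "\<H> (CARD('n) - 1) :: (real^'n) set => ennreal"
 obtain G where G: "G \<in> sets borel" "A \<subseteq> G" "?H G = ?H A" using hausdorff_borel_hull by blast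
 let ?G = "G \<inter> {x. x \<bullet> v = 0}"
 have "closed {x. x \<bullet> v = 0}" by (intro closed_Collect_eq continuous_intros)
 hence Gb: "?G \<in> sets borel" using G(1) by auto
 have "?H (L ` A) <= ?H (L ` ?G)" using G(2) A by (intro hausdorff_outer_mono) auto
 also have "... = ennreal \<bar>det (matrix L)\<bar> * ?H ?G" by (rule hausdorff_linear_image[OF L v Gb]) auto
 also have "... <= ennreal \<bar>det (matrix L)\<bar> * ?H A"
  unfolding G(3)[symmetric] by (intro mult_left_mono hausdorff_outer_mono) auto
 finally show ?thesis .
qed

lemma hausdorff_linear_image_outer:
 fixes L :: "real^'n::finite => real^'n" and v :: "real^'n"
 assumes L: "linear L" "det (matrix L) ~= 0" "!!x. x \<bullet> v = 0 ==> L x \<bullet> v = 0" "L v = v" and v: "norm v = 1"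
  and A: "!!x. x \<in> A ==> x \<bullet> v = 0"
 shows "\<H> (CARD('n) - 1) (L ` A) = ennreal \<bar>det (matrix L)\<bar> * \<H> (CARD('n) - 1) A"
proof (rule antisym[OF hausdorff_linear_image_le[OF assms]])
 let ?H = "\<H> (CARD('n) - 1) :: (real^'n) set => ennreal"
 have inj: "inj L" using L det_nz_iff_inj by blast
 obtain L' where L': "linear L'" "!!x. L' (L x) = x" "!!x. L (L' x) = x"
  using linear_injective_isomorphism[OF L(1) inj] by auto
 have "matrix L' ** matrix L = mat 1"
  using matrix_compose[OF L(1) L'(1)] L'(2) by (simp add: o_def matrix_id_mat_1[symmetric] id_def)
 hence dd: "det (matrix L') * det (matrix L) = 1" by (metis det_I det_mul)
 have "?H (L' ` L ` A) <= ennreal \<bar>det (matrix L')\<bar> * ?H (L ` A)"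
 proof (rule hausdorff_linear_image_le[OF L'(1) _ _ _ v])
  show "det (matrix L') ~= 0" using dd by auto
  show "L' v = v" using L'(2)[of v] L(4) by simp
  fix x :: "real^'n" assume x: "x \<bullet> v = 0"
  define y where "y = L' x - (L' x \<bullet> v) *\<^sub>R v"
  have "y \<bullet> v = 0" using v by (simp add: y_def inner_diff_left norm_eq_1)
  hence "L y \<bullet> v = 0" by (rule L(3))
  moreover have "L y = x - (L' x \<bullet> v) *\<^sub>R v" by (simp add: y_def linear_diff[OF L(1)] linear_cmul[OF L(1)] L(4) L'(3))
  ultimately show "L' x \<bullet> v = 0" using x v by (auto simp: inner_diff_left norm_eq_1)
 qed (use L(3) A in auto)
 hence "?H A <= ennreal \<bar>det (matrix L')\<bar> * ?H (L ` A)" by (simp add: image_image L'(2))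
 hence "ennreal \<bar>det (matrix L)\<bar> * ?H A <= ennreal \<bar>det (matrix L)\<bar> * (ennreal \<bar>det (matrix L')\<bar> * ?H (L ` A))"
  by (rule mult_left_mono) simp
 also have "... = ennreal \<bar>det (matrix L') * det (matrix L)\<bar> * ?H (L ` A)"
  by (simp add: ennreal_mult abs_mult mult.assoc mult.commute mult.left_commute)
 finally show "ennreal \<bar>det (matrix L)\<bar> * ?H A <= ?H (L ` A)" by (simp add: dd)
qed

text \<open>A rotation taking \<open>a\<close> to an axis vector makes the map diagonal. With
  \<open>s = 1 / d - 1\<close> it is the stretch applied where the curvature vanishes.\<close>

lemma det_stretch:
 fixes a :: "real^'n::finite"
 assumes a: "norm a = 1"
 shows "det (matrix (%v. v + (s * (v \<bullet> a)) *\<^sub>R a)) = 1 + s"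
proof -
 obtain i0 :: 'n where True by blast
 have "norm a = norm (axis i0 1 :: real^'n)" using a by simp
 from orth_exists[OF this] obtain R :: "real^'n => real^'n" where R: "orthogonal_transformation R" "R a = axis i0 1" by blast
 define R' where "R' = inv R"
 have RR: "R (R' x) = x" "R' (R x) = x" for x
  using orthogonal_transformation_bij[OF R(1)] unfolding R'_def by (simp_all add: bij_is_surj surj_f_inv_f bij_is_inj)
 have linR: "linear R" "linear R'"
  using R(1) orthogonal_transformation_inv[OF R(1)] by (auto simp: R'_def orthogonal_transformation_linear)
 define D where "D = (%w::real^'n. \<chi> i. (if i = i0 then 1 + s else 1) * w $ i)"
 have linD: "linear D" by (intro linearI) (auto simp: D_def vec_eq_iff algebra_simps)
 have Deq: "D w = w + (s * w $ i0) *\<^sub>R axis i0 1" for w by (auto simp: D_def vec_eq_iff axis_def algebra_simps)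
 have R'ax: "R' (axis i0 1) = a" using RR(2)[of a] R(2) by simp
 have "R v $ i0 = v \<bullet> a" for v
 proof -
  have "R v \<bullet> R a = v \<bullet> a" using R(1) by (simp add: orthogonal_transformation_def)
  thus ?thesis by (simp add: R(2) inner_axis)
 qed
 hence eq: "(%v. v + (s * (v \<bullet> a)) *\<^sub>R a) = R' \<circ> (D \<circ> R)"
  by (auto simp: fun_eq_iff Deq linear_add[OF linR(2)] linear_cmul[OF linR(2)] RR R'ax)
 have "matrix (R' \<circ> (D \<circ> R)) = matrix R' ** (matrix D ** matrix R)"
  using matrix_compose[OF linear_compose[OF linR(1) linD] linR(2)] matrix_compose[OF linR(1) linD] by simp
 moreover have "matrix R' ** matrix R = mat 1"
  using matrix_compose[OF linR] RR(2) by (simp add: o_def matrix_id_mat_1[symmetric] id_def)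
 hence "det (matrix R') * det (matrix R) = 1" by (metis det_I det_mul)
 moreover have "det (matrix D) = 1 + s"
 proof -
  have "det (matrix D) = (\<Prod>i\<in>UNIV. matrix D $ i $ i)" by (rule det_diagonal) (auto simp: matrix_def D_def axis_def)
  also have "... = (\<Prod>i\<in>UNIV. if i = i0 then 1 + s else 1)" by (intro prod.cong) (auto simp: matrix_def D_def axis_def)
  finally show ?thesis by simp
 qed
 ultimately show ?thesis unfolding eq by (simp add: det_mul algebra_simps)
qed

subsection \<open>The Gauss map of a level set\<close>

lemma Ck_on_sqrt: "Ck_on k {0<..} sqrt"
proof (induction k)
 case 0 thus ?case by (auto intro!: continuous_intros)
next
 case (Suc k)
 show ?case
 proof (rule Ck_on_SucI[where g' = "%x v. inverse (2 * sqrt x) * v"])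
  fix x :: real assume "x \<in> {0<..}"
  thus "(sqrt has_derivative (%v. inverse (2 * sqrt x) * v)) (at x)"
  proof -
   have "inverse (sqrt x) / 2 = inverse (2 * sqrt x)" by simp
   thus ?thesis using DERIV_real_sqrt[of x] \<open>x \<in> {0<..}\<close> by (simp only: has_field_derivative_def greaterThan_iff)
  qed
 next
  show "Ck_on k {0<..} (%x. inverse (2 * sqrt x) * v)" for v
   by (intro Ck_on_mult Ck_on_inverse Ck_on_const Suc) auto
 qed auto
qed

lemma Ck_on_norm:
 assumes "open U" "Ck_on k U g" "!!x. x \<in> U ==> g x ~= 0"
 shows "Ck_on k U (%x. norm (g x :: 'b::euclidean_space))"
 unfolding norm_eq_sqrt_inner
 by (rule Ck_on_compose[OF assms(1) _ _ Ck_on_sqrt]) (use assms in \<open>auto intro: Ck_on_inner\<close>)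

lemma Ck_on_grad:
 assumes "Ck_on (Suc k) U f" "open U" shows "Ck_on k U (grad f)"
 unfolding grad_def[abs_def]
 by (intro Ck_on_sum Ck_on_scaleR Ck_on_const assms) (use assms(1) in simp)

lemma grad_has_derivative:
 fixes f :: "'a::euclidean_space => real"
 assumes "f differentiable (at x)" shows "(f has_derivative (%v. grad f x \<bullet> v)) (at x)"
proof -
 have d: "(f has_derivative frechet_derivative f (at x)) (at x)" using assms frechet_derivative_works by blast
 have "frechet_derivative f (at x) v = grad f x \<bullet> v" for v
  unfolding grad_def inner_sum_left
  using linear_eq_sum_Basis[OF has_derivative_linear[OF d], of v] by (simp add: inner_commute mult.commute)
 thus ?thesis using d by presburger
qed

locale level_sets =
 fixes f :: "real^'n::finite => real"
 assumes f2: "Ck_on 2 UNIV f" and nocrit: "grad f x ~= 0"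
begin

abbreviation "HH \<equiv> \<H> (CARD('n) - 1) :: (real^'n) set => ennreal"
abbreviation "\<nu> \<equiv> gauss_map f"
definition "\<nu>' x = frechet_derivative (gauss_map f) (at x)"

lemma grad_C1: "Ck_on 1 UNIV (grad f)"
 using Ck_on_grad[of 1 UNIV f] f2 by (simp add: numeral_2_eq_2)

lemma f_derivative: "(f has_derivative (%v. grad f x \<bullet> v)) (at x)"
 by (rule grad_has_derivative) (use f2 in \<open>simp add: numeral_2_eq_2\<close>)

lemma \<nu>_C1: "Ck_on 1 UNIV \<nu>"
 unfolding gauss_map_def[abs_def]
 by (intro Ck_on_scaleR Ck_on_inverse Ck_on_norm grad_C1 open_UNIV) (use nocrit in auto)

lemma \<nu>_derivative: "(\<nu> has_derivative \<nu>' x) (at x)"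
 unfolding \<nu>'_def using Ck_on_has_derivative[of 0 UNIV \<nu> x] \<nu>_C1 by simp

lemma \<nu>'_linear: "linear (\<nu>' x)"
 using \<nu>_derivative has_derivative_linear by blast

lemma \<nu>'_continuous: "continuous_on UNIV (%x. \<nu>' x v)"
proof -
 have "(%x. \<nu>' x v) = (%x. \<Sum>b\<in>Basis. (v \<bullet> b) *\<^sub>R \<nu>' x b)"
  using linear_eq_sum_Basis[OF \<nu>'_linear] by blast
 moreover have "continuous_on UNIV (%x. \<nu>' x b)" if "b \<in> Basis" for b
  using \<nu>_C1 that by (simp add: \<nu>'_def)
 ultimately show ?thesis by (simp only:) (intro continuous_intros)
qed

lemma \<nu>_continuous: "continuous_on UNIV \<nu>"
 using Ck_on_continuous[OF \<nu>_C1] .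

lemma f_continuous: "continuous_on UNIV f"
 using Ck_on_continuous[OF f2] .

lemma norm_\<nu> [simp]: "norm (\<nu> x) = 1"
 using nocrit[of x] by (simp add: gauss_map_def)

lemma \<nu>_self [simp]: "\<nu> x \<bullet> \<nu> x = 1"
 by (metis norm_\<nu> norm_eq_1)

lemma \<nu>_tangent: "\<nu> x \<bullet> \<nu>' x v = 0"
proof -
 have 1: "((%x. \<nu> x \<bullet> \<nu> x) has_derivative (%v. \<nu> x \<bullet> \<nu>' x v + \<nu>' x v \<bullet> \<nu> x)) (at x)"
  by (rule has_derivative_inner[OF \<nu>_derivative \<nu>_derivative])
 have 2: "((%x. \<nu> x \<bullet> \<nu> x) has_derivative (%v. 0)) (at x)" by simp
 have "\<nu> x \<bullet> \<nu>' x v + \<nu>' x v \<bullet> \<nu> x = 0" using has_derivative_unique[OF 1 2] by metis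
 thus ?thesis by (simp add: inner_commute)
qed

text \<open>The Weingarten map, extended by the identity on the normal line, so that its determinant
  is the curvature and \<open>hausdorff_linear_image_outer\<close> applies with the normal as fixed
  vector.\<close>

definition "shape x v = \<nu>' x (v - (v \<bullet> \<nu> x) *\<^sub>R \<nu> x) + (v \<bullet> \<nu> x) *\<^sub>R \<nu> x"

lemma gauss_curv_eq: "gauss_curv f x = det (matrix (shape x))"
 unfolding gauss_curv_def shape_def[abs_def] \<nu>'_def Let_def ..

lemma shape_linear: "linear (shape x)"
 unfolding shape_def[abs_def]
 by (intro linearI)
  (simp_all add: inner_add_left algebra_simps linear_add[OF \<nu>'_linear] linear_diff[OF \<nu>'_linear] linear_cmul[OF \<nu>'_linear])

lemma shape_normal: "shape x (\<nu> x) = \<nu> x"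
 by (simp add: shape_def linear_0[OF \<nu>'_linear])

lemma shape_tangent: "v \<bullet> \<nu> x = 0 ==> shape x v = \<nu>' x v" "v \<bullet> \<nu> x = 0 ==> shape x v \<bullet> \<nu> x = 0"
 using \<nu>_tangent[of x] by (auto simp: shape_def inner_commute)

lemma gauss_curv_continuous: "continuous_on UNIV (gauss_curv f)"
proof -
 have c: "continuous_on UNIV (%x. shape x v)" for v
 proof -
  have "(%x. shape x v) = (%x. \<nu>' x v - (v \<bullet> \<nu> x) *\<^sub>R \<nu>' x (\<nu> x) + (v \<bullet> \<nu> x) *\<^sub>R \<nu> x)"
   by (auto simp: shape_def linear_diff[OF \<nu>'_linear] linear_cmul[OF \<nu>'_linear])
  moreover have "(%x. \<nu>' x (\<nu> x)) = (%x. \<Sum>b\<in>Basis. (\<nu> x \<bullet> b) *\<^sub>R \<nu>' x b)"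
   using linear_eq_sum_Basis[OF \<nu>'_linear] by blast
  hence "continuous_on UNIV (%x. \<nu>' x (\<nu> x))"
   by (simp only:) (intro continuous_intros \<nu>_continuous \<nu>'_continuous)
  ultimately show ?thesis by (simp only:) (intro continuous_intros \<nu>_continuous \<nu>'_continuous)
 qed
 have "gauss_curv f = (%x. \<Sum>p\<in>{p. p permutes UNIV}. of_int (sign p) * (\<Prod>i\<in>UNIV. shape x (axis (p i) 1) $ i))"
  by (auto simp: gauss_curv_eq det_def matrix_def)
 thus ?thesis by (simp only:) (intro continuous_intros c)
qed

section \<open>Distortion of area by the Gauss map\<close>

definition "proj x v = v - (v \<bullet> \<nu> x) *\<^sub>R \<nu> x"

lemma proj_linear: "linear (proj x)"
 unfolding proj_def[abs_def] by (intro linearI) (simp_all add: inner_add_left algebra_simps)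

lemma proj_normal: "proj x v \<bullet> \<nu> x = 0"
 by (simp add: proj_def inner_diff_left)

lemma norm_proj: "(norm (proj x v))\<^sup>2 = (norm v)\<^sup>2 - (v \<bullet> \<nu> x)\<^sup>2"
 unfolding proj_def power2_norm_eq_inner
 by (simp add: inner_diff_left inner_diff_right inner_commute power2_eq_square algebra_simps)

lemma norm_proj_le: "norm (proj x v) <= norm v"
 by (rule power2_le_imp_le) (auto simp: norm_proj)

lemma norm_proj_ge:
 assumes "\<bar>v \<bullet> \<nu> x\<bar> <= e * norm v" "e \<ge> 0" shows "(1 - e) * norm v <= norm (proj x v)"
proof -
 have "norm v <= norm (proj x v) + norm ((v \<bullet> \<nu> x) *\<^sub>R \<nu> x)"
  unfolding proj_def by (metis diff_add_cancel norm_triangle_ineq)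
 also have "norm ((v \<bullet> \<nu> x) *\<^sub>R \<nu> x) = \<bar>v \<bullet> \<nu> x\<bar>" by simp
 finally show ?thesis using assms by (simp add: algebra_simps)
qed

text \<open>On a level the first-order term of \<open>f\<close> must nearly vanish, so a short chord
  is almost tangent at \<open>x\<close>, even if it belongs to a neighbouring level. The derivative
  of the Gauss map may then be replaced by the shape operator on the tangential part.\<close>

lemma level_local:
 assumes e: "e > 0"
 shows "\<exists>\<delta>>0. \<forall>z1\<in>ball x \<delta>. \<forall>z2\<in>ball x \<delta>. f z1 = f z2 -->
   \<bar>(z2 - z1) \<bullet> \<nu> x\<bar> <= e * norm (z2 - z1) \<and>
   norm (\<nu> z2 - \<nu> z1 - shape x (proj x (z2 - z1))) <= e * norm (z2 - z1)"
proof -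
 let ?g = "norm (grad f x)"
 have g: "?g > 0" using nocrit[of x] by simp
 define B where "B = norm (\<nu>' x (\<nu> x)) + 1"
 have B: "B > 0" unfolding B_def by (simp add: add_nonneg_pos)
 \<comment> \<open>Besides the linearisation error of \<open>\<nu>\<close>, the normal component of
   the chord contributes up to \<open>B\<close> times its size; \<open>e1\<close> keeps this below e
   / 2 times the chord.\<close>
 define e1 where "e1 = min e (e / (2 * B))"
 have e1: "e1 > 0" "e1 <= e" using e B by (auto simp: e1_def)
 have "\<exists>\<delta>>0. \<forall>z\<in>{x}. \<forall>z1 z2. dist z1 z < \<delta> --> dist z2 z < \<delta> -->
   norm (f z2 - f z1 - grad f z \<bullet> (z2 - z1)) <= (e1 * ?g) * norm (z2 - z1)"
 proof (rule C1_uniform_differentiability)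
  show "(f has_derivative (%v. grad f z \<bullet> v)) (at z)" for z by (rule f_derivative)
  show "continuous_on UNIV (%z. grad f z \<bullet> v)" for v
   by (intro continuous_intros Ck_on_continuous[OF grad_C1])
 qed (use e1 g in auto)
 then obtain \<delta>1 where \<delta>1: "\<delta>1 > 0" "!!z1 z2. dist z1 x < \<delta>1 ==> dist z2 x < \<delta>1 ==>
   norm (f z2 - f z1 - grad f x \<bullet> (z2 - z1)) <= (e1 * ?g) * norm (z2 - z1)" by auto
 have "\<exists>\<delta>>0. \<forall>z\<in>{x}. \<forall>z1 z2. dist z1 z < \<delta> --> dist z2 z < \<delta> -->
   norm (\<nu> z2 - \<nu> z1 - \<nu>' z (z2 - z1)) <= (e / 2) * norm (z2 - z1)"
  by (rule C1_uniform_differentiability[OF \<nu>_derivative \<nu>'_continuous]) (use e in auto)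
 then obtain \<delta>2 where \<delta>2: "\<delta>2 > 0" "!!z1 z2. dist z1 x < \<delta>2 ==> dist z2 x < \<delta>2 ==>
   norm (\<nu> z2 - \<nu> z1 - \<nu>' x (z2 - z1)) <= (e / 2) * norm (z2 - z1)" by auto
 have "\<bar>(z2 - z1) \<bullet> \<nu> x\<bar> <= e * norm (z2 - z1) \<and>
   norm (\<nu> z2 - \<nu> z1 - shape x (proj x (z2 - z1))) <= e * norm (z2 - z1)"
  if z: "z1 \<in> ball x (min \<delta>1 \<delta>2)" "z2 \<in> ball x (min \<delta>1 \<delta>2)" "f z1 = f z2" for z1 z2
 proof -
  define w where "w = z2 - z1"
  have zd: "dist z1 x < \<delta>1" "dist z2 x < \<delta>1" "dist z1 x < \<delta>2" "dist z2 x < \<delta>2" using z by (auto simp: dist_commute)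
  have "\<bar>grad f x \<bullet> w\<bar> <= (e1 * ?g) * norm w" using \<delta>1(2)[OF zd(1,2)] z(3) by (simp add: w_def)
  moreover have "grad f x \<bullet> w = ?g * (w \<bullet> \<nu> x)" using g by (simp add: gauss_map_def inner_commute)
  ultimately have "?g * \<bar>w \<bullet> \<nu> x\<bar> <= ?g * (e1 * norm w)" using g by (simp add: abs_mult mult.commute mult.left_commute)
  hence n1: "\<bar>w \<bullet> \<nu> x\<bar> <= e1 * norm w" using g by (simp add: mult_le_cancel_left)
  have "shape x (proj x w) = \<nu>' x (proj x w)" by (rule shape_tangent(1)[OF proj_normal])
  also have "... = \<nu>' x w - (w \<bullet> \<nu> x) *\<^sub>R \<nu>' x (\<nu> x)"
   by (simp add: proj_def linear_diff[OF \<nu>'_linear] linear_cmul[OF \<nu>'_linear])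
  finally have "\<nu> z2 - \<nu> z1 - shape x (proj x w) = (\<nu> z2 - \<nu> z1 - \<nu>' x w) + (w \<bullet> \<nu> x) *\<^sub>R \<nu>' x (\<nu> x)" by simp
  hence "norm (\<nu> z2 - \<nu> z1 - shape x (proj x w)) <= norm (\<nu> z2 - \<nu> z1 - \<nu>' x w) + \<bar>w \<bullet> \<nu> x\<bar> * norm (\<nu>' x (\<nu> x))"
   by (metis norm_scaleR norm_triangle_ineq)
  also have "... <= (e / 2) * norm w + (e1 * norm w) * B"
   using \<delta>2(2)[OF zd(3,4)] n1 by (intro add_mono mult_mono) (auto simp: w_def B_def)
  also have "... <= (e / 2) * norm w + (e / 2) * norm w"
  proof -
   have "e1 * B <= e / (2 * B) * B" unfolding e1_def using B by (intro mult_right_mono) auto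
   hence "e1 * B <= e / 2" using B by simp
   hence "e1 * B * norm w <= e / 2 * norm w" by (intro mult_right_mono) auto
   thus ?thesis by (simp add: mult.commute mult.left_commute)
  qed
  also have "... = e * norm w" by simp
  finally show ?thesis using n1 mult_right_mono[OF e1(2), of "norm w"] by (simp add: w_def)
 qed
 thus ?thesis using \<delta>1(1) \<delta>2(1) by (intro exI[of _ "min \<delta>1 \<delta>2"]) auto
qed

lemma hausdorff_proj_le: "HH (proj x ` B) <= HH B"
 using hausdorff_outer_lipschitz[of 1 B "proj x" "CARD('n) - 1"] norm_proj_le
 by (simp add: dist_norm linear_diff[OF proj_linear, symmetric])

text \<open>The value of \<open>h\<close> determines that of \<open>g\<close>, in a Lipschitz way,
  so the bound is the one for Lipschitz images.\<close>

lemma hausdorff_le_of_expanding: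
 fixes g h :: "real^'n => real^'n"
 assumes K: "K > 0" and e: "!!x y. x \<in> B ==> y \<in> B ==> norm (g x - g y) <= K * norm (h x - h y)"
 shows "HH (g ` B) <= ennreal (K ^ (CARD('n) - 1)) * HH (h ` B)"
proof -
 define s where "s y = (SOME x. x \<in> B \<and> h x = y)" for y
 have s: "s y \<in> B" "h (s y) = y" if "y \<in> h ` B" for y
  using someI_ex[of "%x. x \<in> B \<and> h x = y"] that unfolding s_def by auto
 have "g ` B = (%y. g (s y)) ` h ` B"
 proof -
  have "g x = g (s (h x))" if "x \<in> B" for x
  proof -
   have "norm (g x - g (s (h x))) <= K * norm (h x - h (s (h x)))" using that s by (intro e) auto
   thus ?thesis using s[of "h x"] that by simp
  qed
  thus ?thesis by (auto simp: image_image)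
 qed
 moreover have "HH ((%y. g (s y)) ` h ` B) <= ennreal (K ^ (CARD('n) - 1)) * HH (h ` B)"
 proof (rule hausdorff_outer_lipschitz[OF K])
  fix a b assume "a \<in> h ` B" "b \<in> h ` B"
  thus "dist (g (s a)) (g (s b)) <= K * dist a b"
   using e[OF s(1) s(1), of a b] s(2) by (simp add: dist_norm)
 qed
 ultimately show ?thesis by simp
qed

lemma exists_near_one_power:
 assumes "C > (1::real)" shows "\<exists>q>1. q ^ k <= C"
proof -
 define q where "q = C powr (1 / real (Suc k))"
 have "q > 1" using assms by (simp add: q_def)
 moreover have "q ^ k = C powr (1 / real (Suc k) * real k)"
  using assms by (simp add: q_def powr_powr powr_realpow[symmetric])
 moreover have "... <= C powr 1" using assms by (intro powr_mono) auto
 ultimately show ?thesis using assms by (intro exI[of _ q]) auto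
qed

text \<open>On one level near \<open>x\<close>, the length of a chord is comparable with that of its
  tangential projection, and the change of \<open>\<nu>\<close> with the shape operator on that
  projection, both up to a factor \<open>q\<close>. Each comparison costs \<open>q ^ ?m\<close> in
  measure and at most two are chained; the linear map contributes its determinant, the curvature.
  The radius serves all levels at once.\<close>

lemma curv_local_nonzero:
 assumes k: "gauss_curv f x ~= 0" and C: "C > 1"
 shows "\<exists>\<delta>>0. (\<forall>z1\<in>ball x \<delta>. \<forall>z2\<in>ball x \<delta>. f z1 = f z2 \<and> \<nu> z1 = \<nu> z2 --> z1 = z2) \<and>
  (\<forall>t B. B \<subseteq> ball x \<delta> \<inter> f -` {t} -->
   HH (\<nu> ` B) <= ennreal (C * \<bar>gauss_curv f x\<bar>) * HH B \<and> ennreal \<bar>gauss_curv f x\<bar> * HH B <= ennreal C * HH (\<nu> ` B))"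
proof -
 let ?m = "CARD('n) - 1" and ?M = "shape x" and ?k = "\<bar>gauss_curv f x\<bar>"
 obtain q where q: "q > 1" "q ^ (2 * ?m) <= C" using exists_near_one_power[OF C] by blast
 have "inj ?M" using k det_nz_iff_inj[OF shape_linear] by (simp add: gauss_curv_eq)
 then obtain c where c: "c > 0" "!!v. c * norm v <= norm (?M v)"
  using linear_inj_bounded_below_pos[OF shape_linear] by (metis mult.commute)
 \<comment> \<open>The first bound makes the chord comparable with its projection; the second makes
   the error small against the shape operator, whose lower bound is \<open>c\<close>.\<close>
 define e where "e = (1 - 1 / q) * min 1 (c / q)"
 have e: "e > 0" using q c by (simp add: e_def)
 have e1: "e <= 1 - 1 / q" using q unfolding e_def by (intro mult_left_le) auto
 have e2: "e * q / c <= 1 - 1 / q"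
 proof -
  have "e <= (1 - 1 / q) * (c / q)" unfolding e_def using q by (intro mult_left_mono) auto
  thus ?thesis using q c by (simp add: field_simps)
 qed
 obtain \<delta> where \<delta>: "\<delta> > 0" "!!z1 z2. z1 \<in> ball x \<delta> ==> z2 \<in> ball x \<delta> ==> f z1 = f z2 ==>
   \<bar>(z2 - z1) \<bullet> \<nu> x\<bar> <= e * norm (z2 - z1) \<and>
   norm (\<nu> z2 - \<nu> z1 - ?M (proj x (z2 - z1))) <= e * norm (z2 - z1)"
  using level_local[OF e, of x] by metis
 have est: "norm (z2 - z1) <= q * norm (proj x (z2 - z1))"
  "norm (\<nu> z2 - \<nu> z1) <= q * norm (?M (proj x (z2 - z1)))"
  "norm (?M (proj x (z2 - z1))) <= q * norm (\<nu> z2 - \<nu> z1)"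
  if z: "z1 \<in> ball x \<delta>" "z2 \<in> ball x \<delta>" "f z1 = f z2" for z1 z2
 proof -
  define w where "w = z2 - z1"
  define a where "a = norm (?M (proj x w))"
  note * = \<delta>(2)[OF z, folded w_def]
  have "(1 / q) * norm w <= (1 - e) * norm w" using e1 by (intro mult_right_mono) auto
  also have "... <= norm (proj x w)" using * e by (intro norm_proj_ge) auto
  finally have w1: "norm w <= q * norm (proj x w)" using q by (simp add: field_simps)
  thus "norm (z2 - z1) <= q * norm (proj x (z2 - z1))" by (simp add: w_def)
  have ca: "c * norm (proj x w) <= a" using c(2) by (simp add: a_def)
  have "e * norm w <= e * (q * norm (proj x w))" using w1 e by (intro mult_left_mono) auto
  also have "... = (e * q / c) * (c * norm (proj x w))" using c by simp
  also have "... <= (1 - 1 / q) * a" using e2 ca q c by (intro mult_mono) auto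
  finally have ew: "e * norm w <= (1 - 1 / q) * a" .
  have n: "norm (\<nu> z2 - \<nu> z1) <= a + e * norm w" "a <= norm (\<nu> z2 - \<nu> z1) + e * norm w"
   using * norm_triangle_sub[of "\<nu> z2 - \<nu> z1" "?M (proj x w)"] norm_triangle_sub[of "?M (proj x w)" "\<nu> z2 - \<nu> z1"]
   by (auto simp: a_def norm_minus_commute)
  have a0: "a \<ge> 0" by (simp add: a_def)
  have "1 + (1 - 1 / q) <= q"
  proof -
   have "(q - 1) * (q - 1) \<ge> 0" by simp
   thus ?thesis using q by (simp add: field_simps)
  qed
  hence "(1 + (1 - 1 / q)) * a <= q * a" using a0 by (intro mult_right_mono) auto
  hence "norm (\<nu> z2 - \<nu> z1) <= q * a" using n(1) ew by (simp add: algebra_simps)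
  thus "norm (\<nu> z2 - \<nu> z1) <= q * norm (?M (proj x (z2 - z1)))" by (simp add: a_def w_def)
  have "a / q <= norm (\<nu> z2 - \<nu> z1)" using n(2) ew by (simp add: algebra_simps)
  hence "a <= q * norm (\<nu> z2 - \<nu> z1)" using q by (simp add: field_simps)
  thus "norm (?M (proj x (z2 - z1))) <= q * norm (\<nu> z2 - \<nu> z1)" by (simp add: a_def w_def)
 qed
 have inj: "z1 = z2" if z: "z1 \<in> ball x \<delta>" "z2 \<in> ball x \<delta>" "f z1 = f z2" "\<nu> z1 = \<nu> z2" for z1 z2
 proof -
  have "norm (?M (proj x (z2 - z1))) <= 0" using est(3)[OF z(1-3)] z(4) by simp
  hence "c * norm (proj x (z2 - z1)) <= 0" using c(2)[of "proj x (z2 - z1)"] by linarith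
  hence "norm (proj x (z2 - z1)) = 0" using c(1) by (metis antisym mult_le_0_iff norm_ge_zero not_le)
  thus ?thesis using est(1)[OF z(1-3)] by simp
 qed
 have "HH (\<nu> ` B) <= ennreal (C * ?k) * HH B \<and> ennreal ?k * HH B <= ennreal C * HH (\<nu> ` B)"
  if B: "B \<subseteq> ball x \<delta> \<inter> f -` {t}" for t B
 proof -
  have Bz: "z1 \<in> ball x \<delta>" "z2 \<in> ball x \<delta>" "f z1 = f z2" if "z1 \<in> B" "z2 \<in> B" for z1 z2 using B that by auto
  have q0: "q > 0" using q by simp
  have MP: "HH ((%z. ?M (proj x z)) ` B) = ennreal ?k * HH (proj x ` B)"
  proof -
   have "HH (?M ` (proj x ` B)) = ennreal \<bar>det (matrix ?M)\<bar> * HH (proj x ` B)"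
    by (rule hausdorff_linear_image_outer[OF shape_linear _ shape_tangent(2) shape_normal norm_\<nu>])
     (use k in \<open>auto simp: gauss_curv_eq proj_normal\<close>)
   thus ?thesis by (simp add: gauss_curv_eq image_image)
  qed
  have qm: "q ^ ?m <= C" "q ^ ?m * q ^ ?m <= C"
  proof -
   show 1: "q ^ ?m * q ^ ?m <= C" using q(2) by (simp add: power_add[symmetric] mult_2)
   have "q ^ ?m * 1 <= q ^ ?m * q ^ ?m" using q by (intro mult_left_mono) auto
   thus "q ^ ?m <= C" using 1 by simp
  qed
  have "HH (\<nu> ` B) <= ennreal (q ^ ?m) * HH ((%z. ?M (proj x z)) ` B)"
  proof (rule hausdorff_le_of_expanding[OF q0])
   fix z2 z1 assume "z2 \<in> B" "z1 \<in> B"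
   thus "norm (\<nu> z2 - \<nu> z1) <= q * norm (?M (proj x z2) - ?M (proj x z1))"
    using est(2)[OF Bz, of z1 z2] by (simp add: linear_diff[OF shape_linear] linear_diff[OF proj_linear])
  qed
  also have "... <= ennreal (q ^ ?m) * (ennreal ?k * HH B)"
   unfolding MP by (intro mult_left_mono hausdorff_proj_le) auto
  also have "... = ennreal (q ^ ?m * ?k) * HH B" using q0 by (simp add: ennreal_mult mult.assoc)
  also have "... <= ennreal (C * ?k) * HH B" using qm by (intro mult_right_mono ennreal_leI mult_right_mono) auto
  finally have 1: "HH (\<nu> ` B) <= ennreal (C * ?k) * HH B" .
  have "HH ((%z. z) ` B) <= ennreal (q ^ ?m) * HH (proj x ` B)"
  proof (rule hausdorff_le_of_expanding[OF q0])
   fix z2 z1 assume "z2 \<in> B" "z1 \<in> B"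
   thus "norm (z2 - z1) <= q * norm (proj x z2 - proj x z1)"
    using est(1)[OF Bz, of z1 z2] by (simp add: linear_diff[OF proj_linear])
  qed
  hence "ennreal ?k * HH B <= ennreal ?k * (ennreal (q ^ ?m) * HH (proj x ` B))" by (intro mult_left_mono) auto
  also have "... = ennreal (q ^ ?m) * HH ((%z. ?M (proj x z)) ` B)" unfolding MP by (simp only: ac_simps)
  also have "... <= ennreal (q ^ ?m) * (ennreal (q ^ ?m) * HH (\<nu> ` B))"
  proof (intro mult_left_mono hausdorff_le_of_expanding[OF q0])
   fix z2 z1 assume "z2 \<in> B" "z1 \<in> B"
   thus "norm (?M (proj x z2) - ?M (proj x z1)) <= q * norm (\<nu> z2 - \<nu> z1)"
    using est(3)[OF Bz, of z1 z2] by (simp add: linear_diff[OF shape_linear] linear_diff[OF proj_linear])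
  qed auto
  also have "... = ennreal (q ^ ?m * q ^ ?m) * HH (\<nu> ` B)" using q0 by (simp add: ennreal_mult mult.assoc)
  also have "... <= ennreal C * HH (\<nu> ` B)" using qm by (intro mult_right_mono ennreal_leI) auto
  finally show ?thesis using 1 by blast
 qed
 thus ?thesis using \<delta>(1) inj by (intro exI[of _ \<delta>]) blast
qed

text \<open>If the curvature vanishes, the image of the shape operator is orthogonal to some tangent vector \<open>a\<close>; stretching by
 \<open>1/d\<close> along \<open>a\<close> keeps the Gauss map Lipschitz, so its image has measure \<open>O(d)\<close>.\<close>

lemma curv_local_zero:
 assumes k: "gauss_curv f x = 0" and e: "e > 0"
 shows "\<exists>\<delta>>0. \<forall>t B. B \<subseteq> ball x \<delta> \<inter> f -` {t} --> HH (\<nu> ` B) <= ennreal e * HH B"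
proof -
 let ?m = "CARD('n) - 1" and ?M = "shape x" and ?n = "\<nu> x"
 have "\<not> inj ?M" using k det_nz_iff_inj[OF shape_linear, of x] by (simp add: gauss_curv_eq)
 then obtain a0 where a0: "a0 ~= 0" "!!v. a0 \<bullet> ?M v = 0"
  using linear_singular_into_hyperplane[OF shape_linear, of x] by blast
 define a where "a = a0 /\<^sub>R norm a0"
 have a: "norm a = 1" "!!v. ?M v \<bullet> a = 0" using a0 by (auto simp: a_def inner_commute)
 have an: "?n \<bullet> a = 0" using a(2)[of ?n] by (simp add: shape_normal)
 have blM: "bounded_linear ?M" using shape_linear linear_conv_bounded_linear by blast
 obtain B0 where B0: "B0 > 0" "!!v. norm (?M v) <= norm v * B0" using bounded_linear.pos_bounded[OF blM] by blast
 define K where "K = B0 + 1"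
 \<comment> \<open>The final bound has three factors: \<open>d\<close> from undoing the stretch,
   \<open>K ^ ?m\<close> from the Lipschitz constant of the stretched map, and \<open>2 ^ ?m\<close>
   from recovering the Gauss map from its tangential projection.\<close>
 define d where "d = min 1 (e / (2 ^ ?m * K ^ ?m))"
 have K: "K > 0" using B0 by (simp add: K_def)
 have d: "d > 0" "d <= 1" using e K by (auto simp: d_def)
 have dK: "2 ^ ?m * (d * K ^ ?m) <= e"
 proof -
  have p: "2 ^ ?m * K ^ ?m > 0" using K by simp
  have "d <= e / (2 ^ ?m * K ^ ?m)" by (simp only: d_def min.cobounded2)
  hence "d * (2 ^ ?m * K ^ ?m) <= e" using p by (simp only: pos_le_divide_eq)
  thus ?thesis by (simp only: ac_simps)
 qed
 define S where "S v = v + ((1 / d - 1) * (v \<bullet> a)) *\<^sub>R a" for v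
 have linS: "linear S" unfolding S_def[abs_def] by (intro linearI) (auto simp: inner_add_left algebra_simps)
 have detS: "det (matrix S) = 1 / d" unfolding S_def[abs_def] using det_stretch[OF a(1), of "1 / d - 1"] by simp
 have S1: "S v = v" if "v \<bullet> a = 0" for v using that by (simp add: S_def)
 have S2: "S v \<bullet> ?n = v \<bullet> ?n" for v using an by (simp add: S_def inner_add_left inner_commute[of a])
 have S3: "norm (S v) <= (1 / d) * norm v" for v
 proof -
  have d1: "1 / d - 1 \<ge> 0" using d by simp
  have "norm (S v) <= norm v + norm (((1 / d - 1) * (v \<bullet> a)) *\<^sub>R a)" unfolding S_def by (rule norm_triangle_ineq)
  also have "... = norm v + (1 / d - 1) * \<bar>v \<bullet> a\<bar>" using a(1) d1 by (simp add: abs_mult)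
  also have "... <= norm v + (1 / d - 1) * norm v"
   using Cauchy_Schwarz_ineq2[of v a] a(1) d1 by (intro add_left_mono mult_left_mono) auto
  finally show ?thesis by (simp add: algebra_simps)
 qed
 obtain \<delta>1 where \<delta>1: "\<delta>1 > 0" "!!z1 z2. z1 \<in> ball x \<delta>1 ==> z2 \<in> ball x \<delta>1 ==> f z1 = f z2 ==>
   norm (\<nu> z2 - \<nu> z1 - ?M (proj x (z2 - z1))) <= d * norm (z2 - z1)"
  using level_local[OF d(1), of x] by metis
 have "isCont \<nu> x" using \<nu>_continuous by (simp add: continuous_on_eq_continuous_at)
 then obtain \<delta>2 where \<delta>2: "\<delta>2 > 0" "!!z. dist z x < \<delta>2 ==> dist (\<nu> z) ?n < 1/2"
  unfolding continuous_at_eps_delta by (metis half_gt_zero zero_less_one)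
 have "HH (\<nu> ` B) <= ennreal e * HH B" if B: "B \<subseteq> ball x (min \<delta>1 \<delta>2) \<inter> f -` {t}" for t B
 proof -
  define G where "G z = S (proj x (\<nu> z))" for z
  have Bz: "z1 \<in> ball x \<delta>1" "z2 \<in> ball x \<delta>1" "f z1 = f z2" "dist z1 x < \<delta>2" "dist z2 x < \<delta>2"
   if "z1 \<in> B" "z2 \<in> B" for z1 z2 using B that by (auto simp: dist_commute)
  have "HH (G ` B) <= ennreal (K ^ ?m) * HH B"
  proof (rule hausdorff_outer_lipschitz[OF K])
   fix z2 z1 assume z: "z2 \<in> B" "z1 \<in> B"
   define w where "w = z2 - z1"
   define r where "r = \<nu> z2 - \<nu> z1 - ?M (proj x w)"
   have r: "norm r <= d * norm w" using \<delta>1(2)[OF Bz(1-3)[OF z(2,1)]] by (simp add: r_def w_def)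
   have MT: "?M (proj x w) \<bullet> ?n = 0" by (rule shape_tangent(2)[OF proj_normal])
   have "proj x (\<nu> z2 - \<nu> z1) = ?M (proj x w) + proj x r"
   proof -
    have "\<nu> z2 - \<nu> z1 = ?M (proj x w) + r" by (simp add: r_def)
    hence "proj x (\<nu> z2 - \<nu> z1) = proj x (?M (proj x w)) + proj x r" by (simp add: linear_add[OF proj_linear])
    thus ?thesis using MT by (simp add: proj_def)
   qed
   hence "G z2 - G z1 = ?M (proj x w) + S (proj x r)"
    unfolding G_def using S1[OF a(2)] by (simp add: linear_diff[OF linS, symmetric] linear_diff[OF proj_linear, symmetric] linear_add[OF linS])
   hence "norm (G z2 - G z1) <= norm (?M (proj x w)) + norm (S (proj x r))" by (metis norm_triangle_ineq)
   also have "... <= norm (proj x w) * B0 + (1 / d) * norm (proj x r)" by (intro add_mono B0 S3)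
   also have "... <= norm w * B0 + (1 / d) * (d * norm w)"
    using B0 d r norm_proj_le[of x w] norm_proj_le[of x r] by (intro add_mono mult_mono) auto
   also have "... = K * norm w" using d by (simp add: K_def algebra_simps)
   finally show "dist (G z2) (G z1) <= K * dist z2 z1" by (simp add: dist_norm w_def)
  qed
  moreover have "HH (G ` B) = ennreal (1 / d) * HH ((%z. proj x (\<nu> z)) ` B)"
  proof -
   have "HH (S ` ((%z. proj x (\<nu> z)) ` B)) = ennreal \<bar>det (matrix S)\<bar> * HH ((%z. proj x (\<nu> z)) ` B)"
    by (rule hausdorff_linear_image_outer[where v = "?n"])
     (use linS detS d S1[of ?n] an S2 in \<open>auto simp: proj_normal\<close>)
   thus ?thesis using d detS by (simp add: image_image G_def)
  qed
  ultimately have "ennreal (1 / d) * HH ((%z. proj x (\<nu> z)) ` B) <= ennreal (K ^ ?m) * HH B" by simp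
  hence "ennreal d * (ennreal (1 / d) * HH ((%z. proj x (\<nu> z)) ` B)) <= ennreal d * (ennreal (K ^ ?m) * HH B)"
   by (rule mult_left_mono) simp
  hence p: "HH ((%z. proj x (\<nu> z)) ` B) <= ennreal (d * K ^ ?m) * HH B"
   using d K by (simp add: mult.assoc[symmetric] ennreal_mult[symmetric])
  have "HH (\<nu> ` B) <= ennreal (2 ^ ?m) * HH ((%z. proj x (\<nu> z)) ` B)"
  proof (rule hausdorff_le_of_expanding)
   fix z2 z1 assume z: "z2 \<in> B" "z1 \<in> B"
   define w where "w = \<nu> z2 - \<nu> z1"
   \<comment> \<open>Both normals lie on the unit sphere, so their difference is orthogonal to their
     sum; the sum being close to twice \<open>?n\<close>, the difference is almost tangent at
     \<open>x\<close>.\<close>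
   have "(\<nu> z1 + \<nu> z2) \<bullet> w = 0"
    using inner_commute[of "\<nu> z1" "\<nu> z2"] by (simp add: w_def inner_add_left inner_diff_right)
   hence "w \<bullet> ?n = ((1/2) *\<^sub>R (?n - \<nu> z1) + (1/2) *\<^sub>R (?n - \<nu> z2)) \<bullet> w"
    unfolding inner_add_left inner_scaleR_left inner_diff_left inner_commute[of w ?n] by (simp add: field_simps)
   hence "\<bar>w \<bullet> ?n\<bar> <= norm ((1/2) *\<^sub>R (?n - \<nu> z1) + (1/2) *\<^sub>R (?n - \<nu> z2)) * norm w"
    using Cauchy_Schwarz_ineq2 by metis
   also have "... <= (1/2) * norm w"
   proof (rule mult_right_mono)
    have "norm ((1/2) *\<^sub>R (?n - \<nu> z1) + (1/2) *\<^sub>R (?n - \<nu> z2)) <= (1/2) * norm (?n - \<nu> z1) + (1/2) * norm (?n - \<nu> z2)"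
     by (rule norm_triangle_le) simp
    also have "... <= 1/2" using \<delta>2(2)[OF Bz(4)[OF z(2,1)]] \<delta>2(2)[OF Bz(5)[OF z(2,1)]]
     by (simp add: dist_norm norm_minus_commute)
    finally show "norm ((1/2) *\<^sub>R (?n - \<nu> z1) + (1/2) *\<^sub>R (?n - \<nu> z2)) <= 1/2" .
   qed simp
   finally have "(1 - 1/2) * norm w <= norm (proj x w)" by (intro norm_proj_ge) auto
   thus "norm (\<nu> z2 - \<nu> z1) <= 2 * norm (proj x (\<nu> z2) - proj x (\<nu> z1))"
    by (simp add: w_def linear_diff[OF proj_linear])
  qed simp
  also have "... <= ennreal (2 ^ ?m) * (ennreal (d * K ^ ?m) * HH B)" by (intro mult_left_mono p) simp
  also have "... = ennreal (2 ^ ?m * (d * K ^ ?m)) * HH B" using d K by (simp add: ennreal_mult mult.assoc)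
  also have "... <= ennreal e * HH B" using dK by (intro mult_right_mono ennreal_leI) auto
  finally show ?thesis .
 qed
 thus ?thesis using \<delta>1(1) \<delta>2(1) by (intro exI[of _ "min \<delta>1 \<delta>2"]) auto
qed

text \<open>Projection to the tangent hyperplane at \<open>x\<close> shrinks chords of a nearby
  level by at most a factor 2, and its image is bounded.\<close>

lemma level_locally_finite: "\<exists>\<delta>>0. \<forall>t. HH (ball x \<delta> \<inter> f -` {t}) < \<infinity>"
proof -
 obtain \<delta> where \<delta>: "\<delta> > 0" "!!z1 z2. z1 \<in> ball x \<delta> ==> z2 \<in> ball x \<delta> ==> f z1 = f z2 ==>
   \<bar>(z2 - z1) \<bullet> \<nu> x\<bar> <= (1/2) * norm (z2 - z1)"
  using level_local[of "1/2" x] by (metis half_gt_zero zero_less_one)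
 have "HH (ball x \<delta> \<inter> f -` {t}) < \<infinity>" for t
 proof -
  let ?B = "ball x \<delta> \<inter> f -` {t}"
  have "HH ((%z. z) ` ?B) <= ennreal (2 ^ (CARD('n) - 1)) * HH (proj x ` ?B)"
  proof (rule hausdorff_le_of_expanding)
   fix z2 z1 assume "z2 \<in> ?B" "z1 \<in> ?B"
   hence "(1 - 1/2) * norm (z2 - z1) <= norm (proj x (z2 - z1))" by (intro norm_proj_ge \<delta>(2)) auto
   thus "norm (z2 - z1) <= 2 * norm (proj x z2 - proj x z1)" by (simp add: linear_diff[OF proj_linear])
  qed simp
  also have "HH (proj x ` ?B) <= HH {v. v \<bullet> \<nu> x = 0 \<and> norm v <= norm x + \<delta>}"
  proof (rule hausdorff_outer_mono, safe)
   fix z assume "z \<in> ball x \<delta>"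
   hence "norm z <= norm x + \<delta>" using norm_triangle_sub[of z x] by (simp add: dist_norm norm_minus_commute)
   thus "norm (proj x z) <= norm x + \<delta>" using norm_proj_le[of x z] by linarith
  qed (rule proj_normal)
  finally have "HH ?B <= ennreal (2 ^ (CARD('n) - 1)) * HH {v. v \<bullet> \<nu> x = 0 \<and> norm v <= norm x + \<delta>}"
   by (simp add: mult_left_mono)
  also have "... < \<infinity>" using hausdorff_hyperplane_ball_finite[of "\<nu> x" "norm x + \<delta>"] by (simp add: ennreal_mult_less_top)
  finally show ?thesis .
 qed
 thus ?thesis using \<delta>(1) by blast
qed

end

section \<open>The area formula for the Gauss map\<close>

lemma lindelof_partition:
 fixes Q :: "'a::euclidean_space set" and r :: "'a => real"
 assumes r: "!!x. x \<in> Q ==> r x > 0"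
 shows "\<exists>P c. Q = (\<Union>i::nat. P i) \<and> disjoint_family P \<and>
  (\<forall>i. P i = {} \<or> c i \<in> Q \<and> P i \<subseteq> ball (c i) (r (c i))) \<and>
  (\<forall>i. \<exists>C V. closed C \<and> open V \<and> P i = Q \<inter> C \<inter> V)"
proof (cases "Q = {}")
 case True
 thus ?thesis
  by (intro exI[of _ "%_. {}"]) (auto simp: disjoint_family_on_def)
next
 case False
 obtain F' where F': "F' \<subseteq> (%x. ball x (r x / 2)) ` Q" "countable F'" "\<Union>F' = \<Union>((%x. ball x (r x / 2)) ` Q)"
  using Lindelof[of "(%x. ball x (r x / 2)) ` Q"] by auto
 obtain X where X: "countable X" "X \<subseteq> Q" "F' = (%x. ball x (r x / 2)) ` X"
  using countable_subset_image[of F' "%x. ball x (r x / 2)" Q] F' by blast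
 have cover: "Q \<subseteq> (\<Union>x\<in>X. ball x (r x / 2))" using F'(3) X(3) r by fastforce
 hence "X ~= {}" using False by auto
 define c where "c = from_nat_into X"
 have cX: "c i \<in> X" for i using \<open>X ~= {}\<close> by (simp add: c_def from_nat_into)
 have cr: "range c = X" using X(1) \<open>X ~= {}\<close> by (simp add: c_def)
 define D where "D i = cball (c i) (r (c i) / 2)" for i
 \<comment> \<open>Subtracting the earlier closed balls makes the pieces disjoint and keeps each of
   them the trace on \<open>Q\<close> of a closed and an open set, which later makes their images
   Borel. The half radius leaves room to pass from closed to open balls.\<close>
 define P where "P i = Q \<inter> D i \<inter> (- (\<Union>j<i. D j))" for i
 have OD: "Q \<subseteq> (\<Union>i. D i)"
 proof
  fix x assume "x \<in> Q"
  then obtain i where "x \<in> ball (c i) (r (c i) / 2)" using cover cr by blast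
  hence "x \<in> D i" by (simp add: D_def)
  thus "x \<in> (\<Union>i. D i)" by blast
 qed
 have "Q = (\<Union>i. P i)"
 proof
  show "Q \<subseteq> (\<Union>i. P i)"
  proof
   fix x assume x: "x \<in> Q"
   hence ex: "\<exists>i. x \<in> D i" using OD by blast
   define i where "i = (LEAST i. x \<in> D i)"
   have "x \<in> D i" unfolding i_def using ex by (rule LeastI_ex)
   moreover have "x \<notin> D j" if "j < i" for j using that not_less_Least unfolding i_def by blast
   ultimately have "x \<in> P i" using x by (auto simp: P_def)
   thus "x \<in> (\<Union>i. P i)" by blast
  qed
 qed (auto simp: P_def)
 moreover have "disjoint_family P"
  unfolding disjoint_family_on_def
 proof (intro ballI impI)
  fix i j :: nat assume "i ~= j"
  thus "P i \<inter> P j = {}" by (cases i j rule: linorder_cases) (auto simp: P_def)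
 qed
 moreover have "c i \<in> Q \<and> P i \<subseteq> ball (c i) (r (c i))" for i
 proof -
  have "c i \<in> Q" using cX X(2) by blast
  moreover have "D i \<subseteq> ball (c i) (r (c i))" using r[OF \<open>c i \<in> Q\<close>] by (auto simp: D_def)
  ultimately show ?thesis by (auto simp: P_def)
 qed
 moreover have "\<exists>C V. closed C \<and> open V \<and> P i = Q \<inter> C \<inter> V" for i
  by (intro exI[of _ "D i"] exI[of _ "- (\<Union>j<i. D j)"])
   (auto simp: P_def D_def intro!: open_Compl closed_UN)
 ultimately show ?thesis by blast
qed

lemma lindelof_partitionE:
 fixes Q :: "'a::euclidean_space set" and r :: "'a => real"
 assumes r: "\<forall>x\<in>Q. r x > 0"
 obtains P c where "Q = (\<Union>i::nat. P i)" "disjoint_family P"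
  "\<forall>i. P i = {} \<or> c i \<in> Q \<and> P i \<subseteq> ball (c i) (r (c i))"
  "\<forall>i. \<exists>C V. closed C \<and> open V \<and> P i = Q \<inter> C \<inter> V"
proof -
 have "\<exists>P c. Q = (\<Union>i::nat. P i) \<and> disjoint_family P \<and>
  (\<forall>i. P i = {} \<or> c i \<in> Q \<and> P i \<subseteq> ball (c i) (r (c i))) \<and>
  (\<forall>i. \<exists>C V. closed C \<and> open V \<and> P i = Q \<inter> C \<inter> V)" by (rule lindelof_partition) (use r in blast)
 thus thesis using that by blast
qed

text \<open>The intersection of a closed and an open set is a countable union of compact sets, and
  continuous images of these are compact. For a general Borel set the image could fail to be
  Borel.\<close>

lemma image_closed_Int_open_borel:
 fixes g :: "'a::euclidean_space => 'b::euclidean_space"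
 assumes "closed C" "open V" "continuous_on UNIV g"
 shows "g ` (C \<inter> V) \<in> sets borel"
proof -
 obtain D where D: "countable D" "!!X. X \<in> D ==> \<exists>a b. X = cbox a b" "\<Union>D = V"
  using open_countable_Union_open_cbox[OF assms(2)] by metis
 have "g ` (C \<inter> X) \<in> sets borel" if "X \<in> D" for X
 proof -
  have "compact X" using D(2)[OF that] compact_cbox by metis
  hence "compact (C \<inter> X)" using assms(1) by (simp add: closed_Int_compact)
  hence "compact (g ` (C \<inter> X))"
   by (rule compact_continuous_image[rotated]) (use assms(3) in \<open>auto intro: continuous_on_subset\<close>)
  thus ?thesis by (intro borel_closed compact_imp_closed)
 qed
 moreover have "g ` (C \<inter> V) = (\<Union>X\<in>D. g ` (C \<inter> X))" using D(3) by auto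
 ultimately show ?thesis using D(1) by (simp only:) (rule sets.countable_UN', auto)
qed

lemma ennreal_le_of_factor:
 assumes "!!C. C > 1 ==> a <= ennreal C * b" shows "a <= b"
proof (cases "b = \<infinity>")
 case False
 then obtain r where r: "b = ennreal r" "r \<ge> 0" by (cases b) auto
 show ?thesis
 proof (rule ennreal_le_epsilon)
  fix e :: real assume e: "e > 0"
  have "(1 + e / (r + 1)) * r <= r + e"
  proof -
   have "e * r <= e * (r + 1)" using e by (intro mult_left_mono) auto
   thus ?thesis using r(2) by (simp add: field_simps)
  qed
  hence "ennreal (1 + e / (r + 1)) * b <= b + ennreal e"
   unfolding r(1) using r(2) e by (subst ennreal_mult[symmetric]) (auto simp: ennreal_plus[symmetric] intro!: ennreal_leI simp del: ennreal_plus)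
  thus "a <= b + ennreal e" using assms[of "1 + e / (r + 1)"] e r(2) by (auto intro: order_trans)
 qed
qed simp

context level_sets
begin

abbreviation "HM \<equiv> hausdorff_measure (CARD('n) - 1) :: (real^'n) measure"

definition "regs t = {x. f x = t \<and> gauss_curv f x ~= 0}"

text \<open>Measuring by \<open>count_space\<close> gives an infinite fibre the value
  \<infinity>.\<close>

definition NN :: "real => real^'n => ennreal" where
 "NN t u = emeasure (count_space UNIV) {x \<in> regs t. \<nu> x = u}"

lemma regs_closed_open: "regs t = f -` {t} \<inter> {x. gauss_curv f x ~= 0}" "closed (f -` {t})" "open {x. gauss_curv f x ~= 0}"
proof -
 show "closed (f -` {t})" by (rule continuous_closed_vimage) (use f_continuous in \<open>auto simp: continuous_on_eq_continuous_at\<close>)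
 show "open {x. gauss_curv f x ~= 0}" by (intro open_Collect_neq gauss_curv_continuous continuous_intros)
qed (auto simp: regs_def)

text \<open>With \<open>q\<close> the square root of \<open>C\<close>, one factor \<open>q\<close>
  pays for the distortion of the Gauss map relative to the curvature at the centre, and one for the
  variation of the curvature on the piece.\<close>

lemma area_pieces:
 assumes C: "C > 1"
 shows "\<exists>P. regs t = (\<Union>i::nat. P i) \<and> disjoint_family P \<and> (\<forall>i. P i \<in> sets borel \<and> \<nu> ` P i \<in> sets borel \<and> inj_on \<nu> (P i) \<and>
   (\<integral>\<^sup>+ x. indicator (P i) x * ennreal \<bar>gauss_curv f x\<bar> \<partial>HM) <= ennreal C * HH (\<nu> ` P i) \<and>
   HH (\<nu> ` P i) <= ennreal C * (\<integral>\<^sup>+ x. indicator (P i) x * ennreal \<bar>gauss_curv f x\<bar> \<partial>HM))"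
proof -
 define q where "q = sqrt C"
 have q: "q > 1" "q * q = C" using C by (auto simp: q_def)
 define ok where "ok x \<delta> \<longleftrightarrow> \<delta> > 0 \<and> (\<forall>z1\<in>ball x \<delta>. \<forall>z2\<in>ball x \<delta>. f z1 = f z2 \<and> \<nu> z1 = \<nu> z2 --> z1 = z2) \<and>
  (\<forall>t B. B \<subseteq> ball x \<delta> \<inter> f -` {t} -->
   HH (\<nu> ` B) <= ennreal (q * \<bar>gauss_curv f x\<bar>) * HH B \<and> ennreal \<bar>gauss_curv f x\<bar> * HH B <= ennreal q * HH (\<nu> ` B)) \<and>
  (\<forall>z\<in>ball x \<delta>. \<bar>gauss_curv f z\<bar> <= q * \<bar>gauss_curv f x\<bar> \<and> \<bar>gauss_curv f x\<bar> <= q * \<bar>gauss_curv f z\<bar>)" for x \<delta>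
 have "\<exists>\<delta>. ok x \<delta>"
  if x: "x \<in> regs t" for x
 proof -
  let ?k = "\<bar>gauss_curv f x\<bar>"
  have k: "gauss_curv f x ~= 0" using x by (simp add: regs_def)
  obtain \<delta>1 where \<delta>1: "\<delta>1 > 0" "\<forall>z1\<in>ball x \<delta>1. \<forall>z2\<in>ball x \<delta>1. f z1 = f z2 \<and> \<nu> z1 = \<nu> z2 --> z1 = z2"
   "\<forall>t B. B \<subseteq> ball x \<delta>1 \<inter> f -` {t} -->
    HH (\<nu> ` B) <= ennreal (q * ?k) * HH B \<and> ennreal ?k * HH B <= ennreal q * HH (\<nu> ` B)"
   using curv_local_nonzero[OF k q(1)] by blast
  have "isCont (%z. \<bar>gauss_curv f z\<bar>) x"
   using gauss_curv_continuous by (intro continuous_intros) (simp add: continuous_on_eq_continuous_at)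
  moreover have "?k * (1 - 1 / q) > 0" using k q by simp
  ultimately obtain \<delta>2 where \<delta>2: "\<delta>2 > 0" "!!z. dist z x < \<delta>2 ==> dist \<bar>gauss_curv f z\<bar> ?k < ?k * (1 - 1 / q)"
   unfolding continuous_at_eps_delta by metis
  have near: "\<bar>gauss_curv f z\<bar> <= q * ?k \<and> ?k <= q * \<bar>gauss_curv f z\<bar>" if "z \<in> ball x \<delta>2" for z
  proof -
   have d: "\<bar>\<bar>gauss_curv f z\<bar> - ?k\<bar> < ?k * (1 - 1 / q)" using \<delta>2(2)[of z] that by (simp add: dist_real_def dist_commute)
   have "1 + (1 - 1 / q) <= q"
   proof -
    have "(q - 1) * (q - 1) \<ge> 0" by simp
    thus ?thesis using q by (simp add: field_simps)
   qed
   hence "?k * (1 + (1 - 1 / q)) <= ?k * q" by (intro mult_left_mono) auto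
   moreover have d1: "\<bar>gauss_curv f z\<bar> - ?k < ?k * (1 - 1 / q)" "?k - \<bar>gauss_curv f z\<bar> < ?k * (1 - 1 / q)"
    using d unfolding abs_less_iff by linarith+
   have "?k * (1 - 1 / q) = ?k - ?k / q" by (simp add: algebra_simps)
   hence "?k / q <= \<bar>gauss_curv f z\<bar>" using d1(2) by linarith
   hence "?k <= q * \<bar>gauss_curv f z\<bar>" using q by (simp add: field_simps)
   moreover have "?k * (1 + (1 - 1 / q)) = ?k + ?k * (1 - 1 / q)" by (rule distrib_left[of ?k 1, simplified])
   ultimately have "\<bar>gauss_curv f z\<bar> <= ?k * q \<and> ?k <= q * \<bar>gauss_curv f z\<bar>" using d1(1) by linarith
   thus ?thesis by (simp only: mult.commute)
  qed
  show ?thesis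
   unfolding ok_def
  proof (intro exI[of _ "min \<delta>1 \<delta>2"] conjI allI impI)
   have b: "ball x (min \<delta>1 \<delta>2) \<subseteq> ball x \<delta>1" "ball x (min \<delta>1 \<delta>2) \<subseteq> ball x \<delta>2" by auto
   show "\<forall>z1\<in>ball x (min \<delta>1 \<delta>2). \<forall>z2\<in>ball x (min \<delta>1 \<delta>2). f z1 = f z2 \<and> \<nu> z1 = \<nu> z2 --> z1 = z2"
    using \<delta>1(2) b by blast
   show "\<forall>z\<in>ball x (min \<delta>1 \<delta>2). \<bar>gauss_curv f z\<bar> <= q * ?k \<and> ?k <= q * \<bar>gauss_curv f z\<bar>" using near b by blast
   fix t B assume "B \<subseteq> ball x (min \<delta>1 \<delta>2) \<inter> f -` {t}"
   hence "B \<subseteq> ball x \<delta>1 \<inter> f -` {t}" using b(1) by blast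
   thus "HH (\<nu> ` B) <= ennreal (q * ?k) * HH B" "ennreal ?k * HH B <= ennreal q * HH (\<nu> ` B)"
    using \<delta>1(3) by blast+
  qed (use \<delta>1(1) \<delta>2(1) in auto)
 qed
 hence "\<forall>x\<in>regs t. \<exists>\<delta>. ok x \<delta>" by (rule ballI)
 from bchoice[OF this] obtain r where r0: "\<forall>x\<in>regs t. ok x (r x)" by (rule exE)
 have r: "r x > 0" "z1 \<in> ball x (r x) ==> z2 \<in> ball x (r x) ==> f z1 = f z2 ==> \<nu> z1 = \<nu> z2 ==> z1 = z2"
  "B \<subseteq> ball x (r x) \<inter> f -` {t'} ==>
   HH (\<nu> ` B) <= ennreal (q * \<bar>gauss_curv f x\<bar>) * HH B \<and> ennreal \<bar>gauss_curv f x\<bar> * HH B <= ennreal q * HH (\<nu> ` B)"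
  "z \<in> ball x (r x) ==> \<bar>gauss_curv f z\<bar> <= q * \<bar>gauss_curv f x\<bar> \<and> \<bar>gauss_curv f x\<bar> <= q * \<bar>gauss_curv f z\<bar>"
  if "x \<in> regs t" for x z z1 z2 t' B using bspec[OF r0 that] unfolding ok_def by blast+
 have rpos: "\<forall>x\<in>regs t. r x > 0" using r(1) by (intro ballI)
 obtain P c where P: "regs t = (\<Union>i::nat. P i)" "disjoint_family P"
  "\<forall>i. P i = {} \<or> c i \<in> regs t \<and> P i \<subseteq> ball (c i) (r (c i))"
  "\<forall>i. \<exists>C V. closed C \<and> open V \<and> P i = regs t \<inter> C \<inter> V"
  by (rule lindelof_partitionE[OF rpos])
 have bor: "P i \<in> sets borel" "\<nu> ` P i \<in> sets borel" for i
 proof -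
  obtain C V where CV0: "closed C \<and> open V \<and> P i = regs t \<inter> C \<inter> V" using P(4)[rule_format, of i] by (elim exE)
  note CV = CV0[THEN conjunct1] CV0[THEN conjunct2, THEN conjunct1] CV0[THEN conjunct2, THEN conjunct2]
  hence eq: "P i = (f -` {t} \<inter> C) \<inter> ({x. gauss_curv f x ~= 0} \<inter> V)" by (auto simp: regs_closed_open(1))
  have cl: "closed (f -` {t} \<inter> C)" "open ({x. gauss_curv f x ~= 0} \<inter> V)" using CV regs_closed_open by auto
  show "\<nu> ` P i \<in> sets borel" unfolding eq by (rule image_closed_Int_open_borel[OF cl \<nu>_continuous])
  show "P i \<in> sets borel" unfolding eq using cl by auto
 qed
 have "inj_on \<nu> (P i) \<and>
   (\<integral>\<^sup>+ x. indicator (P i) x * ennreal \<bar>gauss_curv f x\<bar> \<partial>HM) <= ennreal C * HH (\<nu> ` P i) \<and>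
   HH (\<nu> ` P i) <= ennreal C * (\<integral>\<^sup>+ x. indicator (P i) x * ennreal \<bar>gauss_curv f x\<bar> \<partial>HM)" for i
 proof (cases "P i = {}")
  case True thus ?thesis by simp
 next
  case False
  let ?c = "c i" and ?I = "\<integral>\<^sup>+ x. indicator (P i) x * ennreal \<bar>gauss_curv f x\<bar> \<partial>HM"
  have c: "?c \<in> regs t" "P i \<subseteq> ball ?c (r ?c)" using P(3)[rule_format, of i] False by auto
  have Pt: "P i \<subseteq> f -` {t}" using P(1) by (auto simp: regs_def)
  have "inj_on \<nu> (P i)"
  proof (rule inj_onI)
   fix x y assume xy: "x \<in> P i" "y \<in> P i" "\<nu> x = \<nu> y"
   hence "f x = t" "f y = t" using Pt by auto
   thus "x = y" using r(2)[OF c(1) subsetD[OF c(2) xy(1)] subsetD[OF c(2) xy(2)]] xy(3) by simp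
  qed
  moreover have H: "HH (\<nu> ` P i) <= ennreal (q * \<bar>gauss_curv f ?c\<bar>) * HH (P i)"
   "ennreal \<bar>gauss_curv f ?c\<bar> * HH (P i) <= ennreal q * HH (\<nu> ` P i)"
   using r(3)[OF c(1), of "P i" t] c(2) Pt by auto
  have I1: "?I <= ennreal (q * \<bar>gauss_curv f ?c\<bar>) * HH (P i)"
  proof -
   have "?I <= (\<integral>\<^sup>+ x. ennreal (q * \<bar>gauss_curv f ?c\<bar>) * indicator (P i) x \<partial>HM)"
    using r(4)[OF c(1)] c(2) by (intro nn_integral_mono) (auto simp: indicator_def intro!: ennreal_leI)
   thus ?thesis using bor by (simp add: nn_integral_cmult emeasure_hausdorff_measure)
  qed
  have I2: "ennreal \<bar>gauss_curv f ?c\<bar> * HH (P i) <= ennreal q * ?I"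
  proof -
   have "ennreal \<bar>gauss_curv f ?c\<bar> * HH (P i) = (\<integral>\<^sup>+ x. ennreal \<bar>gauss_curv f ?c\<bar> * indicator (P i) x \<partial>HM)"
    using bor by (simp add: nn_integral_cmult emeasure_hausdorff_measure)
   also have "... <= (\<integral>\<^sup>+ x. ennreal q * (indicator (P i) x * ennreal \<bar>gauss_curv f x\<bar>) \<partial>HM)"
    using r(4)[OF c(1)] c(2) q(1) by (intro nn_integral_mono) (auto simp: indicator_def ennreal_mult[symmetric] intro!: ennreal_leI)
   also have "... = ennreal q * ?I"
   proof (rule nn_integral_cmult)
    have [measurable]: "gauss_curv f \<in> borel_measurable borel" by (rule borel_measurable_continuous_onI[OF gauss_curv_continuous])
    have [measurable]: "P i \<in> sets borel" by (rule bor)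
    show "(%x. indicator (P i) x * ennreal \<bar>gauss_curv f x\<bar>) \<in> borel_measurable HM" by measurable
   qed
   finally show ?thesis .
  qed
  have sp: "ennreal (q * \<bar>gauss_curv f ?c\<bar>) * HH (P i) = ennreal q * (ennreal \<bar>gauss_curv f ?c\<bar> * HH (P i))"
   using q(1) by (simp add: ennreal_mult mult.assoc)
  have qq: "ennreal C = ennreal q * ennreal q" using q by (simp add: ennreal_mult[symmetric])
  have "?I <= ennreal C * HH (\<nu> ` P i)"
   using order_trans[OF I1[unfolded sp] mult_left_mono[OF H(2)]] by (simp add: qq mult.assoc)
  moreover have "HH (\<nu> ` P i) <= ennreal C * ?I"
   using order_trans[OF H(1)[unfolded sp] mult_left_mono[OF I2]] by (simp add: qq mult.assoc)
  ultimately show ?thesis by blast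
 qed
 thus ?thesis using P(1,2) bor by blast
qed

lemma NN_pieces:
 assumes "regs t = (\<Union>i::nat. P i)" "disjoint_family P" "!!i. inj_on \<nu> (P i)"
 shows "NN t u = (\<Sum>i. indicator (\<nu> ` P i) u)"
proof -
 have "emeasure (count_space UNIV) {x \<in> P i. \<nu> x = u} = indicator (\<nu> ` P i) u" for i
 proof (cases "u \<in> \<nu> ` P i")
  case True
  then obtain x where x: "x \<in> P i" "\<nu> x = u" by blast
  hence "{x \<in> P i. \<nu> x = u} = {x}" using assms(3)[of i] by (auto simp: inj_on_def)
  thus ?thesis using True by simp
 next
  case False
  hence e: "{x \<in> P i. \<nu> x = u} = {}" by auto
  show ?thesis using False unfolding e by simp
 qed
 moreover have "(\<Sum>i. emeasure (count_space UNIV) {x \<in> P i. \<nu> x = u}) = emeasure (count_space UNIV) (\<Union>i. {x \<in> P i. \<nu> x = u})"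
  by (rule suminf_emeasure) (use assms(2) in \<open>auto simp: disjoint_family_on_def\<close>)
 moreover have "(\<Union>i. {x \<in> P i. \<nu> x = u}) = {x \<in> regs t. \<nu> x = u}" using assms(1) by auto
 ultimately show ?thesis by (simp add: NN_def)
qed

text \<open>Summing over the pieces compares the two integrals up to the factor \<open>C\<close>.
  The pieces depend on \<open>C\<close> but the integrals do not, so \<open>C\<close> may tend to 1.
  Degenerate points drop out because the integrand vanishes there.\<close>

theorem area_formula:
 shows NN_measurable: "NN t \<in> borel_measurable HM"
  and total_abs_curv_eq: "total_abs_curv f t = (\<integral>\<^sup>+ u. NN t u \<partial>HM)"
proof -
 have main: "NN t \<in> borel_measurable HM \<and> total_abs_curv f t <= ennreal C * (\<integral>\<^sup>+ u. NN t u \<partial>HM) \<and>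
   (\<integral>\<^sup>+ u. NN t u \<partial>HM) <= ennreal C * total_abs_curv f t" if C: "C > 1" for C
 proof -
  obtain P where P0: "regs t = (\<Union>i::nat. P i) \<and> disjoint_family P \<and>
   (\<forall>i. P i \<in> sets borel \<and> \<nu> ` P i \<in> sets borel \<and> inj_on \<nu> (P i) \<and>
   (\<integral>\<^sup>+ x. indicator (P i) x * ennreal \<bar>gauss_curv f x\<bar> \<partial>HM) <= ennreal C * HH (\<nu> ` P i) \<and>
   HH (\<nu> ` P i) <= ennreal C * (\<integral>\<^sup>+ x. indicator (P i) x * ennreal \<bar>gauss_curv f x\<bar> \<partial>HM))"
   using area_pieces[OF C, of t] by (rule exE)
  note P1 = P0[THEN conjunct1] and P2 = P0[THEN conjunct2, THEN conjunct1]
   and P3 = P0[THEN conjunct2, THEN conjunct2, rule_format]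
  note P = P1 P2 P3[THEN conjunct1] P3[THEN conjunct2, THEN conjunct1]
   P3[THEN conjunct2, THEN conjunct2, THEN conjunct1]
   P3[THEN conjunct2, THEN conjunct2, THEN conjunct2, THEN conjunct1]
   P3[THEN conjunct2, THEN conjunct2, THEN conjunct2, THEN conjunct2]
  have Neq: "NN t = (%u. \<Sum>i. indicator (\<nu> ` P i) u)" using NN_pieces[OF P(1,2,5)] by blast
  have meas: "NN t \<in> borel_measurable HM" unfolding Neq using P(4) by (intro borel_measurable_suminf_order borel_measurable_indicator) auto
  have int: "(\<integral>\<^sup>+ u. NN t u \<partial>HM) = (\<Sum>i. HH (\<nu> ` P i))"
  proof -
   have "(\<integral>\<^sup>+ u. NN t u \<partial>HM) = (\<Sum>i. \<integral>\<^sup>+ u. indicator (\<nu> ` P i) u \<partial>HM)"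
    unfolding Neq using P(4) by (intro nn_integral_suminf borel_measurable_indicator) auto
   thus ?thesis using P(4) by (simp add: emeasure_hausdorff_measure)
  qed
  have tot: "total_abs_curv f t = (\<Sum>i. \<integral>\<^sup>+ x. indicator (P i) x * ennreal \<bar>gauss_curv f x\<bar> \<partial>HM)"
  proof -
   have gm[measurable]: "gauss_curv f \<in> borel_measurable borel" by (rule borel_measurable_continuous_onI[OF gauss_curv_continuous])
   note P(3)[measurable]
   have "indicator (f -` {t}) x * ennreal \<bar>gauss_curv f x\<bar> = (\<Sum>i. indicator (P i) x * ennreal \<bar>gauss_curv f x\<bar>)" for x
   proof -
    have "(\<Sum>i. indicator (P i) x * ennreal \<bar>gauss_curv f x\<bar>) = (\<Sum>i. indicator (P i) x) * ennreal \<bar>gauss_curv f x\<bar>"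
     by (simp add: ennreal_suminf_multc)
    also have "(\<Sum>i. indicator (P i) x :: ennreal) = indicator (\<Union>i. P i) x" by (rule suminf_indicator[OF P(2)])
    also have "(\<Union>i. P i) = regs t" using P(1) by simp
    finally show ?thesis by (auto simp: indicator_def regs_def)
   qed
   hence "total_abs_curv f t = (\<integral>\<^sup>+ x. (\<Sum>i. indicator (P i) x * ennreal \<bar>gauss_curv f x\<bar>) \<partial>HM)"
    by (simp add: total_abs_curv_def)
   also have "... = (\<Sum>i. \<integral>\<^sup>+ x. indicator (P i) x * ennreal \<bar>gauss_curv f x\<bar> \<partial>HM)"
    by (rule nn_integral_suminf) measurable
   finally show ?thesis .
  qed
  have "total_abs_curv f t <= (\<Sum>i. ennreal C * HH (\<nu> ` P i))" unfolding tot by (intro suminf_le P(6)) auto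
  moreover have "(\<integral>\<^sup>+ u. NN t u \<partial>HM) <= (\<Sum>i. ennreal C * (\<integral>\<^sup>+ x. indicator (P i) x * ennreal \<bar>gauss_curv f x\<bar> \<partial>HM))"
   unfolding int by (intro suminf_le P(7)) auto
  ultimately show ?thesis using meas
   unfolding ennreal_suminf_cmult int[symmetric] tot[symmetric] by blast
 qed
 show "NN t \<in> borel_measurable HM" using main[of 2] by simp
 show "total_abs_curv f t = (\<integral>\<^sup>+ u. NN t u \<partial>HM)"
  by (rule antisym; rule ennreal_le_of_factor) (use main in blast)+
qed

lemma level_finite_cball: "HH (f -` {t} \<inter> cball 0 R) < \<infinity>"
proof -
 have "\<exists>\<delta>>0. \<forall>t. HH (ball x \<delta> \<inter> f -` {t}) < \<infinity>" for x by (rule level_locally_finite)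
 then obtain \<delta> where \<delta>: "!!x. \<delta> x > 0" "!!x t. HH (ball x (\<delta> x) \<inter> f -` {t}) < \<infinity>" by metis
 have "compact (cball (0::real^'n) R)" by simp
 then obtain D where D: "finite D" "cball 0 R \<subseteq> (\<Union>x\<in>D. ball x (\<delta> x))"
 proof (rule compactE_image[of _ UNIV "%x. ball x (\<delta> x)"])
  show "cball 0 R \<subseteq> (\<Union>x. ball x (\<delta> x))"
  proof
   fix x show "x \<in> (\<Union>x. ball x (\<delta> x))" using \<delta>(1)[of x] by (intro UN_I[of x]) auto
  qed
 qed auto
 have "HH (\<Union>x\<in>D. ball x (\<delta> x) \<inter> f -` {t}) < \<infinity>" using D(1)
 proof (induction D rule: finite_induct)
  case (insert x D)
  have "HH (ball x (\<delta> x) \<inter> f -` {t} \<union> (\<Union>x\<in>D. ball x (\<delta> x) \<inter> f -` {t})) \<le>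
    HH (ball x (\<delta> x) \<inter> f -` {t}) + HH (\<Union>x\<in>D. ball x (\<delta> x) \<inter> f -` {t})" by (rule hausdorff_outer_Un_le)
  also have "... < \<infinity>" using insert.IH \<delta>(2) by simp
  finally show ?case by simp
 qed simp
 moreover have "f -` {t} \<inter> cball 0 R \<subseteq> (\<Union>x\<in>D. ball x (\<delta> x) \<inter> f -` {t})" using D(2) by auto
 ultimately show ?thesis using hausdorff_outer_mono le_less_trans by blast
qed

text \<open>Every degenerate point has a ball on which the Gauss map multiplies measure by at most
  \<open>e\<close>. Adding over disjoint pieces gives \<open>e\<close> times the measure of the
  degenerate set, which tends to 0 with \<open>e\<close> if that measure is finite; hence the
  exhaustion by balls.\<close>

lemma gauss_sard: "HH (\<nu> ` {x. f x = t \<and> gauss_curv f x = 0}) = 0"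
proof -
 let ?Z = "{x. f x = t \<and> gauss_curv f x = 0}"
 have clZ: "closed ?Z"
 proof -
  have "?Z = f -` {t} \<inter> {x. gauss_curv f x = 0}" by auto
  moreover have "closed {x. gauss_curv f x = 0}" by (intro closed_Collect_eq gauss_curv_continuous continuous_on_const)
  ultimately show ?thesis using regs_closed_open(2)[of t] by (simp add: closed_Int)
 qed
 have zero: "HH (\<nu> ` (?Z \<inter> cball 0 R)) = 0" for R
 proof -
  let ?A = "?Z \<inter> cball 0 R"
  have fin: "HH ?A < \<infinity>"
   by (rule le_less_trans[OF hausdorff_outer_mono level_finite_cball[of t R]]) auto
  have A: "closed ?A" using clZ by (intro closed_Int) auto
  have le: "HH (\<nu> ` ?A) <= ennreal e * HH ?A" if e: "e > 0" for e
  proof -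
   have "\<exists>\<delta>>0. \<forall>t B. B \<subseteq> ball x \<delta> \<inter> f -` {t} --> HH (\<nu> ` B) <= ennreal e * HH B" if "x \<in> ?A" for x
    using curv_local_zero[OF _ e, of x] that by blast
   hence "\<forall>x\<in>?A. \<exists>\<delta>>0. \<forall>t B. B \<subseteq> ball x \<delta> \<inter> f -` {t} --> HH (\<nu> ` B) <= ennreal e * HH B" by (rule ballI)
   from bchoice[OF this] obtain r where r0: "\<forall>x\<in>?A. r x > 0 \<and> (\<forall>t B. B \<subseteq> ball x (r x) \<inter> f -` {t} --> HH (\<nu> ` B) <= ennreal e * HH B)"
    by (rule exE)
   have r: "r x > 0" "B \<subseteq> ball x (r x) \<inter> f -` {t} ==> HH (\<nu> ` B) <= ennreal e * HH B" if "x \<in> ?A" for x t B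
    using bspec[OF r0 that] by blast+
   have rpos: "\<forall>x\<in>?A. r x > 0" using r(1) by (intro ballI)
   obtain P c where P: "?A = (\<Union>i::nat. P i)" "disjoint_family P"
    "\<forall>i. P i = {} \<or> c i \<in> ?A \<and> P i \<subseteq> ball (c i) (r (c i))"
    "\<forall>i. \<exists>C V. closed C \<and> open V \<and> P i = ?A \<inter> C \<inter> V"
    by (rule lindelof_partitionE[OF rpos])
   have bor: "P i \<in> sets borel" for i
   proof -
    obtain C V where CV: "closed C \<and> open V \<and> P i = ?A \<inter> C \<inter> V" using P(4)[rule_format, of i] by (elim exE)
    hence "?A \<inter> C \<in> sets borel" "V \<in> sets borel" using A by (auto intro!: borel_closed)
    thus ?thesis using CV by (simp only: sets.Int)
   qed
   have Pi: "HH (\<nu> ` P i) <= ennreal e * HH (P i)" for i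
   proof (cases "P i = {}")
    case False
    hence "c i \<in> ?A" "P i \<subseteq> ball (c i) (r (c i))" using P(3)[rule_format, of i] by auto
    moreover have "P i \<subseteq> f -` {t}" using P(1) by blast
    ultimately show ?thesis using r(2)[of "c i" "P i" t] by blast
   qed simp
   have "HH (\<nu> ` ?A) = HH (\<Union>i. \<nu> ` P i)" unfolding P(1) by (simp only: image_UN)
   also have "... <= (\<Sum>i. HH (\<nu> ` P i))" by (rule hausdorff_outer_subadditive)
   also have "... <= (\<Sum>i. ennreal e * HH (P i))" by (intro suminf_le Pi) auto
   also have "... = ennreal e * (\<Sum>i. emeasure HM (P i))" using bor by (simp add: emeasure_hausdorff_measure)
   also have "(\<Sum>i. emeasure HM (P i)) = emeasure HM (\<Union>i. P i)" using bor P(2) by (intro suminf_emeasure) auto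
   also have "... = HH (\<Union>i. P i)" by (rule emeasure_hausdorff_measure) (use bor in auto)
   also have "... = HH ?A" by (rule arg_cong[OF P(1)[symmetric]])
   finally show ?thesis .
  qed
  obtain s where s: "HH ?A = ennreal s" "s \<ge> 0" using fin by (rule_tac ennreal_cases[of "HH ?A"]) auto
  have "HH (\<nu> ` ?A) <= 0"
  proof (rule ennreal_le_epsilon)
   fix e :: real assume e: "e > 0"
   have "HH (\<nu> ` ?A) <= ennreal (e / (s + 1)) * ennreal s" using le[of "e / (s + 1)"] e s by simp
   also have "... = ennreal (e / (s + 1) * s)" using e s by (intro ennreal_mult[symmetric]) auto
   also have "... <= ennreal e"
   proof (rule ennreal_leI)
    have "e * s <= e * (s + 1)" using e by (intro mult_left_mono) auto
    thus "e / (s + 1) * s <= e" using s by (simp add: field_simps)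
   qed
   finally show "HH (\<nu> ` ?A) <= 0 + ennreal e" by simp
  qed
  thus ?thesis by simp
 qed
 have "\<nu> ` ?Z = (\<Union>j::nat. \<nu> ` (?Z \<inter> cball 0 (real j)))"
 proof (intro equalityI subsetI)
  fix u assume "u \<in> \<nu> ` ?Z"
  then obtain x where x: "x \<in> ?Z" "u = \<nu> x" by blast
  obtain j :: nat where "norm x <= real j" using real_arch_simple by blast
  hence "u \<in> \<nu> ` (?Z \<inter> cball 0 (real j))" using x by auto
  thus "u \<in> (\<Union>j::nat. \<nu> ` (?Z \<inter> cball 0 (real j)))" by blast
 qed blast
 hence "HH (\<nu> ` ?Z) <= (\<Sum>j. HH (\<nu> ` (?Z \<inter> cball 0 (real j))))"
  using hausdorff_outer_subadditive[of "CARD('n) - 1" "%j. \<nu> ` (?Z \<inter> cball 0 (real j))"] by simp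
 thus ?thesis unfolding zero by simp
qed

end

subsection \<open>Definable functions on euclidean space\<close>

lemma enum_idx_bij: "bij_betw (enum_idx :: nat => 'n::finite) {..<CARD('n)} UNIV"
proof -
 obtain e :: "nat => 'n" where "bij_betw e {0..<CARD('n)} UNIV"
  using ex_bij_betw_nat_finite[of "UNIV :: 'n set"] by auto
 hence "\<exists>e :: nat => 'n. bij_betw e {..<CARD('n)} UNIV" by (auto simp: atLeast0LessThan)
 thus ?thesis unfolding enum_idx_def by (rule someI_ex)
qed

definition vec_basis :: "(real^'n::finite) list" where
 "vec_basis = map (%i. axis (enum_idx i) 1) [0..<CARD('n)]"

lemma basis_list_vec: "basis_list (vec_basis :: (real^'n::finite) list)"
proof -
 have "inj_on (%i. axis (enum_idx i) 1 :: real^'n) {..<CARD('n)}"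
  using enum_idx_bij[where 'n='n] by (auto simp: bij_betw_def inj_on_def axis_eq_axis)
 moreover have "(%i. axis (enum_idx i) 1 :: real^'n) ` {..<CARD('n)} = (%j. axis j 1) ` (enum_idx ` {..<CARD('n)})"
  by auto
 hence "(%i. axis (enum_idx i) 1 :: real^'n) ` {..<CARD('n)} = Basis"
  using enum_idx_bij[where 'n='n] by (auto simp: bij_betw_def Basis_vec_def)
 ultimately show ?thesis by (simp add: basis_list_def vec_basis_def distinct_map atLeast_upt[symmetric] atLeast0LessThan)
qed

lemma length_vec_basis: "length (vec_basis :: (real^'n::finite) list) = CARD('n)"
 by (simp add: vec_basis_def)

lemma vec_to_list_eq_coords: "vec_to_list x = coords vec_basis x"
 by (simp add: vec_to_list_def coords_def vec_basis_def inner_axis)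

lemma length_vec_to_list [simp]: "length (vec_to_list (x :: real^'n::finite)) = CARD('n)"
 by (simp add: vec_to_list_def)

lemma list_to_vec_to_list [simp]: "list_to_vec (vec_to_list (x :: real^'n::finite)) = x"
proof -
 have "inv_into {..<CARD('n)} enum_idx j < CARD('n)" "enum_idx (inv_into {..<CARD('n)} enum_idx j) = j" for j :: 'n
  using enum_idx_bij[where 'n='n] inv_into_into[of j enum_idx "{..<CARD('n)}"] f_inv_into_f[of j enum_idx "{..<CARD('n)}"]
  by (auto simp: bij_betw_def)
 thus ?thesis by (simp add: vec_eq_iff list_to_vec_def vec_to_list_def)
qed

lemma vec_to_list_surj: "length xs = CARD('n) ==> \<exists>x :: real^'n::finite. vec_to_list x = xs"
 using coords_surj[OF basis_list_vec[where 'n='n], of xs] by (simp add: vec_to_list_eq_coords length_vec_basis)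

lemma lconv_vec_to_list: "lconv (%k. vec_to_list (u k)) (vec_to_list (v :: real^'n::finite)) \<longleftrightarrow> u \<longlonglongrightarrow> v"
proof
 assume l: "lconv (%k. vec_to_list (u k)) (vec_to_list v)"
 show "u \<longlonglongrightarrow> v"
 proof (rule vec_tendstoI)
  fix j :: 'n
  obtain i where i: "i < CARD('n)" "j = enum_idx i" using enum_idx_bij[where 'n='n] unfolding bij_betw_def by blast
  thus "(%k. u k $ j) \<longlonglongrightarrow> v $ j" using l by (simp add: lconv_def vec_to_list_def)
 qed
next
 assume "u \<longlonglongrightarrow> v"
 thus "lconv (%k. vec_to_list (u k)) (vec_to_list v)"
  by (auto simp: lconv_def vec_to_list_def intro: tendsto_vec_nth)
qed

lemma lconv_epsilon:
 "lconv u v ==> e > 0 ==> \<exists>k0. \<forall>k\<ge>k0. \<forall>i<length v. \<bar>u k ! i - v ! i\<bar> < e"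
proof -
 assume "lconv u v" "e > 0"
 hence "\<forall>i\<in>{..<length v}. eventually (%k. \<bar>u k ! i - v ! i\<bar> < e) sequentially"
  by (auto simp: lconv_def dest!: tendstoD simp: dist_real_def)
 hence "eventually (%k. \<forall>i\<in>{..<length v}. \<bar>u k ! i - v ! i\<bar> < e) sequentially"
  by (simp add: eventually_ball_finite)
 thus ?thesis by (auto simp: eventually_sequentially)
qed

text \<open>A first-order formula cannot quantify over sequences, but it can over a tolerance
  \<open>e\<close>. This makes closures of graphs of definable maps definable.\<close>

lemma graph_closure_chart_epsilon:
 assumes y: "length y = p" "i <= p" and X: "!!x. x \<in> X ==> length x = p" and g: "!!x. x \<in> X ==> length (g x) = length w"
 shows "graph_closure_chart i X g y w \<longleftrightarrow> (\<forall>e>0. \<exists>s x. s ~= 0 \<and> x \<in> X \<and>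
  (\<forall>j\<le>p. \<bar>s * (1 # x) ! j - chart_ins i y ! j\<bar> < e) \<and> (\<forall>j<length w. \<bar>g x ! j - w ! j\<bar> < e))" (is "_ \<longleftrightarrow> (\<forall>e>0. \<exists>s x. ?R e s x)")
proof -
 have len: "length (chart_ins i y) = Suc p" using y by (simp add: chart_ins_def)
 show ?thesis
 proof
  assume "graph_closure_chart i X g y w"
  then obtain s x where sx: "!!k. x k \<in> X \<and> s k ~= 0"
   "lconv (%k. map (%z. s k * z) (1 # x k)) (chart_ins i y)" "lconv (%k. g (x k)) w"
   unfolding graph_closure_chart_def by auto
  show "\<forall>e>0. \<exists>s x. ?R e s x"
  proof (intro allI impI)
   fix e :: real assume e: "e > 0"
   obtain k1 k2 where k: "!!k. k \<ge> k1 ==> \<forall>j<Suc p. \<bar>map (%z. s k * z) (1 # x k) ! j - chart_ins i y ! j\<bar> < e"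
    "!!k. k \<ge> k2 ==> \<forall>j<length w. \<bar>g (x k) ! j - w ! j\<bar> < e"
    using lconv_epsilon[OF sx(2) e] lconv_epsilon[OF sx(3) e] unfolding len by metis
   let ?k = "max k1 k2"
   have "\<bar>s ?k * (1 # x ?k) ! j - chart_ins i y ! j\<bar> < e" if "j <= p" for j
    using k(1)[of ?k] that X[of "x ?k"] sx(1)[of ?k] by (auto simp del: list.map simp: nth_map)
   thus "\<exists>s x. ?R e s x"
    using k(2)[of ?k] sx(1)[of ?k] by (intro exI[of _ "s ?k"] exI[of _ "x ?k"]) auto
  qed
 next
  assume a: "\<forall>e>0. \<exists>s x. ?R e s x"
  hence "\<exists>s x. ?R (inverse (Suc k)) s x" for k
   by (meson inverse_Suc)
  then obtain s x where sx: "!!k. s k ~= 0" "!!k. x k \<in> X"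
   "!!k j. j <= p ==> \<bar>s k * (1 # x k) ! j - chart_ins i y ! j\<bar> < inverse (Suc k)"
   "!!k j. j < length w ==> \<bar>g (x k) ! j - w ! j\<bar> < inverse (Suc k)" by metis
  have lim: "h \<longlonglongrightarrow> l" if "!!k. \<bar>h k - l\<bar> < inverse (Suc k)" for h and l :: real
   by (rule Lim_transform_bound[of "%k. h k - l", THEN LIM_zero_cancel, OF _ LIMSEQ_inverse_real_of_nat])
    (use that in \<open>auto simp: less_imp_le intro!: always_eventually\<close>)
  have "lconv (%k. map (%z. s k * z) (1 # x k)) (chart_ins i y)"
   unfolding lconv_def len
  proof (intro conjI allI impI)
   fix k show "length (map (%z. s k * z) (1 # x k)) = Suc p" using X sx(2) by simp
  next
   fix j assume j: "j < Suc p"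
   hence "(%k. s k * (1 # x k) ! j) \<longlonglongrightarrow> chart_ins i y ! j" using sx(3) by (intro lim) auto
   moreover have "map (%z. s k * z) (1 # x k) ! j = s k * (1 # x k) ! j" for k
    using j X[OF sx(2)] by (intro nth_map) simp
   ultimately show "(%k. map (%z. s k * z) (1 # x k) ! j) \<longlonglongrightarrow> chart_ins i y ! j" by presburger
  qed
  moreover have "lconv (%k. g (x k)) w"
   unfolding lconv_def using sx(2,4) g by (auto intro!: lim)
  ultimately show "graph_closure_chart i X g y w" unfolding graph_closure_chart_def using sx(1,2) by blast
 qed
qed

text \<open>In chart 0 the representatives are normalised in the first entry, so the factors
  \<open>s k\<close> tend to 1 and the points converge in affine space; continuity then leaves no
  further closure point.\<close>

lemma graph_closure_chart_affine:
 fixes f :: "real^'n::finite => real"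
 assumes f: "continuous_on UNIV f"
 shows "graph_closure_chart 0 {xs. length xs = CARD('n)} (%xs. [f (list_to_vec xs)]) (vec_to_list y) [t] \<longleftrightarrow> t = f y"
proof
 assume "graph_closure_chart 0 {xs. length xs = CARD('n)} (%xs. [f (list_to_vec xs)]) (vec_to_list y) [t]"
 then obtain s x where sx: "!!k. length (x k) = CARD('n)" "!!k. s k ~= 0"
  "lconv (%k. map (%z. s k * z) (1 # x k)) (1 # vec_to_list y)" "lconv (%k. [f (list_to_vec (x k))]) [t]"
  unfolding graph_closure_chart_def chart_ins_def by auto
 obtain v where v: "!!k. x k = vec_to_list (v k :: real^'n)" using vec_to_list_surj[OF sx(1)] by metis
 have s: "s \<longlonglongrightarrow> 1" using sx(3) by (auto simp: lconv_def)
 have "lconv (%k. vec_to_list (v k)) (vec_to_list y)"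
  unfolding lconv_def
 proof (intro conjI allI impI)
  fix j assume j: "j < length (vec_to_list y)"
  hence "(%k. map (%z. s k * z) (1 # x k) ! Suc j) \<longlonglongrightarrow> (1 # vec_to_list y) ! Suc j"
   using sx(3) unfolding lconv_def by (metis Suc_mono length_Cons)
  hence "(%k. s k * vec_to_list (v k) ! j) \<longlonglongrightarrow> vec_to_list y ! j" using j by (simp add: v)
  hence "(%k. s k * vec_to_list (v k) ! j / s k) \<longlonglongrightarrow> vec_to_list y ! j / 1" by (intro tendsto_divide s) auto
  thus "(%k. vec_to_list (v k) ! j) \<longlonglongrightarrow> vec_to_list y ! j" using sx(2) by simp
 qed simp
 hence "(%k. f (v k)) \<longlonglongrightarrow> f y"
  using f unfolding lconv_vec_to_list by (auto intro: continuous_on_tendsto_compose)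
 moreover have "(%k. f (v k)) \<longlonglongrightarrow> t" using sx(4) by (simp add: lconv_def v)
 ultimately show "t = f y" using LIMSEQ_unique by blast
next
 have m: "map (%z. 1 * z) ys = ys" for ys :: "real list" by (induction ys) auto
 assume "t = f y"
 thus "graph_closure_chart 0 {xs. length xs = CARD('n)} (%xs. [f (list_to_vec xs)]) (vec_to_list y) [t]"
  unfolding graph_closure_chart_def chart_ins_def
  by (intro exI[of _ "%_. 1"] exI[of _ "%_. vec_to_list y"]) (auto simp: lconv_def m)
qed

text \<open>The epsilon-delta formula for the derivative is first-order and is satisfied by the
  gradient only, hence it defines its graph.\<close>

lemma (in ominimal) dfn_grad_on:
 fixes F :: "'a::euclidean_space => real"
 assumes F: "dfn F" and P: "dpred P" and d: "!!x. P x ==> (F has_derivative (%h. G x \<bullet> h)) (at x)"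
 shows "dfn (%x. if P x then G x else 0)"
proof (rule dfnI)
 let ?Q = "%x v. \<forall>e::real. 0 < e --> (\<exists>d::real. 0 < d \<and> (\<forall>y. norm (y - x) < d -->
   norm (F y - F x - v \<bullet> (y - x)) <= e * norm (y - x)))"
 have Q: "?Q x v \<longleftrightarrow> v = G x" if "P x" for x v
 proof -
  have "?Q x v \<longleftrightarrow> (F has_derivative (%h. v \<bullet> h)) (at x)"
   unfolding has_derivative_at_alt using bounded_linear_inner_right[of v] by blast
  also have "... \<longleftrightarrow> v = G x"
  proof
   assume "(F has_derivative (%h. v \<bullet> h)) (at x)"
   hence "(%h. v \<bullet> h) = (%h. G x \<bullet> h)" using has_derivative_unique d[OF that] by blast
   thus "v = G x" by (metis vector_eq_rdot inner_commute)
  qed (use d[OF that] in auto)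
  finally show ?thesis .
 qed
 have "(%z. snd z = (if P (fst z) then G (fst z) else 0)) = (%z. (P (fst z) \<and> ?Q (fst z) (snd z)) \<or> (\<not> P (fst z) \<and> snd z = 0))"
  using Q by (auto simp: fun_eq_iff)
 moreover have "dpred (%z. (P (fst z) \<and> ?Q (fst z) (snd z)) \<or> (\<not> P (fst z) \<and> snd z = 0))"
  by (intro dintros dpred_compose[OF P] dfn_compose[OF F])
 ultimately show "dpred (%z. snd z = (if P (fst z) then G (fst z) else 0))" by simp
qed

section \<open>A definable function near a level\<close>

locale definable_level = ominimal S + level_sets f for S and f :: "real^'n::finite => real" +
 fixes c :: real
 assumes definable: "definable_fun S f"
begin

text \<open>Definability of a map speaks of its graph over balls of the target; the ball of radius 1
  about \<open>c\<close>, in the affine chart, gives this strip.\<close>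

lemma graph_dpred: "dpred (%z. snd z = f (fst z) \<and> \<bar>snd z - c\<bar> < 1)"
proof -
 let ?bs = "map (%a. (a, 0)) (vec_basis :: (real^'n) list) @ map (%b. (0, b)) [1::real]"
 have b: "basis_list ?bs" by (rule basis_list_prod[OF basis_list_vec basis_list_real])
 let ?A = "{y @ w |y w. length y = CARD('n) \<and> length w = 1 \<and> (\<Sum>j<1. (w ! j - [c] ! j)^2) < 1^2 \<and>
   graph_closure_chart 0 {xs. length xs = CARD('n)} (%xs. [f (list_to_vec xs)]) y w}"
 have A: "?A \<in> S (CARD('n) + 1)"
  using definable[unfolded definable_fun_def definable_map_def, rule_format, of "[c]" 1 0] by simp
 have co: "coords ?bs (y, t) = vec_to_list y @ [t]" for y :: "real^'n" and t
  using coords_prod[of vec_basis "[1]" y t] by (simp add: vec_to_list_eq_coords coords_real)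
 have "coords ?bs ` {z. snd z = f (fst z) \<and> \<bar>snd z - c\<bar> < 1} = ?A"
 proof (intro equalityI subsetI)
  fix xs assume "xs \<in> coords ?bs ` {z. snd z = f (fst z) \<and> \<bar>snd z - c\<bar> < 1}"
  then obtain y where y: "\<bar>f y - c\<bar> < 1" "xs = vec_to_list y @ [f y]" using co by auto
  have "(f y - c)\<^sup>2 < 1" using y(1) by (simp add: abs_square_less_1)
  thus "xs \<in> ?A" using graph_closure_chart_affine[OF f_continuous, of y "f y"] y(2)
   by (intro CollectI exI[of _ "vec_to_list y"] exI[of _ "[f y]"]) auto
 next
  fix xs assume "xs \<in> ?A"
  then obtain y w where yw: "xs = y @ w" "length y = CARD('n)" "length w = 1" "(\<Sum>j<1. (w ! j - [c] ! j)^2) < 1^2"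
   "graph_closure_chart 0 {xs. length xs = CARD('n)} (%xs. [f (list_to_vec xs)]) y w" by blast
  obtain t where t: "w = [t]" using yw(3) by (cases w) auto
  obtain v where v: "y = vec_to_list (v :: real^'n)" using vec_to_list_surj[OF yw(2)] by metis
  have "t = f v" using yw(5) graph_closure_chart_affine[OF f_continuous] unfolding t v by blast
  moreover have "\<bar>t - c\<bar> < 1" using yw(4) by (simp add: t abs_square_less_1)
  moreover have "xs = coords ?bs (v, t)" unfolding co yw(1) t v ..
  ultimately show "xs \<in> coords ?bs ` {z. snd z = f (fst z) \<and> \<bar>snd z - c\<bar> < 1}" by (intro image_eqI[of _ _ "(v, t)"]) auto
 qed
 thus ?thesis using A dpred_iff[OF b] by (simp add: length_vec_basis)
qed

definition "near_c x \<longleftrightarrow> \<bar>f x - c\<bar> < 1"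

text \<open>\<open>dfn\<close> concerns total functions. The default \<open>c + 1\<close> lies just
  outside the strip, so it is never mistaken for a value within distance 1 of
  \<open>c\<close>.\<close>

definition "ftrunc x = (if near_c x then f x else c + 1)"

definition "gtrunc x = (if near_c x then grad f x else 0)"

lemma near_c_dpred: "dpred near_c"
proof -
 have "near_c = (%x. \<exists>t. t = f x \<and> \<bar>t - c\<bar> < 1)" by (auto simp: near_c_def)
 thus ?thesis using dpred_ex[of "%x t. t = f x \<and> \<bar>t - c\<bar> < 1", OF graph_dpred] by simp
qed

lemma ftrunc_dfn: "dfn ftrunc"
proof (rule dfnI)
 have "(%z. snd z = ftrunc (fst z)) = (%z. (snd z = f (fst z) \<and> \<bar>snd z - c\<bar> < 1) \<or> (snd z = c + 1 \<and> \<not> near_c (fst z)))"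
  by (auto simp: ftrunc_def near_c_def)
 moreover have "dpred (%z. (snd z = f (fst z) \<and> \<bar>snd z - c\<bar> < 1) \<or> (snd z = c + 1 \<and> \<not> near_c (fst z)))"
  by (rule dpred_or[OF graph_dpred]) (intro dintros dpred_compose[OF near_c_dpred])
 ultimately show "dpred (%z. snd z = ftrunc (fst z))" by simp
qed

lemma gtrunc_dfn: "dfn gtrunc"
 unfolding gtrunc_def[abs_def]
proof (rule dfn_grad_on[OF ftrunc_dfn near_c_dpred])
 fix x assume x: "near_c x"
 have "open {x. near_c x}" unfolding near_c_def by (intro open_Collect_less continuous_intros f_continuous)
 thus "(ftrunc has_derivative (%h. grad f x \<bullet> h)) (at x)"
  by (rule has_derivative_transform_within_open[OF f_derivative]) (use x in \<open>auto simp: ftrunc_def\<close>)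
qed

end

subsection \<open>Total curvature and limits of tangent hyperplanes\<close>

lemma closest_point_subspace_eq:
 fixes V :: "'a::euclidean_space set"
 assumes V: "subspace V" and p: "p \<in> V" and o: "!!z. z \<in> V ==> (u - p) \<bullet> z = 0"
 shows "closest_point V u = p"
proof (rule closest_point_unique[symmetric])
 show "\<forall>z\<in>V. dist u p <= dist u z"
 proof
  fix z assume "z \<in> V"
  hence "orthogonal (u - p) (p - z)" unfolding orthogonal_def using p V by (intro o subspace_diff)
  moreover have "(u - p) + (p - z) = u - z" by simp
  ultimately have "(norm (u - z))\<^sup>2 = (norm (u - p))\<^sup>2 + (norm (p - z))\<^sup>2"
   using norm_add_Pythagorean by metis
  hence "(norm (u - p))\<^sup>2 <= (norm (u - z))\<^sup>2" by simp
  thus "dist u p <= dist u z" unfolding dist_norm by (rule power2_le_imp_le) simp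
 qed
qed (use V p in \<open>auto intro: subspace_imp_convex closed_subspace\<close>)

lemma closest_point_hyperplane:
 fixes a :: "'a::euclidean_space"
 assumes "a ~= 0"
 shows "closest_point {v. a \<bullet> v = 0} u = u - ((a \<bullet> u) / (a \<bullet> a)) *\<^sub>R a"
 using assms by (intro closest_point_subspace_eq subspace_hyperplane) (auto simp: inner_diff_right)

lemma norm_reject_unit:
 assumes "b \<bullet> b = 1" shows "(norm (x - (x \<bullet> b) *\<^sub>R b))\<^sup>2 = (norm x)\<^sup>2 - (x \<bullet> b)\<^sup>2"
proof -
 have "(x - t *\<^sub>R b) \<bullet> (x - t *\<^sub>R b) = x \<bullet> x - 2 * t * (x \<bullet> b) + t * t" for t
  unfolding inner_diff_left inner_diff_right inner_scaleR_left inner_scaleR_right inner_commute[of b x] assms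
  by (simp add: algebra_simps)
 from this[of "x \<bullet> b"] show ?thesis unfolding power2_norm_eq_inner by (simp add: power2_eq_square)
qed

text \<open>On the cap where a signed coordinate is at least 1/n, the projection along that axis has
  a Lipschitz inverse. Finitely many caps cover the sphere, because the norm is at most the sum of
  the absolute coordinates and so one of these is at least 1/n.\<close>

lemma hausdorff_sphere_finite:
 "\<H> (CARD('n) - 1) (sphere (0 :: real^'n::finite) 1) < \<infinity>"
proof -
 let ?H = "\<H> (CARD('n) - 1) :: (real^'n) set => ennreal"
 define a where "a = 1 / real CARD('n)"
 have a: "a > 0" by (simp add: a_def)
 define C where "C b s = {x :: real^'n. norm x = 1 \<and> s * (x \<bullet> b) \<ge> a}" for b and s :: real
 have fin: "?H (C b s) < \<infinity>" if b: "b \<in> Basis" and s: "s = 1 \<or> s = -1" for b s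
 proof -
  define P where "P x = x - (x \<bullet> b) *\<^sub>R b" for x :: "real^'n"
  have bb: "b \<bullet> b = 1" "norm b = 1" using b by auto
  have nP: "(norm (P x))\<^sup>2 = (norm x)\<^sup>2 - (x \<bullet> b)\<^sup>2" for x
   unfolding P_def by (rule norm_reject_unit[OF bb(1)])
  have exp: "dist x y <= (1 + 1 / a) * dist (P x) (P y)" if xy: "x \<in> C b s" "y \<in> C b s" for x y
  proof -
   have n: "norm x = 1" "norm y = 1" "s * (x \<bullet> b) \<ge> a" "s * (y \<bullet> b) \<ge> a" using xy by (auto simp: C_def)
   have P1: "norm (P x) <= 1" "norm (P y) <= 1"
    using nP[of x] nP[of y] n power2_le_imp_le[of "norm (P x)" 1] power2_le_imp_le[of "norm (P y)" 1] by auto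
   have "\<bar>x \<bullet> b - y \<bullet> b\<bar> * (2 * a) <= \<bar>x \<bullet> b - y \<bullet> b\<bar> * \<bar>x \<bullet> b + y \<bullet> b\<bar>"
    using s n by (intro mult_left_mono) auto
   also have "... = \<bar>(norm (P y))\<^sup>2 - (norm (P x))\<^sup>2\<bar>" unfolding nP n abs_mult[symmetric] by (simp add: power2_eq_square algebra_simps)
   also have "... = \<bar>norm (P y) - norm (P x)\<bar> * \<bar>norm (P y) + norm (P x)\<bar>"
    unfolding abs_mult[symmetric] by (simp add: power2_eq_square algebra_simps)
   also have "... <= norm (P y - P x) * 2" using P1 norm_triangle_ineq3 by (intro mult_mono) auto
   finally have d: "\<bar>x \<bullet> b - y \<bullet> b\<bar> <= norm (P x - P y) / a" using a by (simp add: field_simps norm_minus_commute)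
   have "x - y = (P x - P y) + (x \<bullet> b - y \<bullet> b) *\<^sub>R b" by (simp add: P_def algebra_simps)
   hence "norm (x - y) <= norm (P x - P y) + \<bar>x \<bullet> b - y \<bullet> b\<bar>" by (metis bb(2) norm_triangle_ineq norm_scaleR mult.right_neutral)
   thus ?thesis using d by (simp add: dist_norm algebra_simps)
  qed
  have inj: "inj_on P (C b s)"
   using exp by (intro inj_onI) (metis dist_eq_0_iff dist_le_zero_iff mult_zero_right)
  define g where "g = inv_into (C b s) P"
  have l: "?H (g ` (P ` C b s)) <= ennreal ((1 + 1 / a) ^ (CARD('n) - 1)) * ?H (P ` C b s)"
  proof (rule hausdorff_outer_lipschitz)
   fix x y assume "x \<in> P ` C b s" "y \<in> P ` C b s"
   then obtain x' y' where "x' \<in> C b s" "x = P x'" "y' \<in> C b s" "y = P y'" by auto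
   thus "dist (g x) (g y) <= (1 + 1 / a) * dist x y" using exp inj by (simp add: g_def)
  qed (use a in \<open>simp add: add_pos_pos\<close>)
  have i: "g ` (P ` C b s) = C b s" unfolding g_def by (rule inv_into_image_cancel[OF inj order_refl])
  have m: "?H (P ` C b s) <= ?H {x. x \<bullet> b = 0 \<and> norm x <= 1}"
  proof (rule hausdorff_outer_mono, safe)
   fix x assume "x \<in> C b s"
   hence "(norm (P x))\<^sup>2 <= 1\<^sup>2" using nP[of x] by (simp add: C_def)
   thus "norm (P x) <= 1" by (rule power2_le_imp_le) simp
   show "P x \<bullet> b = 0" by (simp add: P_def inner_diff_left bb)
  qed
  have "?H (C b s) <= ennreal ((1 + 1 / a) ^ (CARD('n) - 1)) * ?H {x. x \<bullet> b = 0 \<and> norm x <= 1}"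
   by (rule order_trans[OF l[unfolded i] mult_left_mono[OF m]]) simp
  also have "... < \<infinity>" using hausdorff_hyperplane_ball_finite[OF bb(2), of 1] by (simp add: ennreal_mult_less_top)
  finally show ?thesis .
 qed
 have fin2: "?H (\<Union>p\<in>I. C (fst p) (snd p)) < \<infinity>" if "finite I" "I \<subseteq> Basis \<times> {1, -1}" for I
  using that
 proof (induction I rule: finite_induct)
  case (insert p I)
  have "?H (C (fst p) (snd p) \<union> (\<Union>p\<in>I. C (fst p) (snd p))) <= ?H (C (fst p) (snd p)) + ?H (\<Union>p\<in>I. C (fst p) (snd p))"
   by (rule hausdorff_outer_Un_le)
  also have "... < \<infinity>" using insert fin[of "fst p" "snd p"] by auto
  finally show ?case by simp
 qed (simp add: hausdorff_outer_empty)
 have "sphere 0 1 \<subseteq> (\<Union>p\<in>Basis \<times> {1, -1}. C (fst p) (snd p))"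
 proof
  fix x :: "real^'n" assume "x \<in> sphere 0 1"
  hence n: "norm x = 1" by simp
  have "\<exists>b\<in>Basis. \<bar>x \<bullet> b\<bar> \<ge> a"
  proof (rule ccontr)
   assume "\<not> ?thesis"
   hence "(\<Sum>b\<in>Basis. \<bar>x \<bullet> b\<bar>) < (\<Sum>b\<in>(Basis :: (real^'n) set). a)" by (intro sum_strict_mono) auto
   thus False using norm_le_l1[of x] n by (simp add: a_def)
  qed
  then obtain b where b: "b \<in> Basis" "\<bar>x \<bullet> b\<bar> \<ge> a" by blast
  define s :: real where "s = (if x \<bullet> b \<ge> 0 then 1 else -1)"
  have "x \<in> C b s" using n b(2) by (auto simp: C_def s_def split: if_splits)
  moreover have "(b, s) \<in> Basis \<times> {1, -1}" using b(1) by (simp add: s_def)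
  ultimately show "x \<in> (\<Union>p\<in>Basis \<times> {1, -1}. C (fst p) (snd p))" by (intro UN_I[of "(b, s)"]) auto
 qed
 thus ?thesis by (rule le_less_trans[OF hausdorff_outer_mono fin2]) auto
qed

text \<open>Projection along \<open>u\<close> does not increase distances, and the image of the cap
  contains a disc.\<close>

lemma hausdorff_sphere_cap_pos:
 fixes u :: "real^'n::finite"
 assumes u: "norm u = 1" and r: "r > 0"
 shows "\<H> (CARD('n) - 1) {x. norm x = 1 \<and> norm (x - u) < r} > 0"
proof -
 let ?H = "\<H> (CARD('n) - 1) :: (real^'n) set => ennreal" and ?A = "{x. norm x = 1 \<and> norm (x - u) < r}"
 have uu: "u \<bullet> u = 1" using u by (simp add: norm_eq_1)
 define P where "P x = x - (x \<bullet> u) *\<^sub>R u" for x :: "real^'n"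
 define d where "d = min 1 (r / 2)"
 have d: "d > 0" "d <= 1" "d < r" using r by (auto simp: d_def)
 have "{y. y \<bullet> u = 0 \<and> norm y < d / 2} \<subseteq> P ` ?A"
 proof
  fix y assume "y \<in> {y. y \<bullet> u = 0 \<and> norm y < d / 2}"
  hence y: "y \<bullet> u = 0" "u \<bullet> y = 0" "norm y < d / 2" by (auto simp: inner_commute)
  define t where "t = sqrt (1 - (norm y)\<^sup>2)"
  have ny: "norm y <= 1" "(norm y)\<^sup>2 <= norm y" using y d by (auto simp: power2_eq_square mult_left_le)
  have tt: "t\<^sup>2 = 1 - (norm y)\<^sup>2" "t \<ge> 0" using ny by (auto simp: t_def)
  have t1: "t <= 1" using tt power2_le_imp_le[of t 1] by auto
  hence "1 - t <= 1 - t\<^sup>2" using tt(2) by (simp add: power2_eq_square mult_left_le)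
  hence t2: "1 - t <= norm y" using tt(1) ny(2) by linarith
  define x where "x = y + t *\<^sub>R u"
  have "x \<bullet> x = y \<bullet> y + t\<^sup>2"
   unfolding x_def inner_add_left inner_add_right inner_scaleR_left inner_scaleR_right y(1,2) uu by (simp add: power2_eq_square)
  hence "x \<bullet> x = 1" using tt(1) by (simp add: power2_norm_eq_inner)
  hence n: "norm x = 1" by (simp add: norm_eq_1)
  have "norm (x - u) <= norm y + norm ((1 - t) *\<^sub>R u)"
   unfolding x_def using norm_triangle_ineq4[of y "(1 - t) *\<^sub>R u"] by (simp add: algebra_simps)
  also have "... < r" using t1 t2 y(3) d u by simp
  finally have "x \<in> ?A" using n by simp
  moreover have "P x = y" using y uu by (simp add: P_def x_def inner_add_left)
  ultimately show "y \<in> P ` ?A" by blast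
 qed
 hence "?H {y. y \<bullet> u = 0 \<and> norm y < d / 2} <= ?H (P ` ?A)" by (rule hausdorff_outer_mono)
 also have "... <= ennreal (1 ^ (CARD('n) - 1)) * ?H ?A"
 proof (rule hausdorff_outer_lipschitz)
  fix x y :: "real^'n"
  have "(norm (P (x - y)))\<^sup>2 = (norm (x - y))\<^sup>2 - ((x - y) \<bullet> u)\<^sup>2"
   unfolding P_def by (rule norm_reject_unit[OF uu])
  hence "norm (P (x - y)) <= norm (x - y)" using power2_le_imp_le[of "norm (P (x - y))" "norm (x - y)"] by auto
  moreover have "P (x - y) = P x - P y" by (simp add: P_def inner_diff_left algebra_simps)
  ultimately show "dist (P x) (P y) <= 1 * dist x y" by (simp add: dist_norm)
 qed simp
 finally show ?thesis using hausdorff_hyperplane_ball_pos[OF u, of "d / 2"] d(1) by (simp add: order_less_le_trans)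
qed

section \<open>Counting points with a given normal\<close>

context level_sets
begin

text \<open>Value and normal are combined in polar form into the map \<open>\<Psi>\<close> from the
  space to itself: direction \<open>\<nu>\<close>, radius the exponential of \<open>f - f a\<close>.
  Its derivative at \<open>a\<close> is injective, since the gradient controls the radial part and
  the shape operator the rest. So a neighbourhood of \<open>\<nu> a\<close> is attained, in
  particular a piece of the ray through it.\<close>

lemma level_persistence:
 assumes k: "gauss_curv f a ~= 0" and U: "open U" "a \<in> U"
 shows "\<exists>d>0. \<forall>t. \<bar>t - f a\<bar> < d --> (\<exists>x\<in>U. f x = t \<and> \<nu> x = \<nu> a)"
proof -
 define \<Psi> where "\<Psi> x = exp (f x - f a) *\<^sub>R \<nu> x" for x
 define L where "L v = \<nu>' a v + (grad f a \<bullet> v) *\<^sub>R \<nu> a" for v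
 have der: "(\<Psi> has_derivative L) (at a)"
  unfolding \<Psi>_def[abs_def] L_def[abs_def]
  by (rule has_derivative_eq_rhs, (rule derivative_intros \<nu>_derivative f_derivative)+) (auto simp: fun_eq_iff)
 have lin: "linear L" using der by (rule has_derivative_linear)
 have "v = 0" if v: "L v = 0" for v
 proof -
  have g: "grad f a = norm (grad f a) *\<^sub>R \<nu> a" using nocrit[of a] by (simp add: gauss_map_def)
  have "\<nu> a \<bullet> L v = grad f a \<bullet> v" using \<nu>_tangent[of a v] by (simp add: L_def inner_add_right)
  hence gv: "grad f a \<bullet> v = 0" using v by simp
  hence "v \<bullet> \<nu> a = 0" using g nocrit[of a] by (metis inner_commute inner_scaleR_left mult_eq_0_iff norm_eq_zero)
  moreover have "\<nu>' a v = 0" using v gv by (simp add: L_def)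
  ultimately have "shape a v = 0" using shape_tangent(1) by simp
  moreover have "inj (shape a)" using k det_nz_iff_inj[OF shape_linear] by (simp add: gauss_curv_eq)
  ultimately show "v = 0" using linear_injective_0[OF shape_linear] by blast
 qed
 hence "inj L" using linear_injective_0[OF lin] by blast
 then obtain L' where L': "linear L'" "!!x. L (L' x) = x" using linear_injective_isomorphism[OF lin] by metis
 have "\<Psi> a \<in> interior (\<Psi> ` U)"
 proof (rule sussmann_open_mapping[OF open_UNIV _ UNIV_I der])
  show "continuous_on UNIV \<Psi>" unfolding \<Psi>_def[abs_def] by (intro continuous_intros f_continuous \<nu>_continuous)
  show "L \<circ> L' = id" using L'(2) by auto
 qed (use L'(1) U interior_open in \<open>auto simp: linear_conv_bounded_linear\<close>)
 then obtain e where e: "e > 0" "ball (\<nu> a) e \<subseteq> \<Psi> ` U" unfolding mem_interior by (auto simp: \<Psi>_def)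
 have "isCont exp (0::real)" by simp
 then obtain d where d: "d > 0" "!!s::real. \<bar>s\<bar> < d ==> \<bar>exp s - 1\<bar> < e"
  unfolding continuous_at_eps_delta using e(1) by (auto simp: dist_real_def)
 have "\<exists>x\<in>U. f x = t \<and> \<nu> x = \<nu> a" if "\<bar>t - f a\<bar> < d" for t
 proof -
  let ?s = "exp (t - f a)"
  have "dist (\<nu> a) (?s *\<^sub>R \<nu> a) = norm ((1 - ?s) *\<^sub>R \<nu> a)" by (simp add: dist_norm scaleR_diff_left)
  also have "... < e" using d(2)[OF that] by simp
  finally have "?s *\<^sub>R \<nu> a \<in> \<Psi> ` U" using e(2) by auto
  then obtain x where x: "x \<in> U" "\<Psi> x = ?s *\<^sub>R \<nu> a" by auto
  hence "norm (exp (f x - f a) *\<^sub>R \<nu> x) = norm (?s *\<^sub>R \<nu> a)" by (simp add: \<Psi>_def)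
  hence "f x = t" by simp
  moreover have "\<nu> x = \<nu> a" using x(2) \<open>f x = t\<close> by (simp add: \<Psi>_def)
  ultimately show ?thesis using x(1) by blast
 qed
 thus ?thesis using d(1) by blast
qed

lemma hausdorff_uminus: "\<H> m (uminus ` A) = \<H> m (A :: 'a::euclidean_space set)"
 by (rule hausdorff_outer_isometry) (simp add: dist_norm norm_minus_commute)

text \<open>Tangent hyperplanes leave the sign of the normal open, so counts at \<open>u\<close> and
  \<open>- u\<close> will be added; the antipodal map is an isometry and preserves the
  measure.\<close>

lemma NN_uminus:
 "(%u. NN t (- u)) \<in> borel_measurable HM" "(\<integral>\<^sup>+ u. NN t (- u) \<partial>HM) = (\<integral>\<^sup>+ u. NN t u \<partial>HM)"
proof -
 have m: "uminus \<in> measurable HM HM"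
  using measurable_sets_borel[OF borel_measurable_continuous_onI[of "uminus :: real^'n => _"]] continuous_on_minus[OF continuous_on_id, of UNIV]
  by (intro measurableI) (auto simp: id_def)
 show "(%u. NN t (- u)) \<in> borel_measurable HM" by (rule measurable_compose[OF m NN_measurable])
 have "distr HM HM uminus = HM"
 proof (rule measure_eqI)
  fix A assume A: "A \<in> sets (distr HM HM uminus)"
  hence Ab: "A \<in> sets borel" by simp
  have b: "uminus -` A \<in> sets borel" using measurable_sets[OF m, of A] A by simp
  have "uminus -` A = uminus ` A" by (auto simp: image_iff) (metis minus_minus)
  thus "emeasure (distr HM HM uminus) A = emeasure HM A"
   using A m b Ab by (simp add: emeasure_distr emeasure_hausdorff_measure hausdorff_uminus)
 qed simp
 thus "(\<integral>\<^sup>+ u. NN t (- u) \<partial>HM) = (\<integral>\<^sup>+ u. NN t u \<partial>HM)"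
  using nn_integral_distr[OF m, of "NN t"] NN_measurable by simp
qed

end

context definable_level
begin

text \<open>Isolation among the points of the level with normal \<open>u\<close> is a first-order
  stand-in for nonvanishing curvature: it follows from the latter and still yields countable
  fibres.\<close>

definition "isolated_normal u x \<longleftrightarrow> ftrunc x = c \<and> (\<exists>s>0. gtrunc x = s *\<^sub>R u) \<and>
 (\<exists>d>0. \<forall>z. norm (z - x) < d \<and> ftrunc z = c \<and> (\<exists>s>0. gtrunc z = s *\<^sub>R u) --> z = x)"

lemma isolated_normal_dpred: "dpred (%z. isolated_normal (fst z) (snd z))"
 unfolding isolated_normal_def
 by (intro dintros dfn_compose[OF ftrunc_dfn] dfn_compose[OF gtrunc_dfn])

lemma ftrunc_eq_c: "ftrunc x = c \<longleftrightarrow> f x = c"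
 by (auto simp: ftrunc_def near_c_def)

lemma normal_iff: "f x = c ==> norm u = 1 ==> (\<exists>s>0. gtrunc x = s *\<^sub>R u) \<longleftrightarrow> \<nu> x = u"
proof
 assume a: "f x = c" "norm u = 1" "\<exists>s>0. gtrunc x = s *\<^sub>R u"
 thus "\<nu> x = u" by (auto simp: gtrunc_def near_c_def gauss_map_def)
next
 assume a: "f x = c" "norm u = 1" "\<nu> x = u"
 thus "\<exists>s>0. gtrunc x = s *\<^sub>R u" using nocrit[of x]
  by (intro exI[of _ "norm (grad f x)"]) (auto simp: gtrunc_def near_c_def gauss_map_def)
qed

lemma isolated_normal_countable: "countable {x. isolated_normal u x}"
proof -
 let ?Q = "{x. isolated_normal u x}"
 have "\<forall>x\<in>?Q. \<exists>d>0. \<forall>z\<in>?Q. norm (z - x) < d --> z = x" by (auto simp: isolated_normal_def)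
 from bchoice[OF this] obtain d where d: "\<forall>x\<in>?Q. d x > 0 \<and> (\<forall>z\<in>?Q. norm (z - x) < d x --> z = x)" by (rule exE)
 hence dpos: "\<forall>x\<in>?Q. d x > 0" by blast
 obtain P k where P: "?Q = (\<Union>i::nat. P i)" "disjoint_family P"
  "\<forall>i. P i = {} \<or> k i \<in> ?Q \<and> P i \<subseteq> ball (k i) (d (k i))" "\<forall>i. \<exists>C V. closed C \<and> open V \<and> P i = ?Q \<inter> C \<inter> V"
  by (rule lindelof_partitionE[OF dpos])
 have "P i \<subseteq> {k i}" for i
 proof
  fix z assume z: "z \<in> P i"
  hence "k i \<in> ?Q" "z \<in> ball (k i) (d (k i))" using P(3)[rule_format, of i] by auto
  moreover have "z \<in> ?Q" using P(1) z by blast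
  ultimately have "z = k i" using d by (auto simp: dist_norm norm_minus_commute)
  thus "z \<in> {k i}" by simp
 qed
 hence "(\<Union>i. P i) \<subseteq> range k" by blast
 thus ?thesis unfolding P(1) by (rule countable_subset) simp
qed

text \<open>Nondegenerate points are isolated in their fibre of the Gauss map. Each coordinate of
  the isolated points ranges over a definable countable, hence finite, set of reals, and uniform
  finiteness bounds these sets for all \<open>u\<close> at once.\<close>

lemma NN_bounded: "\<exists>N::nat. \<forall>u. finite {x \<in> regs c. \<nu> x = u} \<and> NN c u <= of_nat N"
proof -
 define B where "B b u y \<longleftrightarrow> (\<exists>x. isolated_normal u x \<and> y = x \<bullet> b)" for b u :: "real^'n" and y
 have fin: "finite {y. B b u y}" if b: "b \<in> Basis" for b u
 proof (rule dpred_countable_finite)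
  show "dpred (B b u)" unfolding B_def
   by (intro dintros dpred_compose[OF isolated_normal_dpred, of "%z. (u, snd z)", simplified] dfn_inner_Basis b)
  have "{y. B b u y} = (%x. x \<bullet> b) ` {x. isolated_normal u x}" by (auto simp: B_def)
  thus "countable {y. B b u y}" using isolated_normal_countable by simp
 qed
 have "\<exists>N. \<forall>u. card {y. B b u y} <= N" if b: "b \<in> Basis" for b
 proof (rule uniform_finiteness)
  have "dpred (%z. \<exists>x. isolated_normal (fst z) x \<and> snd z = x \<bullet> b)"
   by (intro dintros dpred_compose[OF isolated_normal_dpred, of "%z. (fst (fst z), snd z)", simplified] dfn_inner_Basis b)
  thus "dpred (%z. B b (fst z) (snd z))" unfolding B_def .
 qed (rule fin[OF b])
 then obtain M where M: "!!b u. b \<in> Basis ==> card {y. B b u y} <= M b" by metis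
 have "finite {x \<in> regs c. \<nu> x = u} \<and> NN c u <= of_nat (\<Prod>b\<in>Basis. M b)" for u
 proof (cases "norm u = 1")
  case True
  let ?I = "{x. isolated_normal u x}" and ?e = "%x::real^'n. restrict (%b. x \<bullet> b) Basis"
  have inj: "inj_on ?e ?I"
  proof (rule inj_onI)
   fix x y :: "real^'n" assume "?e x = ?e y"
   hence "x \<bullet> b = y \<bullet> b" if "b \<in> Basis" for b using that by (metis restrict_apply')
   thus "x = y" by (rule euclidean_eqI)
  qed
  have sub: "?e ` ?I \<subseteq> PiE Basis (%b. {y. B b u y})" by (auto simp: B_def)
  have finP: "finite (PiE Basis (%b. {y. B b u y}))" by (intro finite_PiE fin) auto
  have I: "finite ?I" "card ?I <= (\<Prod>b\<in>Basis. M b)"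
  proof -
   show "finite ?I" using inj sub finP by (meson finite_imageD finite_subset)
   have "card ?I <= card (PiE Basis (%b. {y. B b u y}))" by (rule card_inj_on_le[OF inj sub finP])
   also have "... = (\<Prod>b\<in>Basis. card {y. B b u y})" by (simp add: card_PiE)
   also have "... <= (\<Prod>b\<in>Basis. M b)" using M by (intro prod_mono) auto
   finally show "card ?I <= (\<Prod>b\<in>Basis. M b)" .
  qed
  have R: "{x \<in> regs c. \<nu> x = u} \<subseteq> ?I"
  proof
   fix x assume "x \<in> {x \<in> regs c. \<nu> x = u}"
   hence x: "f x = c" "gauss_curv f x ~= 0" "\<nu> x = u" by (auto simp: regs_def)
   have "(2::real) > 1" by simp
   from curv_local_nonzero[OF x(2) this] obtain \<delta> where \<delta>: "\<delta> > 0"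
    "\<forall>z1\<in>ball x \<delta>. \<forall>z2\<in>ball x \<delta>. f z1 = f z2 \<and> \<nu> z1 = \<nu> z2 --> z1 = z2" by blast
   have "z = x" if z: "norm (z - x) < \<delta>" "ftrunc z = c" "\<exists>s>0. gtrunc z = s *\<^sub>R u" for z
   proof -
    have "f z = c" using z(2) ftrunc_eq_c by simp
    moreover have "\<nu> z = u" using normal_iff[OF \<open>f z = c\<close> True] z(3) by simp
    moreover have "z \<in> ball x \<delta>" "x \<in> ball x \<delta>" using z(1) \<delta>(1) by (auto simp: dist_norm norm_minus_commute)
    ultimately show "z = x" using \<delta>(2) x by blast
   qed
   hence "isolated_normal u x" unfolding isolated_normal_def
    using x(1) normal_iff[OF x(1) True] x(3) ftrunc_eq_c \<delta>(1) by blast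
   thus "x \<in> ?I" by simp
  qed
  have f: "finite {x \<in> regs c. \<nu> x = u}" using R I(1) by (rule finite_subset)
  hence "NN c u = of_nat (card {x \<in> regs c. \<nu> x = u})" by (simp add: NN_def emeasure_count_space_finite)
  also have "... <= of_nat (\<Prod>b\<in>Basis. M b)" using card_mono[OF I(1) R] I(2) by (intro of_nat_mono) linarith
  finally show ?thesis using f by blast
 next
  case False
  hence e: "{x \<in> regs c. \<nu> x = u} = {}" by auto
  show ?thesis unfolding NN_def e by simp
 qed
 thus ?thesis by blast
qed

text \<open>The bounded count lives on the unit sphere, which has finite measure. Finiteness is what
  permits a cancellation after Fatou's lemma.\<close>

lemma total_abs_curv_finite: "total_abs_curv f c < \<infinity>"
proof -
 obtain N :: nat where N: "!!u. NN c u <= of_nat N" using NN_bounded by blast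
 have s: "sphere 0 1 \<in> sets (borel :: (real^'n) measure)" by simp
 have "NN c u <= of_nat N * indicator (sphere 0 1) u" for u
 proof (cases "norm u = 1")
  case False
  hence e: "{x \<in> regs c. \<nu> x = u} = {}" by auto
  show ?thesis unfolding NN_def e by simp
 qed (use N[of u] in simp)
 hence "total_abs_curv f c <= (\<integral>\<^sup>+u. of_nat N * indicator (sphere 0 1) u \<partial>HM)"
  unfolding total_abs_curv_eq by (intro nn_integral_mono)
 also have "... = of_nat N * HH (sphere 0 1)" using s by (subst nn_integral_cmult_indicator) (simp_all add: emeasure_hausdorff_measure)
 also have "... < \<infinity>" using hausdorff_sphere_finite[where 'n='n] by (simp add: ennreal_mult_less_top of_nat_less_top)
 finally show ?thesis .
qed

section \<open>Normals attained near infinity\<close>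

lemma Omega_density:
 assumes O: "{v. u \<bullet> v = 0} \<in> Omega f lam c" and u: "u ~= 0" and e: "e > 0" "\<eta> > 0"
 shows "\<exists>x s. norm x > R \<and> \<bar>f x - c\<bar> < e \<and> norm (s *\<^sub>R grad f x - u) < \<eta>"
proof -
 obtain x :: "nat => real^'n" where x: "filterlim (%k. norm (x k)) at_top sequentially" "(%k. f (x k)) \<longlonglongrightarrow> c"
  "subspace_conv (%k. tangent_level f (x k)) {v. u \<bullet> v = 0}" using O unfolding Omega_def by blast
 \<comment> \<open>Projecting \<open>u\<close> to a tangent hyperplane subtracts the multiple
   \<open>s k\<close> of the gradient, while its projection to the limit hyperplane is 0; so these
   multiples converge to \<open>u\<close>.\<close>
 define s where "s k = (grad f (x k) \<bullet> u) / (grad f (x k) \<bullet> grad f (x k))" for k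
 have "(%k. closest_point (tangent_level f (x k)) u) \<longlonglongrightarrow> closest_point {v. u \<bullet> v = 0} u"
  using x(3) unfolding subspace_conv_def by blast
 moreover have "closest_point {v. u \<bullet> v = 0} u = 0" using closest_point_hyperplane[OF u, of u] u by simp
 moreover have "closest_point (tangent_level f (x k)) u = u - s k *\<^sub>R grad f (x k)" for k
  unfolding tangent_level_def s_def by (rule closest_point_hyperplane[OF nocrit])
 ultimately have "(%k. u - s k *\<^sub>R grad f (x k)) \<longlonglongrightarrow> 0" by simp
 hence "eventually (%k. norm (s k *\<^sub>R grad f (x k) - u) < \<eta>) sequentially"
  by (drule_tac tendstoD[OF _ e(2)]) (simp add: norm_minus_commute)
 moreover have "eventually (%k. norm (x k) > R) sequentially" using x(1) unfolding filterlim_at_top_dense by blast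
 moreover have "eventually (%k. \<bar>f (x k) - c\<bar> < e) sequentially" using tendstoD[OF x(2) e(1)] by (simp add: dist_real_def)
 ultimately have "eventually (%k. norm (s k *\<^sub>R grad f (x k) - u) < \<eta> \<and> norm (x k) > R \<and> \<bar>f (x k) - c\<bar> < e) sequentially"
  by (intro eventually_conj)
 then obtain k where "norm (s k *\<^sub>R grad f (x k) - u) < \<eta> \<and> norm (x k) > R \<and> \<bar>f (x k) - c\<bar> < e"
  using eventually_happens'[OF sequentially_bot] by blast
 thus ?thesis by blast
qed

definition "parallel_at R t u \<longleftrightarrow> (\<exists>x. norm x > R \<and> near_c x \<and> ftrunc x = t \<and> (\<exists>s. gtrunc x = s *\<^sub>R u))"

text \<open>\<open>\<sigma>\<close> is 1 or -1 and selects the side of \<open>c\<close>; the width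
  \<open>e\<close> may shrink as \<open>R\<close> grows.\<close>

definition "escaping \<sigma> u \<longleftrightarrow> (\<forall>R. \<exists>e>0. \<forall>t. 0 < \<sigma> * (t - c) \<and> \<sigma> * (t - c) < e --> parallel_at R t u)"

text \<open>The level \<open>c\<close> itself is left out, as \<open>escaping\<close> asserts
  nothing about it.\<close>

definition "avoided k u \<longleftrightarrow> (\<forall>x. norm x > k \<and> near_c x \<and> 0 < \<bar>ftrunc x - c\<bar> \<and> \<bar>ftrunc x - c\<bar> < 1 / (k + 1) -->
 \<not> (\<exists>s. gtrunc x = s *\<^sub>R u))"

lemma parallel_at_dpred: "dpred (%z. parallel_at (fst z) (fst (snd z)) (snd (snd z)))"
 unfolding parallel_at_def
 by (intro dintros dpred_compose[OF near_c_dpred] dfn_compose[OF ftrunc_dfn] dfn_compose[OF gtrunc_dfn])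

lemma parallel_at_dpred': "dfn r ==> dfn t ==> dfn u ==> dpred (%z. parallel_at (r z) (t z) (u z))"
 using dpred_compose[OF parallel_at_dpred dfn_Pair[OF _ dfn_Pair], of r t u] by simp

lemma escaping_dpred: "dpred (escaping \<sigma>)"
 unfolding escaping_def by (intro dintros parallel_at_dpred')

lemma avoided_dpred: "dpred (avoided k)"
 unfolding avoided_def
 by (intro dintros dpred_compose[OF near_c_dpred] dfn_compose[OF ftrunc_dfn] dfn_compose[OF gtrunc_dfn])

text \<open>For fixed \<open>R\<close>, the levels at which \<open>u\<close> occurs form a definable
  set of reals; on each side it contains all or none of the levels close to \<open>c\<close>. If
  \<open>u\<close> escapes on neither side, its occurrences stop beyond some radius on both, and one
  integer serves as threshold.\<close>

lemma escaping_or_avoided: "escaping 1 u \<or> escaping (-1) u \<or> (\<exists>k::nat. avoided (real k) u)"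
proof (rule ccontr)
 assume n: "\<not> ?thesis"
 have d: "dpred (%t. parallel_at R t u)" for R by (intro parallel_at_dpred' dintros)
 have "\<exists>R e. e > 0 \<and> (\<forall>t. c < t \<and> t < c + e --> \<not> parallel_at R t u)"
 proof -
  obtain R where R: "!!e. e > 0 ==> \<exists>t. c < t \<and> t < c + e \<and> \<not> parallel_at R t u"
   using n unfolding escaping_def by (auto simp: algebra_simps)
  obtain e where e: "e > 0" "(\<forall>t. c < t \<and> t < c + e --> parallel_at R t u) \<or> (\<forall>t. c < t \<and> t < c + e --> \<not> parallel_at R t u)"
   using dpred_right_germ[OF d, of c R] by blast
  thus ?thesis using R[OF e(1)] by blast
 qed
 then obtain R1 e1 where 1: "e1 > 0" "!!t. c < t ==> t < c + e1 ==> \<not> parallel_at R1 t u" by blast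
 have "\<exists>R e. e > 0 \<and> (\<forall>t. c - e < t \<and> t < c --> \<not> parallel_at R t u)"
 proof -
  obtain R where R: "!!e. e > 0 ==> \<exists>t. t < c \<and> c - e < t \<and> \<not> parallel_at R t u"
   using n unfolding escaping_def by (auto simp: algebra_simps)
  obtain e where e: "e > 0" "(\<forall>t. c - e < t \<and> t < c --> parallel_at R t u) \<or> (\<forall>t. c - e < t \<and> t < c --> \<not> parallel_at R t u)"
   using dpred_left_germ[OF d, of c R] by blast
  thus ?thesis using R[OF e(1)] by blast
 qed
 then obtain R2 e2 where 2: "e2 > 0" "!!t. c - e2 < t ==> t < c ==> \<not> parallel_at R2 t u" by blast
 obtain k :: nat where k: "real k \<ge> max (max R1 R2) (max (1 / e1) (1 / e2))" using real_arch_simple by blast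
 have small: "1 / (real k + 1) <= e1" "1 / (real k + 1) <= e2"
 proof -
  have "1 / e1 <= real k + 1" "1 / e2 <= real k + 1" using k by auto
  thus "1 / (real k + 1) <= e1" "1 / (real k + 1) <= e2" using 1(1) 2(1) by (auto simp: field_simps)
 qed
 have "avoided (real k) u"
  unfolding avoided_def
 proof (intro allI impI notI)
  fix x assume x: "norm x > real k \<and> near_c x \<and> 0 < \<bar>ftrunc x - c\<bar> \<and> \<bar>ftrunc x - c\<bar> < 1 / (real k + 1)" "\<exists>s. gtrunc x = s *\<^sub>R u"
  have "norm x > R1" "norm x > R2" using x k by auto
  hence p: "parallel_at R1 (ftrunc x) u" "parallel_at R2 (ftrunc x) u" using x unfolding parallel_at_def by blast+
  show False
  proof (cases "ftrunc x > c")
   case True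
   thus False using 1(2)[of "ftrunc x"] p(1) x(1) small(1) by linarith
  next
   case False
   thus False using 2(2)[of "ftrunc x"] p(2) x(1) small(2) by linarith
  qed
 qed
 thus False using n by blast
qed

text \<open>Countably many definable sets cover the directions, so one of them contains an open set
  \<open>W\<close>. It cannot be an \<open>avoided\<close> one, because directions in
  \<open>W\<close> are approached by multiples of gradients at points near infinity with values near
  \<open>c\<close>. Escaping is invariant under scaling of the direction, so \<open>W\<close> can be
  brought to the unit sphere.\<close>

lemma escaping_cap:
 assumes e: "e ~= 0" and full: "!!u. u \<bullet> e ~= 0 ==> {v. u \<bullet> v = 0} \<in> Omega f lam c"
 shows "\<exists>\<sigma> u r. (\<sigma> = 1 \<or> \<sigma> = -1) \<and> norm u = 1 \<and> r > 0 \<and> (\<forall>v. norm v = 1 \<and> norm (v - u) < r --> escaping \<sigma> v)"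
proof -
 define P where "P k = (if k = (0::nat) then escaping 1 else if k = 1 then escaping (-1) else avoided (real (k - 2)))" for k
 let ?U = "{u. u \<bullet> e ~= 0}"
 have cov: "\<exists>k. P k u" for u
 proof -
  consider "escaping 1 u" | "escaping (-1) u" | k :: nat where "avoided (real k) u" using escaping_or_avoided by blast
  thus ?thesis
  proof cases
   case 1 thus ?thesis by (intro exI[of _ 0]) (simp add: P_def)
  next
   case 2 thus ?thesis by (intro exI[of _ 1]) (simp add: P_def)
  next
   case 3 thus ?thesis by (intro exI[of _ "k + 2"]) (simp add: P_def)
  qed
 qed
 have oU: "open ?U" by (intro open_Collect_neq continuous_intros)
 have "e \<in> ?U" using e by simp
 hence neU: "?U ~= {}" by blast
 have dP: "dpred (P k)" for k by (auto simp: P_def escaping_dpred avoided_dpred)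
 obtain k W where W: "open W" "W ~= {}" "W \<subseteq> ?U" "\<forall>x\<in>W. P k x"
  using dpred_cover_interior[of P ?U] dP oU neU cov by metis
 obtain w where w: "w \<in> W" using W(2) by blast
 obtain r where r: "r > 0" "ball w r \<subseteq> W" using W(1) w openE by blast
 have w0: "w ~= 0" "w \<bullet> e ~= 0" using W(3) w by auto
 have "k < 2"
 proof (rule ccontr)
  assume "\<not> k < 2"
  define m where "m = k - 2"
  have av: "avoided (real m) u" if "u \<in> W" for u using W(4) that \<open>\<not> k < 2\<close> by (simp add: P_def m_def)
  define e1 where "e1 = min 1 (1 / (real m + 1))"
  have e1: "e1 > 0" "e1 <= 1" "e1 <= 1 / (real m + 1)" by (auto simp: e1_def)
  have rw: "min r (norm w) > 0" using r(1) w0 by simp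
  obtain x s where xs: "norm x > real m" "\<bar>f x - c\<bar> < e1" "norm (s *\<^sub>R grad f x - w) < min r (norm w)"
   using Omega_density[OF full[OF w0(2)] w0(1) e1(1) rw] by blast
  let ?Z = "{z. norm z > real m} \<inter> {z. \<bar>f z - c\<bar> < e1} \<inter> {z. norm (s *\<^sub>R grad f z - w) < min r (norm w)}"
  have oZ: "open ?Z"
   by (intro open_Int open_Collect_less continuous_intros f_continuous Ck_on_continuous[OF grad_C1])
  have xZ: "x \<in> ?Z" using xs by simp
  \<comment> \<open>The point found may lie on the level \<open>c\<close>, which
    \<open>avoided\<close> ignores. Having no critical point, \<open>f\<close> is not locally
    constant, so a nearby point works.\<close>
  have "\<exists>z\<in>?Z. f z ~= c"
  proof (rule ccontr)
   assume "\<not> ?thesis"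
   hence "f z = c" if "z \<in> ?Z" for z using that by blast
   hence "(f has_derivative (%v. 0)) (at x)"
    by (intro has_derivative_transform_within_open[OF has_derivative_const[of c] oZ xZ]) auto
   hence "(%v. grad f x \<bullet> v) = (%v. 0)" using has_derivative_unique f_derivative by blast
   hence "grad f x \<bullet> grad f x = 0" by metis
   thus False using nocrit[of x] by simp
  qed
  then obtain z where z: "norm z > real m" "\<bar>f z - c\<bar> < e1" "norm (s *\<^sub>R grad f z - w) < min r (norm w)" "f z ~= c" by blast
  have "s ~= 0" using z(3) by auto
  have nz: "near_c z" using z(2) e1(2) by (simp add: near_c_def)
  have "s *\<^sub>R grad f z \<in> W" using r(2) z(3) by (auto simp: dist_norm norm_minus_commute)
  hence "avoided (real m) (s *\<^sub>R grad f z)" by (rule av)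
  moreover have "gtrunc z = (1 / s) *\<^sub>R (s *\<^sub>R grad f z)" using nz \<open>s ~= 0\<close> by (simp add: gtrunc_def)
  moreover have "0 < \<bar>ftrunc z - c\<bar> \<and> \<bar>ftrunc z - c\<bar> < 1 / (real m + 1)" using nz z(2,4) e1(3) by (simp add: ftrunc_def)
  ultimately show False using z(1) nz unfolding avoided_def by blast
 qed
 define \<sigma> :: real where "\<sigma> = (if k = 0 then 1 else -1)"
 have esc: "escaping \<sigma> u" if "u \<in> W" for u using W(4) that \<open>k < 2\<close> by (auto simp: P_def \<sigma>_def split: if_splits)
 define u where "u = w /\<^sub>R norm w"
 have "escaping \<sigma> v" if v: "norm v = 1" "norm (v - u) < r / norm w" for v
 proof -
  have "norm w *\<^sub>R v - w = norm w *\<^sub>R (v - u)" using w0 by (simp add: u_def algebra_simps)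
  hence "norm (norm w *\<^sub>R v - w) = norm w * norm (v - u)" by simp
  also have "... < r" using v(2) w0 by (simp add: field_simps)
  finally have "norm w *\<^sub>R v \<in> W" using r(2) by (auto simp: dist_norm norm_minus_commute)
  hence E: "escaping \<sigma> (norm w *\<^sub>R v)" by (rule esc)
  have "parallel_at R t (norm w *\<^sub>R v) ==> parallel_at R t v" for R t
   unfolding parallel_at_def by (metis scaleR_scaleR)
  thus ?thesis using E unfolding escaping_def by metis
 qed
 moreover have "norm u = 1" "r / norm w > 0" using w0 r(1) by (auto simp: u_def)
 ultimately show ?thesis by (intro exI[of _ \<sigma>] exI[of _ u] exI[of _ "r / norm w"]) (auto simp: \<sigma>_def)
qed

theorem Omega_omits_hyperplane:
 assumes cont: "isCont (total_abs_curv f) c" and e: "e ~= 0"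
 shows "\<exists>u. u \<bullet> e ~= 0 \<and> {v. u \<bullet> v = 0} \<notin> Omega f lam c"
proof (rule ccontr)
 assume "\<not> ?thesis"
 hence full: "!!u. u \<bullet> e ~= 0 ==> {v. u \<bullet> v = 0} \<in> Omega f lam c" by blast
 obtain \<sigma> w r where \<sigma>: "\<sigma> = 1 \<or> \<sigma> = -1" and w: "norm w = 1" "r > 0"
  and esc: "!!v. norm v = 1 ==> norm (v - w) < r ==> escaping \<sigma> v"
  using escaping_cap[OF e full] by blast
 define W where "W = {v. norm v = 1 \<and> norm (v - w) < r}"
 have Wb: "W \<in> sets borel"
 proof -
  have "W = sphere 0 1 \<inter> ball w r" by (auto simp: W_def dist_norm norm_minus_commute)
  thus ?thesis by simp
 qed
 \<comment> \<open>The levels approach \<open>c\<close> from the side on which the normals in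
   \<open>W\<close> escape.\<close>
 define t where "t j = c + \<sigma> / (real j + 2)" for j :: nat
 have tlim: "t \<longlonglongrightarrow> c"
  unfolding t_def[abs_def]
  using tendsto_add[OF tendsto_const[of c] tendsto_mult_right[OF LIMSEQ_inverse_real_of_nat[THEN LIMSEQ_Suc], of \<sigma>]]
  by (simp add: field_simps)
 define Z where "Z = (%j. {x. f x = t j \<and> gauss_curv f x = 0})"
 have clZ: "closed (Z j)" for j
 proof -
  have "Z j = f -` {t j} \<inter> {x. gauss_curv f x = 0}" by (auto simp: Z_def)
  moreover have "closed {x. gauss_curv f x = 0}" by (intro closed_Collect_eq gauss_curv_continuous continuous_on_const)
  ultimately show ?thesis using regs_closed_open(2)[of "t j"] by (simp add: closed_Int)
 qed
 have null: "\<nu> ` Z j \<in> null_sets HM" "(%x. - \<nu> x) ` Z j \<in> null_sets HM" for j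
 proof -
  have z: "HH (\<nu> ` Z j) = 0" unfolding Z_def by (rule gauss_sard)
  have b: "\<nu> ` Z j \<in> sets borel" "(%x. - \<nu> x) ` Z j \<in> sets borel"
   using image_closed_Int_open_borel[OF clZ open_UNIV, of _ j] \<nu>_continuous continuous_on_minus[OF \<nu>_continuous] by auto
  have "(%x. - \<nu> x) ` Z j = uminus ` (\<nu> ` Z j)" by (simp add: image_image)
  hence "HH ((%x. - \<nu> x) ` Z j) = 0" using z by (simp only: hausdorff_uminus)
  thus "\<nu> ` Z j \<in> null_sets HM" "(%x. - \<nu> x) ` Z j \<in> null_sets HM"
   using b z by (simp_all add: null_sets_def emeasure_hausdorff_measure)
 qed
 define M where "M s u = {x \<in> regs s. \<nu> x = u} \<union> {x \<in> regs s. \<nu> x = - u}" for s u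
 define N2 where "N2 s u = NN s u + NN s (- u)" for s u
 have N2: "N2 s u = emeasure (count_space UNIV) (M s u)" if "u ~= 0" for s u
 proof -
  have "u ~= - u" using that by (simp add: eq_neg_iff_add_eq_0 flip: scaleR_2)
  thus ?thesis unfolding N2_def NN_def M_def by (intro plus_emeasure) auto
 qed
 \<comment> \<open>This holds off the null set of degenerate normals. Points counted at level
   \<open>c\<close> persist in disjoint balls inside the ball of radius \<open>R\<close>; a normal
   in \<open>W\<close> has one more point beyond \<open>R\<close>, which is therefore new.\<close>
 have pointwise: "N2 c u + indicator W u <= liminf (%j. N2 (t j) u)"
  if good: "!!j. u \<notin> \<nu> ` Z j" "!!j. u \<notin> (%x. - \<nu> x) ` Z j" for u
 proof (cases "norm u = 1")
  case False
  hence "\<nu> x ~= u" "\<nu> x ~= - u" for x using norm_\<nu>[of x] by (metis, metis norm_minus_cancel)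
  hence "{x \<in> regs c. \<nu> x = u} = {}" "{x \<in> regs c. \<nu> x = - u} = {}" by auto
  hence "N2 c u = 0" unfolding N2_def NN_def by (simp only: emeasure_empty add_0)
  thus ?thesis using False by (simp add: W_def)
 next
  case True
  hence u0: "u ~= 0" by auto
  let ?F = "M c u"
  have fin: "finite ?F" using NN_bounded unfolding M_def by blast
  have "\<forall>x\<in>?F. \<exists>d>0. \<forall>y\<in>?F. y ~= x --> d <= dist x y" using finite_set_avoid[OF fin] by blast
  from bchoice[OF this] obtain d where d: "\<forall>x\<in>?F. d x > 0 \<and> (\<forall>y\<in>?F. y ~= x --> d x <= dist x y)" by (rule exE)
  obtain R where R: "?F \<subseteq> ball 0 R" using finite_imp_bounded[OF fin] bounded_subset_ballD by blast
  have curv: "z \<in> M (t j) u" if "f z = t j" "\<nu> z = u \<or> \<nu> z = - u" for z j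
  proof -
   have "z \<notin> Z j"
   proof
    assume "z \<in> Z j"
    hence "\<nu> z \<in> \<nu> ` Z j" "- \<nu> z \<in> (%x. - \<nu> x) ` Z j" by blast+
    moreover have "u = \<nu> z \<or> u = - \<nu> z" using that(2) by auto
    ultimately show False using good[of j] by metis
   qed
   thus ?thesis using that by (auto simp: M_def regs_def Z_def)
  qed
  have "eventually (%j. \<exists>z\<in>ball x (d x / 2) \<inter> ball 0 R. f z = t j \<and> \<nu> z = \<nu> x) sequentially" if x: "x \<in> ?F" for x
  proof -
   have "gauss_curv f x ~= 0" "f x = c" using x by (auto simp: M_def regs_def)
   moreover have "x \<in> ball x (d x / 2) \<inter> ball 0 R" using d x R by auto
   moreover have "open (ball x (d x / 2) \<inter> ball 0 R)" by auto
   ultimately obtain e where e: "e > 0" "!!s. \<bar>s - c\<bar> < e ==> \<exists>z\<in>ball x (d x / 2) \<inter> ball 0 R. f z = s \<and> \<nu> z = \<nu> x"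
    using level_persistence[of x "ball x (d x / 2) \<inter> ball 0 R"] by auto
   have "eventually (%j. \<bar>t j - c\<bar> < e) sequentially" using tendstoD[OF tlim e(1)] by (simp add: dist_real_def)
   thus ?thesis by (rule eventually_mono) (rule e(2))
  qed
  hence ev1: "eventually (%j. \<forall>x\<in>?F. \<exists>z\<in>ball x (d x / 2) \<inter> ball 0 R. f z = t j \<and> \<nu> z = \<nu> x) sequentially"
   using fin by (simp add: eventually_ball_finite)
  have ev2: "eventually (%j. u \<in> W --> parallel_at R (t j) u) sequentially"
  proof (cases "u \<in> W")
   case True
   hence "escaping \<sigma> u" using esc by (simp add: W_def)
   then obtain e where e: "e > 0" "!!s. 0 < \<sigma> * (s - c) ==> \<sigma> * (s - c) < e ==> parallel_at R s u"
    unfolding escaping_def by blast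
   have "eventually (%j. \<bar>t j - c\<bar> < e) sequentially" using tendstoD[OF tlim e(1)] by (simp add: dist_real_def)
   thus ?thesis
   proof (rule eventually_mono)
    fix j assume "\<bar>t j - c\<bar> < e"
    moreover have "0 < \<sigma> * (t j - c)" "\<sigma> * (t j - c) = \<bar>t j - c\<bar>" using \<sigma> by (auto simp: t_def)
    ultimately show "u \<in> W --> parallel_at R (t j) u" using e(2)[of "t j"] by simp
   qed
  qed simp
  have "eventually (%j. N2 c u + indicator W u <= N2 (t j) u) sequentially"
   using ev1 ev2
  proof eventually_elim
   case (elim j)
   from bchoice[OF elim(1)[unfolded Bex_def]] obtain z where z: "\<forall>x\<in>?F. z x \<in> ball x (d x / 2) \<inter> ball 0 R \<and> f (z x) = t j \<and> \<nu> (z x) = \<nu> x" by blast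
   have inj: "inj_on z ?F"
   proof (rule inj_onI, rule ccontr)
    fix x y assume xy: "x \<in> ?F" "y \<in> ?F" "z x = z y" "x ~= y"
    hence "dist x (z x) < d x / 2" "dist y (z x) < d y / 2" using z by auto
    hence "dist x y < d x / 2 + d y / 2" using dist_triangle[of x y "z x"] by (simp add: dist_commute)
    moreover have "d x <= dist x y" "d y <= dist x y" using d xy by (auto simp: dist_commute)
    ultimately show False by linarith
   qed
   have sub: "z ` ?F \<subseteq> M (t j) u" using z by (auto intro!: curv) (auto simp: M_def)
   have Nc: "N2 c u = of_nat (card ?F)" using N2[OF u0] fin by (simp add: emeasure_count_space_finite)
   show ?case
   proof (cases "u \<in> W")
    case False
    have "of_nat (card (z ` ?F)) <= N2 (t j) u"
     unfolding N2[OF u0] using emeasure_mono[OF sub, of "count_space UNIV"] fin by (simp add: emeasure_count_space_finite)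
    thus ?thesis using False inj Nc by (simp add: card_image)
   next
    case True
    then obtain y s where y: "norm y > R" "near_c y" "ftrunc y = t j" "gtrunc y = s *\<^sub>R u"
     using elim(2) unfolding parallel_at_def by blast
    have fy: "f y = t j" using y(2,3) by (simp add: ftrunc_def)
    have gy: "grad f y = s *\<^sub>R u" using y(2,4) by (simp add: gtrunc_def)
    hence "s ~= 0" using nocrit[of y] by auto
    hence "\<nu> y = u \<or> \<nu> y = - u" using \<open>norm u = 1\<close> gy by (cases "s > 0") (auto simp: gauss_map_def)
    hence yM: "y \<in> M (t j) u" by (rule curv[OF fy])
    have "y \<notin> z ` ?F" using z y(1) by fastforce
    hence "card (insert y (z ` ?F)) = Suc (card ?F)" using fin inj by (simp add: card_image)
    moreover have "of_nat (card (insert y (z ` ?F))) <= N2 (t j) u"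
     unfolding N2[OF u0] using emeasure_mono[of "insert y (z ` ?F)" "M (t j) u" "count_space UNIV"] sub yM fin
     by (simp add: emeasure_count_space_finite)
    ultimately show ?thesis using True Nc by (simp add: add.commute)
   qed
  qed
  thus ?thesis by (rule Liminf_bounded)
 qed
 have int: "(\<integral>\<^sup>+u. N2 s u \<partial>HM) = total_abs_curv f s + total_abs_curv f s" for s
  unfolding N2_def total_abs_curv_eq using NN_uminus NN_measurable by (simp add: nn_integral_add)
 have meas: "N2 s \<in> borel_measurable HM" for s
  unfolding N2_def[abs_def] using NN_uminus(1) NN_measurable by (intro borel_measurable_add)
 have "AE u in HM. (\<forall>j. u \<notin> \<nu> ` Z j) \<and> (\<forall>j. u \<notin> (%x. - \<nu> x) ` Z j)"
  using null by (auto simp: AE_all_countable intro: AE_not_in)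
 hence ae: "AE u in HM. N2 c u + indicator W u <= liminf (%j. N2 (t j) u)"
  by (rule eventually_mono) (use pointwise in blast)
 have "(\<integral>\<^sup>+u. N2 c u \<partial>HM) + HH W = (\<integral>\<^sup>+u. N2 c u + indicator W u \<partial>HM)"
  using Wb meas by (subst nn_integral_add) (auto simp: emeasure_hausdorff_measure)
 also have "... <= (\<integral>\<^sup>+u. liminf (%j. N2 (t j) u) \<partial>HM)" by (rule nn_integral_mono_AE[OF ae])
 also have "... <= liminf (%j. \<integral>\<^sup>+u. N2 (t j) u \<partial>HM)" by (rule nn_integral_liminf[OF meas])
 also have "... = total_abs_curv f c + total_abs_curv f c"
 proof (rule lim_imp_Liminf)
  have "(%j. total_abs_curv f (t j)) \<longlonglongrightarrow> total_abs_curv f c" using isCont_tendsto_compose[OF cont tlim] .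
  thus "(%j. \<integral>\<^sup>+u. N2 (t j) u \<partial>HM) \<longlonglongrightarrow> total_abs_curv f c + total_abs_curv f c"
   unfolding int by (intro tendsto_add)
 qed simp
 finally have "total_abs_curv f c + total_abs_curv f c + HH W <= total_abs_curv f c + total_abs_curv f c + 0" unfolding int by simp
 \<comment> \<open>The curvature at \<open>c\<close> is finite and cancels, which leaves a cap of
   measure zero.\<close>
 hence "HH W <= 0" using total_abs_curv_finite ennreal_add_left_cancel_le[of "total_abs_curv f c + total_abs_curv f c" "HH W" 0] by auto
 thus False using hausdorff_sphere_cap_pos[OF w] by (simp add: W_def)
qed

end

subsection \<open>Trivialising flow\<close>

lemma Ck_on_prod:
 fixes g :: "'i => 'a::euclidean_space => real"
 shows "open U ==> (!!i. i \<in> I ==> Ck_on k U (g i)) ==> Ck_on k U (%x. \<Prod>i\<in>I. g i x)"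
 by (induction I rule: infinite_finite_induct) (auto intro!: Ck_on_const Ck_on_mult)

lemma (in ominimal) dfn_prod:
 fixes g :: "'i => 'a::euclidean_space => real"
 shows "(!!i. i \<in> I ==> dfn (g i)) ==> dfn (%x. \<Prod>i\<in>I. g i x)"
 by (induction I rule: infinite_finite_induct) (auto intro: dfn_const dfn_mult)

text \<open>For a unit vector \<open>e\<close> this is the squared distance of \<open>x\<close> from
  the line through \<open>e\<close>.\<close>

definition line_gap :: "'a::real_inner => 'a => real" where
 "line_gap e x = x \<bullet> x - (e \<bullet> x)\<^sup>2"

text \<open>The first term makes the polynomial proper; the middle terms tilt its gradient at each \<open>e \<in> E\<close>
 by a multiple of \<open>b e\<close>, because every \<open>line_gap e\<close> vanishes to second order along \<open>e\<close>; the last term,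
 which vanishes to second order along all of \<open>E\<close>, restores positivity.\<close>

definition tilt :: "'a::euclidean_space set => ('a => 'a) => real => 'a => real" where
 "tilt E b K x = (x \<bullet> x) ^ card E + (\<Sum>e\<in>E. (b e \<bullet> x) * ((e \<bullet> x) * (\<Prod>e'\<in>E - {e}. line_gap e' x)))
   + K * (\<Prod>e\<in>E. line_gap e x)"

lemma line_gap_scaleR: "line_gap e (r *\<^sub>R x) = r\<^sup>2 * line_gap e x"
 by (simp add: line_gap_def power2_eq_square algebra_simps)

lemma line_gap_bounds:
 assumes "norm e = 1" shows "0 <= line_gap e x" "line_gap e x <= x \<bullet> x"
proof -
 have "(e \<bullet> x)\<^sup>2 <= (e \<bullet> e) * (x \<bullet> x)" by (rule Cauchy_Schwarz_ineq)
 moreover have "e \<bullet> e = 1" using assms by (simp add: norm_eq_1)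
 ultimately show "0 <= line_gap e x" by (simp add: line_gap_def)
qed (simp add: line_gap_def)

lemma tilt_scaleR:
 assumes "finite E" "E ~= {}" shows "tilt E b K (r *\<^sub>R x) = r ^ (2 * card E) * tilt E b K x"
proof -
 have "(b e \<bullet> r *\<^sub>R x) * ((e \<bullet> r *\<^sub>R x) * (\<Prod>e'\<in>E - {e}. line_gap e' (r *\<^sub>R x)))
   = r ^ (2 * card E) * ((b e \<bullet> x) * ((e \<bullet> x) * (\<Prod>e'\<in>E - {e}. line_gap e' x)))" if "e \<in> E" for e
 proof -
  have "card E = Suc (card (E - {e}))" by (rule card.remove[OF assms(1) that])
  hence "r ^ (2 * card E) = r * r * (r\<^sup>2) ^ card (E - {e})" by (simp add: power_mult power2_eq_square)
  moreover have "(\<Prod>e'\<in>E - {e}. line_gap e' (r *\<^sub>R x)) = (r\<^sup>2) ^ card (E - {e}) * (\<Prod>e'\<in>E - {e}. line_gap e' x)"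
   by (simp add: line_gap_scaleR prod.distrib)
  ultimately show ?thesis by simp
 qed
 hence "(\<Sum>e\<in>E. (b e \<bullet> r *\<^sub>R x) * ((e \<bullet> r *\<^sub>R x) * (\<Prod>e'\<in>E - {e}. line_gap e' (r *\<^sub>R x))))
   = r ^ (2 * card E) * (\<Sum>e\<in>E. (b e \<bullet> x) * ((e \<bullet> x) * (\<Prod>e'\<in>E - {e}. line_gap e' x)))"
  unfolding sum_distrib_left by (rule sum.cong[OF refl])
 moreover have "(\<Prod>e\<in>E. line_gap e (r *\<^sub>R x)) = r ^ (2 * card E) * (\<Prod>e\<in>E. line_gap e x)"
  by (simp add: line_gap_scaleR prod.distrib power_mult)
 moreover have "(r *\<^sub>R x \<bullet> r *\<^sub>R x) ^ card E = r ^ (2 * card E) * (x \<bullet> x) ^ card E"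
  by (simp add: power_mult power_mult_distrib power2_eq_square)
 ultimately show ?thesis unfolding tilt_def by (simp only: distrib_left mult.left_commute)
qed

lemma Ck_on_line_gap: "Ck_on k UNIV (line_gap e)"
 unfolding line_gap_def[abs_def]
 by (intro Ck_on_diff Ck_on_inner Ck_on_power Ck_on_ident Ck_on_const open_UNIV)

lemma Ck_on_tilt: "Ck_on k UNIV (tilt E b K)"
 unfolding tilt_def[abs_def]
 by (intro Ck_on_add Ck_on_sum Ck_on_mult Ck_on_prod Ck_on_line_gap Ck_on_inner Ck_on_power Ck_on_ident Ck_on_const open_UNIV)

lemma (in ominimal) dfn_tilt: "dfn (tilt E b K)"
 unfolding tilt_def[abs_def] line_gap_def
 by (intro dintros dfn_sum dfn_prod)

text \<open>As \<open>b e\<close> is orthogonal to \<open>e\<close>, the factor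
  \<open>b e \<bullet> x\<close> is at most the norm of \<open>b e\<close> times the distance to the
  line. The inequality st <= \<eta> s^2 + t^2 / (4 \<eta>) splits each tilting term into a part
  absorbed by the first term of \<open>tilt\<close> and a part absorbed by the last.\<close>

lemma tilt_lower_bound:
 assumes E: "finite E" "!!e. e \<in> E ==> norm e = 1" "!!e. e \<in> E ==> b e \<bullet> e = 0"
 shows "\<exists>K. \<forall>x. tilt E b K x \<ge> (1/2) * (x \<bullet> x) ^ card E"
proof -
 define B where "B = (\<Sum>e\<in>E. norm (b e))"
 have B0: "B \<ge> 0" unfolding B_def by (intro sum_nonneg) auto
 \<comment> \<open>Together the first parts carry the coefficient \<open>B * \<eta>\<close>, which
   must not exceed 1/2; the second parts then dictate \<open>K\<close>.\<close>
 define \<eta> where "\<eta> = 1 / (2 * (B + 1))"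
 have \<eta>: "\<eta> > 0" "B * \<eta> <= 1/2" using B0 by (auto simp: \<eta>_def field_simps)
 define K where "K = B / (4 * \<eta>)"
 have "tilt E b K x \<ge> (1/2) * (x \<bullet> x) ^ card E" for x
 proof -
  let ?G = "\<Prod>e\<in>E. line_gap e x"
  have tm: "- ((b e \<bullet> x) * ((e \<bullet> x) * (\<Prod>e'\<in>E - {e}. line_gap e' x))) <= norm (b e) * (\<eta> * (x \<bullet> x) ^ card E + ?G / (4 * \<eta>))"
   if e: "e \<in> E" for e
  proof -
   let ?D = "\<Prod>e'\<in>E - {e}. line_gap e' x" and ?d = "line_gap e x"
   have D: "0 <= ?D" "?D <= (x \<bullet> x) ^ card (E - {e})"
    using line_gap_bounds[OF E(2), of _ x] prod_mono[of "E - {e}" "%e. line_gap e x" "%_. x \<bullet> x"]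
    by (auto intro!: prod_nonneg)
   have d0: "?d \<ge> 0" by (rule line_gap_bounds(1)[OF E(2)[OF e]])
   have "b e \<bullet> x = b e \<bullet> (x - (e \<bullet> x) *\<^sub>R e)" using E(3)[OF e] by (simp add: inner_diff_right)
   hence "\<bar>b e \<bullet> x\<bar> <= norm (b e) * norm (x - (e \<bullet> x) *\<^sub>R e)" using Cauchy_Schwarz_ineq2 by metis
   moreover have "norm (x - (e \<bullet> x) *\<^sub>R e) = sqrt ?d"
   proof -
    have "(norm (x - (x \<bullet> e) *\<^sub>R e))\<^sup>2 = ?d"
     using norm_reject_unit[of e x] E(2)[OF e] by (simp add: norm_eq_1 line_gap_def power2_norm_eq_inner inner_commute)
    thus ?thesis by (simp add: inner_commute real_sqrt_unique)
   qed
   moreover have "\<bar>e \<bullet> x\<bar> <= norm x" using Cauchy_Schwarz_ineq2[of e x] E(2)[OF e] by simp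
   ultimately have "\<bar>b e \<bullet> x\<bar> * \<bar>e \<bullet> x\<bar> <= (norm (b e) * sqrt ?d) * norm x" by (intro mult_mono) (use d0 in auto)
   also have "... = norm (b e) * (sqrt ?d * norm x)" by simp
   also have "sqrt ?d * norm x <= \<eta> * (x \<bullet> x) + ?d / (4 * \<eta>)"
   proof -
    have "0 <= (2 * \<eta> * norm x - sqrt ?d)\<^sup>2" by simp
    also have "... = 4 * \<eta> * (\<eta> * (x \<bullet> x) + ?d / (4 * \<eta>) - sqrt ?d * norm x)"
     using \<eta>(1) d0 by (simp add: power2_diff power_mult_distrib power2_norm_eq_inner algebra_simps) (simp add: power2_eq_square)
    finally show ?thesis using \<eta>(1) by (simp add: zero_le_mult_iff)
   qed
   finally have "\<bar>b e \<bullet> x\<bar> * \<bar>e \<bullet> x\<bar> <= norm (b e) * (\<eta> * (x \<bullet> x) + ?d / (4 * \<eta>))" by (simp add: mult_left_mono)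
   hence "\<bar>b e \<bullet> x\<bar> * \<bar>e \<bullet> x\<bar> * ?D <= norm (b e) * (\<eta> * (x \<bullet> x) + ?d / (4 * \<eta>)) * ?D" using D(1) by (rule mult_right_mono)
   also have "... = norm (b e) * (\<eta> * ((x \<bullet> x) * ?D) + (?d * ?D) / (4 * \<eta>))" by (simp add: algebra_simps)
   also have "... <= norm (b e) * (\<eta> * ((x \<bullet> x) * (x \<bullet> x) ^ card (E - {e})) + (?d * ?D) / (4 * \<eta>))"
    using D(2) \<eta>(1) by (intro mult_left_mono add_right_mono) auto
   also have "(x \<bullet> x) * (x \<bullet> x) ^ card (E - {e}) = (x \<bullet> x) ^ card E" using card.remove[OF E(1) e] by simp
   also have "?d * ?D = ?G" using prod.remove[OF E(1) e, of "%e. line_gap e x"] by simp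
   finally have "\<bar>b e \<bullet> x\<bar> * \<bar>e \<bullet> x\<bar> * ?D <= norm (b e) * (\<eta> * (x \<bullet> x) ^ card E + ?G / (4 * \<eta>))" .
   moreover have "- ((b e \<bullet> x) * ((e \<bullet> x) * ?D)) <= \<bar>b e \<bullet> x\<bar> * \<bar>e \<bullet> x\<bar> * ?D"
    using abs_ge_minus_self[of "(b e \<bullet> x) * ((e \<bullet> x) * ?D)"] D(1) by (simp add: abs_mult mult.assoc)
   ultimately show ?thesis by linarith
  qed
  have "- (\<Sum>e\<in>E. (b e \<bullet> x) * ((e \<bullet> x) * (\<Prod>e'\<in>E - {e}. line_gap e' x))) <= (\<Sum>e\<in>E. norm (b e) * (\<eta> * (x \<bullet> x) ^ card E + ?G / (4 * \<eta>)))"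
   unfolding sum_negf[symmetric] by (intro sum_mono tm)
  also have "... = B * (\<eta> * (x \<bullet> x) ^ card E + ?G / (4 * \<eta>))" by (simp only: B_def sum_distrib_right)
  also have "... = B * \<eta> * (x \<bullet> x) ^ card E + K * ?G" by (simp add: K_def algebra_simps)
  also have "... <= (1/2) * (x \<bullet> x) ^ card E + K * ?G" using \<eta>(2) by (intro add_right_mono mult_right_mono) auto
  finally show ?thesis by (simp add: tilt_def)
 qed
 thus ?thesis by blast
qed

text \<open>Every term except the first and the tilting term of \<open>a\<close> has the factor
  \<open>line_gap a\<close>, which vanishes at \<open>a\<close> together with its derivative. In the
  tilting term of \<open>a\<close> only the factor \<open>b a \<bullet> x\<close> contributes its
  derivative, because it vanishes at \<open>a\<close>.\<close>

lemma tilt_derivative: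
 assumes E: "finite E" "!!e. e \<in> E ==> norm e = 1" "!!e. e \<in> E ==> b e \<bullet> e = 0" and a: "a \<in> E"
 shows "(tilt E b K has_derivative (%h. ((2 * real (card E)) *\<^sub>R a + (\<Prod>e'\<in>E - {a}. line_gap e' a) *\<^sub>R b a) \<bullet> h)) (at a)"
proof -
 have aa: "a \<bullet> a = 1" using E(2)[OF a] by (simp add: norm_eq_1)
 have diff: "(%x. g x) differentiable (at a)" if "Ck_on 1 UNIV g" for g :: "'a => real" using that by simp
 have gap0: "line_gap a a = 0" by (simp add: line_gap_def aa)
 have gap: "(line_gap a has_derivative (%h. 0)) (at a)"
  unfolding line_gap_def[abs_def]
  by (rule has_derivative_eq_rhs, (rule derivative_intros)+) (auto simp: fun_eq_iff aa inner_commute)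
 have vanish: "((%x. g x * line_gap a x) has_derivative (%h. 0)) (at a)" if "Ck_on 1 UNIV g" for g :: "'a => real"
  using has_derivative_mult[OF diff[OF that, unfolded frechet_derivative_works] gap] by (simp add: gap0)
 have C: "Ck_on 1 UNIV (%x. \<Prod>e'\<in>I. line_gap e' x)" for I :: "'a set" by (intro Ck_on_prod Ck_on_line_gap open_UNIV)
 have t1: "((%x. (x \<bullet> x) ^ card E) has_derivative (%h. 2 * real (card E) * (a \<bullet> h))) (at a)"
  by (rule has_derivative_eq_rhs, (rule derivative_intros)+) (auto simp: fun_eq_iff aa inner_commute)
 have t3: "((%x. K * (\<Prod>e\<in>E. line_gap e x)) has_derivative (%h. 0)) (at a)"
 proof -
  have eq: "(%x. K * (\<Prod>e\<in>E. line_gap e x)) = (%x. (K * (\<Prod>e\<in>E - {a}. line_gap e x)) * line_gap a x)"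
   by (auto simp: prod.remove[OF E(1) a])
  show ?thesis unfolding eq by (rule vanish) (intro Ck_on_mult Ck_on_const C open_UNIV)
 qed
 define T where "T e x = (b e \<bullet> x) * ((e \<bullet> x) * (\<Prod>e'\<in>E - {e}. line_gap e' x))" for e x
 have Te: "(T e has_derivative (%h. 0)) (at a)" if e: "e \<in> E - {a}" for e
 proof -
  have eq: "T e = (%x. ((b e \<bullet> x) * ((e \<bullet> x) * (\<Prod>e'\<in>E - {e} - {a}. line_gap e' x))) * line_gap a x)"
  proof (rule ext)
   fix x
   have "(\<Prod>e'\<in>E - {e}. line_gap e' x) = line_gap a x * (\<Prod>e'\<in>E - {e} - {a}. line_gap e' x)"
    by (rule prod.remove) (use E(1) a e in auto)
   thus "T e x = ((b e \<bullet> x) * ((e \<bullet> x) * (\<Prod>e'\<in>E - {e} - {a}. line_gap e' x))) * line_gap a x"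
    unfolding T_def by (simp only: ac_simps)
  qed
  show ?thesis unfolding eq by (rule vanish) (intro Ck_on_mult Ck_on_inner Ck_on_ident Ck_on_const C open_UNIV)
 qed
 have Ta: "(T a has_derivative (%h. (\<Prod>e'\<in>E - {a}. line_gap e' a) * (b a \<bullet> h))) (at a)"
 proof -
  have "Ck_on 1 UNIV (%x. (a \<bullet> x) * (\<Prod>e'\<in>E - {a}. line_gap e' x))"
   by (intro Ck_on_mult Ck_on_inner Ck_on_ident Ck_on_const C open_UNIV)
  from diff[OF this, unfolded frechet_derivative_works]
  have "((%x. (b a \<bullet> x) * ((a \<bullet> x) * (\<Prod>e'\<in>E - {a}. line_gap e' x))) has_derivative
    (%h. (b a \<bullet> a) * frechet_derivative (%x. (a \<bullet> x) * (\<Prod>e'\<in>E - {a}. line_gap e' x)) (at a) h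
     + (b a \<bullet> h) * ((a \<bullet> a) * (\<Prod>e'\<in>E - {a}. line_gap e' a)))) (at a)"
   by (intro has_derivative_mult) (auto intro!: derivative_eq_intros)
  thus ?thesis unfolding T_def[abs_def] by (simp add: E(3)[OF a] aa mult.commute)
 qed
 have "((%x. \<Sum>e\<in>E. T e x) has_derivative (%h. \<Sum>e\<in>E. if e = a then (\<Prod>e'\<in>E - {a}. line_gap e' a) * (b a \<bullet> h) else 0)) (at a)"
 proof (rule has_derivative_sum)
  fix e assume "e \<in> E"
  thus "(T e has_derivative (%h. if e = a then (\<Prod>e'\<in>E - {a}. line_gap e' a) * (b a \<bullet> h) else 0)) (at a)"
   using Te[of e] Ta by (cases "e = a") auto
 qed
 hence t2: "((%x. \<Sum>e\<in>E. T e x) has_derivative (%h. (\<Prod>e'\<in>E - {a}. line_gap e' a) * (b a \<bullet> h))) (at a)"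
  using E(1) a by simp
 show ?thesis
  using has_derivative_add[OF has_derivative_add[OF t1 t2] t3] unfolding tilt_def[abs_def] T_def
  by (simp add: inner_add_left)
qed

section \<open>Cutoffs and compactly supported fields\<close>

lemma Ck_on_pos_power: "Ck_on k UNIV (%t::real. max 0 t ^ Suc k)"
proof (induction k)
 case 0 show ?case by (auto intro!: continuous_intros)
next
 case (Suc k)
 have "((%t::real. max 0 t ^ Suc (Suc k)) has_derivative (%h. (real (Suc (Suc k)) * max 0 t ^ Suc k) * h)) (at t)" for t
 proof -
  consider "t > 0" | "t < 0" | "t = 0" by linarith
  hence "((%t::real. max 0 t ^ Suc (Suc k)) has_field_derivative real (Suc (Suc k)) * max 0 t ^ Suc k) (at t)"
  proof cases
   case 1
   have "((%t::real. t ^ Suc (Suc k)) has_field_derivative real (Suc (Suc k)) * max 0 t ^ Suc k) (at t)"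
    using 1 DERIV_pow[of "Suc (Suc k)" t UNIV] by simp
   thus ?thesis by (rule has_field_derivative_transform_within_open[where S = "{0<..}"]) (use 1 in auto)
  next
   case 2
   have "((%t::real. 0) has_field_derivative real (Suc (Suc k)) * max 0 t ^ Suc k) (at t)" using 2 by simp
   thus ?thesis by (rule has_field_derivative_transform_within_open[where S = "{..<0}"]) (use 2 in auto)
  next
   case 3
   have "(%h::real. max 0 h ^ Suc k * (max 0 h / h)) \<midarrow>0\<rightarrow> 0"
   proof (rule Lim_null_comparison[where g = "%h. max 0 h ^ Suc k"])
    show "\<forall>\<^sub>F h in at 0. norm (max 0 h ^ Suc k * (max 0 h / h)) <= max 0 h ^ Suc k"
     by (intro always_eventually allI) (auto simp: max_def)
    have "isCont (%h::real. max 0 h ^ Suc k) 0" by (intro continuous_intros)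
    thus "(%h::real. max 0 h ^ Suc k) \<midarrow>0\<rightarrow> 0" unfolding isCont_def by simp
   qed
   thus ?thesis using 3 by (simp add: has_field_derivative_iff mult.commute)
  qed
  thus ?thesis by (simp add: has_field_derivative_def)
 qed
 thus ?case by (rule Ck_on_SucI[OF open_UNIV]) (auto intro!: Ck_on_mult Ck_on_const Suc.IH[simplified])
qed

text \<open>A quotient of powers of positive parts has the finite smoothness in question; the
  denominator never vanishes, since \<open>t\<close> or \<open>1 - t\<close> is positive.\<close>

lemma Ck_cutoff:
 "\<exists>\<eta>::real => real. Ck_on k UNIV \<eta> \<and> (\<forall>t\<le>0. \<eta> t = 1) \<and> (\<forall>t\<ge>1. \<eta> t = 0) \<and> (\<forall>t. 0 <= \<eta> t \<and> \<eta> t <= 1)"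
proof -
 define h where "h t = max 0 t ^ Suc k" for t :: real
 have pos: "h (1 - t) + h t > 0" for t
 proof (cases "t > 0")
  case True thus ?thesis unfolding h_def by (intro add_nonneg_pos) auto
 next
  case False thus ?thesis unfolding h_def by (intro add_pos_nonneg) auto
 qed
 have h0: "h t \<ge> 0" for t by (simp add: h_def)
 have hC: "Ck_on k UNIV h" unfolding h_def[abs_def] by (rule Ck_on_pos_power)
 have "Ck_on k UNIV (%t. h (1 - t))"
  by (rule Ck_on_compose[OF open_UNIV open_UNIV _ hC]) (auto intro!: Ck_on_diff Ck_on_const Ck_on_ident)
 hence "Ck_on k UNIV (%t. h (1 - t) / (h (1 - t) + h t))"
  using hC pos by (intro Ck_on_divide Ck_on_add open_UNIV) (auto simp: less_imp_neq[symmetric])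
 moreover have "h (1 - t) / (h (1 - t) + h t) <= 1" for t using pos[of t] h0[of t] by (simp add: field_simps)
 moreover have "h (1 - t) / (h (1 - t) + h t) = 1" if "t <= 0" for t using that pos[of t] by (auto simp: h_def)
 moreover have "h (1 - t) / (h (1 - t) + h t) = 0" if "t \<ge> 1" for t using that by (simp add: h_def)
 moreover have "0 <= h (1 - t) / (h (1 - t) + h t)" for t using h0 pos less_imp_le by simp
 ultimately show ?thesis by (intro exI[of _ "%t. h (1 - t) / (h (1 - t) + h t)"] conjI allI impI)
qed

text \<open>The derivative is 0 outside the ball and bounded inside by compactness. Through
  \<open>flow_Ck\<close> this makes the truncated lifts complete.\<close>

lemma C1_compact_support_lipschitz:
 fixes F :: "'a::euclidean_space => 'b::euclidean_space"
 assumes F: "Ck_on (Suc k) UNIV F" and z: "!!x. norm x > R ==> F x = 0"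
 shows "\<exists>L>0. \<forall>x y. norm (F x - F y) <= L * norm (x - y)"
proof -
 define F' where "F' x = frechet_derivative F (at x)" for x
 have d: "(F has_derivative F' x) (at x)" for x unfolding F'_def using Ck_on_has_derivative[OF F] by simp
 have "\<exists>M. \<forall>x. norm (F' x v) <= M" if v: "v \<in> Basis" for v
 proof -
  have "continuous_on UNIV (%x. F' x v)"
   unfolding F'_def by (rule Ck_on_continuous[of k]) (use F v in simp)
  hence "compact ((%x. F' x v) ` cball 0 R)" by (intro compact_continuous_image) (auto intro: continuous_on_subset)
  then obtain M where M: "!!x. norm x <= R ==> norm (F' x v) <= M" using compact_imp_bounded bounded_iff by (metis imageI mem_cball_0)
  have "norm (F' x v) <= max M 0" for x
  proof (cases "norm x <= R")
   case False
   have "open {x::'a. norm x > R}" by (intro open_Collect_less continuous_intros)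
   hence "(F has_derivative (%h. 0)) (at x)"
    by (rule has_derivative_transform_within_open[OF has_derivative_const[of 0]]) (use z False in auto)
   hence "F' x = (%h. 0)" using has_derivative_unique d by blast
   thus ?thesis by simp
  qed (use M in fastforce)
  thus ?thesis by blast
 qed
 then obtain M where M: "!!v x. v \<in> Basis ==> norm (F' x v) <= M v" by metis
 define L where "L = (\<Sum>v\<in>Basis. M v) + 1"
 have M0: "M v \<ge> 0" if "v \<in> Basis" for v using M[OF that, of 0] norm_ge_zero order_trans by blast
 have L: "L > 0" unfolding L_def using M0 by (simp add: sum_nonneg add_nonneg_pos)
 have "norm (F x - F y) <= L * norm (x - y)" for x y
 proof (rule differentiable_bound[of UNIV F F'])
  fix x
  show "onorm (F' x) <= L"
  proof (rule onorm_bound)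
   fix h
   have "F' x h = (\<Sum>v\<in>Basis. (h \<bullet> v) *\<^sub>R F' x v)" by (rule linear_eq_sum_Basis[OF has_derivative_linear[OF d]])
   also have "norm ... <= (\<Sum>v\<in>Basis. norm h * M v)"
    by (intro sum_norm_le) (auto intro!: mult_mono M Basis_le_norm)
   also have "... = norm h * (\<Sum>v\<in>Basis. M v)" by (simp only: sum_distrib_left)
   also have "... <= L * norm h" by (simp add: L_def algebra_simps)
   finally show "norm (F' x h) <= L * norm h" .
  qed (use L in simp)
 qed (use d in auto)
 thus ?thesis using L by blast
qed

text \<open>Differentiate the homogeneity relation in \<open>x\<close> and, at \<open>r = 1\<close>,
  in \<open>r\<close>; the second result is Euler's identity. Keeping the factor \<open>r\<close> on
  the left avoids the exponent \<open>m - 1\<close>.\<close>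

lemma homogeneous_grad:
 fixes q :: "'a::euclidean_space => real"
 assumes hom: "!!r x. q (r *\<^sub>R x) = r ^ m * q x" and d: "!!x. (q has_derivative (%h. p x \<bullet> h)) (at x)"
 shows "r *\<^sub>R p (r *\<^sub>R x) = r ^ m *\<^sub>R p x" "p x \<bullet> x = real m * q x"
proof -
 have "((%x. q (r *\<^sub>R x)) has_derivative (%h. p (r *\<^sub>R x) \<bullet> (r *\<^sub>R h))) (at x)"
  by (rule has_derivative_compose[OF _ d]) (auto intro!: derivative_eq_intros)
 moreover have "((%x. q (r *\<^sub>R x)) has_derivative (%h. r ^ m * (p x \<bullet> h))) (at x)"
  unfolding hom by (intro has_derivative_mult_right d)
 ultimately have "(%h. p (r *\<^sub>R x) \<bullet> (r *\<^sub>R h)) = (%h. r ^ m * (p x \<bullet> h))" by (rule has_derivative_unique)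
 hence "(r *\<^sub>R p (r *\<^sub>R x)) \<bullet> h = (r ^ m *\<^sub>R p x) \<bullet> h" for h by (simp add: fun_eq_iff)
 thus "r *\<^sub>R p (r *\<^sub>R x) = r ^ m *\<^sub>R p x" using vector_eq_rdot by blast
 have "((%t. q (t *\<^sub>R x)) has_derivative (%h. p (1 *\<^sub>R x) \<bullet> (h *\<^sub>R x))) (at 1)"
  by (rule has_derivative_compose[OF _ d]) (auto intro!: derivative_eq_intros)
 moreover have "((%t. q (t *\<^sub>R x)) has_derivative (%h. real m * h * q x)) (at 1)"
  unfolding hom by (auto intro!: derivative_eq_intros)
 ultimately have "(%h. p (1 *\<^sub>R x) \<bullet> (h *\<^sub>R x)) = (%h. real m * h * q x)" by (rule has_derivative_unique)
 from fun_cong[OF this, of 1] show "p x \<bullet> x = real m * q x" by simp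
qed

section \<open>Uniform transversality at infinity\<close>

lemma Grass1_span: "lam \<in> Grass 1 ==> \<exists>e :: real^'n::finite. norm e = 1 \<and> lam = span {e}"
proof -
 assume "lam \<in> Grass 1"
 hence lam: "subspace lam" "dim lam = 1" by (auto simp: Grass_def)
 then obtain x where x: "x \<in> lam" "x ~= 0" using dim_eq_0[of lam] by auto
 define e where "e = x /\<^sub>R norm x"
 have e: "norm e = 1" "e \<in> lam" using x lam(1) by (auto simp: e_def subspace_scale)
 have "span {e} = lam"
 proof (rule subspace_dim_equal)
  show "span {e} \<subseteq> lam" using e(2) lam(1) by (simp add: span_minimal)
  show "dim lam <= dim (span {e})" using e(1) lam(2) by (simp add: dim_span dim_singleton split: if_splits) auto
 qed (use lam in auto)
 thus ?thesis using e(1) by blast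
qed

lemma closest_point_span_unit:
 assumes "norm (y :: 'a::euclidean_space) = 1" shows "closest_point (span {y}) v = (v \<bullet> y) *\<^sub>R y"
proof (rule closest_point_subspace_eq)
 fix z assume "z \<in> span {y}"
 then obtain k where "z = k *\<^sub>R y" by (auto simp: span_singleton)
 thus "(v - (v \<bullet> y) *\<^sub>R y) \<bullet> z = 0" using assms by (simp add: inner_diff_left norm_eq_1)
qed (auto simp: span_mul span_base)

context definable_level
begin

text \<open>For unit vectors, the projections onto the spanned line and onto the orthogonal
  hyperplane are given by formulas continuous in the vector, so convergence of unit vectors yields
  convergence of lines and hyperplanes.\<close>

lemma limit_in_Omega:
 assumes x: "filterlim (%k. norm (x k)) at_top sequentially" "!!k. x k ~= 0" "(%k. f (x k)) \<longlonglongrightarrow> c"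
  and y: "(%k. x k /\<^sub>R norm (x k)) \<longlonglongrightarrow> y" "norm y = 1" and n: "(%k. \<nu> (x k)) \<longlonglongrightarrow> n" "norm n = 1"
 shows "{v. n \<bullet> v = 0} \<in> Omega f (span {y}) c"
proof -
 have "subspace_conv (%k. span {x k}) (span {y})"
  unfolding subspace_conv_def
 proof
  fix v
  have "closest_point (span {x k}) v = (v \<bullet> (x k /\<^sub>R norm (x k))) *\<^sub>R (x k /\<^sub>R norm (x k))" for k
  proof -
   have "span {x k /\<^sub>R norm (x k)} = span {x k}" using x(2)[of k] by (intro span_image_scale[of "{x k}" "%_. inverse (norm (x k))", simplified]) auto
   thus ?thesis using closest_point_span_unit[of "x k /\<^sub>R norm (x k)" v] x(2)[of k] by simp
  qed
  thus "(%k. closest_point (span {x k}) v) \<longlonglongrightarrow> closest_point (span {y}) v"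
   unfolding closest_point_span_unit[OF y(2)] by (simp only:) (intro tendsto_intros y(1))
 qed
 moreover have "subspace_conv (%k. tangent_level f (x k)) {v. n \<bullet> v = 0}"
  unfolding subspace_conv_def
 proof
  fix v
  have "tangent_level f (x k) = {v. \<nu> (x k) \<bullet> v = 0}" for k
   using nocrit[of "x k"] by (auto simp: tangent_level_def gauss_map_def)
  moreover have "closest_point {v. a \<bullet> v = 0} v = v - (a \<bullet> v) *\<^sub>R a" if "norm a = 1" for a :: "real^'n"
  proof -
   have "a ~= 0" "a \<bullet> a = 1" using that by (auto simp: norm_eq_1)
   thus ?thesis using closest_point_hyperplane[of a v] by simp
  qed
  ultimately show "(%k. closest_point (tangent_level f (x k)) v) \<longlonglongrightarrow> closest_point {v. n \<bullet> v = 0} v"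
   using n by (simp add: norm_\<nu>) (intro tendsto_intros)
 qed
 moreover have "{v. n \<bullet> v = 0} \<in> Grass (CARD('n) - 1)"
 proof -
  have "n ~= 0" using n(2) by auto
  hence "dim {v. n \<bullet> v = 0} = DIM(real^'n) - 1" by (rule dim_hyperplane)
  thus ?thesis by (simp add: Grass_def subspace_hyperplane)
 qed
 ultimately show ?thesis unfolding Omega_def using x nocrit by blast
qed

text \<open>Otherwise the gradients of \<open>q\<close> and \<open>f\<close> become parallel along a
  sequence tending to infinity. By homogeneity the direction of \<open>p\<close> depends on the ray
  only, so compactness of two spheres gives a limit ray \<open>yl\<close> and a limit normal
  \<open>n\<close> parallel to \<open>p yl\<close>. By Euler's identity \<open>n\<close> is not
  orthogonal to \<open>yl\<close>, against the condition if the line is ordinary; if it is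
  exceptional, the hyperplane orthogonal to \<open>p yl\<close> was excluded.\<close>

lemma transversal_of_homogeneous:
 assumes sisi: "!!y h. norm y = 1 ==> span {y} \<notin> \<Lambda> ==> h \<in> Omega f (span {y}) c ==> span {y} \<subseteq> h"
  and hom: "!!r x. q (r *\<^sub>R x) = r ^ m * q x" and d: "!!x. (q has_derivative (%h. p x \<bullet> h)) (at x)"
  and cont: "continuous_on UNIV p" and pos: "!!x. norm x = 1 ==> q x > 0" and m: "m > 0"
  and om: "!!y. norm y = 1 ==> span {y} \<in> \<Lambda> ==> {v. p y \<bullet> v = 0} \<notin> Omega f (span {y}) c"
 shows "\<exists>R \<epsilon> \<delta>. 0 < \<epsilon> \<and> \<epsilon> < 1 \<and> 0 < \<delta> \<and> \<delta> <= 1 \<and> (\<forall>x. norm x \<ge> R \<and> \<bar>f x - c\<bar> < \<epsilon> -->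
  (p x \<bullet> grad f x)\<^sup>2 <= (1 - \<delta>) * ((p x \<bullet> p x) * (grad f x \<bullet> grad f x)))"
proof (rule ccontr)
 assume neg: "\<not> ?thesis"
 \<comment> \<open>\<open>Suc (Suc k)\<close> keeps the tolerance strictly below 1 from the start,
   as the negated claim requires of \<open>\<epsilon>\<close>.\<close>
 define s :: "nat => real" where "s k = inverse (Suc (Suc k))" for k
 have s: "0 < s k" "s k < 1" for k by (auto simp: s_def inverse_less_1_iff)
 have s0: "s \<longlonglongrightarrow> 0" unfolding s_def[abs_def] using LIMSEQ_Suc[OF LIMSEQ_inverse_real_of_nat] .
 have "\<exists>x. norm x \<ge> real (Suc k) \<and> \<bar>f x - c\<bar> < s k \<and> (p x \<bullet> grad f x)\<^sup>2 > (1 - s k) * ((p x \<bullet> p x) * (grad f x \<bullet> grad f x))" for k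
 proof (rule ccontr)
  assume "\<not> ?thesis"
  hence "\<forall>x. norm x \<ge> real (Suc k) \<and> \<bar>f x - c\<bar> < s k --> (p x \<bullet> grad f x)\<^sup>2 <= (1 - s k) * ((p x \<bullet> p x) * (grad f x \<bullet> grad f x))"
   by (auto simp: not_less)
  thus False using neg s[of k] less_imp_le by blast
 qed
 then obtain x where x: "!!k. norm (x k) \<ge> real (Suc k)" "!!k. \<bar>f (x k) - c\<bar> < s k"
  "!!k. (p (x k) \<bullet> grad f (x k))\<^sup>2 > (1 - s k) * ((p (x k) \<bullet> p (x k)) * (grad f (x k) \<bullet> grad f (x k)))" by metis
 have x0: "x k ~= 0" for k using x(1)[of k] by auto
 define y where "y k = x k /\<^sub>R norm (x k)" for k
 have ny: "norm (y k) = 1" for k using x0 by (simp add: y_def)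
 have key: "(p (y k) \<bullet> \<nu> (x k))\<^sup>2 \<ge> (1 - s k) * (p (y k) \<bullet> p (y k))" for k
 proof -
  define a where "a = norm (x k) ^ m / norm (x k)"
  have a: "a > 0" using x0 by (simp add: a_def)
  have "norm (x k) *\<^sub>R p (norm (x k) *\<^sub>R y k) = norm (x k) ^ m *\<^sub>R p (y k)" by (rule homogeneous_grad(1)[OF hom d])
  moreover have "norm (x k) *\<^sub>R y k = x k" using x0 by (simp add: y_def)
  ultimately have px: "p (x k) = a *\<^sub>R p (y k)" using x0[of k]
   by (simp add: a_def) (metis divide_inverse_commute norm_eq_zero scaleR_scaleR scaleR_one left_inverse)
  define b where "b = norm (grad f (x k))"
  have b: "b > 0" using nocrit by (simp add: b_def)
  have gx: "grad f (x k) = b *\<^sub>R \<nu> (x k)" using nocrit[of "x k"] by (simp add: b_def gauss_map_def)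
  have "(1 - s k) * ((a * a * (p (y k) \<bullet> p (y k))) * (b * b)) < (a * (b * (p (y k) \<bullet> \<nu> (x k))))\<^sup>2"
   using x(3)[of k] unfolding px gx by (simp add: ac_simps)
  hence "(a * b)\<^sup>2 * ((1 - s k) * (p (y k) \<bullet> p (y k))) < (a * b)\<^sup>2 * (p (y k) \<bullet> \<nu> (x k))\<^sup>2"
   by (simp add: power2_eq_square algebra_simps)
  moreover have "(a * b)\<^sup>2 > 0" using a b by simp
  ultimately show ?thesis by (simp add: mult_less_cancel_left_pos)
 qed
 let ?K = "sphere (0::real^'n) 1 \<times> sphere (0::real^'n) 1"
 have cK: "compact ?K" by (intro compact_Times compact_sphere)
 have "\<forall>k. (y k, \<nu> (x k)) \<in> ?K" using ny by simp
 with cK[unfolded compact_def, THEN spec, of "%k. (y k, \<nu> (x k))"]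
 have "\<exists>z\<in>?K. \<exists>r. strict_mono r \<and> ((%k. (y k, \<nu> (x k))) \<circ> r) \<longlonglongrightarrow> z" by (rule mp)
 then obtain z r where z: "z \<in> ?K" and r: "strict_mono (r :: nat => nat)"
  and lim: "((%k. (y k, \<nu> (x k))) \<circ> r) \<longlonglongrightarrow> z" by (elim bexE exE conjE)
 define yl n where "yl = fst z" and "n = snd z"
 have nn: "norm yl = 1" "norm n = 1" using z by (auto simp: yl_def n_def)
 have ylim: "(%k. y (r k)) \<longlonglongrightarrow> yl" and nlim: "(%k. \<nu> (x (r k))) \<longlonglongrightarrow> n"
  using tendsto_fst[OF lim] tendsto_snd[OF lim] by (auto simp: o_def yl_def n_def)
 have plim: "(%k. p (y (r k))) \<longlonglongrightarrow> p yl" using continuous_on_tendsto_compose[OF cont ylim] by auto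
 have sr: "(%k. s (r k)) \<longlonglongrightarrow> 0" using LIMSEQ_subseq_LIMSEQ[OF s0 r] by (simp add: o_def)
 have l1: "(%k. (1 - s (r k)) * (p (y (r k)) \<bullet> p (y (r k)))) \<longlonglongrightarrow> (1 - 0) * (p yl \<bullet> p yl)"
  by (intro tendsto_intros plim sr)
 have l2: "(%k. (p (y (r k)) \<bullet> \<nu> (x (r k)))\<^sup>2) \<longlonglongrightarrow> (p yl \<bullet> n)\<^sup>2" by (intro tendsto_intros plim nlim)
 have "(p yl \<bullet> n)\<^sup>2 \<ge> (1 - 0) * (p yl \<bullet> p yl)" using LIMSEQ_le[OF l1 l2] key by blast
 hence "(norm (p yl - (p yl \<bullet> n) *\<^sub>R n))\<^sup>2 <= 0"
  using norm_reject_unit[of n "p yl"] nn(2) by (simp add: norm_eq_1 power2_norm_eq_inner)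
 hence pn: "p yl = (p yl \<bullet> n) *\<^sub>R n" by simp
 have euler: "p yl \<bullet> yl > 0" using homogeneous_grad(2)[OF hom d, of yl] pos[OF nn(1)] m by simp
 have pn0: "p yl \<bullet> n ~= 0"
 proof
  assume "p yl \<bullet> n = 0"
  hence "p yl = 0" using pn by simp
  thus False using euler by simp
 qed
 have O: "{v. n \<bullet> v = 0} \<in> Omega f (span {yl}) c"
 proof (rule limit_in_Omega[where x = "%k. x (r k)"])
  show "filterlim (%k. norm (x (r k))) at_top sequentially"
  proof (rule filterlim_at_top_mono[OF filterlim_real_sequentially], rule always_eventually, rule allI)
   fix k have "k <= r k" by (rule seq_suble[OF r])
   thus "real k <= norm (x (r k))" using x(1)[of "r k"] by simp
  qed
  show "(%k. f (x (r k))) \<longlonglongrightarrow> c"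
   by (rule LIM_zero_cancel, rule Lim_null_comparison[OF _ sr]) (use x(2) in \<open>auto intro!: always_eventually less_imp_le\<close>)
 qed (use x0 nn ylim nlim in \<open>auto simp: y_def\<close>)
 show False
 proof (cases "span {yl} \<in> \<Lambda>")
  case True
  have "n \<bullet> v = 0 \<longleftrightarrow> p yl \<bullet> v = 0" for v
  proof -
   have "p yl \<bullet> v = (p yl \<bullet> n) * (n \<bullet> v)" by (subst pn) simp
   thus ?thesis using pn0 by simp
  qed
  thus False using om[OF nn(1) True] O by simp
 next
  case False
  hence "span {yl} \<subseteq> {v. n \<bullet> v = 0}" using sisi[OF nn(1) _ O] by blast
  hence "n \<bullet> yl = 0" using span_base[of yl "{yl}"] by auto
  moreover have "p yl \<bullet> yl = (p yl \<bullet> n) * (n \<bullet> yl)" by (subst pn) simp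
  ultimately show False using euler by simp
 qed
qed

lemma adapted_function:
 assumes sisi: "SISI f c" and cont: "isCont (total_abs_curv f) c"
 shows "\<exists>q p m R \<epsilon> \<delta>. (\<forall>k. Ck_on k UNIV q \<and> Ck_on k UNIV p) \<and> dfn p \<and> (\<forall>x. (q has_derivative (%h. p x \<bullet> h)) (at x)) \<and>
  0 < m \<and> (\<forall>x. (1/2) * (x \<bullet> x) ^ m <= q x) \<and> 0 < \<epsilon> \<and> \<epsilon> < 1 \<and> 0 < \<delta> \<and> \<delta> <= 1 \<and>
  (\<forall>x. norm x \<ge> R \<and> \<bar>f x - c\<bar> < \<epsilon> --> (p x \<bullet> grad f x)\<^sup>2 <= (1 - \<delta>) * ((p x \<bullet> p x) * (grad f x \<bullet> grad f x)))"
proof -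
 obtain \<Lambda>0 where L0: "finite \<Lambda>0" "\<Lambda>0 \<subseteq> Grass 1" "\<forall>lam \<in> Xinf f c - \<Lambda>0. \<forall>h \<in> Omega f lam c. lam \<subseteq> h"
  using sisi unfolding SISI_def by blast
 have G1: "span {e} \<in> Grass 1" if "norm e = 1" for e :: "real^'n"
  using that by (auto simp: Grass_def dim_span dim_singleton)
 obtain i0 :: 'n where True by blast
 \<comment> \<open>A coordinate line is added, so that there is at least one line and
   \<open>q\<close> has positive degree. It is treated like an exceptional line; the condition on
   the remaining ones persists.\<close>
 define \<Lambda> where "\<Lambda> = insert (span {axis i0 1}) \<Lambda>0"
 have L: "finite \<Lambda>" "\<Lambda> ~= {}" "!!lam. lam \<in> \<Lambda> ==> lam \<in> Grass 1"
  using L0 G1[of "axis i0 1"] by (auto simp: \<Lambda>_def)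
 obtain e0 where e0: "!!lam. lam \<in> \<Lambda> ==> norm (e0 lam) = 1 \<and> lam = span {e0 lam}"
  using Grass1_span[OF L(3)] by metis
 define E where "E = e0 ` \<Lambda>"
 have E: "finite E" "E ~= {}" "!!e. e \<in> E ==> norm e = 1" using L e0 by (auto simp: E_def)
 have Espan: "e = e'" if "e \<in> E" "e' \<in> E" "span {e} = span {e'}" for e e' using that e0 by (auto simp: E_def)
 define cE where "cE = card E"
 have cE: "cE > 0" using E by (simp add: cE_def card_gt_0_iff)
 \<comment> \<open>Equality in Cauchy-Schwarz would put both unit vectors on one line, whereas
   \<open>E\<close> holds one vector for each line.\<close>
 have gap: "line_gap e' e > 0" if "e \<in> E" "e' \<in> E" "e ~= e'" for e e'
 proof (rule ccontr)
  have ee: "e \<bullet> e = 1" "e' \<bullet> e' = 1" using E(3) that by (auto simp: norm_eq_1)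
  assume "\<not> line_gap e' e > 0"
  hence g: "line_gap e' e = 0" "line_gap e e' = 0"
   using line_gap_bounds(1)[OF E(3)[OF that(2)], of e] ee by (auto simp: line_gap_def inner_commute)
  have "(norm (e - (e \<bullet> e') *\<^sub>R e'))\<^sup>2 = 0" "(norm (e' - (e' \<bullet> e) *\<^sub>R e))\<^sup>2 = 0"
   using norm_reject_unit[of e' e] norm_reject_unit[of e e'] ee g by (auto simp: line_gap_def power2_norm_eq_inner inner_commute)
  hence "e = (e \<bullet> e') *\<^sub>R e'" "e' = (e' \<bullet> e) *\<^sub>R e" by auto
  hence "e \<in> span {e'}" "e' \<in> span {e}" by (metis span_base span_mul singletonI)+
  hence "span {e} = span {e'}" by (intro subset_antisym span_minimal subspace_span) auto
  thus False using Espan that by blast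
 qed
 have "\<exists>u. u \<bullet> e ~= 0 \<and> {v. u \<bullet> v = 0} \<notin> Omega f (span {e}) c" if "e \<in> E" for e

  by (rule Omega_omits_hyperplane[OF cont]) (use E(3)[OF that] in auto)
 then obtain U where U: "!!e. e \<in> E ==> U e \<bullet> e ~= 0" "!!e. e \<in> E ==> {v. U e \<bullet> v = 0} \<notin> Omega f (span {e}) c" by metis
 define D where "D e = (\<Prod>e'\<in>E - {e}. line_gap e' e)" for e
 have D: "D e > 0" if "e \<in> E" for e unfolding D_def using gap that by (intro prod_pos) auto
 \<comment> \<open>Solves 2 cE e + D e * b e = 2 cE U e / (U e \<bullet> e) for \<open>b e\<close>:
   by \<open>tilt_derivative\<close> the gradient at \<open>e\<close> becomes a multiple of the
   omitted normal \<open>U e\<close>, and the normalisation by \<open>U e \<bullet> e\<close> makes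
   \<open>b e\<close> orthogonal to \<open>e\<close>.\<close>
 define b where "b e = (2 * real cE / D e) *\<^sub>R (U e /\<^sub>R (U e \<bullet> e) - e)" for e
 have be: "b e \<bullet> e = 0" if "e \<in> E" for e
  using U(1)[OF that] E(3)[OF that] by (simp add: b_def inner_diff_left norm_eq_1)
 obtain K where K: "!!x. tilt E b K x \<ge> (1/2) * (x \<bullet> x) ^ cE"
  using tilt_lower_bound[OF E(1,3) be] unfolding cE_def by blast
 define q where "q = tilt E b K"
 define p where "p = grad q"
 have qC: "Ck_on k UNIV q" for k unfolding q_def by (rule Ck_on_tilt)
 have pC: "Ck_on k UNIV p" for k unfolding p_def by (rule Ck_on_grad[OF qC open_UNIV])
 have qd: "(q has_derivative (%h. p x \<bullet> h)) (at x)" for x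
  unfolding p_def using qC[of 1] by (intro grad_has_derivative) simp
 have pe: "p e = (2 * real cE / (U e \<bullet> e)) *\<^sub>R U e" if e: "e \<in> E" for e
 proof -
  have "(%h. p e \<bullet> h) = (%h. ((2 * real (card E)) *\<^sub>R e + D e *\<^sub>R b e) \<bullet> h)"
   using has_derivative_unique[OF qd[of e, unfolded q_def] tilt_derivative[OF E(1,3) be e]] unfolding D_def by blast
  hence "p e = (2 * real cE) *\<^sub>R e + D e *\<^sub>R b e" unfolding cE_def by (metis vector_eq_rdot)
  moreover have "D e *\<^sub>R b e = (2 * real cE) *\<^sub>R (U e /\<^sub>R (U e \<bullet> e) - e)" using D[OF e] by (simp add: b_def)
  ultimately show ?thesis by (simp add: algebra_simps divide_inverse)
 qed
 have hom: "q (r *\<^sub>R x) = r ^ (2 * cE) * q x" for r x unfolding q_def cE_def by (rule tilt_scaleR[OF E(1,2)])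
 have "\<exists>R \<epsilon> \<delta>. 0 < \<epsilon> \<and> \<epsilon> < 1 \<and> 0 < \<delta> \<and> \<delta> <= 1 \<and> (\<forall>x. norm x \<ge> R \<and> \<bar>f x - c\<bar> < \<epsilon> -->
  (p x \<bullet> grad f x)\<^sup>2 <= (1 - \<delta>) * ((p x \<bullet> p x) * (grad f x \<bullet> grad f x)))"
 proof (rule transversal_of_homogeneous[where \<Lambda> = \<Lambda>, OF _ hom qd])
  fix y :: "real^'n" and h assume y: "norm y = 1" "span {y} \<notin> \<Lambda>" "h \<in> Omega f (span {y}) c"
  hence "span {y} \<in> Xinf f c - \<Lambda>0" using G1 by (auto simp: Xinf_def \<Lambda>_def)
  thus "span {y} \<subseteq> h" using L0(3) y(3) by blast
 next
  fix x :: "real^'n" assume "norm x = 1"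
  hence "x \<bullet> x = 1" by (simp add: norm_eq_1)
  thus "q x > 0" using K[of x] by (simp add: q_def)
 next
  fix y :: "real^'n" assume y: "norm y = 1" "span {y} \<in> \<Lambda>"
  define e where "e = e0 (span {y})"
  have e: "e \<in> E" "norm e = 1" "span {y} = span {e}" using e0[OF y(2)] y(2) by (auto simp: e_def E_def)
  then obtain s where s: "y = s *\<^sub>R e" using span_base[of y "{y}"] by (auto simp: span_singleton)
  hence s1: "\<bar>s\<bar> = 1" using y(1) e(2) by simp
  \<comment> \<open>\<open>y\<close> is the chosen vector \<open>e\<close> up to sign, and the
    degree is even, so the gradients at both span the same line.\<close>
  have "s ^ (2 * cE) = 1" using s1 by (simp add: power_mult power2_abs[symmetric, of s] del: power2_abs)
  hence "s *\<^sub>R p y = p e" using homogeneous_grad(1)[OF hom qd, of s e] s by simp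
  hence "(s *\<^sub>R p y) \<bullet> v = ((2 * real cE / (U e \<bullet> e)) *\<^sub>R U e) \<bullet> v" for v
   using pe[OF e(1)] by (simp only:)
  hence "s * (p y \<bullet> v) = (2 * real cE / (U e \<bullet> e)) * (U e \<bullet> v)" for v by (simp only: inner_scaleR_left)
  moreover have "s ~= 0" "2 * real cE / (U e \<bullet> e) ~= 0" using s1 U(1)[OF e(1)] cE by auto
  ultimately have "p y \<bullet> v = 0 \<longleftrightarrow> U e \<bullet> v = 0" for v
   using mult_eq_0_iff[of s "p y \<bullet> v"] mult_eq_0_iff[of "2 * real cE / (U e \<bullet> e)" "U e \<bullet> v"] by metis
  thus "{v. p y \<bullet> v = 0} \<notin> Omega f (span {y}) c" using U(2)[OF e(1)] e(3) by simp
 qed (use cE Ck_on_continuous[OF pC] in auto)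
 then obtain R \<epsilon> \<delta> where tr: "0 < \<epsilon>" "\<epsilon> < 1" "0 < \<delta>" "\<delta> <= 1" "\<forall>x. norm x \<ge> R \<and> \<bar>f x - c\<bar> < \<epsilon> -->
  (p x \<bullet> grad f x)\<^sup>2 <= (1 - \<delta>) * ((p x \<bullet> p x) * (grad f x \<bullet> grad f x))" by blast
 have "dfn q" unfolding q_def by (rule dfn_tilt)
 hence dp: "dfn p" using dfn_grad_on[of q "%_. True" p] qd dpred_True by simp
 have low: "\<forall>x. (1/2) * (x \<bullet> x) ^ cE <= q x" using K by (simp add: q_def)
 show ?thesis
  by (intro exI[of _ q] exI[of _ p] exI[of _ cE] exI[of _ R] exI[of _ \<epsilon>] exI[of _ \<delta>] conjI allI)
   (rule qC pC dp qd cE low[THEN spec] tr(1-4) tr(5)[THEN spec])+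
qed

end

text \<open>Among the vectors w with w \<bullet> g = 1 this one minimises (g \<bullet> g) (w
  \<bullet> w) + (w \<bullet> p)^2 when \<open>g\<close> is nonzero. The positive weight keeps the
  denominator positive even where \<open>p\<close> is parallel to \<open>g\<close>, so one formula
  serves on the whole space; where the two are transverse, w \<bullet> p stays bounded.\<close>

definition lift_field :: "'a::real_inner => 'a => 'a" where
 "lift_field g p = (1 / ((g \<bullet> g)\<^sup>2 + (g \<bullet> g) * (p \<bullet> p) - (p \<bullet> g)\<^sup>2)) *\<^sub>R ((g \<bullet> g + p \<bullet> p) *\<^sub>R g - (p \<bullet> g) *\<^sub>R p)"

lemma lift_field_denom: "g ~= 0 ==> 0 < (g \<bullet> g)\<^sup>2 + (g \<bullet> g) * (p \<bullet> p) - (p \<bullet> g)\<^sup>2"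
proof -
 assume "g ~= 0"
 hence "(g \<bullet> g)\<^sup>2 > 0" by simp
 moreover have "(p \<bullet> g)\<^sup>2 <= (p \<bullet> p) * (g \<bullet> g)" by (rule Cauchy_Schwarz_ineq)
 ultimately show ?thesis using mult.commute[of "p \<bullet> p" "g \<bullet> g"] by linarith
qed

lemma lift_field_inner: "g ~= 0 ==> lift_field g p \<bullet> g = 1"
proof -
 assume "g ~= 0"
 let ?D = "(g \<bullet> g)\<^sup>2 + (g \<bullet> g) * (p \<bullet> p) - (p \<bullet> g)\<^sup>2"
 have "lift_field g p \<bullet> g = (1 / ?D) * ((g \<bullet> g + p \<bullet> p) * (g \<bullet> g) - (p \<bullet> g) * (p \<bullet> g))"
  by (simp only: lift_field_def inner_scaleR_left inner_diff_left)
 also have "(g \<bullet> g + p \<bullet> p) * (g \<bullet> g) - (p \<bullet> g) * (p \<bullet> g) = ?D" by (simp add: power2_eq_square algebra_simps)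
 finally show ?thesis using lift_field_denom[OF \<open>g ~= 0\<close>, of p] by simp
qed

text \<open>Transversality bounds the denominator below by G (G + \<delta> P); the numerator of the
  product with \<open>p\<close> is G q, and \<delta> |q| is at most G + \<delta> P.\<close>

lemma lift_field_bound:
 assumes g: "g ~= 0" and t: "(p \<bullet> g)\<^sup>2 <= (1 - \<delta>) * ((p \<bullet> p) * (g \<bullet> g))" and \<delta>: "0 < \<delta>" "\<delta> <= 1"
 shows "\<bar>lift_field g p \<bullet> p\<bar> <= 1 / \<delta>"
proof -
 define G P q where "G = g \<bullet> g" and "P = p \<bullet> p" and "q = p \<bullet> g"
 have GP: "G > 0" "P \<ge> 0" using g by (auto simp: G_def P_def)
 let ?D = "G\<^sup>2 + G * P - q\<^sup>2"
 have D: "?D > 0" using lift_field_denom[OF g, of p] by (simp add: G_def P_def q_def)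
 have "lift_field g p \<bullet> p = G * q / ?D"
  by (simp add: lift_field_def G_def P_def q_def inner_diff_left inner_commute algebra_simps)
 hence "\<bar>lift_field g p \<bullet> p\<bar> = G * \<bar>q\<bar> / ?D" using GP D by (simp add: abs_mult)
 moreover have "\<delta> * \<bar>q\<bar> <= G + \<delta> * P"
 proof -
  have "\<bar>q\<bar> <= norm p * norm g" unfolding q_def by (rule Cauchy_Schwarz_ineq2)
  also have "... <= P + G"
   using sum_squares_bound[of "norm p" "norm g"] mult_nonneg_nonneg[OF norm_ge_zero[of p] norm_ge_zero[of g]]
   unfolding P_def G_def power2_norm_eq_inner by linarith
  finally have "\<delta> * \<bar>q\<bar> <= \<delta> * (P + G)" using \<delta> by (intro mult_left_mono) auto
  moreover have "\<delta> * G <= G" using \<delta> GP by (simp add: mult_left_le_one_le)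
  ultimately show ?thesis by (simp add: algebra_simps)
 qed
 hence "G * (\<delta> * \<bar>q\<bar>) <= G * (G + \<delta> * P)" using GP by (intro mult_left_mono) auto
 moreover have "G * (G + \<delta> * P) <= ?D" using t by (simp add: G_def P_def q_def power2_eq_square algebra_simps)
 ultimately have m: "G * \<bar>q\<bar> * \<delta> <= ?D" "\<bar>lift_field g p \<bullet> p\<bar> = G * \<bar>q\<bar> / ?D"
  by (metis mult.assoc mult.commute order_trans, blast)
 hence "G * \<bar>q\<bar> / ?D * \<delta> <= 1" using D by (metis divide_le_eq_1_pos times_divide_eq_left)
 thus ?thesis unfolding m(2) using \<delta>(1) by (metis pos_le_divide_eq)
qed

section \<open>Completeness of the flow over an interval\<close>

lemma mvt_segment:
 fixes F :: "real => real"
 assumes "!!t. (F has_real_derivative F' t) (at t)"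
 shows "\<exists>\<xi>\<in>closed_segment 0 s. F s = F 0 + s * F' \<xi>"
proof -
 consider "s = 0" | "s > 0" | "s < 0" by linarith
 thus ?thesis
 proof cases
  case 2
  then obtain z where "0 < z" "z < s" "F s - F 0 = (s - 0) * F' z" using MVT2[of 0 s F F'] assms by blast
  thus ?thesis using 2 by (intro bexI[of _ z]) (auto simp: closed_segment_eq_real_ivl)
 next
  case 3
  then obtain z where "s < z" "z < 0" "F 0 - F s = (0 - s) * F' z" using MVT2[of s 0 F F'] assms by blast
  thus ?thesis using 3 by (intro bexI[of _ z]) (auto simp: closed_segment_eq_real_ivl)
 qed simp
qed

text \<open>The field is cut off where \<open>q\<close> passes from \<open>N\<close> to
  \<open>N + 1\<close>, which makes it compactly supported and its flow complete. A trajectory over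
  \<open>D\<close> lasts less than \<open>2 * \<epsilon>\<close>, so \<open>q\<close> grows by at
  most \<open>2 * \<epsilon> * B\<close> and for large \<open>N\<close> the cutoff is not felt; the
  truncated flows agree there and glue.\<close>

lemma controlled_flow:
 fixes f q :: "'a::euclidean_space => real" and w g p :: "'a => 'a"
 assumes fd: "!!x. (f has_derivative (%h. g x \<bullet> h)) (at x)" and qd: "!!x. (q has_derivative (%h. p x \<bullet> h)) (at x)"
  and wg: "!!x. w x \<bullet> g x = 1" and wC: "Ck_on (Suc k) UNIV w" and qC: "Ck_on (Suc k) UNIV q"
  and proper: "!!N. \<exists>R. \<forall>x. norm x > R --> q x > N"
  and B: "!!x. \<bar>f x - c\<bar> < \<epsilon> ==> \<bar>w x \<bullet> p x\<bar> <= B" "B \<ge> 0" and \<epsilon>: "\<epsilon> > 0" and D: "D = {c - \<epsilon><..<c + \<epsilon>}"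
 shows "\<exists>\<phi>. Ck_on (Suc k) {(s, x). f x \<in> D \<and> f x + s \<in> D} \<phi> \<and> (\<forall>x. f x \<in> D --> \<phi> (0, x) = x) \<and>
  (\<forall>s x. f x \<in> D \<and> f x + s \<in> D --> ((%\<sigma>. \<phi> (\<sigma>, x)) has_vector_derivative w (\<phi> (s, x))) (at s) \<and>
    f (\<phi> (s, x)) = f x + s \<and> \<phi> (- s, \<phi> (s, x)) = x)"
proof -
 have fc: "continuous_on UNIV f" by (intro continuous_at_imp_continuous_on ballI has_derivative_continuous[OF fd])
 have qc: "continuous_on UNIV q" using Ck_on_continuous[OF qC] .
 obtain \<eta> where \<eta>: "Ck_on (Suc k) UNIV \<eta>" "!!t. t <= 0 ==> \<eta> t = 1" "!!t. t \<ge> 1 ==> \<eta> t = 0" "!!t::real. 0 <= \<eta> t \<and> \<eta> t <= (1::real)"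
  using Ck_cutoff[of "Suc k"] by blast
 define cut where "cut N x = \<eta> (q x - real N)" for N :: nat and x
 define W where "W N x = cut N x *\<^sub>R w x" for N x
 have WC: "Ck_on (Suc k) UNIV (W N)" for N
  unfolding W_def[abs_def] cut_def
  by (intro Ck_on_scaleR wC open_UNIV Ck_on_compose[OF open_UNIV open_UNIV _ \<eta>(1)] Ck_on_diff qC Ck_on_const) auto
 have "\<exists>L>0. \<forall>x y. norm (W N x - W N y) <= L * norm (x - y)" for N
 proof -
  obtain R where R: "!!x. norm x > R ==> q x > real N + 1" using proper[of "real N + 1"] by blast
  show ?thesis
  proof (rule C1_compact_support_lipschitz[OF WC])
   fix x :: 'a assume "norm x > R"
   hence "q x - real N \<ge> 1" using R[of x] by linarith
   thus "W N x = 0" using \<eta>(3) by (simp add: W_def cut_def)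
  qed
 qed
 then obtain L where L: "!!N. L N > 0" "!!N x y. norm (W N x - W N y) <= L N * norm (x - y)" by metis
 have "\<exists>\<phi>. Ck_on (Suc k) UNIV \<phi> \<and> (\<forall>x. \<phi> (0, x) = x) \<and>
  (\<forall>s x. ((%s. \<phi> (s, x)) has_vector_derivative W N (\<phi> (s, x))) (at s))" for N
  by (rule flow_Ck[OF WC L(2) L(1)])
 then obtain \<Phi> where \<Phi>: "!!N. Ck_on (Suc k) UNIV (\<Phi> N)" "!!N x. \<Phi> N (0, x) = x"
  "!!N s x. ((%s. \<Phi> N (s, x)) has_vector_derivative W N (\<Phi> N (s, x))) (at s)" by metis
 have inD: "t \<in> D \<longleftrightarrow> \<bar>t - c\<bar> < \<epsilon>" for t unfolding D by auto
 have chain: "((%s. h (\<Phi> N (s, x))) has_real_derivative r (\<Phi> N (s, x)) \<bullet> W N (\<Phi> N (s, x))) (at s)"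
  if "!!x. (h has_derivative (%v. r x \<bullet> v)) (at x)" for h r N x s
 proof -
  have "((%s. h (\<Phi> N (s, x))) has_derivative (%t. r (\<Phi> N (s, x)) \<bullet> (t *\<^sub>R W N (\<Phi> N (s, x))))) (at s)"
   by (rule has_derivative_compose[OF \<Phi>(3)[unfolded has_vector_derivative_def] that])
  moreover have "(%t. r (\<Phi> N (s, x)) \<bullet> (t *\<^sub>R W N (\<Phi> N (s, x)))) = (%t. (r (\<Phi> N (s, x)) \<bullet> W N (\<Phi> N (s, x))) * t)"
   by (rule ext) (simp only: inner_scaleR_right mult.commute)
  ultimately show ?thesis unfolding has_field_derivative_def by (simp only:)
 qed
 \<comment> \<open>The order of the estimates avoids a circle. Whatever the cutoff does, the speed
   of \<open>f\<close> is between 0 and 1, so \<open>f\<close> stays in \<open>D\<close>; there the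
   bound \<open>B\<close> applies and limits \<open>q\<close>; hence the cutoff is 1 and
   \<open>f\<close> moves at unit speed.\<close>
 have traj: "q (\<Phi> N (\<sigma>, x)) <= q x + 2 * \<epsilon> * B \<and> W N (\<Phi> N (\<sigma>, x)) = w (\<Phi> N (\<sigma>, x)) \<and> f (\<Phi> N (\<sigma>, x)) = f x + \<sigma>"
  if x: "f x \<in> D" "f x + s \<in> D" and N: "real N \<ge> q x + 2 * \<epsilon> * B" and \<sigma>: "\<sigma> \<in> closed_segment 0 s" for s N \<sigma> and x :: 'a
 proof -
  let ?\<gamma> = "%\<sigma>. \<Phi> N (\<sigma>, x)"
  have seg: "closed_segment 0 \<sigma> \<subseteq> closed_segment 0 s" if "\<sigma> \<in> closed_segment 0 s" for \<sigma> using that by (simp add: subset_closed_segment)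
  have gW: "g z \<bullet> W N z = cut N z" for z using wg[of z] by (simp add: W_def inner_commute)
  have F: "((%\<sigma>. f (?\<gamma> \<sigma>)) has_real_derivative cut N (?\<gamma> \<sigma>)) (at \<sigma>)" for \<sigma>
   using chain[OF fd, of N x \<sigma>] gW by simp
  have inside: "\<bar>f (?\<gamma> \<sigma>) - c\<bar> < \<epsilon>" if \<sigma>: "\<sigma> \<in> closed_segment 0 s" for \<sigma>
  proof -
   obtain \<xi> where "f (?\<gamma> \<sigma>) = f (?\<gamma> 0) + \<sigma> * cut N (?\<gamma> \<xi>)" using mvt_segment[OF F, of \<sigma>] by blast
   hence fe: "f (?\<gamma> \<sigma>) = f x + \<sigma> * cut N (?\<gamma> \<xi>)" by (simp add: \<Phi>(2))
   have cut01: "0 <= cut N (?\<gamma> \<xi>)" "cut N (?\<gamma> \<xi>) <= 1" using \<eta>(4) by (auto simp: cut_def)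
   consider "\<sigma> = 0" | "\<sigma> > 0" | "\<sigma> < 0" by linarith
   thus ?thesis
   proof cases
    case 1 thus ?thesis using fe x unfolding inD by simp
   next
    case 2
    hence "\<sigma> <= s" using \<sigma> by (auto simp: closed_segment_eq_real_ivl split: if_splits)
    moreover have "0 <= \<sigma> * cut N (?\<gamma> \<xi>)" "\<sigma> * cut N (?\<gamma> \<xi>) <= \<sigma>" using 2 cut01 by (auto simp: mult_left_le)
    ultimately show ?thesis using x fe unfolding inD by linarith
   next
    case 3
    hence "s <= \<sigma>" using \<sigma> by (auto simp: closed_segment_eq_real_ivl split: if_splits)
    moreover have "\<sigma> * cut N (?\<gamma> \<xi>) <= 0" "\<sigma> <= \<sigma> * cut N (?\<gamma> \<xi>)"
     using 3 cut01 mult_left_mono[of "cut N (?\<gamma> \<xi>)" 1 "- \<sigma>"] by (auto simp: mult_nonpos_nonneg)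
    ultimately show ?thesis using x fe unfolding inD by linarith
   qed
  qed
  have qb: "q (?\<gamma> \<sigma>) <= q x + 2 * \<epsilon> * B" if \<sigma>: "\<sigma> \<in> closed_segment 0 s" for \<sigma>
  proof -
   obtain \<xi> where \<xi>: "\<xi> \<in> closed_segment 0 \<sigma>" "q (?\<gamma> \<sigma>) = q (?\<gamma> 0) + \<sigma> * (p (?\<gamma> \<xi>) \<bullet> W N (?\<gamma> \<xi>))"
    using mvt_segment[OF chain[OF qd], where s = \<sigma>] by blast
   have "\<bar>w (?\<gamma> \<xi>) \<bullet> p (?\<gamma> \<xi>)\<bar> <= B" using seg[OF \<sigma>] \<xi>(1) inside B(1) by blast
   moreover have "\<bar>p (?\<gamma> \<xi>) \<bullet> W N (?\<gamma> \<xi>)\<bar> <= 1 * \<bar>w (?\<gamma> \<xi>) \<bullet> p (?\<gamma> \<xi>)\<bar>"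
    unfolding W_def inner_scaleR_right abs_mult inner_commute[of "p _"] using \<eta>(4) by (intro mult_right_mono) (auto simp: cut_def)
   ultimately have pb: "\<bar>p (?\<gamma> \<xi>) \<bullet> W N (?\<gamma> \<xi>)\<bar> <= B" by linarith
   have "\<bar>\<sigma>\<bar> <= \<bar>s\<bar>" using \<sigma> by (auto simp: closed_segment_eq_real_ivl split: if_splits)
   hence "\<bar>\<sigma>\<bar> <= 2 * \<epsilon>" using x unfolding inD by linarith
   hence "\<bar>\<sigma>\<bar> * \<bar>p (?\<gamma> \<xi>) \<bullet> W N (?\<gamma> \<xi>)\<bar> <= (2 * \<epsilon>) * B" using pb \<epsilon> by (intro mult_mono) auto
   thus ?thesis using \<xi>(2) abs_le_D1[of "\<sigma> * (p (?\<gamma> \<xi>) \<bullet> W N (?\<gamma> \<xi>))" "(2 * \<epsilon>) * B"] by (simp add: \<Phi>(2) abs_mult)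
  qed
  have cut_one: "cut N (?\<gamma> \<sigma>) = 1" if "\<sigma> \<in> closed_segment 0 s" for \<sigma> using qb[OF that] N \<eta>(2) by (simp add: cut_def)
  obtain \<xi> where \<xi>: "\<xi> \<in> closed_segment 0 \<sigma>" "f (?\<gamma> \<sigma>) = f (?\<gamma> 0) + \<sigma> * cut N (?\<gamma> \<xi>)" using mvt_segment[OF F, of \<sigma>] by blast
  have "f (?\<gamma> \<sigma>) = f x + \<sigma>" using \<xi>(2) cut_one[of \<xi>] seg[OF \<sigma>] \<xi>(1) by (auto simp: \<Phi>(2))
  thus ?thesis using qb[OF \<sigma>] cut_one[OF \<sigma>] by (simp add: W_def)
 qed
 have uniq: "\<Phi> N (s, x) = \<Phi> M (s, x)"
  if x: "f x \<in> D" "f x + s \<in> D" and N: "real N \<ge> q x + 2 * \<epsilon> * B" and M: "real M \<ge> q x + 2 * \<epsilon> * B" for s x N M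
 proof (rule ode_unique[of s "%s. \<Phi> N (s, x)" "%_. W N" "%s. \<Phi> M (s, x)" "L N"])
  fix \<sigma> assume \<sigma>: "\<sigma> \<in> closed_segment 0 s"
  have "W M (\<Phi> M (\<sigma>, x)) = W N (\<Phi> M (\<sigma>, x))" using traj[OF x M \<sigma>] N \<eta>(2) by (simp add: W_def cut_def)
  thus "((%s. \<Phi> M (s, x)) has_vector_derivative W N (\<Phi> M (\<sigma>, x))) (at \<sigma>)" using \<Phi>(3)[of M x \<sigma>] by simp
 qed (rule \<Phi>(3) L(2) less_imp_le[OF L(1)] | simp only: \<Phi>(2))+
 \<comment> \<open>This choice jumps with \<open>x\<close>. Smoothness of \<open>\<phi>\<close>
   comes from \<open>\<phi>eq\<close>: any larger \<open>N\<close> gives the same value, in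
   particular one that serves a whole neighbourhood.\<close>
 define N0 where "N0 x = nat \<lceil>q x + 2 * \<epsilon> * B\<rceil>" for x
 have N0: "real (N0 x) \<ge> q x + 2 * \<epsilon> * B" for x unfolding N0_def by (rule real_nat_ceiling_ge)
 define \<phi> where "\<phi> = (%(s, x). \<Phi> (N0 x) (s, x))"
 have \<phi>eq: "\<phi> (s, x) = \<Phi> N (s, x)" if "f x \<in> D" "f x + s \<in> D" "real N \<ge> q x + 2 * \<epsilon> * B" for s x N
  unfolding \<phi>_def using uniq[OF that(1,2) N0 that(3)] by simp
 let ?T = "{(s, x). f x \<in> D \<and> f x + s \<in> D}"
 have T: "open ?T"
 proof -
  have "?T = {z. \<bar>f (snd z) - c\<bar> < \<epsilon>} \<inter> {z. \<bar>f (snd z) + fst z - c\<bar> < \<epsilon>}" by (auto simp: inD)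
  thus ?thesis
   by (simp only:) (intro open_Int open_Collect_less continuous_intros continuous_on_compose2[OF fc], auto)
 qed
 have "Ck_on (Suc k) ?T \<phi>"
 proof (rule Ck_on_locally)
  fix z assume z: "z \<in> ?T"
  define N where "N = Suc (N0 (snd z))"
  let ?V = "?T \<inter> {z. q (snd z) + 2 * \<epsilon> * B < real N}"
  have V: "open ?V" by (intro open_Int T open_Collect_less continuous_intros continuous_on_compose2[OF qc]) auto
  have "Ck_on (Suc k) ?V (\<Phi> N)" using Ck_on_subset[OF \<Phi>(1)] by blast
  moreover have "\<phi> y = \<Phi> N y" if "y \<in> ?V" for y using that \<phi>eq[of "snd y" "fst y" N] by (auto simp: less_imp_le)
  ultimately have "Ck_on (Suc k) ?V \<phi>" using Ck_on_cong[OF V, of \<phi> "\<Phi> N" "Suc k"] by blast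
  moreover have "z \<in> ?V" using z N0[of "snd z"] by (auto simp: N_def)
  ultimately show "\<exists>V. open V \<and> z \<in> V \<and> Ck_on (Suc k) V \<phi>" using V by blast
 qed
 moreover have "\<phi> (0, x) = x" for x by (simp add: \<phi>_def \<Phi>(2))
 moreover have "((%\<sigma>. \<phi> (\<sigma>, x)) has_vector_derivative w (\<phi> (s, x))) (at s) \<and> f (\<phi> (s, x)) = f x + s \<and> \<phi> (- s, \<phi> (s, x)) = x"
  if x: "f x \<in> D" "f x + s \<in> D" for s x
 proof -
  have se: "s \<in> closed_segment 0 s" by simp
  have t: "W (N0 x) (\<phi> (s, x)) = w (\<phi> (s, x))" "f (\<phi> (s, x)) = f x + s" using traj[OF x N0 se] by (auto simp: \<phi>_def)
  have d: "((%\<sigma>. \<phi> (\<sigma>, x)) has_vector_derivative w (\<phi> (s, x))) (at s)"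
   using \<Phi>(3)[of "N0 x" x s] t(1) by (simp add: \<phi>_def)
  define y where "y = \<phi> (s, x)"
  define N where "N = max (N0 x) (N0 y)"
  have Nx: "real N \<ge> q x + 2 * \<epsilon> * B" "real N \<ge> q y + 2 * \<epsilon> * B" using N0[of x] N0[of y] by (auto simp: N_def)
  have yN: "y = \<Phi> N (s, x)" unfolding y_def by (rule \<phi>eq[OF x Nx(1)])
  have "\<phi> (- s, y) = \<Phi> N (- s, y)" using x t(2) Nx(2) by (intro \<phi>eq) (auto simp: y_def)
  also have "... = \<Phi> N (s + - s, x)"
  proof (rule ode_unique[of "- s" "%\<sigma>. \<Phi> N (\<sigma>, y)" "%_. W N" "%\<sigma>. \<Phi> N (s + \<sigma>, x)" "L N"])
   fix \<sigma>
   have "((%\<sigma>. \<Phi> N (\<sigma>, x)) \<circ> (%\<sigma>. s + \<sigma>) has_vector_derivative 1 *\<^sub>R W N (\<Phi> N (s + \<sigma>, x))) (at \<sigma>)"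
    by (rule vector_diff_chain_at[OF _ \<Phi>(3)]) (auto intro!: derivative_eq_intros)
   thus "((%\<sigma>. \<Phi> N (s + \<sigma>, x)) has_vector_derivative W N (\<Phi> N (s + \<sigma>, x))) (at \<sigma>)" by (simp add: o_def)
  qed (rule \<Phi>(3) L(2) less_imp_le[OF L(1)] | simp only: \<Phi>(2) yN add_0_right)+
  also have "... = x" by (simp add: \<Phi>(2))
  finally show ?thesis using d t(2) by (simp add: y_def)
 qed
 ultimately show ?thesis by (intro exI[of _ \<phi>]) blast
qed

section \<open>Definability of the field and the trivialisation\<close>

lemma nth_vec_to_list: "j < CARD('n) ==> vec_to_list (x :: real^'n::finite) ! j = x \<bullet> (vec_basis ! j)"
 by (simp add: vec_to_list_eq_coords coords_def length_vec_basis)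

lemma (in ominimal) dfn_nth_vec_to_list:
 "dfn g ==> j < CARD('n) ==> dfn (%z. vec_to_list (g z :: real^'n::finite) ! j)"
 using dfn_inner_Basis[of g "vec_basis ! j"] basis_list_vec[where 'n='n] nth_mem[of j "vec_basis :: (real^'n) list"]
 by (simp add: nth_vec_to_list basis_list_def length_vec_basis)

text \<open>The closure of the graph in every chart is written as a first-order formula with a
  tolerance \<open>e\<close>. Since \<open>dfn\<close> concerns total functions, \<open>w\<close>
  enters through a definable \<open>w'\<close> that agrees with it on \<open>U\<close>.\<close>

lemma (in ominimal) definable_vfieldI:
 fixes w :: "real^'n::finite => real^'n"
 assumes U: "dpred (%x. x \<in> U)" and w': "dfn w'" "!!x. x \<in> U ==> w' x = w x"
 shows "definable_vfield S U w"
 unfolding definable_vfield_def definable_map_def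
proof (intro allI impI)
 let ?n = "CARD('n)"
 fix a :: "real list" and r :: real and i assume asm: "length a = ?n \<and> r > 0 \<and> i <= ?n"
 let ?g = "%xs. vec_to_list (w (list_to_vec xs))"
 let ?bs = "map (%a. (a, 0)) (vec_basis :: (real^'n) list) @ map (%b. (0, b)) (vec_basis :: (real^'n) list)"
 have b: "basis_list ?bs" by (rule basis_list_prod[OF basis_list_vec basis_list_vec])
 have co: "coords ?bs (y, v) = vec_to_list y @ vec_to_list v" for y v :: "real^'n"
  using coords_prod[of vec_basis vec_basis y v] by (simp add: vec_to_list_eq_coords)
 let ?Q = "%y v :: real^'n. \<forall>e::real. 0 < e --> (\<exists>s::real. \<exists>x::real^'n. s ~= 0 \<and> x \<in> U \<and>
  (\<forall>j\<in>{..?n}. \<bar>s * (1 # vec_to_list x) ! j - chart_ins i (vec_to_list y) ! j\<bar> < e) \<and>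
  (\<forall>j\<in>{..<?n}. \<bar>vec_to_list (w' x) ! j - vec_to_list v ! j\<bar> < e))"
 let ?P = "%z :: (real^'n) \<times> (real^'n). (\<Sum>j<?n. (vec_to_list (snd z) ! j - a ! j)^2) < r^2 \<and> ?Q (fst z) (snd z)"
 have Q: "graph_closure_chart i (vec_to_list ` U) ?g (vec_to_list y) (vec_to_list v) \<longleftrightarrow> ?Q y v" for y v :: "real^'n"
 proof -
  have "graph_closure_chart i (vec_to_list ` U) ?g (vec_to_list y) (vec_to_list v) \<longleftrightarrow>
   (\<forall>e>0. \<exists>s x. s ~= 0 \<and> x \<in> vec_to_list ` U \<and> (\<forall>j\<le>?n. \<bar>s * (1 # x) ! j - chart_ins i (vec_to_list y) ! j\<bar> < e) \<and>
    (\<forall>j<length (vec_to_list v). \<bar>?g x ! j - vec_to_list v ! j\<bar> < e))"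
   by (rule graph_closure_chart_epsilon) (use asm in auto)
  also have "... \<longleftrightarrow> ?Q y v"
  proof -
   have "(\<exists>x. s ~= 0 \<and> x \<in> vec_to_list ` U \<and> (\<forall>j\<le>?n. \<bar>s * (1 # x) ! j - chart_ins i (vec_to_list y) ! j\<bar> < e) \<and>
     (\<forall>j<length (vec_to_list v). \<bar>?g x ! j - vec_to_list v ! j\<bar> < e)) \<longleftrightarrow>
    (\<exists>x. s ~= 0 \<and> x \<in> U \<and> (\<forall>j\<in>{..?n}. \<bar>s * (1 # vec_to_list x) ! j - chart_ins i (vec_to_list y) ! j\<bar> < e) \<and>
     (\<forall>j\<in>{..<?n}. \<bar>vec_to_list (w' x) ! j - vec_to_list v ! j\<bar> < e))" for s e :: real
    using w'(2) by (auto simp: image_iff Ball_def)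
   thus ?thesis by (simp only:)
  qed
  finally show ?thesis .
 qed
 have head: "dfn (%z. (1 # vec_to_list (h z :: real^'n)) ! j)" if "dfn h" "j <= ?n" for h j
  using that dfn_nth_vec_to_list[of h "j - 1"] by (cases j) (auto intro: dfn_const)
 have chart: "dfn (%z. chart_ins i (vec_to_list (h z :: real^'n)) ! j)" if h: "dfn h" and j: "j <= ?n" for h j
 proof -
  consider "j < i" | "j = i" | "j > i" by linarith
  thus ?thesis
  proof cases
   case 1
   hence "(%z. chart_ins i (vec_to_list (h z)) ! j) = (%z. vec_to_list (h z) ! j)" using asm by (simp add: chart_ins_def nth_append)
   thus ?thesis using dfn_nth_vec_to_list[OF h, of j] 1 asm by simp
  next
   case 2
   thus ?thesis using asm by (simp add: chart_ins_def nth_append dfn_const)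
  next
   case 3
   hence "(%z. chart_ins i (vec_to_list (h z)) ! j) = (%z. vec_to_list (h z) ! (j - 1))"
    using asm j by (auto simp: chart_ins_def nth_append nth_Cons' nth_drop fun_eq_iff)
   thus ?thesis using dfn_nth_vec_to_list[OF h, of "j - 1"] 3 j by simp
  qed
 qed
 have "dpred ?P"
  by (intro dintros dfn_sum dpred_ball finite_atMost finite_lessThan dpred_compose[OF U] head chart dfn_nth_vec_to_list
    dfn_compose[OF w'(1)]) auto
 hence P: "coords ?bs ` Collect ?P \<in> S (?n + ?n)" using dpred_iff[OF b, of ?P] by (simp add: length_vec_basis)
 have "{y @ v |y v. length y = ?n \<and> length v = ?n \<and> (\<Sum>j<?n. (v ! j - a ! j)^2) < r^2 \<and>
   graph_closure_chart i (vec_to_list ` U) ?g y v} = coords ?bs ` Collect ?P" (is "?A = _")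
 proof (intro equalityI subsetI)
  fix xs assume "xs \<in> ?A"
  then obtain y v where yv: "xs = y @ v" "length y = ?n" "length v = ?n" "(\<Sum>j<?n. (v ! j - a ! j)^2) < r^2"
   "graph_closure_chart i (vec_to_list ` U) ?g y v" by blast
  obtain y' v' where y': "y = vec_to_list (y' :: real^'n)" "v = vec_to_list (v' :: real^'n)"
   using vec_to_list_surj[OF yv(2)] vec_to_list_surj[OF yv(3)] by metis
  have "?P (y', v')" using yv(4,5) Q unfolding y' by simp
  moreover have "xs = coords ?bs (y', v')" unfolding co yv(1) y' ..
  ultimately show "xs \<in> coords ?bs ` Collect ?P" by blast
 next
  fix xs assume "xs \<in> coords ?bs ` Collect ?P"
  then obtain y v where yv: "?P (y, v)" "xs = coords ?bs (y, v)" by auto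
  thus "xs \<in> ?A" unfolding co using Q[of y v]
   by (intro CollectI exI[of _ "vec_to_list y"] exI[of _ "vec_to_list v"]) simp
 qed
 thus "{y @ w |y w. length y = ?n \<and> length w = ?n \<and> (\<Sum>j<?n. (w ! j - a ! j)\<^sup>2) < r\<^sup>2 \<and>
   graph_closure_chart i (vec_to_list ` U) ?g y w} \<in> S (?n + ?n)" using P by simp
qed

theorem (in definable_level) trivialised:
 assumes smooth: "Ck_on (Suc (Suc k)) UNIV f" and sisi: "SISI f c" and cont: "isCont (total_abs_curv f) c"
 shows "\<exists>D w \<phi>. open D \<and> c \<in> D \<and>
      Ck_on (Suc k) (f -` D) w \<and> definable_vfield S (f -` D) w \<and>
      Ck_on (Suc k) {(s, x). f x \<in> D \<and> f x + s \<in> D} (\<phi> :: real \<times> (real^'n) => real^'n) \<and>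
      (\<forall>x\<in>f -` D. \<phi> (0, x) = x) \<and>
      (\<forall>s x. f x \<in> D \<and> f x + s \<in> D -->
       ((%\<sigma>. \<phi> (\<sigma>, x)) has_vector_derivative w (\<phi> (s, x))) (at s) \<and>
       f (\<phi> (s, x)) = f x + s) \<and>
      trivialising_diffeo (Suc k) f D c (%x. (f x, \<phi> (c - f x, x)))"
proof -
 obtain q p m R \<epsilon> \<delta> where q: "!!k. Ck_on k UNIV q" "!!k. Ck_on k UNIV p" "dfn p" "!!x. (q has_derivative (%h. p x \<bullet> h)) (at x)"
  "0 < m" "!!x. (1/2) * (x \<bullet> x) ^ m <= q x" and \<epsilon>: "0 < \<epsilon>" "\<epsilon> < 1" and \<delta>: "0 < \<delta>" "\<delta> <= 1"
  and tr: "!!x. norm x \<ge> R ==> \<bar>f x - c\<bar> < \<epsilon> ==> (p x \<bullet> grad f x)\<^sup>2 <= (1 - \<delta>) * ((p x \<bullet> p x) * (grad f x \<bullet> grad f x))"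
  using adapted_function[OF sisi cont] by metis
 define w where "w x = lift_field (grad f x) (p x)" for x
 define D where "D = {c - \<epsilon><..<c + \<epsilon>}"
 have inD: "t \<in> D \<longleftrightarrow> \<bar>t - c\<bar> < \<epsilon>" for t unfolding D_def by auto
 have wC: "Ck_on (Suc k) UNIV w"
  unfolding w_def[abs_def] lift_field_def
  by (intro Ck_on_scaleR Ck_on_divide Ck_on_add Ck_on_diff Ck_on_mult Ck_on_power Ck_on_inner Ck_on_const
    Ck_on_grad[OF smooth] q(2) open_UNIV) (rule less_imp_neq[OF lift_field_denom[OF nocrit], symmetric])
 have wg: "w x \<bullet> grad f x = 1" for x unfolding w_def by (rule lift_field_inner[OF nocrit])
 have "continuous_on UNIV (%x. w x \<bullet> p x)" by (intro continuous_intros Ck_on_continuous[OF wC] Ck_on_continuous[OF q(2)])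
 hence "compact ((%x. w x \<bullet> p x) ` cball 0 R)" by (intro compact_continuous_image) (auto intro: continuous_on_subset)
 then obtain B0 where "\<forall>t\<in>(%x. w x \<bullet> p x) ` cball 0 R. norm t <= B0" using compact_imp_bounded bounded_iff by blast
 hence B0: "!!x. norm x <= R ==> \<bar>w x \<bullet> p x\<bar> <= B0" by auto
 \<comment> \<open>Inside the ball of radius \<open>R\<close> the bound comes from compactness,
   outside from uniform transversality.\<close>
 have B: "\<bar>w x \<bullet> p x\<bar> <= max B0 (1 / \<delta>)" if "\<bar>f x - c\<bar> < \<epsilon>" for x
 proof (cases "norm x <= R")
  case False
  thus ?thesis using lift_field_bound[OF nocrit tr[OF _ that] \<delta>] by (simp add: w_def le_max_iff_disj)
 qed (use B0 in \<open>simp add: le_max_iff_disj\<close>)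
 have Bp: "max B0 (1 / \<delta>) \<ge> 0" using \<delta> by (simp add: le_max_iff_disj)
 have proper: "\<exists>R. \<forall>x. norm x > R --> q x > N" for N
 \<comment> \<open>Beyond radius 1 a positive power of the norm dominates the norm itself, and
   \<open>q\<close> is at least half of such a power.\<close>
 proof (intro exI[of _ "max 1 (2 * N)"] allI impI)
  fix x :: "real^'n" assume "norm x > max 1 (2 * N)"
  hence x: "norm x > 1" "norm x > 2 * N" by auto
  have "norm x <= norm x ^ (2 * m)" using x q(5) by (intro self_le_power) auto
  also have "... = (x \<bullet> x) ^ m" by (simp add: power_mult power2_norm_eq_inner)
  finally show "q x > N" using q(6)[of x] x by linarith
 qed
 obtain \<phi> where \<phi>: "Ck_on (Suc k) {(s, x). f x \<in> D \<and> f x + s \<in> D} \<phi>" "!!x. f x \<in> D ==> \<phi> (0, x) = x"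
  "!!s x. f x \<in> D ==> f x + s \<in> D ==> ((%\<sigma>. \<phi> (\<sigma>, x)) has_vector_derivative w (\<phi> (s, x))) (at s)"
  "!!s x. f x \<in> D ==> f x + s \<in> D ==> f (\<phi> (s, x)) = f x + s"
  "!!s x. f x \<in> D ==> f x + s \<in> D ==> \<phi> (- s, \<phi> (s, x)) = x"
  using controlled_flow[OF f_derivative q(4) wg wC q(1) proper B Bp \<epsilon>(1) D_def] by blast
 let ?T = "{(s, x). f x \<in> D \<and> f x + s \<in> D}"
 have T: "open ?T"
 proof -
  have "?T = {z. \<bar>f (snd z) - c\<bar> < \<epsilon>} \<inter> {z. \<bar>f (snd z) + fst z - c\<bar> < \<epsilon>}" by (auto simp: inD)
  thus ?thesis
   by (simp only:) (intro open_Int open_Collect_less continuous_intros continuous_on_compose2[OF f_continuous], auto)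
 qed
 have oD: "open (f -` D)" using f_continuous unfolding D_def by (intro open_vimage) auto
 have cD: "c \<in> D" using \<epsilon>(1) by (simp add: D_def)
 have fC: "Ck_on (Suc k) UNIV f" by (rule Ck_on_mono[OF smooth]) simp
 \<comment> \<open>Values move at unit speed, so following the flow for time \<open>c - f x\<close>
   leads from \<open>x\<close> to the level \<open>c\<close>; flowing for time
   \<open>fst z - c\<close> is the inverse.\<close>
 let ?h = "%x. (f x, \<phi> (c - f x, x))" and ?G = "%z. \<phi> (fst z - c, snd z)"
 have h: "?h x \<in> D \<times> f -` {c}" "?G (?h x) = x" if "x \<in> f -` D" for x
  using that \<phi>(4)[of x "c - f x"] \<phi>(5)[of x "c - f x"] cD by auto
 have G: "?G z \<in> f -` D" "?h (?G z) = z" if "z \<in> D \<times> f -` {c}" for z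
  using that \<phi>(4)[of "snd z" "fst z - c"] \<phi>(5)[of "snd z" "fst z - c"] cD by auto
 have triv: "trivialising_diffeo (Suc k) f D c ?h"
  unfolding trivialising_diffeo_def
 proof (intro conjI exI)
  show "bij_betw ?h (f -` D) (D \<times> f -` {c})"
   by (rule bij_betw_byWitness[of _ ?G]) (use h G in auto)
  show "\<forall>x\<in>f -` D. fst (?h x) = f x" by simp
  show "Ck_on (Suc k) (f -` D) ?h"
   by (intro Ck_on_Pair oD Ck_on_compose[OF oD T _ \<phi>(1)] Ck_on_diff Ck_on_const Ck_on_ident Ck_on_subset[OF fC]) (use cD in auto)
  \<comment> \<open>The formula for the inverse makes sense whenever start and target value both lie
    in \<open>D\<close>; this is the open neighbourhood on which \<open>trivialising_diffeo\<close>
    asks for a smooth extension.\<close>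
  let ?V = "(%z. (fst z - c, snd z)) -` ?T"
  show V: "open ?V" by (intro open_vimage T continuous_intros)
  show "D \<times> f -` {c} \<subseteq> ?V" using cD by auto
  show "Ck_on (Suc k) ?V ?G"
   by (rule Ck_on_compose[OF V T _ \<phi>(1)], erule vimageD, intro Ck_on_Pair Ck_on_diff Ck_on_const Ck_on_fst Ck_on_snd V)
  show "\<forall>p\<in>D \<times> f -` {c}. ?G p \<in> f -` D \<and> ?h (?G p) = p" using G by blast
 qed
 have def: "definable_vfield S (f -` D) w"
 proof (rule definable_vfieldI)
  have "(%x. x \<in> f -` D) = (%x. near_c x \<and> \<bar>ftrunc x - c\<bar> < \<epsilon>)"
   using \<epsilon>(2) by (auto simp: inD near_c_def ftrunc_def)
  thus "dpred (%x. x \<in> f -` D)" using dpred_and[OF near_c_dpred, of "%x. \<bar>ftrunc x - c\<bar> < \<epsilon>"]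
   by (simp add: dpred_less dfn_abs dfn_minus dfn_const ftrunc_dfn)
  \<comment> \<open>The truncated gradient stands in for the gradient; both agree over
    \<open>D\<close> because \<open>\<epsilon> < 1\<close>.\<close>
  show "dfn (%x. lift_field (gtrunc x) (p x))"
   unfolding lift_field_def by (intro dintros gtrunc_dfn q(3))
  show "lift_field (gtrunc x) (p x) = w x" if "x \<in> f -` D" for x
   using that \<epsilon>(2) by (simp add: w_def gtrunc_def near_c_def inD)
 qed
 have "open D" "Ck_on (Suc k) (f -` D) w" by (simp add: D_def, rule Ck_on_subset[OF wC subset_UNIV])
 thus ?thesis using cD def \<phi>(1) triv \<phi>(2-4)
  by (intro exI[of _ D] exI[of _ w] exI[of _ \<phi>] conjI ballI allI impI) (assumption | simp only: vimage_eq)+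
qed

theorem theorem6p2:
  fixes S :: "nat \<Rightarrow> real list set set"
    and f :: "real^'n::finite \<Rightarrow> real"
    and l :: nat and c :: real
  assumes omin: "o_minimal S"
    and l2: "l \<ge> 2"
    and smooth: "Ck_on l UNIV f"
    and defbl: "definable_fun S f"
    and nocrit: "\<forall>x. grad f x \<noteq> 0"
    and K: "Kgen f \<subseteq> {c}"
    and sisi: "SISI f c"
    and cont: "isCont (total_abs_curv f) c"
  shows "\<exists>D w \<phi>. open D \<and> c \<in> D \<and>
           Ck_on (l - 1) (f -` D) w \<and> definable_vfield S (f -` D) w \<and>
           Ck_on (l - 1) {(s, x). f x \<in> D \<and> f x + s \<in> D} (\<phi> :: real \<times> (real^'n) \<Rightarrow> real^'n) \<and>
           (\<forall>x\<in>f -` D. \<phi> (0, x) = x) \<and>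
           (\<forall>s x. f x \<in> D \<and> f x + s \<in> D \<longrightarrow>
              ((\<lambda>\<sigma>. \<phi> (\<sigma>, x)) has_vector_derivative w (\<phi> (s, x))) (at s) \<and>
              f (\<phi> (s, x)) = f x + s) \<and>
           trivialising_diffeo (l - 1) f D c (\<lambda>x. (f x, \<phi> (c - f x, x))) \<and>
           c \<notin> bifurcation_values l f"
proof -
 obtain k where l: "l = Suc (Suc k)" using l2 by (metis add_2_eq_Suc le_Suc_ex)
 interpret definable_level S f c
  by unfold_locales (use omin defbl nocrit Ck_on_mono[OF smooth l2] in auto)
 have "l - 1 = Suc k" by (simp add: l)
 obtain D w \<phi> where "open D \<and> c \<in> D \<and>
      Ck_on (Suc k) (f -` D) w \<and> definable_vfield S (f -` D) w \<and>
      Ck_on (Suc k) {(s, x). f x \<in> D \<and> f x + s \<in> D} (\<phi> :: real \<times> (real^'n) => real^'n) \<and>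
      (\<forall>x\<in>f -` D. \<phi> (0, x) = x) \<and>
      (\<forall>s x. f x \<in> D \<and> f x + s \<in> D -->
       ((%\<sigma>. \<phi> (\<sigma>, x)) has_vector_derivative w (\<phi> (s, x))) (at s) \<and>
       f (\<phi> (s, x)) = f x + s) \<and>
      trivialising_diffeo (Suc k) f D c (%x. (f x, \<phi> (c - f x, x)))" (is ?P)
  using trivialised[OF smooth[unfolded l] sisi cont] by (elim exE)
 moreover from \<open>?P\<close> have "c \<notin> bifurcation_values l f"
  unfolding bifurcation_values_def trivial_fibration_over_def \<open>l - 1 = Suc k\<close> by blast
 ultimately show ?thesis unfolding \<open>l - 1 = Suc k\<close> by (intro exI[of _ D] exI[of _ w] exI[of _ \<phi>]) simp
qed

end
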